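(* Let $g\geq 1$ be an integer. Then: (i) For every oriented maximal Wicks form $w$, the group $\mathrm{Aut}(w)$ is cyclic of order $1$, $2$, $3$ or $6$. (ii) $\displaystyle m_1^g=\frac{2}{1}\Big(\frac{1^2}{12}\Big)^g\frac{(6g-5)!}{g!\,(3g-3)!}$. (iii) For a nonnegative integer $r$, one has $m_2^g(r)>0$ if and only if $f=\frac{2g+1-r}{4}\in\{0,1,2,\dots\}$, and in that case $$m_2^g(r)=\frac{2}{2}\Big(\frac{2^2}{12}\Big)^f\frac{1}{r!}\,\frac{(6f+2r-5)!}{f!\,(3f+r-3)!}.$$ (iv) For nonnegative integers $s,t$, one has $m_3^g(s,t)>0$ if and only if $f=\frac{g+1-s-t}{3}\in\{0,1,2,\dots\}$, $s\equiv 2g+1\pmod 3$ and $t\equiv 2g\pmod 3$. In that case, if $g>1$, $$m_3^g(s,t)=\frac{2}{3}\Big(\frac{3^2}{12}\Big)^f\frac{1}{s!\,t!}\,\frac{(6f+2s+2t-5)!}{f!\,(3f+s+t-3)!},$$ and for $g=1$ one has $m_3^1(0,2)=\frac16$. (v) For nonnegative integers $r,s,t$, one has $m_6^g(3r;2s,2t)>0$ if and only if $f=\frac{2g+5-3r-4s-4t}{12}\in\{0,1,2,\dots\}$, $2s\equiv 2g+1\pmod 3$ and $2t\equiv 2g\pmod 3$. In that case, if $g>1$, $$m_6^g(3r;2s,2t)=\frac{2}{6}\Big(\frac{6^2}{12}\Big)^f\frac{1}{r!\,s!\,t!}\,\frac{(6f+2r+2s+2t-5)!}{f!\,(3f+r+s+t-3)!},$$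 and for $g=1$ one has $m_6^1(3;0,2)=\frac16$.
   Context: An oriented Wicks form is a cyclic word $w=w_1w_2\cdots w_{2l}$ (an orbit of a linear word under cyclic permutations) over an alphabet $a_1^{\pm1},a_2^{\pm1},\dots$ such that: (1) if $a_i^{\epsilon}$ ($\epsilon\in\{\pm1\}$) appears in $w$, then $a_i^{-\epsilon}$ appears exactly once in $w$; (2) no cyclic factor (subword of cyclically consecutive letters) of $w$ has the form $a_ia_i^{-1}$ or $a_i^{-1}a_i$; (3) if $a_i^{\epsilon}a_j^{\delta}$ is a cyclic factor of $w$, then $a_j^{-\delta}a_i^{-\epsilon}$ is not a cyclic factor of $w$. Two such forms $w$ (over alphabet $A$) and $w'$ (over alphabet $A'$) are isomorphic, or equivalent, if there is a bijection $\varphi:A\to A'$ with $\varphi(a^{-1})=\varphi(a)^{-1}$ such that $\varphi(w_1)\varphi(w_2)\cdots$ and $w'$ define the same cyclic word. Gluing the sides of a $2l$-gon in the oriented plane, labelled and oriented according to $w$, pairwise along equal labels gives a closed oriented surface $S$. The genus of $S$ is the genus of $w$. The images of the sides and corners of the polygon form a graph $\Gamma\subset S$ (the edges and vertices of $w$). Edges correspond to the letter pairs $\{a_i,a_i^{-1}\}$, and each vertex is the class of the corners between cyclically consecutive letters $w_kw_{k+1}$ that get identified. An oriented Wicks form of genus $g$ has length at most $6(2g-1)$. It is maximal if its length is exactly $6(2g-1)$; then $\Gamma$ has $2(2g-1)$ vertices, all of degree $3$, and $3(2g-1)$ edges. Sign of a vertex: let $V$ be a vertex of a maximal form and let $a,b,c$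 be the three edges at $V$, oriented toward $V$. Then $V$ is positive if $w=ab^{-1}\cdots bc^{-1}\cdots ca^{-1}\cdots$ or $w=ac^{-1}\cdots cb^{-1}\cdots ba^{-1}\cdots$ (as cyclic words). It is negative if $w=ab^{-1}\cdots ca^{-1}\cdots bc^{-1}\cdots$ or $w=ac^{-1}\cdots ba^{-1}\cdots cb^{-1}\cdots$. The automorphism group $\mathrm{Aut}(w)$ of $w=w_1\cdots w_{2e}$ is the group of cyclic shifts $\mu$ of the linear word $w_1\cdots w_{2e}$ (a subgroup of $\mathbb{Z}/2e\mathbb{Z}$) such that $\mu(w)$ is obtained from $w$ by a bijection $\varphi_\mu$ of the alphabet compatible with inverses. Such a $\mu$ permutes the corners, and hence the edges and vertices of $\Gamma$. An edge $\{a,a^{-1}\}$ is invariant with reversed orientation if $\varphi_\mu(a)=a^{-1}$. The sets of equivalence classes of oriented maximal Wicks forms of genus $g$ are: - $W_1^g$: all such forms; - $W_2^g(r)$: those having an automorphism of order $2$ that leaves exactly $r$ edges invariant with their orientation reversed; - $W_3^g(s,t)$: those having an automorphism of order $3$ that fixes exactly $s$ positive and $t$ negative vertices; - $W_6^g(3r;2s,2t)=W_2^g(3r)\cap W_3^g(2s,2t)$. The mass of a finite set $W$ is $m(W)=\sum_{w\in W}1/|\mathrm{Aut}(w)|$. We write $m_1^g=m(W_1^g)$, $m_2^g(r)=m(W_2^g(r))$, $m_3^g(s,t)=m(W_3^g(s,t))$ and $m_6^g(3r;2s,2t)=m(W_6^g(3r;2s,2t))$. *)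

theory Defs
  imports
    Complex_Main
    "HOL-Algebra.Elementary_Groups"
    "HOL-Algebra.Multiplicative_Group"
    "HOL-Number_Theory.Cong"
begin

text \<open>The pair \<open>(i, True)\<close> is the letter $a_i$ and \<open>(i, False)\<close> is its inverse.\<close>

type_synonym letter = "nat \<times> bool"

definition letter_inv :: "letter \<Rightarrow> letter" where
  "letter_inv a = (fst a, \<not> snd a)"

text \<open>
  A cyclic word is represented by any of its linear representatives; all notions below
  depend on the word only up to rotation.
\<close>

definition same_cyclic_word :: "letter list \<Rightarrow> letter list \<Rightarrow> bool" where
  "same_cyclic_word u w \<longleftrightarrow> (\<exists>k. rotate k w = u)"

definition cyclic_factor :: "letter list \<Rightarrow> letter list \<Rightarrow> bool" where
  "cyclic_factor u w \<longleftrightarrow> (\<exists>v. same_cyclic_word (u @ v) w)"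

definition oriented_wicks :: "letter list \<Rightarrow> bool" where
  "oriented_wicks w \<longleftrightarrow>
     (\<forall>a \<in> set w. count_list w (letter_inv a) = 1) \<and>
     (\<forall>a. \<not> cyclic_factor [a, letter_inv a] w) \<and>
     (\<forall>a b. cyclic_factor [a, b] w \<longrightarrow> \<not> cyclic_factor [letter_inv b, letter_inv a] w)"

definition edges :: "letter list \<Rightarrow> letter set set" where
  "edges w = {{a, letter_inv a} | a. a \<in> set w}"

text \<open>
  Corner \<open>i\<close> of the polygon lies between the letters at positions \<open>i\<close> and \<open>i + 1\<close>, taken modulo
  the length, so it is the end point of the side \<open>w ! i\<close>. Gluing identifies it with the
  starting point of the side labelled \<open>letter_inv (w ! i)\<close>; if that side is at position \<open>j + 1\<close>,
  its starting point is corner \<open>j\<close>. The vertices are the classes of the equivalence relation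
  generated by these identifications.
\<close>

definition corner_gluing :: "letter list \<Rightarrow> (nat \<times> nat) set" where
  "corner_gluing w =
     {(i, j). i < length w \<and> j < length w \<and>
              w ! (Suc j mod length w) = letter_inv (w ! i)}"

definition vertices :: "letter list \<Rightarrow> nat set set" where
  "vertices w = {..<length w} // (corner_gluing w \<union> (corner_gluing w)\<inverse>)\<^sup>*"

text \<open>
  The polygon is the only face, so the closed oriented surface obtained by gluing has Euler
  characteristic \<open>card (vertices w) - card (edges w) + 1\<close>, and the genus is the number \<open>g\<close> for
  which this equals \<open>2 - 2 * g\<close>.
\<close>

definition has_genus :: "letter list \<Rightarrow> nat \<Rightarrow> bool" where
  "has_genus w g \<longleftrightarrow>
     w \<noteq> [] \<and> int (card (vertices w)) - int (card (edges w)) + 1 = 2 - 2 * int g"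

definition maximal_wicks :: "nat \<Rightarrow> letter list \<Rightarrow> bool" where
  "maximal_wicks g w \<longleftrightarrow>
     oriented_wicks w \<and> has_genus w g \<and> int (length w) = 6 * (2 * int g - 1)"

definition relabelling :: "(letter \<Rightarrow> letter) \<Rightarrow> letter list \<Rightarrow> letter list \<Rightarrow> bool" where
  "relabelling \<phi> w w' \<longleftrightarrow>
     bij_betw \<phi> (set w) (set w') \<and> (\<forall>a \<in> set w. \<phi> (letter_inv a) = letter_inv (\<phi> a))"

definition wicks_isomorphic :: "letter list \<Rightarrow> letter list \<Rightarrow> bool" where
  "wicks_isomorphic w w' \<longleftrightarrow>
     (\<exists>\<phi>. relabelling \<phi> w w' \<and> same_cyclic_word (map \<phi> w) w')"

text \<open>
  The letters of \<open>w\<close> oriented toward a vertex \<open>V\<close> are those ending at one of its corners.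
\<close>

definition incoming :: "letter list \<Rightarrow> nat set \<Rightarrow> letter set" where
  "incoming w V = (\<lambda>i. w ! i) ` V"

definition positive_pattern :: "letter list \<Rightarrow> letter \<Rightarrow> letter \<Rightarrow> letter \<Rightarrow> bool" where
  "positive_pattern w a b c \<longleftrightarrow>
     (\<exists>x y z. same_cyclic_word
        ([a, letter_inv b] @ x @ [b, letter_inv c] @ y @ [c, letter_inv a] @ z) w)"

definition negative_pattern :: "letter list \<Rightarrow> letter \<Rightarrow> letter \<Rightarrow> letter \<Rightarrow> bool" where
  "negative_pattern w a b c \<longleftrightarrow>
     (\<exists>x y z. same_cyclic_word
        ([a, letter_inv b] @ x @ [c, letter_inv a] @ y @ [b, letter_inv c] @ z) w)"

definition positive_vertex :: "letter list \<Rightarrow> nat set \<Rightarrow> bool" where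
  "positive_vertex w V \<longleftrightarrow>
     (\<exists>a b c. distinct [a, b, c] \<and> incoming w V = {a, b, c} \<and>
        (positive_pattern w a b c \<or> positive_pattern w a c b))"

definition negative_vertex :: "letter list \<Rightarrow> nat set \<Rightarrow> bool" where
  "negative_vertex w V \<longleftrightarrow>
     (\<exists>a b c. distinct [a, b, c] \<and> incoming w V = {a, b, c} \<and>
        (negative_pattern w a b c \<or> negative_pattern w a c b))"

text \<open>
  \<open>shift_relabelling w \<mu> \<phi>\<close> determines \<open>\<phi>\<close> uniquely on the letters of \<open>w\<close>.
\<close>

definition shift_relabelling :: "letter list \<Rightarrow> int \<Rightarrow> (letter \<Rightarrow> letter) \<Rightarrow> bool" where
  "shift_relabelling w \<mu> \<phi> \<longleftrightarrow> relabelling \<phi> w w \<and> rotate (nat \<mu>) w = map \<phi> w"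

definition wicks_Aut :: "letter list \<Rightarrow> int monoid" where
  "wicks_Aut w = (integer_mod_group (length w))
     \<lparr>carrier := {\<mu> \<in> carrier (integer_mod_group (length w)). \<exists>\<phi>. shift_relabelling w \<mu> \<phi>}\<rparr>"

definition reversed_edges :: "letter list \<Rightarrow> (letter \<Rightarrow> letter) \<Rightarrow> letter set set" where
  "reversed_edges w \<phi> = {{a, letter_inv a} | a. a \<in> set w \<and> \<phi> a = letter_inv a}"

definition fixed_vertices :: "letter list \<Rightarrow> int \<Rightarrow> nat set set" where
  "fixed_vertices w \<mu> = {V \<in> vertices w. (\<lambda>i. (i + nat \<mu>) mod length w) ` V = V}"

definition W1 :: "nat \<Rightarrow> letter list set set" where
  "W1 g = {w. maximal_wicks g w} //
     {(w, w'). maximal_wicks g w \<and> maximal_wicks g w' \<and> wicks_isomorphic w w'}"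

definition W2 :: "nat \<Rightarrow> nat \<Rightarrow> letter list set set" where
  "W2 g r = {C \<in> W1 g. \<exists>w \<in> C. \<exists>\<mu> \<in> carrier (wicks_Aut w). \<exists>\<phi>.
     group.ord (wicks_Aut w) \<mu> = 2 \<and> shift_relabelling w \<mu> \<phi> \<and>
     card (reversed_edges w \<phi>) = r}"

definition W3 :: "nat \<Rightarrow> nat \<Rightarrow> nat \<Rightarrow> letter list set set" where
  "W3 g s t = {C \<in> W1 g. \<exists>w \<in> C. \<exists>\<mu> \<in> carrier (wicks_Aut w).
     group.ord (wicks_Aut w) \<mu> = 3 \<and>
     card {V \<in> fixed_vertices w \<mu>. positive_vertex w V} = s \<and>
     card {V \<in> fixed_vertices w \<mu>. negative_vertex w V} = t}"

text \<open>
  The arguments of \<open>W6 g r s t\<close> are those of $W_6^g(3r;2s,2t)$ without the factors.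
\<close>

definition W6 :: "nat \<Rightarrow> nat \<Rightarrow> nat \<Rightarrow> nat \<Rightarrow> letter list set set" where
  "W6 g r s t = W2 g (3 * r) \<inter> W3 g (2 * s) (2 * t)"

definition mass :: "letter list set set \<Rightarrow> real" where
  "mass W = (\<Sum>C \<in> W. 1 / real (order (wicks_Aut (SOME w. w \<in> C))))"

end

theory Submission
  imports Defs "HOL-Combinatorics.Permutations" "HOL-Combinatorics.Cycles" "HOL-Library.FuncSet"
begin

text \<open>
  A maximal Wicks form is a fixed-point-free involution \<open>\<alpha>\<close> of the positions of a cyclic word (which
  letters are inverse to each other) such that \<open>\<alpha>\<close> composed with the rotation by one position has
  only 3-cycles. Isomorphism is conjugation by rotations, so by orbit counting the mass of a class
  of forms is the number of such involutions divided by the length of the word.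

  If \<open>\<alpha>\<close> commutes with a rotation of order \<open>d\<close>, it descends to a map with one face whose
  half-edges and degree-1 vertices are the reversed edges and the fixed vertices, together with
  voltages in \<open>\<int>/d\<close>. The voltages solve a linear system on a connected graph; if it is solvable at
  all, it has \<open>d\<^sup>2\<^sup>f\<close> solutions, where \<open>f\<close> is the genus of the quotient. Solvability is a congruence,
  and the sign of a fixed vertex is the value of its voltage.

  One-face maps with vertices of degree 1 and 3 are counted by Chapuy's trisections: exactly \<open>2f\<close>
  of the degree-3 vertices can be cut into three leaves so that a single face remains, and each
  choice of three leaves of a map of genus \<open>f - 1\<close> arises in this way. This reduces to plane trees,
  which are counted by removing a leaf.
\<close>

section \<open>Plane trees with vertices of degree 1 and 3\<close>

text \<open>The sets \<open>W2\<close>, \<open>W3\<close> and \<open>W6\<close> ask only for certain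
  automorphisms, not for the exact group. Their masses are therefore plain numbers of involutions
  that commute with a \<open>d\<close>-th of a full turn, over the length of the word, and no
  inclusion-exclusion is needed. The factors of the formulas have separate origins. Voltages give
  \<open>d ^ (2 * f)\<close>, trisections \<open>1 / (12 ^ f * fact f)\<close>, plane trees with
  \<open>V\<close> vertices of degree 3 give \<open>fact (2 * V) / fact V\<close>. Choosing
  \<open>s\<close> of the \<open>s + t\<close> leaves turns \<open>1 / fact (s + t)\<close> into
  \<open>1 / (fact s * fact t)\<close>. Labels cost nothing, since a rooted map has no
  automorphisms. For \<open>V = 0\<close> the tree factor cannot be rewritten as
  \<open>2 * fact (2 * V - 1) / fact (V - 1)\<close>, which is why genus 1 stands apart for
  \<open>d = 3\<close> and \<open>d = 6\<close>. The face of the covering must be single too, so the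
  monodromy around the quotient face generates the deck group and is normalised to 1. This
  inhomogeneous term in the voltage system is the source of the congruences and of the bound
  \<open>d dvd 6\<close>.\<close>

definition single_cycle :: "('a \<Rightarrow> 'a) \<Rightarrow> 'a set \<Rightarrow> bool" where
  "single_cycle f D \<longleftrightarrow> f permutes D \<and> (\<forall>S. S \<subseteq> D \<longrightarrow> S \<noteq> {} \<longrightarrow> f ` S \<subseteq> S \<longrightarrow> S = D)"

definition involutions :: "'a set \<Rightarrow> nat \<Rightarrow> ('a \<Rightarrow> 'a) set" where
  "involutions D r = {\<beta>. \<beta> permutes D \<and> (\<forall>x. \<beta> (\<beta> x) = x) \<and> card {x \<in> D. \<beta> x = x} = r}"

definition cube_roots :: "'a set \<Rightarrow> nat \<Rightarrow> ('a \<Rightarrow> 'a) set" where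
  "cube_roots D k = {\<theta>. \<theta> permutes D \<and> (\<forall>x. \<theta> (\<theta> (\<theta> x)) = x) \<and> card {x \<in> D. \<theta> x = x} = k}"

text \<open>\<open>\<theta>\<close> permutes the half-edges around the vertices and \<open>\<beta> \<circ> \<theta>\<close> is the face permutation; fixed points
  of \<open>\<beta>\<close> are half-edges without a partner. The map is a tree only if the numbers of vertices and
  edges match, as in the hypotheses of the counting lemma.\<close>

definition trees :: "'a set \<Rightarrow> ('a \<Rightarrow> 'a) \<Rightarrow> nat \<Rightarrow> ('a \<Rightarrow> 'a) set" where
  "trees D \<theta> r = {\<beta> \<in> involutions D r. single_cycle (\<beta> \<circ> \<theta>) D}"

lemma single_cycleD: "single_cycle f D \<Longrightarrow> S \<subseteq> D \<Longrightarrow> S \<noteq> {} \<Longrightarrow> f ` S \<subseteq> S \<Longrightarrow> S = D"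
  unfolding single_cycle_def by blast

lemma permutes_of_involution:
  assumes "\<And>x. f (f x) = x" "\<And>x. x \<notin> D \<Longrightarrow> f x = x"
  shows "f permutes D"
  unfolding permutes_def using assms by metis

lemma permutes_of_cube_root:
  assumes "\<And>x. f (f (f x)) = x" "\<And>x. x \<notin> D \<Longrightarrow> f x = x"
  shows "f permutes D"
  unfolding permutes_def using assms by metis

lemma funpow_closed: "f ` S \<subseteq> S \<Longrightarrow> x \<in> S \<Longrightarrow> (f ^^ k) x \<in> S"
  by (induction k) auto

text \<open>\<open>ex\<close> sends a point to the first point of \<open>D'\<close> on its forward
  orbit, so \<open>c'\<close> is the first-return map of \<open>c\<close>. Closed sets correspond:
  those of \<open>c'\<close> are pulled back along \<open>ex\<close>, those of \<open>c\<close> are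
  intersected with \<open>D'\<close>. The tree surgeries below control the face through this lemma,
  by naming where the walk leaves the removed vertex.\<close>

lemma single_cycle_first_return:
  assumes fin: "finite D" and sub: "D' \<subseteq> D" and c: "c permutes D" and c': "c' permutes D'"
    and e0: "\<And>u. u \<in> D' \<Longrightarrow> ex u = u"
    and e1: "\<And>u. u \<in> D - D' \<Longrightarrow> ex (c u) = ex u"
    and e2: "\<And>u. u \<in> D' \<Longrightarrow> ex (c u) = c' u"
    and e3: "\<And>u. u \<in> D \<Longrightarrow> ex u \<in> D' \<and> (\<exists>k. ex u = (c ^^ k) u)"
  shows "single_cycle c D \<longleftrightarrow> single_cycle c' D'"
proof
  assume sc: "single_cycle c D"
  show "single_cycle c' D'" unfolding single_cycle_def
  proof (intro conjI allI impI c')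
    fix S' assume S': "S' \<subseteq> D'" "S' \<noteq> {}" "c' ` S' \<subseteq> S'"
    define S where "S = {u \<in> D. ex u \<in> S'}"
    have "c ` S \<subseteq> S"
    proof
      fix v assume "v \<in> c ` S"
      then obtain u where u: "u \<in> D" "ex u \<in> S'" "v = c u" unfolding S_def by blast
      have "c u \<in> D" using u c by (simp add: permutes_in_image)
      moreover have "ex (c u) \<in> S'"
        using u S' e0 e1 e2 by (cases "u \<in> D'") (auto simp: image_subset_iff)
      ultimately show "v \<in> S" using u unfolding S_def by simp
    qed
    moreover have "S \<noteq> {}" using S' sub e0 unfolding S_def by fastforce
    moreover have "S \<subseteq> D" unfolding S_def by blast
    ultimately have "S = D" using sc single_cycleD by metis
    then have "ex u \<in> S'" if "u \<in> D" for u using that unfolding S_def by blast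
    then have "D' \<subseteq> S'" using sub e0 by (metis subset_iff)
    then show "S' = D'" using S' by blast
  qed
next
  assume sc: "single_cycle c' D'"
  show "single_cycle c D" unfolding single_cycle_def
  proof (intro conjI allI impI c)
    fix S assume S: "S \<subseteq> D" "S \<noteq> {}" "c ` S \<subseteq> S"
    have exS: "ex u \<in> T" if "u \<in> T" "T \<subseteq> D" "c ` T \<subseteq> T" for u T
    proof -
      obtain k where "ex u = (c ^^ k) u" using e3[of u] \<open>u \<in> T\<close> \<open>T \<subseteq> D\<close> by blast
      then show ?thesis using funpow_closed[OF \<open>c ` T \<subseteq> T\<close> \<open>u \<in> T\<close>] by simp
    qed
    have "c' ` (S \<inter> D') \<subseteq> S \<inter> D'"
    proof
      fix v assume "v \<in> c' ` (S \<inter> D')"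
      then obtain u where u: "u \<in> S" "u \<in> D'" "v = c' u" by blast
      have "c u \<in> S" using u S by blast
      then have "ex (c u) \<in> S" using exS S by blast
      then show "v \<in> S \<inter> D'" using u e2 c' by (simp add: permutes_in_image)
    qed
    moreover have "S \<inter> D' \<noteq> {}" using S e3 exS by blast
    ultimately have "S \<inter> D' = D'" using sc single_cycleD by (metis Int_lower2)
    then have D'S: "D' \<subseteq> S" by blast
    have "finite S" using S fin finite_subset by blast
    moreover have "inj_on c S" using c permutes_inj_on by blast
    ultimately have "c ` S = S" using S by (simp add: endo_inj_surj)
    then have cS: "c v \<in> S \<Longrightarrow> v \<in> S" for v
      using permutes_inj[OF c] by (metis imageE injD)
    \<comment> \<open>The complement of \<open>S\<close> is closed as well; a point of it would
      enter \<open>D'\<close> inside the complement, although \<open>D'\<close> lies in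
      \<open>S\<close>.\<close>
    have "c ` (D - S) \<subseteq> D - S"
      using c cS by (auto simp: permutes_in_image)
    then show "S = D" using D'S exS[of _ "D - S"] S e3 by blast
  qed
qed

section \<open>Removal of one vertex from a plane tree\<close>

lemma finite_involutions: "finite D \<Longrightarrow> finite (involutions D r)"
  unfolding involutions_def by (rule finite_subset[OF _ finite_permutations[of D]]) auto

lemma finite_cube_roots: "finite D \<Longrightarrow> finite (cube_roots D k)"
  unfolding cube_roots_def by (rule finite_subset[OF _ finite_permutations[of D]]) auto

lemma finite_trees: "finite D \<Longrightarrow> finite (trees D \<theta> r)"
  unfolding trees_def using finite_involutions[of D r] by simp

lemma cube_root_orbit_closed:
  assumes "\<And>u. \<theta> (\<theta> (\<theta> u)) = u" "E = {x, \<theta> x, \<theta> (\<theta> x)}"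
  shows "\<theta> u \<in> E \<longleftrightarrow> u \<in> E"
proof -
  have step: "\<theta> v \<in> E" if "v \<in> E" for v
    using that assms(1)[of x] unfolding assms(2) by (elim insertE emptyE) simp_all
  show ?thesis using step[of u] step[of "\<theta> u"] step[of "\<theta> (\<theta> u)"] assms(1)[of u] by auto
qed

text \<open>\<open>E\<close> is a vertex of degree 1 or 3 that hangs on the rest only through
  \<open>e\<close>. Detaching it leaves the former partner of \<open>e\<close> free; conversely the
  \<open>r'\<close> free half-edges are the possible places of attachment. The fixed points in
  \<open>E - {e}\<close> are lost and one is gained, which is the relation
  \<open>r + 2 = r' + card E\<close>.\<close>

lemma card_trees_attach:
  assumes fin: "finite D" and th: "\<theta> permutes D" and th3: "\<And>u. \<theta> (\<theta> (\<theta> u)) = u"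
    and xD: "x \<in> D" and E: "E = {x, \<theta> x, \<theta> (\<theta> x)}" and e: "e \<in> E" and ne: "D - E \<noteq> {}"
    and th': "\<theta>' permutes (D - E)" and agree: "\<And>u. u \<in> D - E \<Longrightarrow> \<theta>' u = \<theta> u"
    and r: "r + 2 = r' + card E"
  shows "card {\<beta> \<in> trees D \<theta> r. (\<forall>u \<in> E - {e}. \<beta> u = u) \<and> \<beta> e \<notin> E}
    = r' * card (trees (D - E) \<theta>' r')"
proof -
  let ?D = "D - E"
  have ED: "E \<subseteq> D" using xD th unfolding E by (auto simp: permutes_in_image)
  have finE: "finite E" unfolding E by simp
  have cE: "card (E - {e}) + 1 = card E" using card_Suc_Diff1[OF finE e] by simp
  have thE: "\<theta> u \<in> E \<longleftrightarrow> u \<in> E" for u by (rule cube_root_orbit_closed[OF th3 E])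
  have the: "\<theta> u = e \<or> \<theta> (\<theta> u) = e \<or> u = e" if "u \<in> E" for u
    using that e th3[of x] unfolding E by (elim insertE emptyE) simp_all
  define F where "F = (\<lambda>\<beta>. (\<lambda>u. if u = e \<or> u = \<beta> e then u else \<beta> u, \<beta> e) :: ('a \<Rightarrow> 'a) \<times> 'a)"
  define G where "G = (\<lambda>(\<beta>' :: 'a \<Rightarrow> 'a, y). \<lambda>u. if u = e then y else if u = y then e else \<beta>' u)"
  let ?A = "{\<beta> \<in> trees D \<theta> r. (\<forall>u \<in> E - {e}. \<beta> u = u) \<and> \<beta> e \<notin> E}"
  let ?B = "Sigma (trees ?D \<theta>' r') (\<lambda>\<beta>'. {y \<in> ?D. \<beta>' y = y})"
  have key: "single_cycle (\<beta> \<circ> \<theta>) D \<longleftrightarrow> single_cycle (\<beta>' \<circ> \<theta>') ?D"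
    if b: "\<beta> permutes D" "\<beta>' permutes ?D" "\<beta> e = y" "y \<in> ?D" "\<beta> y = e" "\<beta>' y = y"
      "\<And>u. u \<noteq> e \<Longrightarrow> u \<noteq> y \<Longrightarrow> \<beta> u = \<beta>' u" for \<beta> \<beta>' y
  \<comment> \<open>Inside \<open>E\<close> the face walk runs around the vertex until it reaches
    \<open>e\<close> and leaves to \<open>y\<close>.\<close>
  proof (rule single_cycle_first_return[where ex = "\<lambda>u. if u \<in> E then y else u"])
    have b'E: "\<beta>' u = u" if "u \<in> E" for u using b(2) that by (simp add: permutes_def)
    show "finite D" "?D \<subseteq> D" using fin by auto
    show "\<beta> \<circ> \<theta> permutes D" using permutes_compose[OF th b(1)] .
    show "\<beta>' \<circ> \<theta>' permutes ?D" using permutes_compose[OF th' b(2)] .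
    show "(if (\<beta> \<circ> \<theta>) u \<in> E then y else (\<beta> \<circ> \<theta>) u) = (if u \<in> E then y else u)"
      if "u \<in> D - ?D" for u
    proof -
      have "u \<in> E" using that by blast
      then have "\<theta> u \<in> E" using thE by blast
      have "\<beta> (\<theta> u) = (if \<theta> u = e then y else \<theta> u)"
        using b(3,4) b(7)[of "\<theta> u"] b'E[OF \<open>\<theta> u \<in> E\<close>] \<open>\<theta> u \<in> E\<close> by (metis DiffD2)
      then show ?thesis using \<open>u \<in> E\<close> \<open>\<theta> u \<in> E\<close> b(4) by auto
    qed
    show "(if (\<beta> \<circ> \<theta>) u \<in> E then y else (\<beta> \<circ> \<theta>) u) = (\<beta>' \<circ> \<theta>') u" if "u \<in> ?D" for u
    proof -
      have t: "\<theta> u \<in> ?D" using that thE th by (simp add: permutes_in_image)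
      then have ne': "\<theta> u \<noteq> e" using e by blast
      have "\<beta>' (\<theta> u) \<in> ?D" using t b(2) by (simp only: permutes_in_image)
      moreover have "\<beta> (\<theta> u) = (if \<theta> u = y then e else \<beta>' (\<theta> u))"
        using b(5) b(7)[OF ne'] by simp
      ultimately show ?thesis using e b(6) agree[OF that] by (cases "\<theta> u = y") auto
    qed
    show "(if u \<in> E then y else u) \<in> ?D \<and> (\<exists>k. (if u \<in> E then y else u) = ((\<beta> \<circ> \<theta>) ^^ k) u)"
      if u: "u \<in> D" for u
    proof (cases "u \<in> E")
      case True
      let ?c = "\<beta> \<circ> \<theta>"
      have s1: "?c v = y" if "\<theta> v = e" for v using that b(3) by simp
      have s2: "?c v = \<theta> v" if "v \<in> E" "\<theta> v \<noteq> e" for v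
        using that b(4) b(7)[of "\<theta> v"] b'E[of "\<theta> v"] thE[of v] by (metis DiffE comp_apply)
      have "(?c ^^ 1) u = y \<or> (?c ^^ 2) u = y \<or> (?c ^^ 3) u = y"
      proof (cases "\<theta> u = e")
        case True then show ?thesis using s1 by simp
      next
        case F1: False
        then have c1: "?c u = \<theta> u" using s2 True by blast
        show ?thesis
        proof (cases "\<theta> (\<theta> u) = e")
          case True
          then have "?c (?c u) = y" using c1 s1 by metis
          then show ?thesis by (simp add: numeral_2_eq_2)
        next
          case False
          then have ue: "u = e" using the[OF True] F1 by blast
          have c2: "?c (?c u) = \<theta> (\<theta> u)" using c1 s2[of "\<theta> u"] False True thE by metis
          have "\<theta> (\<theta> (\<theta> u)) = e" using th3 ue by simp
          then have "?c (?c (?c u)) = y" using c2 s1 by metis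
          then show ?thesis by (simp add: numeral_3_eq_3)
        qed
      qed
      then show ?thesis using True b(4) by metis
    next
      case False
      have "((\<beta> \<circ> \<theta>) ^^ 0) u = u" by simp
      then show ?thesis using u False by (metis DiffI)
    qed
  qed simp
  have bij: "bij_betw F ?A ?B"
  proof (rule bij_betw_byWitness[where f' = G])
    show "F ` ?A \<subseteq> ?B"
    proof
      fix p assume "p \<in> F ` ?A"
      then obtain \<beta> where b: "\<beta> permutes D" "\<And>x. \<beta> (\<beta> x) = x" "card {x \<in> D. \<beta> x = x} = r"
        "single_cycle (\<beta> \<circ> \<theta>) D" "\<And>u. u \<in> E - {e} \<Longrightarrow> \<beta> u = u" "\<beta> e \<notin> E" and p: "p = F \<beta>"
        unfolding trees_def involutions_def by auto
      define y where "y = \<beta> e"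
      define \<beta>' where "\<beta>' = (\<lambda>u. if u = e \<or> u = y then u else \<beta> u)"
      have p': "p = (\<beta>', y)" unfolding p F_def \<beta>'_def y_def by simp
      have yE: "y \<notin> E" using b y_def by simp
      have yD: "y \<in> D" using b(1) e ED y_def by (auto simp: permutes_in_image)
      have by': "\<beta> y = e" using b y_def by simp
      have inv': "\<beta>' (\<beta>' u) = u" for u unfolding \<beta>'_def using b(2) by' y_def by (smt (verit))
      have perm': "\<beta>' permutes ?D"
        by (rule permutes_of_involution) (use inv' b(1,5) in \<open>auto simp: \<beta>'_def permutes_def\<close>)
      have eq: "{u \<in> D. \<beta> u = u} \<union> {y} = {u \<in> ?D. \<beta>' u = u} \<union> (E - {e})"
        unfolding \<beta>'_def using yE yD by' y_def b(5,6) e ED by auto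
      have "card ({u \<in> D. \<beta> u = u} \<union> {y}) = r + 1"
        using b(3) fin by' yE e by (subst card_Un_disjoint) auto
      moreover have "card ({u \<in> ?D. \<beta>' u = u} \<union> (E - {e})) = card {u \<in> ?D. \<beta>' u = u} + card (E - {e})"
        using fin finE by (subst card_Un_disjoint) auto
      ultimately have card': "card {u \<in> ?D. \<beta>' u = u} = r'" using eq cE r by simp
      have "single_cycle (\<beta>' \<circ> \<theta>') ?D"
        using key[OF b(1) perm' y_def[symmetric] _ by'] b(4) yD yE unfolding \<beta>'_def by simp
      then show "p \<in> ?B" unfolding p' trees_def involutions_def
        using inv' perm' card' yE yD by (simp add: \<beta>'_def)
    qed
    show "G ` ?B \<subseteq> ?A"
    proof
      fix \<beta> assume "\<beta> \<in> G ` ?B"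
      then obtain \<beta>' y where b: "\<beta>' permutes ?D" "\<And>x. \<beta>' (\<beta>' x) = x" "card {x \<in> ?D. \<beta>' x = x} = r'"
        "single_cycle (\<beta>' \<circ> \<theta>') ?D" and y: "y \<in> D" "y \<notin> E" "\<beta>' y = y" and bG: "\<beta> = G (\<beta>', y)"
        unfolding trees_def involutions_def by auto
      have beta: "\<beta> = (\<lambda>u. if u = e then y else if u = y then e else \<beta>' u)" unfolding bG G_def by simp
      have b'E: "\<beta>' u = u" if "u \<in> E" for u using b(1) that by (simp add: permutes_def)
      have inv': "\<beta> (\<beta> u) = u" for u unfolding beta using b(2) y b'E[OF e] by (smt (verit))
      have perm': "\<beta> permutes D"
        by (rule permutes_of_involution) (use inv' b(1) ED e y in \<open>auto simp: beta permutes_def\<close>)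
      have eq: "{u \<in> D. \<beta> u = u} \<union> {y} = {u \<in> ?D. \<beta>' u = u} \<union> (E - {e})"
        unfolding beta using y ED e b'E by auto
      have "card ({u \<in> D. \<beta> u = u} \<union> {y}) = card {u \<in> D. \<beta> u = u} + 1"
        using fin y e by (subst card_Un_disjoint) (auto simp: beta)
      moreover have "card ({u \<in> ?D. \<beta>' u = u} \<union> (E - {e})) = card {u \<in> ?D. \<beta>' u = u} + card (E - {e})"
        using fin finE by (subst card_Un_disjoint) auto
      ultimately have card': "card {u \<in> D. \<beta> u = u} = r" using eq cE r b(3) by simp
      have "single_cycle (\<beta> \<circ> \<theta>) D"
        using iffD2[OF key[OF perm' b(1), of y]] y b(4) e by (auto simp: beta)
      then show "\<beta> \<in> ?A" unfolding trees_def involutions_def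
      proof -
        have "\<forall>u \<in> E - {e}. \<beta> u = u" using y b'E by (auto simp: beta)
        moreover have "\<beta> e \<notin> E" using y by (simp add: beta)
        ultimately show "\<beta> \<in> {\<beta> \<in> {\<beta> \<in> {\<beta>. \<beta> permutes D \<and> (\<forall>x. \<beta> (\<beta> x) = x) \<and> card {x \<in> D. \<beta> x = x} = r}.
           single_cycle (\<beta> \<circ> \<theta>) D}. (\<forall>u \<in> E - {e}. \<beta> u = u) \<and> \<beta> e \<notin> E}"
          using inv' perm' card' \<open>single_cycle (\<beta> \<circ> \<theta>) D\<close> by simp
      qed
    qed
    show "\<forall>\<beta>\<in>?A. G (F \<beta>) = \<beta>"
      unfolding F_def G_def trees_def involutions_def by auto
    show "\<forall>p\<in>?B. F (G p) = p"
      using e unfolding F_def G_def trees_def involutions_def by (auto simp: fun_eq_iff permutes_def)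
  qed
  have "card ?A = card ?B" using bij_betw_same_card[OF bij] .
  also have "\<dots> = (\<Sum>\<beta>'\<in>trees ?D \<theta>' r'. card {y \<in> ?D. \<beta>' y = y})"
    by (rule card_SigmaI) (use fin in \<open>auto intro: finite_trees\<close>)
  also have "\<dots> = (\<Sum>\<beta>'\<in>trees ?D \<theta>' r'. r')"
    by (rule sum.cong) (auto simp: trees_def involutions_def)
  finally show ?thesis by simp
qed

text \<open>Here \<open>x\<close> is free and the other two half-edges of its vertex lead outside.
  Erasing the vertex fuses their two edges into one. Conversely, a vertex with a free half-edge is
  inserted into an edge, on a chosen side of it, so the choices are the half-edges that have a
  partner.\<close>

lemma card_trees_subdivide:
  assumes fin: "finite D" and th: "\<theta> permutes D" and th3: "\<And>u. \<theta> (\<theta> (\<theta> u)) = u"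
    and xD: "x \<in> D" and nf: "\<theta> x \<noteq> x" and E: "E = {x, \<theta> x, \<theta> (\<theta> x)}" and ne: "D - E \<noteq> {}"
    and th': "\<theta>' permutes (D - E)" and agree: "\<And>u. u \<in> D - E \<Longrightarrow> \<theta>' u = \<theta> u"
  shows "card {\<beta> \<in> trees D \<theta> (Suc r). \<beta> x = x \<and> \<beta> (\<theta> x) \<notin> E \<and> \<beta> (\<theta> (\<theta> x)) \<notin> E}
    = (card (D - E) - r) * card (trees (D - E) \<theta>' r)"
proof -
  let ?D = "D - E"
  define y where "y = \<theta> x"
  define z where "z = \<theta> y"
  have tz: "\<theta> z = x" using th3[of x] unfolding y_def z_def .
  have E': "E = {x, y, z}" unfolding E y_def z_def ..
  have inj: "\<theta> u = \<theta> v \<longleftrightarrow> u = v" for u v using permutes_inj[OF th] by (auto dest: injD)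
  have xy: "x \<noteq> y" using nf y_def by metis
  have yz: "y \<noteq> z" using inj[of x y] xy unfolding y_def z_def by simp
  have zx: "z \<noteq> x" using inj[of y z] yz tz unfolding z_def by metis
  have ED: "E \<subseteq> D" using xD th unfolding E by (auto simp: permutes_in_image)
  have thE: "\<theta> u \<in> E \<longleftrightarrow> u \<in> E" for u by (rule cube_root_orbit_closed[OF th3 E])
  define F where "F = (\<lambda>\<beta>. (\<lambda>u. if u = y \<or> u = z then u else if u = \<beta> y then \<beta> z
      else if u = \<beta> z then \<beta> y else \<beta> u, \<beta> y) :: ('a \<Rightarrow> 'a) \<times> 'a)"
  define G where "G = (\<lambda>(\<beta>' :: 'a \<Rightarrow> 'a, w). \<lambda>u. if u = y then w else if u = z then \<beta>' w
      else if u = w then y else if u = \<beta>' w then z else \<beta>' u)"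
  let ?A = "{\<beta> \<in> trees D \<theta> (Suc r). \<beta> x = x \<and> \<beta> y \<notin> E \<and> \<beta> z \<notin> E}"
  let ?B = "Sigma (trees ?D \<theta>' r) (\<lambda>\<beta>'. {w \<in> ?D. \<beta>' w \<noteq> w})"
  have key: "single_cycle (\<beta> \<circ> \<theta>) D \<longleftrightarrow> single_cycle (\<beta>' \<circ> \<theta>') ?D"
    if b: "\<beta> permutes D" "\<beta>' permutes ?D" "\<beta> x = x" "\<beta> y = w" "\<beta> z = w'" "\<beta> w = y" "\<beta> w' = z"
      "\<beta>' w = w'" "\<beta>' w' = w" "w \<noteq> w'" "w \<in> ?D" "w' \<in> ?D"
      "\<And>u. u \<notin> {y, z, w, w'} \<Longrightarrow> \<beta> u = \<beta>' u" for \<beta> \<beta>' w w'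
  proof -
    \<comment> \<open>From \<open>x\<close> and \<open>y\<close> the walk leaves at once, to the
      partners \<open>w\<close> of \<open>y\<close> and \<open>w'\<close> of \<open>z\<close>; from
      \<open>z\<close> it turns back at the free half-edge \<open>x\<close> first.\<close>
    let ?ex = "\<lambda>u. if u = x \<or> u = z then w else if u = y then w' else u"
    have cx: "(\<beta> \<circ> \<theta>) x = w" using b(4) y_def by simp
    have cy: "(\<beta> \<circ> \<theta>) y = w'" using b(5) z_def by simp
    have cz: "(\<beta> \<circ> \<theta>) z = x" using b(3) tz by simp
    have wE: "w \<notin> {x,y,z}" "w' \<notin> {x,y,z}" using b(11,12) E' by auto
    show ?thesis
    proof (rule single_cycle_first_return[where ex = ?ex])
      show "finite D" "?D \<subseteq> D" using fin by auto
      show "\<beta> \<circ> \<theta> permutes D" using permutes_compose[OF th b(1)] .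
      show "\<beta>' \<circ> \<theta>' permutes ?D" using permutes_compose[OF th' b(2)] .
      show "?ex u = u" if "u \<in> ?D" for u using that E' by auto
      show "?ex ((\<beta> \<circ> \<theta>) u) = ?ex u" if "u \<in> D - ?D" for u
      proof -
        have "u \<in> {x,y,z}" using that E' by blast
        then consider "u = x" | "u = y" | "u = z" by blast
        then show ?thesis
        proof cases
          case 1 then show ?thesis using cx wE xy by (simp only:) simp
        next
          case 2 then show ?thesis using cy wE xy yz by (simp only:) simp
        next
          case 3 then show ?thesis using cz by (simp only:) simp
        qed
      qed
      show "?ex ((\<beta> \<circ> \<theta>) u) = (\<beta>' \<circ> \<theta>') u" if "u \<in> ?D" for u
      proof -
        have t: "\<theta> u \<in> ?D" using that thE th by (simp add: permutes_in_image)
        then have tne: "\<theta> u \<noteq> x" "\<theta> u \<noteq> y" "\<theta> u \<noteq> z" using E' by auto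
        have t': "\<beta>' (\<theta> u) \<in> ?D" using t b(2) by (simp only: permutes_in_image)
        have a: "\<theta>' u = \<theta> u" using agree[OF that] .
        consider "\<theta> u = w" | "\<theta> u = w'" | "\<theta> u \<notin> {y, z, w, w'}" using tne by blast
        then show ?thesis
        proof cases
          case 1 then show ?thesis using a b(6,8) xy yz by simp
        next
          case 2 then show ?thesis using a b(7,9) by simp
        next
          case 3
          have "\<beta> (\<theta> u) = \<beta>' (\<theta> u)" using b(13)[OF 3] .
          then show ?thesis using a t' E' by auto
        qed
      qed
      show "?ex u \<in> ?D \<and> (\<exists>k. ?ex u = ((\<beta> \<circ> \<theta>) ^^ k) u)" if u: "u \<in> D" for u
      proof -
        have "\<exists>k. ?ex u = ((\<beta> \<circ> \<theta>) ^^ k) u"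
        proof -
          consider "u = x" | "u = y" | "u = z" | "u \<notin> {x,y,z}" by blast
          then show ?thesis
          proof cases
            case 1
            then have "?ex u = ((\<beta> \<circ> \<theta>) ^^ 1) u" using cx by simp
            then show ?thesis by blast
          next
            case 2
            then have "?ex u = ((\<beta> \<circ> \<theta>) ^^ 1) u" using cy xy yz by simp
            then show ?thesis by blast
          next
            case 3
            then have "?ex u = ((\<beta> \<circ> \<theta>) ^^ 2) u" using cz cx by (simp add: numeral_2_eq_2)
            then show ?thesis by blast
          next
            case 4
            then have "?ex u = ((\<beta> \<circ> \<theta>) ^^ 0) u" by simp
            then show ?thesis by blast
          qed
        qed
        moreover have "?ex u \<in> ?D" using u b(11,12) E' by auto
        ultimately show ?thesis by blast
      qed
    qed
  qed
  have bij: "bij_betw F ?A ?B"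
  proof (rule bij_betw_byWitness[where f' = G])
    show "F ` ?A \<subseteq> ?B"
    proof
      fix p assume "p \<in> F ` ?A"
      then obtain \<beta> where b: "\<beta> permutes D" "\<And>x. \<beta> (\<beta> x) = x" "card {x \<in> D. \<beta> x = x} = Suc r"
        "single_cycle (\<beta> \<circ> \<theta>) D" "\<beta> x = x" "\<beta> y \<notin> E" "\<beta> z \<notin> E" and p: "p = F \<beta>"
        unfolding trees_def involutions_def by auto
      define w w' where "w = \<beta> y" and "w' = \<beta> z"
      define \<beta>' where "\<beta>' = (\<lambda>u. if u = y \<or> u = z then u else if u = w then w' else if u = w' then w else \<beta> u)"
      have p': "p = (\<beta>', w)" unfolding p F_def \<beta>'_def w_def w'_def by simp
      have bw: "\<beta> w = y" "\<beta> w' = z" using b(2) unfolding w_def w'_def by auto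
      have ww: "w \<noteq> w'" using bw yz by metis
      have wE: "w \<notin> E" "w' \<notin> E" using b w_def w'_def by auto
      have wD: "w \<in> D" "w' \<in> D" using b(1) ED E' unfolding w_def w'_def by (auto simp: permutes_in_image)
      have wn: "w \<noteq> y" "w \<noteq> z" "w' \<noteq> y" "w' \<noteq> z" "w \<noteq> x" "w' \<noteq> x" using wE E' by auto
      have inv': "\<beta>' (\<beta>' u) = u" for u
      proof (cases "u \<in> {y, z, w, w'}")
        case True
        then show ?thesis using wn ww unfolding \<beta>'_def by auto
      next
        case False
        then have "\<beta> u \<notin> {y, z, w, w'}" using b(2)[of u] bw w_def w'_def by auto
        then show ?thesis using False b(2)[of u] unfolding \<beta>'_def by simp
      qed
      have perm': "\<beta>' permutes ?D"
      proof (rule permutes_of_involution[OF inv'])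
        fix u assume "u \<notin> ?D"
        then have "u \<notin> D \<or> u = x \<or> u = y \<or> u = z" using E' by blast
        then show "\<beta>' u = u" using b(1,5) wn wD unfolding \<beta>'_def permutes_def by auto
      qed
      have "{u \<in> D. \<beta> u = u} = insert x {u \<in> ?D. \<beta>' u = u}"
      proof (rule Set.set_eqI)
        fix u
        consider "u = x" | "u = y" | "u = z" | "u = w" | "u = w'" | "u \<notin> {x,y,z,w,w'}" by blast
        then show "u \<in> {u \<in> D. \<beta> u = u} \<longleftrightarrow> u \<in> insert x {u \<in> ?D. \<beta>' u = u}"
          by cases (use b(5) bw wn ww xD E' xy yz zx w_def w'_def in \<open>auto simp: \<beta>'_def\<close>)
      qed
      then have card': "card {u \<in> ?D. \<beta>' u = u} = r" using b(3) fin E' by simp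
      have *: "\<beta>' w = w'" "\<beta>' w' = w" using wn ww unfolding \<beta>'_def by auto
      have "single_cycle (\<beta>' \<circ> \<theta>') ?D"
        by (rule iffD1[OF key[OF b(1) perm' b(5) w_def[symmetric] w'_def[symmetric] bw * ww] b(4)])
           (use wD wE in \<open>auto simp: \<beta>'_def\<close>)
      moreover have "w \<in> ?D" "\<beta>' w \<noteq> w" using wD wE * ww by auto
      ultimately show "p \<in> ?B" unfolding p' trees_def involutions_def
        using inv' perm' card' by simp
    qed
    show "G ` ?B \<subseteq> ?A"
    proof
      fix \<beta> assume "\<beta> \<in> G ` ?B"
      then obtain \<beta>' w where b: "\<beta>' permutes ?D" "\<And>x. \<beta>' (\<beta>' x) = x" "card {x \<in> ?D. \<beta>' x = x} = r"
        "single_cycle (\<beta>' \<circ> \<theta>') ?D" and w: "w \<in> ?D" "\<beta>' w \<noteq> w" and bG: "\<beta> = G (\<beta>', w)"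
        unfolding trees_def involutions_def by auto
      define w' where "w' = \<beta>' w"
      have beta: "\<beta> = (\<lambda>u. if u = y then w else if u = z then w' else if u = w then y
          else if u = w' then z else \<beta>' u)"
        unfolding bG G_def w'_def by simp
      have w'D: "w' \<in> ?D" using w(1) b(1) unfolding w'_def by (simp only: permutes_in_image)
      have ww: "w \<noteq> w'" using w w'_def by metis
      have b'w': "\<beta>' w' = w" using b(2) w'_def by simp
      have wn: "w \<noteq> y" "w \<noteq> z" "w' \<noteq> y" "w' \<noteq> z" "w \<noteq> x" "w' \<noteq> x" using w w'D E' by auto
      have b'E: "\<beta>' u = u" if "u \<notin> ?D" for u using b(1) that unfolding permutes_def by metis
      have b'3: "\<beta>' x = x" "\<beta>' y = y" "\<beta>' z = z" using b'E E' by auto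
      have inv': "\<beta> (\<beta> u) = u" for u
      proof (cases "u \<in> {y, z, w, w'}")
        case True
        then show ?thesis using wn ww yz unfolding beta by auto
      next
        case False
        then have "\<beta>' u \<notin> {y, z, w, w'}" using b(2)[of u] b'3 b'w' w'_def by auto
        then show ?thesis using False b(2)[of u] unfolding beta by simp
      qed
      have bx: "\<beta> x = x" using b'3 wn xy zx unfolding beta by auto
      have byz: "\<beta> y = w" "\<beta> z = w'" "\<beta> w = y" "\<beta> w' = z" using wn ww yz unfolding beta by auto
      have perm': "\<beta> permutes D"
      proof (rule permutes_of_involution[OF inv'])
        fix u assume "u \<notin> D"
        then have "u \<notin> {y, z, w, w'}" "u \<notin> ?D" using ED E' w w'D by auto
        then show "\<beta> u = u" using b'E unfolding beta by auto
      qed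
      have "{u \<in> D. \<beta> u = u} = insert x {u \<in> ?D. \<beta>' u = u}"
      proof (rule Set.set_eqI)
        fix u
        consider "u = x" | "u = y" | "u = z" | "u = w" | "u = w'" | "u \<notin> {x,y,z,w,w'}" by blast
        then show "u \<in> {u \<in> D. \<beta> u = u} \<longleftrightarrow> u \<in> insert x {u \<in> ?D. \<beta>' u = u}"
        proof cases
          case 6 then show ?thesis using E' by (auto simp: beta)
        qed (use bx byz wn ww xD xy zx b'w' w'_def E' in auto)
      qed
      then have card': "card {u \<in> D. \<beta> u = u} = Suc r" using b(3) fin E' by simp
      have "single_cycle (\<beta> \<circ> \<theta>) D"
        by (rule iffD2[OF key[OF perm' b(1) bx byz w'_def[symmetric] b'w' ww w(1) w'D] b(4)])
           (auto simp: beta)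
      then show "\<beta> \<in> ?A" unfolding trees_def involutions_def
        using inv' perm' card' bx byz w w'D by simp
    qed
    show "\<forall>\<beta>\<in>?A. G (F \<beta>) = \<beta>"
    proof
      fix \<beta> assume A: "\<beta> \<in> ?A"
      then have b: "\<And>x. \<beta> (\<beta> x) = x" unfolding trees_def involutions_def by auto
      have n: "\<beta> y \<noteq> y" "\<beta> y \<noteq> z" "\<beta> z \<noteq> y" "\<beta> z \<noteq> z" using A E' by auto
      have n2: "\<beta> y \<noteq> \<beta> z" using b yz by metis
      show "G (F \<beta>) = \<beta>"
      proof
        fix u
        consider "u = y" | "u = z" | "u = \<beta> y" | "u = \<beta> z" | "u \<notin> {y, z, \<beta> y, \<beta> z}" by blast
        then show "G (F \<beta>) u = \<beta> u"
          unfolding F_def G_def by cases (use n n2 b in auto)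
      qed
    qed
    show "\<forall>p\<in>?B. F (G p) = p"
    proof
      fix p assume "p \<in> ?B"
      then obtain \<beta>' w where b: "\<beta>' permutes ?D" "\<And>x. \<beta>' (\<beta>' x) = x" and w: "w \<in> ?D" "\<beta>' w \<noteq> w"
        and p: "p = (\<beta>', w)" unfolding trees_def involutions_def by auto
      have w'D: "\<beta>' w \<in> ?D" using w(1) b(1) by (simp only: permutes_in_image)
      have wn: "w \<noteq> y" "w \<noteq> z" "\<beta>' w \<noteq> y" "\<beta>' w \<noteq> z" using w w'D E' by auto
      have b'E: "\<beta>' u = u" if "u \<notin> ?D" for u using b(1) that unfolding permutes_def by metis
      have b'3: "\<beta>' y = y" "\<beta>' z = z" using b'E E' by auto
      have "fst (F (G p)) u = \<beta>' u" for u
      proof -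
        consider "u = y" | "u = z" | "u = w" | "u = \<beta>' w" | "u \<notin> {y, z, w, \<beta>' w}" by blast
        then show ?thesis
          unfolding p F_def G_def by cases (use wn w b(2) b'3 yz in auto)
      qed
      moreover have "snd (F (G p)) = w" unfolding p F_def G_def by simp
      ultimately show "F (G p) = p" unfolding p by (auto simp: prod_eq_iff)
    qed
  qed
  have "card ?A = card ?B" using bij_betw_same_card[OF bij] .
  also have "\<dots> = (\<Sum>\<beta>'\<in>trees ?D \<theta>' r. card {w \<in> ?D. \<beta>' w \<noteq> w})"
    by (rule card_SigmaI) (use fin in \<open>auto intro: finite_trees\<close>)
  also have "\<dots> = (\<Sum>\<beta>'\<in>trees ?D \<theta>' r. card ?D - r)"
  proof (rule sum.cong[OF refl])
    fix \<beta>' assume "\<beta>' \<in> trees ?D \<theta>' r"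
    then have "card {w \<in> ?D. \<beta>' w = w} = r" unfolding trees_def involutions_def by auto
    moreover have "{w \<in> ?D. \<beta>' w \<noteq> w} = ?D - {w \<in> ?D. \<beta>' w = w}" by blast
    ultimately show "card {w \<in> ?D. \<beta>' w \<noteq> w} = card ?D - r"
      using fin by (simp only:) (subst card_Diff_subset, auto)
  qed
  finally show ?thesis unfolding y_def z_def by simp
qed

lemma cube_roots_remove_orbit:
  assumes fin: "finite D" and th: "\<theta> \<in> cube_roots D k" and xD: "x \<in> D"
    and E: "E = {x, \<theta> x, \<theta> (\<theta> x)}" and k: "k = k' + card {u \<in> E. \<theta> u = u}"
  shows "(\<lambda>u. if u \<in> E then u else \<theta> u) \<in> cube_roots (D - E) k'"
proof -
  have t: "\<theta> permutes D" "\<And>u. \<theta> (\<theta> (\<theta> u)) = u" "card {u \<in> D. \<theta> u = u} = k"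
    using th unfolding cube_roots_def by auto
  have ED: "E \<subseteq> D" using xD t(1) unfolding E by (auto simp: permutes_in_image)
  have thE: "\<theta> u \<in> E \<longleftrightarrow> u \<in> E" for u by (rule cube_root_orbit_closed[OF t(2) E])
  let ?t = "\<lambda>u. if u \<in> E then u else \<theta> u"
  have t3: "?t (?t (?t u)) = u" for u using thE t(2) by simp
  have tperm: "?t permutes (D - E)"
    by (rule permutes_of_cube_root[OF t3]) (use t(1) in \<open>auto simp: permutes_def\<close>)
  have "card {u \<in> D. \<theta> u = u} = card ({u \<in> D - E. ?t u = u} \<union> {u \<in> E. \<theta> u = u})"
    by (rule arg_cong[where f = card]) (use ED in auto)
  also have "\<dots> = card {u \<in> D - E. ?t u = u} + card {u \<in> E. \<theta> u = u}"
    by (rule card_Un_disjoint) (use fin E in auto)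
  finally have "k = card {u \<in> D - E. ?t u = u} + card {u \<in> E. \<theta> u = u}" using t(3) by simp
  then show ?thesis unfolding cube_roots_def using t3 k tperm by simp
qed

lemma single_cycle_id_iff:
  assumes "\<theta> permutes D" "\<And>u. \<theta> (\<theta> (\<theta> u)) = u" "D = {x, \<theta> x, \<theta> (\<theta> x)}"
  shows "single_cycle \<theta> D"
  unfolding single_cycle_def
proof (intro conjI allI impI assms(1))
  fix S assume S: "S \<subseteq> D" "S \<noteq> {}" "\<theta> ` S \<subseteq> S"
  then obtain u where u: "u \<in> S" by blast
  have "\<theta> u \<in> S" "\<theta> (\<theta> u) \<in> S" using u S(3) by auto
  moreover have "D = {u, \<theta> u, \<theta> (\<theta> u)}"
  proof -
    have "u = x \<or> u = \<theta> x \<or> u = \<theta> (\<theta> x)" using u S assms(3) by blast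
    then show ?thesis using assms(2)[of x] assms(3) by (elim disjE) auto
  qed
  ultimately show "S = D" using u S(1) by blast
qed

lemma trees_one_orbit:
  assumes "finite D" "\<theta> permutes D" "\<And>u. \<theta> (\<theta> (\<theta> u)) = u" "D = {x, \<theta> x, \<theta> (\<theta> x)}"
  shows "trees D \<theta> (card D) = {id}"
proof -
  have "\<beta> = id" if "\<beta> \<in> trees D \<theta> (card D)" for \<beta>
  proof -
    have b: "\<beta> permutes D" "card {u \<in> D. \<beta> u = u} = card D"
      using that unfolding trees_def involutions_def by auto
    have "{u \<in> D. \<beta> u = u} = D" by (rule card_subset_eq[OF assms(1)]) (use b in auto)
    then show ?thesis using b(1) unfolding permutes_def by (metis (mono_tags, lifting) eq_id_iff mem_Collect_eq)
  qed
  moreover have "id \<in> trees D \<theta> (card D)"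
    using single_cycle_id_iff[OF assms(2-4)] unfolding trees_def involutions_def
    by (auto simp: permutes_id)
  ultimately show ?thesis by blast
qed

text \<open>With \<open>x\<close> free, either both other half-edges of its vertex lead outside, and
  the vertex subdivides an edge, or exactly one does, and the vertex hangs on one of the
  \<open>r\<close> free half-edges. Anything else would close a face inside the vertex. The summand
  \<open>2 * r\<close> covers the two choices of the attaching half-edge.\<close>

lemma card_trees_fixing:
  assumes fin: "finite D" and th: "\<theta> \<in> cube_roots D 0" and xD: "x \<in> D"
    and E: "E = {x, \<theta> x, \<theta> (\<theta> x)}" and ne: "D - E \<noteq> {}"
    and th': "\<theta>' permutes (D - E)" and agree: "\<And>u. u \<in> D - E \<Longrightarrow> \<theta>' u = \<theta> u"
  shows "card {\<beta> \<in> trees D \<theta> (Suc r). \<beta> x = x}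
    = (card (D - E) - r + 2 * r) * card (trees (D - E) \<theta>' r)"
proof -
  have t: "\<theta> permutes D" "\<And>u. \<theta> (\<theta> (\<theta> u)) = u" "card {u \<in> D. \<theta> u = u} = 0"
    using th unfolding cube_roots_def by auto
  have nf: "\<theta> u \<noteq> u" if "u \<in> D" for u using t(3) that fin by auto
  define y where "y = \<theta> x"
  define z where "z = \<theta> y"
  have tz: "\<theta> z = x" using t(2)[of x] unfolding y_def z_def .
  have E': "E = {x, y, z}" unfolding E y_def z_def ..
  have ED: "E \<subseteq> D" using xD t(1) unfolding E by (auto simp: permutes_in_image)
  have yD: "y \<in> D" "z \<in> D" using ED E' by auto
  have xy: "x \<noteq> y" using nf[OF xD] y_def by metis
  have yz: "y \<noteq> z" using nf[OF yD(1)] z_def by metis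
  have zx: "z \<noteq> x" using nf[OF yD(2)] tz by metis
  have cE: "card E = 3" using E' xy yz zx by simp
  let ?A = "{\<beta> \<in> trees D \<theta> (Suc r). \<beta> x = x}"
  let ?A1 = "{\<beta> \<in> trees D \<theta> (Suc r). \<beta> x = x \<and> \<beta> (\<theta> x) \<notin> E \<and> \<beta> (\<theta> (\<theta> x)) \<notin> E}"
  let ?A2 = "{\<beta> \<in> trees D \<theta> (Suc r). (\<forall>u \<in> E - {y}. \<beta> u = u) \<and> \<beta> y \<notin> E}"
  let ?A3 = "{\<beta> \<in> trees D \<theta> (Suc r). (\<forall>u \<in> E - {z}. \<beta> u = u) \<and> \<beta> z \<notin> E}"
  have fins: "finite ?A1" "finite ?A2" "finite ?A3" using finite_trees[OF fin, of \<theta> "Suc r"] by auto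
  have split: "?A = ?A1 \<union> (?A2 \<union> ?A3)"
  proof (intro equalityI subsetI)
    fix \<beta> assume "\<beta> \<in> ?A"
    then have bt: "\<beta> \<in> trees D \<theta> (Suc r)" and bx: "\<beta> x = x" by auto
    have b: "\<And>u. \<beta> (\<beta> u) = u" and sc: "single_cycle (\<beta> \<circ> \<theta>) D"
      using bt unfolding trees_def involutions_def by auto
    have no: "\<not> (\<beta> \<circ> \<theta>) ` S \<subseteq> S" if "S \<subseteq> E" "S \<noteq> {}" for S
      using single_cycleD[OF sc, of S] that ED ne by blast
    have n1: "\<beta> y \<noteq> x" "\<beta> z \<noteq> x" using b[of y] b[of z] bx xy zx by metis+
    \<comment> \<open>Joining \<open>y\<close> to \<open>z\<close> would split off the face
      \<open>{x, z}\<close>; below, a vertex with three free half-edges would be a face by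
      itself.\<close>
    have n2: "\<beta> y \<noteq> z"
    proof
      assume *: "\<beta> y = z"
      then have "(\<beta> \<circ> \<theta>) ` {x, z} \<subseteq> {x, z}" using tz bx y_def by auto
      then show False using no[of "{x,z}"] E' by auto
    qed
    have n3: "\<beta> z \<noteq> y" using n2 b by metis
    have n4: "\<not> (\<beta> y = y \<and> \<beta> z = z)"
    proof
      assume "\<beta> y = y \<and> \<beta> z = z"
      then have "(\<beta> \<circ> \<theta>) ` E \<subseteq> E" using tz bx y_def z_def E' by auto
      then show False using no[of E] E' by auto
    qed
    consider "\<beta> y = y" | "\<beta> y \<noteq> y" "\<beta> z = z" | "\<beta> y \<noteq> y" "\<beta> z \<noteq> z" by blast
    then show "\<beta> \<in> ?A1 \<union> (?A2 \<union> ?A3)"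
    proof cases
      case 1
      then have "\<beta> \<in> ?A3" using bt bx n1 n3 n4 E' by auto
      then show ?thesis by blast
    next
      case 2
      then have "\<beta> \<in> ?A2" using bt bx n1 n2 n4 E' by auto
      then show ?thesis by blast
    next
      case 3
      then have "\<beta> y \<notin> E" "\<beta> z \<notin> E" using n1 n2 n3 E' by auto
      then have "\<beta> \<in> ?A1" using bt bx unfolding y_def z_def by auto
      then show ?thesis by blast
    qed
  qed (use E' xy zx in auto)
  have d1: "?A1 \<inter> (?A2 \<union> ?A3) = {}"
    using E' xy yz zx unfolding y_def z_def by auto
  have d2: "?A2 \<inter> ?A3 = {}" using E' yz by auto
  have c1: "card ?A1 = (card (D - E) - r) * card (trees (D - E) \<theta>' r)"
    by (rule card_trees_subdivide[OF fin t(1,2) xD nf[OF xD] E ne th' agree])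
  have c2: "card ?A2 = r * card (trees (D - E) \<theta>' r)"
    by (rule card_trees_attach[OF fin t(1,2) xD E _ ne th' agree]) (use E' cE in auto)
  have c3: "card ?A3 = r * card (trees (D - E) \<theta>' r)"
    by (rule card_trees_attach[OF fin t(1,2) xD E _ ne th' agree]) (use E' cE in auto)
  have "card ?A = card ?A1 + (card ?A2 + card ?A3)"
    unfolding split using card_Un_disjoint[OF fins(1) _ d1] card_Un_disjoint[OF fins(2,3) d2] fins by simp
  then show ?thesis unfolding c1 c2 c3 by (simp add: algebra_simps)
qed

text \<open>The relation \<open>r + k = V + 2\<close> is Euler's formula for a tree whose leaves are
  the free half-edges and the vertices of degree 1. For \<open>k = 0\<close> the count equals
  \<open>3 ^ V * fact V\<close> labellings times the Catalan number of leaf-rooted binary trees with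
  \<open>V\<close> nodes, over the \<open>V + 2\<close> choices of the root. Vertices of degree 1
  are removed first, each leaving a free half-edge; then a free half-edge is marked and its vertex
  removed.\<close>

lemma card_trees:
  assumes "finite D" "D \<noteq> {}" "\<theta> \<in> cube_roots D k" "card D = k + 3 * V" "r + k = V + 2"
  shows "card (trees D \<theta> r) * fact r = 3 ^ V * fact (2 * V)"
  using assms
proof (induction "card D" arbitrary: D \<theta> k V r rule: less_induct)
  case less
  note fin = less.prems(1)
  have t: "\<theta> permutes D" "\<And>u. \<theta> (\<theta> (\<theta> u)) = u" "card {u \<in> D. \<theta> u = u} = k"
    using less.prems(3) unfolding cube_roots_def by auto
  show ?case
  proof (cases "k = 0")
    case False
    then obtain x where x: "x \<in> D" "\<theta> x = x" using t(3) fin by (metis (mono_tags, lifting) Collect_empty_eq card.empty)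
    let ?E = "{x}"
    have E: "?E = {x, \<theta> x, \<theta> (\<theta> x)}" using x by auto
    show ?thesis
    proof (cases "D - {x} = {}")
      case True
      then have D: "D = {x, \<theta> x, \<theta> (\<theta> x)}" using x by auto
      have "card D = 1" using True x by (metis Diff_eq_empty_iff card_1_singleton_iff One_nat_def subset_singleton_iff less.prems(2))
      then have "V = 0" "k = 1" using less.prems(4) False by auto
      then have "r = card D" using less.prems(5) \<open>card D = 1\<close> by simp
      then have "trees D \<theta> r = {id}" using trees_one_orbit[OF fin t(1,2) D] by simp
      then show ?thesis using \<open>r = card D\<close> \<open>card D = 1\<close> \<open>V = 0\<close> by simp
    next
      case ne: False
      have k: "k = (k - 1) + card {u \<in> ?E. \<theta> u = u}"
      proof -
        have "{u \<in> ?E. \<theta> u = u} = {x}" using x by auto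
        then show ?thesis using False by simp
      qed
      let ?t = "\<lambda>u. if u \<in> ?E then u else \<theta> u"
      have t': "?t \<in> cube_roots (D - ?E) (k - 1)"
        by (rule cube_roots_remove_orbit[OF fin less.prems(3) x(1) E k])
      then have tp: "?t permutes (D - ?E)" unfolding cube_roots_def by blast
      \<comment> \<open>When there are other half-edges, a vertex of degree 1 has a partner, since
        otherwise it would be a face by itself.\<close>
      have all: "{\<beta> \<in> trees D \<theta> r. (\<forall>u \<in> ?E - {x}. \<beta> u = u) \<and> \<beta> x \<notin> ?E} = trees D \<theta> r"
      proof -
        have "\<beta> x \<noteq> x" if "\<beta> \<in> trees D \<theta> r" for \<beta>
        proof
          assume "\<beta> x = x"
          then have "(\<beta> \<circ> \<theta>) ` {x} \<subseteq> {x}" using x by simp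
          then have "{x} = D" using that single_cycleD[of "\<beta> \<circ> \<theta>" D "{x}"] x unfolding trees_def by simp
          then show False using ne by blast
        qed
        then show ?thesis by auto
      qed
      have "card (trees D \<theta> r) = (r + 1) * card (trees (D - ?E) ?t (r + 1))"
        using card_trees_attach[OF fin t(1,2) x(1) E _ ne tp, of x r "r + 1"] unfolding all by simp
      moreover have "card (trees (D - ?E) ?t (r + 1)) * fact (r + 1) = 3 ^ V * fact (2 * V)"
      proof (rule less.hyps[OF _ _ ne t'])
        show "card (D - {x}) < card D" using fin x by (meson card_Diff1_less)
        show "finite (D - {x})" using fin by simp
        show "card (D - {x}) = k - 1 + 3 * V" using less.prems(4) False x fin by simp
        show "r + 1 + (k - 1) = V + 2" using less.prems(5) False by simp
      qed
      ultimately show ?thesis by (simp add: algebra_simps)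
    qed
  next
    case True
    then have r: "r = V + 2" and cD: "card D = 3 * V" using less.prems by auto
    have nf: "\<theta> u \<noteq> u" if "u \<in> D" for u using t(3) True that fin by auto
    have t0: "\<theta> \<in> cube_roots D 0" using less.prems(3) True by simp
    have V0: "V > 0" using cD less.prems(1,2) by (metis card_gt_0_iff mult_eq_0_iff not_gr_zero)
    have cE: "card {x, \<theta> x, \<theta> (\<theta> x)} = 3" if x: "x \<in> D" for x
    proof -
      have D: "\<theta> x \<in> D" "\<theta> (\<theta> x) \<in> D" using x t(1) by (auto simp: permutes_in_image)
      have "\<theta> x \<noteq> x" "\<theta> (\<theta> x) \<noteq> \<theta> x" "\<theta> (\<theta> x) \<noteq> x" using nf[OF x] nf[OF D(1)] nf[OF D(2)] t(2)[of x] by auto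
      then show ?thesis by auto
    qed
    have ED: "{x, \<theta> x, \<theta> (\<theta> x)} \<subseteq> D" if x: "x \<in> D" for x
      using x t(1) by (auto simp: permutes_in_image)
    show ?thesis
    proof (cases "V = 1")
      case V1: True
      obtain x where x: "x \<in> D" using less.prems(2) by blast
      have D: "D = {x, \<theta> x, \<theta> (\<theta> x)}"
        using card_subset_eq[OF fin ED[OF x]] cE[OF x] cD V1 by simp
      have "r = card D" using r V1 cD by simp
      then have "trees D \<theta> r = {id}" using trees_one_orbit[OF fin t(1,2) D] by simp
      then show ?thesis using r V1 by (simp add: numeral_3_eq_3 numeral_2_eq_2)
    next
      case False
      define W where "W = V - 1"
      have W: "V = Suc W" "W > 0" using V0 False unfolding W_def by auto
      \<comment> \<open>Outside the vertex there are \<open>3 * W\<close> half-edges,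
        \<open>V + 1\<close> of them free, so the factor is \<open>3 * W + (V + 1)\<close>, that is
        \<open>4 * V - 2\<close>.\<close>
      have one: "card {\<beta> \<in> trees D \<theta> r. \<beta> x = x} * fact (V + 1) = (4 * V - 2) * (3 ^ W * fact (2 * W))"
        if x: "x \<in> D" for x
      proof -
        let ?E = "{x, \<theta> x, \<theta> (\<theta> x)}"
        let ?t = "\<lambda>u. if u \<in> ?E then u else \<theta> u"
        have cDE: "card (D - ?E) = 3 * W" using card_Diff_subset[OF _ ED[OF x]] cE[OF x] cD W by simp
        then have ne: "D - ?E \<noteq> {}" using W by (metis card.empty mult_eq_0_iff not_gr_zero zero_neq_numeral)
        have "{u \<in> ?E. \<theta> u = u} = {}" using nf ED[OF x] by blast
        then have k: "0 = 0 + card {u \<in> ?E. \<theta> u = u}" by (metis add_0 card.empty)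
        have t': "?t \<in> cube_roots (D - ?E) 0"
          by (rule cube_roots_remove_orbit[OF fin t0 x refl k])
        then have tp: "?t permutes (D - ?E)" unfolding cube_roots_def by blast
        have "card {\<beta> \<in> trees D \<theta> (Suc (V + 1)). \<beta> x = x} =
          (card (D - ?E) - (V + 1) + 2 * (V + 1)) * card (trees (D - ?E) ?t (V + 1))"
          by (rule card_trees_fixing[OF fin t0 x refl ne tp]) simp
        moreover have "card (trees (D - ?E) ?t (V + 1)) * fact (V + 1) = 3 ^ W * fact (2 * W)"
        proof (rule less.hyps[OF _ _ ne t'])
          show "card (D - ?E) < card D" using cDE cD W by simp
          show "finite (D - ?E)" using fin by simp
          show "card (D - ?E) = 0 + 3 * W" using cDE by simp
          show "V + 1 + 0 = W + 2" using W by simp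
        qed
        moreover have "card (D - ?E) - (V + 1) + 2 * (V + 1) = 4 * V - 2"
          if "card (D - ?E) \<ge> V + 1" using cDE W that by simp
        \<comment> \<open>This guards the truncated subtraction: with fewer than
          \<open>V + 1\<close> half-edges the smaller count would vanish, against the induction
          hypothesis.\<close>
        moreover have "trees (D - ?E) ?t (V + 1) = {}" if "card (D - ?E) < V + 1"
        proof -
          have "card {u \<in> D - ?E. \<beta> u = u} \<noteq> V + 1" for \<beta>
          proof -
            have "card {u \<in> D - ?E. \<beta> u = u} \<le> card (D - ?E)"
              by (rule card_mono) (use fin in auto)
            then show ?thesis using that by linarith
          qed
          then show ?thesis unfolding trees_def involutions_def by blast
        qed
        moreover have "(3::nat) ^ W * fact (2 * W) > 0" by simp
        moreover define T where "T = card (trees (D - ?E) ?t (V + 1))"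
        moreover define m where "m = card (D - ?E)"
        moreover have "r = Suc (V + 1)" using r by simp
        ultimately have h: "card {\<beta> \<in> trees D \<theta> r. \<beta> x = x} = (m - (V + 1) + 2 * (V + 1)) * T"
          "T * fact (V + 1) = 3 ^ W * fact (2 * W)"
          "V + 1 \<le> m \<Longrightarrow> m - (V + 1) + 2 * (V + 1) = 4 * V - 2"
          "m < V + 1 \<Longrightarrow> T = 0"
          by simp_all
        have "T \<noteq> 0"
        proof
          assume "T = 0"
          then have "(3::nat) ^ W * fact (2 * W) = 0" using h(2) by simp
          then show False by simp
        qed
        then have "V + 1 \<le> m" using h(4) by linarith
        then have "card {\<beta> \<in> trees D \<theta> r. \<beta> x = x} * fact (V + 1) = (4 * V - 2) * (T * fact (V + 1))"
          using h(1,3) by (simp only: mult.assoc)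
        then show ?thesis using h(2) by (simp only:)
      qed
      \<comment> \<open>Pairs of a tree and one of its free half-edges, counted in both
        orders.\<close>
      have "r * card (trees D \<theta> r) = (\<Sum>\<beta>\<in>trees D \<theta> r. card {x \<in> D. \<beta> x = x})"
        by (simp add: trees_def involutions_def)
      also have "\<dots> = (\<Sum>\<beta>\<in>trees D \<theta> r. \<Sum>x\<in>D. if \<beta> x = x then 1 else 0)"
        using fin by (intro sum.cong refl) (simp add: sum.If_cases Int_def)
      also have "\<dots> = (\<Sum>x\<in>D. \<Sum>\<beta>\<in>trees D \<theta> r. if \<beta> x = x then 1 else 0)"
        by (rule sum.swap)
      also have "\<dots> = (\<Sum>x\<in>D. card {\<beta> \<in> trees D \<theta> r. \<beta> x = x})"
        using finite_trees[OF fin] by (intro sum.cong refl) (simp add: sum.If_cases Int_def)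
      finally have "r * card (trees D \<theta> r) * fact (V + 1) = (\<Sum>x\<in>D. card {\<beta> \<in> trees D \<theta> r. \<beta> x = x} * fact (V + 1))"
        by (simp add: sum_distrib_right)
      also have "\<dots> = 3 * V * ((4 * V - 2) * (3 ^ W * fact (2 * W)))"
        using one cD by simp
      finally have *: "r * card (trees D \<theta> r) * fact (V + 1) = 3 * V * ((4 * V - 2) * (3 ^ W * fact (2 * W)))" .
      have "fact (2 * V) = 2 * V * (2 * V - 1) * (fact (2 * W) :: nat)"
        using W by (simp add: algebra_simps)
      then have "3 ^ V * fact (2 * V) = 3 * V * ((4 * V - 2) * (3 ^ W * (fact (2 * W) :: nat)))"
        using W by (simp add: algebra_simps)
      moreover have "card (trees D \<theta> r) * fact r = r * card (trees D \<theta> r) * (fact (V + 1) :: nat)"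
        using r by (simp add: algebra_simps)
      ultimately show ?thesis using * by metis
    qed
  qed
qed

section \<open>Trisections\<close>

text \<open>In a map, \<open>slice\<close> cuts a vertex of degree 3 open into three leaves, and
  \<open>glue\<close> fuses three leaves into one vertex with the cyclic order of the
  triple.\<close>

definition slice :: "('a \<Rightarrow> 'a) \<Rightarrow> 'a \<Rightarrow> 'a \<Rightarrow> 'a" where
  "slice \<theta> x = (\<lambda>u. if u \<in> {x, \<theta> x, \<theta> (\<theta> x)} then u else \<theta> u)"

definition glue :: "('a \<Rightarrow> 'a) \<Rightarrow> 'a \<times> 'a \<times> 'a \<Rightarrow> 'a \<Rightarrow> 'a" where
  "glue \<theta> = (\<lambda>(x, y, z) u. if u = x then y else if u = y then z else if u = z then x else \<theta> u)"

definition triples :: "'a set \<Rightarrow> ('a \<times> 'a \<times> 'a) set" where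
  "triples A = {(x, y, z). x \<in> A \<and> y \<in> A \<and> z \<in> A \<and> x \<noteq> y \<and> y \<noteq> z \<and> z \<noteq> x}"

lemma finite_triples: "finite A \<Longrightarrow> finite (triples A)"
  by (rule finite_subset[of _ "A \<times> A \<times> A"]) (auto simp: triples_def)

lemma card_triples:
  assumes "finite A"
  shows "card (triples A) = card A * (card A - 1) * (card A - 2)"
proof -
  have eq: "triples A = (SIGMA x:A. SIGMA y:A - {x}. A - {x, y})"
    unfolding triples_def by auto
  have "card (SIGMA y:A - {x}. A - {x, y}) = (card A - 1) * (card A - 2)" if "x \<in> A" for x
  proof -
    have "card (SIGMA y:A - {x}. A - {x, y}) = (\<Sum>y\<in>A - {x}. card (A - {x, y}))"
      using assms by (intro card_SigmaI) auto
    also have "\<dots> = (\<Sum>y\<in>A - {x}. card A - 2)"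
      using assms that by (intro sum.cong refl) (subst card_Diff_subset, auto)
    finally show ?thesis using that assms by simp
  qed
  then have "(\<Sum>x\<in>A. card (SIGMA y:A - {x}. A - {x, y})) = card A * ((card A - 1) * (card A - 2))"
    by simp
  moreover have "card (triples A) = (\<Sum>x\<in>A. card (SIGMA y:A - {x}. A - {x, y}))"
    unfolding eq using assms by (intro card_SigmaI) auto
  ultimately show ?thesis by simp
qed

lemma cube_root_orbit_distinct:
  assumes "\<And>u. \<theta> (\<theta> (\<theta> u)) = u" "\<theta> x \<noteq> x"
  shows "\<theta> (\<theta> x) \<noteq> \<theta> x" "\<theta> (\<theta> x) \<noteq> x"
  using assms by metis+

lemma slice_in_cube_roots:
  assumes fin: "finite D" and th: "\<theta> \<in> cube_roots D k" and x: "x \<in> D" "\<theta> x \<noteq> x"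
  shows "slice \<theta> x \<in> cube_roots D (k + 3)"
    and "(x, \<theta> x, \<theta> (\<theta> x)) \<in> triples {u \<in> D. slice \<theta> x u = u}"
    and "glue (slice \<theta> x) (x, \<theta> x, \<theta> (\<theta> x)) = \<theta>"
proof -
  have t: "\<theta> permutes D" "\<And>u. \<theta> (\<theta> (\<theta> u)) = u" "card {u \<in> D. \<theta> u = u} = k"
    using th unfolding cube_roots_def by auto
  let ?E = "{x, \<theta> x, \<theta> (\<theta> x)}"
  have thE: "\<theta> u \<in> ?E \<longleftrightarrow> u \<in> ?E" for u by (rule cube_root_orbit_closed[OF t(2) refl])
  have ED: "?E \<subseteq> D" using x t(1) by (auto simp: permutes_in_image)
  note dist = cube_root_orbit_distinct[of \<theta>, OF t(2) x(2)]
  have s: "slice \<theta> x u = (if u \<in> ?E then u else \<theta> u)" for u unfolding slice_def by simp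
  have s3: "slice \<theta> x (slice \<theta> x (slice \<theta> x u)) = u" for u
  proof (cases "u \<in> ?E")
    case True then show ?thesis unfolding s by (simp only: if_True)
  next
    case False
    then have "\<theta> u \<notin> ?E" "\<theta> (\<theta> u) \<notin> ?E" using thE by (simp_all only: simp_thms)
    then show ?thesis using False t(2) unfolding s by (simp only: if_False)
  qed
  have perm: "slice \<theta> x permutes D"
    by (rule permutes_of_cube_root[OF s3]) (use t(1) ED in \<open>auto simp: s permutes_def\<close>)
  have nfE: "\<theta> u \<noteq> u" if "u \<in> ?E" for u using that dist x(2) t(2)[of x] by auto
  have "{u \<in> D. slice \<theta> x u = u} = {u \<in> D. \<theta> u = u} \<union> ?E" using ED by (auto simp: s)
  moreover have "card ({u \<in> D. \<theta> u = u} \<union> ?E) = k + card ?E"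
    using t(3) fin nfE by (subst card_Un_disjoint) auto
  moreover have "card ?E = 3" using dist x(2) by auto
  ultimately have "card {u \<in> D. slice \<theta> x u = u} = k + 3" by simp
  then show "slice \<theta> x \<in> cube_roots D (k + 3)" unfolding cube_roots_def using perm s3 by simp
  show "(x, \<theta> x, \<theta> (\<theta> x)) \<in> triples {u \<in> D. slice \<theta> x u = u}"
    unfolding triples_def using dist x ED by (auto simp: s)
  show "glue (slice \<theta> x) (x, \<theta> x, \<theta> (\<theta> x)) = \<theta>"
    unfolding glue_def s using t(2)[of x] by (auto simp: fun_eq_iff)
qed

lemma glue_in_cube_roots:
  assumes fin: "finite D" and th: "\<theta> \<in> cube_roots D (k + 3)"
    and xyz: "(x, y, z) \<in> triples {u \<in> D. \<theta> u = u}"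
  shows "glue \<theta> (x, y, z) \<in> cube_roots D k"
    and "glue \<theta> (x, y, z) x = y" "glue \<theta> (x, y, z) y = z" "glue \<theta> (x, y, z) z = x"
    and "slice (glue \<theta> (x, y, z)) x = \<theta>"
proof -
  have t: "\<theta> permutes D" "\<And>u. \<theta> (\<theta> (\<theta> u)) = u" "card {u \<in> D. \<theta> u = u} = k + 3"
    using th unfolding cube_roots_def by auto
  have d: "x \<in> D" "y \<in> D" "z \<in> D" "\<theta> x = x" "\<theta> y = y" "\<theta> z = z" "x \<noteq> y" "y \<noteq> z" "z \<noteq> x"
    using xyz unfolding triples_def by auto
  have inj: "\<theta> u = \<theta> v \<longleftrightarrow> u = v" for u v using permutes_inj[OF t(1)] by (auto dest: injD)
  let ?g = "glue \<theta> (x, y, z)"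
  have g: "?g u = (if u = x then y else if u = y then z else if u = z then x else \<theta> u)" for u
    unfolding glue_def by simp
  show gx: "?g x = y" "?g y = z" "?g z = x" using d by (auto simp: g)
  have other: "\<theta> u \<notin> {x, y, z}" if "u \<notin> {x, y, z}" for u
    using that inj[of u x] inj[of u y] inj[of u z] d by auto
  have g3: "?g (?g (?g u)) = u" for u
  proof (cases "u \<in> {x, y, z}")
    case True then show ?thesis using gx by auto
  next
    case False
    then have "?g u = \<theta> u" "?g (\<theta> u) = \<theta> (\<theta> u)" "?g (\<theta> (\<theta> u)) = \<theta> (\<theta> (\<theta> u))"
      using other[OF False] other[OF other[OF False]] by (auto simp: g)
    then show ?thesis using t(2) by simp
  qed
  have perm: "?g permutes D"
    by (rule permutes_of_cube_root[OF g3]) (use t(1) d in \<open>auto simp: g permutes_def\<close>)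
  have "{u \<in> D. \<theta> u = u} = {u \<in> D. ?g u = u} \<union> {x, y, z}" using d by (auto simp: g)
  moreover have "card ({u \<in> D. ?g u = u} \<union> {x, y, z}) = card {u \<in> D. ?g u = u} + card {x, y, z}"
    using fin d by (intro card_Un_disjoint) (auto simp: g)
  moreover have "card {x, y, z} = 3" using d by auto
  ultimately have "card {u \<in> D. ?g u = u} = k" using t(3) by simp
  then show "?g \<in> cube_roots D k" unfolding cube_roots_def using perm g3 by simp
  show "slice ?g x = \<theta>"
  proof
    fix u
    show "slice ?g x u = \<theta> u"
      unfolding slice_def gx using d by (auto simp: g)
  qed
qed

text \<open>Recording the half-edge \<open>x\<close> at which a vertex is cut makes the cut
  reversible: the ordered triple \<open>(x, \<theta> x, \<theta> (\<theta> x))\<close> restores both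
  \<open>\<theta>\<close> and \<open>x\<close>. Each cut is thereby counted three times on either
  side.\<close>

lemma slice_glue_double_count:
  assumes fin: "finite D" and A: "A \<subseteq> cube_roots D k" and B: "B \<subseteq> cube_roots D (k + 3)"
  shows "(\<Sum>\<theta>\<in>A. card {x \<in> D. \<theta> x \<noteq> x \<and> slice \<theta> x \<in> B})
       = (\<Sum>\<theta>\<in>B. card {p \<in> triples {u \<in> D. \<theta> u = u}. glue \<theta> p \<in> A})"
proof -
  let ?X = "SIGMA \<theta>:A. {x \<in> D. \<theta> x \<noteq> x \<and> slice \<theta> x \<in> B}"
  let ?Y = "SIGMA \<theta>:B. {p \<in> triples {u \<in> D. \<theta> u = u}. glue \<theta> p \<in> A}"
  have finA: "finite A" using finite_subset[OF A finite_cube_roots[OF fin]] .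
  have finB: "finite B" using finite_subset[OF B finite_cube_roots[OF fin]] .
  have "bij_betw (\<lambda>(\<theta>, x). (slice \<theta> x, (x, \<theta> x, \<theta> (\<theta> x)))) ?X ?Y"
  proof (rule bij_betw_byWitness[where f' = "\<lambda>(\<theta>, p). (glue \<theta> p, fst p)"])
    show "\<forall>a\<in>?X. (\<lambda>(\<theta>, p). (glue \<theta> p, fst p)) ((\<lambda>(\<theta>, x). (slice \<theta> x, (x, \<theta> x, \<theta> (\<theta> x)))) a) = a"
      using slice_in_cube_roots(3)[OF fin] A by (auto simp: subset_iff)
    show "\<forall>b\<in>?Y. (\<lambda>(\<theta>, x). (slice \<theta> x, (x, \<theta> x, \<theta> (\<theta> x)))) ((\<lambda>(\<theta>, p). (glue \<theta> p, fst p)) b) = b"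
      using glue_in_cube_roots(2-5)[OF fin] B by (auto simp: subset_iff)
    show "(\<lambda>(\<theta>, x). (slice \<theta> x, (x, \<theta> x, \<theta> (\<theta> x)))) ` ?X \<subseteq> ?Y"
      using slice_in_cube_roots(2,3)[OF fin] A by (auto simp: subset_iff)
    show "(\<lambda>(\<theta>, p). (glue \<theta> p, fst p)) ` ?Y \<subseteq> ?X"
    proof
      fix a assume "a \<in> (\<lambda>(\<theta>, p). (glue \<theta> p, fst p)) ` ?Y"
      then obtain \<theta> x y z where h: "\<theta> \<in> B" "(x, y, z) \<in> triples {u \<in> D. \<theta> u = u}" "glue \<theta> (x, y, z) \<in> A"
        and a: "a = (glue \<theta> (x, y, z), x)" by auto
      note g = glue_in_cube_roots[OF fin subsetD[OF B h(1)] h(2)]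
      have "x \<in> D" "y \<noteq> x" using h(2) unfolding triples_def by auto
      then show "a \<in> ?X" using a h g by simp
    qed
  qed
  then have "card ?X = card ?Y" by (rule bij_betw_same_card)
  moreover have "card ?X = (\<Sum>\<theta>\<in>A. card {x \<in> D. \<theta> x \<noteq> x \<and> slice \<theta> x \<in> B})"
    using finA fin by (intro card_SigmaI) auto
  moreover have "card ?Y = (\<Sum>\<theta>\<in>B. card {p \<in> triples {u \<in> D. \<theta> u = u}. glue \<theta> p \<in> A})"
    using finB fin by (intro card_SigmaI) (auto simp: finite_triples)
  ultimately show ?thesis by simp
qed

text \<open>The same double count with no condition on the face: any of the \<open>3 * Suc V\<close>
  moved points can be cut at, and any ordered triple of the \<open>k + 3\<close> fixed points can be
  glued.\<close>

lemma card_cube_roots: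
  assumes fin: "finite D" and "card D = k + 3 * V"
  shows "card (cube_roots D k) * (fact k * 3 ^ V * fact V) = fact (card D)"
  using assms(2)
proof (induction V arbitrary: k)
  case 0
  have "cube_roots D k = {id}"
  proof -
    have "\<theta> = id" if "\<theta> \<in> cube_roots D k" for \<theta>
    proof -
      have b: "\<theta> permutes D" "card {u \<in> D. \<theta> u = u} = card D"
        using that 0 unfolding cube_roots_def by auto
      have "{u \<in> D. \<theta> u = u} = D" by (rule card_subset_eq[OF fin]) (use b in auto)
      then show ?thesis using b(1) unfolding permutes_def by (metis (mono_tags, lifting) eq_id_iff mem_Collect_eq)
    qed
    moreover have "id \<in> cube_roots D k" using 0 unfolding cube_roots_def by (auto simp: permutes_id)
    ultimately show ?thesis by blast
  qed
  then show ?case using 0 by simp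
next
  case (Suc V)
  have "(\<Sum>\<theta>\<in>cube_roots D k. card {x \<in> D. \<theta> x \<noteq> x \<and> slice \<theta> x \<in> cube_roots D (k + 3)})
       = (\<Sum>\<theta>\<in>cube_roots D (k + 3). card {p \<in> triples {u \<in> D. \<theta> u = u}. glue \<theta> p \<in> cube_roots D k})"
    by (rule slice_glue_double_count[OF fin]) auto
  moreover have "card {x \<in> D. \<theta> x \<noteq> x \<and> slice \<theta> x \<in> cube_roots D (k + 3)} = 3 * Suc V"
    if "\<theta> \<in> cube_roots D k" for \<theta>
  proof -
    have "{x \<in> D. \<theta> x \<noteq> x \<and> slice \<theta> x \<in> cube_roots D (k + 3)} = D - {x \<in> D. \<theta> x = x}"
      using slice_in_cube_roots(1)[OF fin that] by auto
    moreover have "card {x \<in> D. \<theta> x = x} = k" using that unfolding cube_roots_def by auto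
    ultimately show ?thesis using Suc.prems fin by (simp add: card_Diff_subset)
  qed
  moreover have "card {p \<in> triples {u \<in> D. \<theta> u = u}. glue \<theta> p \<in> cube_roots D k} = (k + 3) * (k + 2) * (k + 1)"
    if "\<theta> \<in> cube_roots D (k + 3)" for \<theta>
  proof -
    have "{p \<in> triples {u \<in> D. \<theta> u = u}. glue \<theta> p \<in> cube_roots D k} = triples {u \<in> D. \<theta> u = u}"
      using glue_in_cube_roots(1)[OF fin that] by auto
    moreover have "card {u \<in> D. \<theta> u = u} = k + 3" using that unfolding cube_roots_def by auto
    ultimately show ?thesis using card_triples[of "{u \<in> D. \<theta> u = u}"] fin by simp
  qed
  ultimately have rec: "card (cube_roots D k) * (3 * Suc V) = card (cube_roots D (k + 3)) * ((k + 3) * (k + 2) * (k + 1))"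
    by simp
  have "card (cube_roots D (k + 3)) * (fact (k + 3) * 3 ^ V * fact V) = fact (card D)"
    by (rule Suc.IH) (use Suc.prems in simp)
  moreover have "fact (k + 3) = (k + 3) * (k + 2) * (k + 1) * (fact k :: nat)"
    by (simp add: numeral_3_eq_3 algebra_simps)
  ultimately have "card (cube_roots D (k + 3)) * ((k + 3) * (k + 2) * (k + 1)) * (fact k * 3 ^ V * fact V) = fact (card D)"
    by (simp add: algebra_simps)
  then show ?case unfolding rec[symmetric] by (simp add: algebra_simps)
qed

section \<open>Composition of a single cycle with a 3-cycle\<close>

lemma single_cycle_positions:
  assumes sc: "single_cycle c D" and fin: "finite D" and d: "d \<in> D"
  shows "bij_betw (\<lambda>i. (c ^^ i) d) {..<card D} D" "(c ^^ card D) d = d"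
proof -
  have c: "c permutes D" using sc unfolding single_cycle_def by blast
  have "permutation c" using c fin permutation_permutes by blast
  then obtain n where n: "c ^^ n = id" "n > 0" using permutation_is_nilpotent by blast
  define m where "m = (LEAST m. m > 0 \<and> (c ^^ m) d = d)"
  have ex: "n > 0 \<and> (c ^^ n) d = d" using n by simp
  have m: "m > 0" "(c ^^ m) d = d" using LeastI[of "\<lambda>m. m > 0 \<and> (c ^^ m) d = d", OF ex] unfolding m_def by auto
  have min: "m \<le> i" if "i > 0" "(c ^^ i) d = d" for i
    unfolding m_def by (rule Least_le) (use that in simp)
  have inD: "(c ^^ i) d \<in> D" for i using d c by (induction i) (auto simp: permutes_in_image)
  have injc: "inj (c ^^ i)" for i using permutes_inj[OF c] by (simp add: inj_fn)
  have lt: "(c ^^ i) d \<noteq> (c ^^ j) d" if "i < j" "j < m" for i j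
  proof
    assume "(c ^^ i) d = (c ^^ j) d"
    moreover have "(c ^^ j) d = (c ^^ i) ((c ^^ (j - i)) d)"
      using that by (metis funpow_add le_add_diff_inverse less_imp_le comp_apply)
    ultimately have "d = (c ^^ (j - i)) d" using injc[of i] by (metis injD)
    then have "m \<le> j - i" using min[of "j - i"] that by simp
    then show False using that by simp
  qed
  have inj: "inj_on (\<lambda>i. (c ^^ i) d) {..<m}"
    by (rule inj_onI) (metis lt lessThan_iff linorder_neqE_nat)
  let ?S = "(\<lambda>i. (c ^^ i) d) ` {..<m}"
  have "c ` ?S \<subseteq> ?S"
  proof
    fix v assume "v \<in> c ` ?S"
    then obtain i where i: "i < m" "v = (c ^^ Suc i) d" by auto
    show "v \<in> ?S"
    proof (cases "Suc i < m")
      case True then show ?thesis using i by blast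
    next
      case False
      then have "Suc i = m" using i by simp
      then have "v = (c ^^ 0) d" using m i by simp
      then show ?thesis using m by blast
    qed
  qed
  moreover have "?S \<noteq> {}" "?S \<subseteq> D" using m inD by auto
  ultimately have S: "?S = D" using single_cycleD[OF sc] by metis
  then have "m = card D" using card_image[OF inj] by simp
  then show "bij_betw (\<lambda>i. (c ^^ i) d) {..<card D} D" "(c ^^ card D) d = d"
    using inj S m by (auto simp: bij_betw_def)
qed

text \<open>Positions \<open>0\<close>, \<open>j\<close> and \<open>k\<close> cut the cycle into
  three arcs, and \<open>f\<close> runs through them in the order \<open>1..j\<close>,
  \<open>k+1..L\<close>, \<open>j+1..k\<close>, where \<open>L = card D\<close> is position
  \<open>0\<close> again. A closed set that meets one arc therefore reaches the start of all
  three.\<close>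

lemma single_cycle_three_arcs:
  assumes fin: "finite D" and f: "f permutes D" and x: "x \<in> D"
    and c: "single_cycle c D" and jk: "0 < j" "j < k" "k < card D"
    and fx: "f x = c ((c ^^ j) x)" "f ((c ^^ j) x) = c ((c ^^ k) x)" "f ((c ^^ k) x) = c x"
    and other: "\<And>u. u \<notin> {x, (c ^^ j) x, (c ^^ k) x} \<Longrightarrow> f u = c u"
  shows "single_cycle f D"
proof -
  define p where "p = (\<lambda>i. (c ^^ i) x)"
  let ?L = "card D"
  have bij: "bij_betw p {..<?L} D" and pL: "p ?L = x"
    using single_cycle_positions[OF c fin x] unfolding p_def by auto
  have p0: "p 0 = x" unfolding p_def by simp
  have pS: "c (p i) = p (Suc i)" for i unfolding p_def by simp
  have inj: "p a = p b \<Longrightarrow> a < ?L \<Longrightarrow> b < ?L \<Longrightarrow> a = b" for a b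
    using bij unfolding bij_betw_def inj_on_def by auto
  have f0: "f x = p (Suc j)" "f (p j) = p (Suc k)" "f (p k) = p 1"
    using fx unfolding p_def by auto
  have stp: "f (p i) = p (Suc i)" if "i < ?L" "i \<notin> {0, j, k}" for i
  proof -
    have "p i \<noteq> x" "p i \<noteq> p j" "p i \<noteq> p k" using inj[of i 0] inj[of i j] inj[of i k] that jk p0 by auto
    then have "f (p i) = c (p i)" by (intro other) (simp add: p_def)
    then show ?thesis using pS[of i] by (rule trans)
  qed
  show ?thesis unfolding single_cycle_def
  proof (intro conjI allI impI f)
    fix S assume S: "S \<subseteq> D" "S \<noteq> {}" "f ` S \<subseteq> S"
    have walk: "p m \<in> S" if "p i \<in> S" "i \<le> m" "m \<le> ?L" "\<And>t. i \<le> t \<Longrightarrow> t < m \<Longrightarrow> t \<notin> {0, j, k}" for i m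
      using that(2,3,4)
    proof (induction m rule: dec_induct)
      case base then show ?case using that(1) by simp
    next
      case (step m)
      have "p m \<in> S" by (rule step.IH) (use step.prems step.hyps in auto)
      moreover have "f (p m) = p (Suc m)"
        by (rule stp) (use step.prems step.hyps in auto)
      ultimately show ?case using S(3) by auto
    qed
    have fS: "f u \<in> S" if "u \<in> S" for u using that S(3) by blast
    have a1: "p (Suc k) \<in> S" if h: "p i \<in> S" "0 < i" "i \<le> j" for i
    proof -
      have "p j \<in> S" by (rule walk[OF h(1,3)]) (use h jk in auto)
      then have "f (p j) \<in> S" using fS by simp
      then show ?thesis using f0 by simp
    qed
    have a2: "p 1 \<in> S" if h: "p i \<in> S" "j < i" "i \<le> k" for i
    proof -
      have "p k \<in> S" by (rule walk[OF h(1,3)]) (use h jk in auto)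
      then have "f (p k) \<in> S" using fS by simp
      then show ?thesis using f0 by simp
    qed
    have a3: "p (Suc j) \<in> S" if h: "p i \<in> S" "k < i" "i \<le> ?L" for i
    proof -
      have "p ?L \<in> S" by (rule walk[OF h(1,3)]) (use h jk in auto)
      then have "f (x) \<in> S" using fS pL by simp
      then show ?thesis using f0 by simp
    qed
    obtain u where u: "u \<in> S" using S by blast
    then obtain i where i: "i < ?L" "u = p i" using S(1) bij unfolding bij_betw_def by blast
    have all: "p 1 \<in> S \<and> p (Suc j) \<in> S \<and> p (Suc k) \<in> S"
    proof -
      have "p 1 \<in> S \<or> p (Suc j) \<in> S \<or> p (Suc k) \<in> S"
      proof (cases "i = 0")
        case True then show ?thesis using fS[OF u] f0 i p0 by simp
      next
        case False
        then consider "0 < i" "i \<le> j" | "j < i" "i \<le> k" | "k < i" by linarith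
        then show ?thesis using a1[of i] a2[of i] a3[of i] u i by cases auto
      qed
      then show ?thesis using a1[of 1] a2[of "Suc j"] a3[of "Suc k"] jk by auto
    qed
    have "p m \<in> S" if "m < ?L" for m
    proof -
      consider "m = 0" | "0 < m" "m \<le> j" | "j < m" "m \<le> k" | "k < m" by linarith
      then show ?thesis
      proof cases
        case 1
        have "p ?L \<in> S" by (rule walk[of "Suc k"]) (use all jk in auto)
        then show ?thesis using 1 pL p0 by simp
      next
        case 2 show ?thesis by (rule walk[of 1]) (use 2 all that jk in auto)
      next
        case 3 show ?thesis by (rule walk[of "Suc j"]) (use 3 all that jk in auto)
      next
        case 4 show ?thesis by (rule walk[of "Suc k"]) (use 4 all that jk in auto)
      qed
    qed
    then have "p ` {..<?L} \<subseteq> S" by auto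
    then have "D \<subseteq> S" using bij unfolding bij_betw_def by simp
    then show "S = D" using S(1) by blast
  qed
qed

text \<open>In the opposite orientation the jump from \<open>x\<close> leads to the start of the arc
  \<open>j+1..card D\<close>, whose last element is \<open>x\<close> again; this arc alone is
  closed.\<close>

lemma not_single_cycle_three_arcs:
  assumes fin: "finite D" and x: "x \<in> D"
    and c: "single_cycle c D" and jk: "0 < k" "k < j" "j < card D"
    and fx: "f x = c ((c ^^ j) x)"
    and other: "\<And>u. u \<notin> {x, (c ^^ j) x, (c ^^ k) x} \<Longrightarrow> f u = c u"
  shows "\<not> single_cycle f D"
proof
  assume sc: "single_cycle f D"
  define p where "p = (\<lambda>i. (c ^^ i) x)"
  let ?L = "card D"
  have bij: "bij_betw p {..<?L} D" and pL: "p ?L = x"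
    using single_cycle_positions[OF c fin x] unfolding p_def by auto
  have p0: "p 0 = x" unfolding p_def by simp
  have pS: "c (p i) = p (Suc i)" for i unfolding p_def by simp
  have inj: "p a = p b \<Longrightarrow> a < ?L \<Longrightarrow> b < ?L \<Longrightarrow> a = b" for a b
    using bij unfolding bij_betw_def inj_on_def by auto
  have step: "f (p i) = p (Suc i)" if "i < ?L" "i \<notin> {0, j, k}" for i
  proof -
    have "p i \<noteq> x" "p i \<noteq> p j" "p i \<noteq> p k" using inj[of i 0] inj[of i j] inj[of i k] that jk p0 by auto
    then have "f (p i) = c (p i)" by (intro other) (simp add: p_def)
    then show ?thesis using pS[of i] by (rule trans)
  qed
  let ?S = "p ` {i. j < i \<and> i \<le> ?L}"
  have pD: "p i \<in> D" if "i \<le> ?L" for i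
    using that bij x pL unfolding bij_betw_def by (cases "i = ?L") auto
  have "f ` ?S \<subseteq> ?S"
  proof
    fix v assume "v \<in> f ` ?S"
    then obtain i where i: "j < i" "i \<le> ?L" "v = f (p i)" by auto
    show "v \<in> ?S"
    proof (cases "i = ?L")
      case True
      then have "v = p (Suc j)" using i fx pL unfolding p_def by simp
      then show ?thesis using jk by auto
    next
      case False
      then have "v = p (Suc i)" using i jk step[of i] by simp
      then show ?thesis using i False by auto
    qed
  qed
  moreover have "?S \<subseteq> D" using pD by auto
  moreover have "?S \<noteq> {}" using jk by auto
  ultimately have "?S = D" using single_cycleD[OF sc] by metis
  then have "p j \<in> ?S" using pD[of j] jk by auto
  then obtain i where i: "j < i" "i \<le> ?L" "p j = p i" by auto
  show False
  proof (cases "i = ?L")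
    case True
    then have "p j = p 0" using i pL p0 by simp
    then show False using inj[of j 0] jk by auto
  next
    case False then show False using inj[of j i] i jk by auto
  qed
qed

definition cyc_order :: "nat \<Rightarrow> nat \<Rightarrow> nat \<Rightarrow> bool" where
  "cyc_order a b e \<longleftrightarrow> (a < b \<and> b < e) \<or> (b < e \<and> e < a) \<or> (e < a \<and> a < b)"

text \<open>Composing a single cycle with a 3-cycle gives one cycle or three,
  depending on the orientation of the 3-cycle.\<close>

lemma single_cycle_three_iff:
  assumes fin: "finite D" and f: "f permutes D" and d: "d \<in> D" and c: "single_cycle c D"
    and lt: "a < card D" "b < card D" "e < card D" and ne: "a \<noteq> b" "b \<noteq> e" "e \<noteq> a"
    and fx: "f ((c ^^ a) d) = c ((c ^^ b) d)" "f ((c ^^ b) d) = c ((c ^^ e) d)"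
      "f ((c ^^ e) d) = c ((c ^^ a) d)"
    and other: "\<And>u. u \<notin> {(c ^^ a) d, (c ^^ b) d, (c ^^ e) d} \<Longrightarrow> f u = c u"
  shows "single_cycle f D \<longleftrightarrow> cyc_order a b e"
proof -
  have cp: "c permutes D" using c unfolding single_cycle_def by blast
  have inD: "(c ^^ i) d \<in> D" for i using d cp by (induction i) (auto simp: permutes_in_image)
  have shift: "(c ^^ (j - i)) ((c ^^ i) d) = (c ^^ j) d" if "i < j" for i j
    using that by (metis comp_apply funpow_add le_add_diff_inverse2 less_imp_le)
  have pos: "single_cycle f D" if h: "a < b" "b < e" "a < card D" "b < card D" "e < card D"
      "f ((c ^^ a) d) = c ((c ^^ b) d)" "f ((c ^^ b) d) = c ((c ^^ e) d)" "f ((c ^^ e) d) = c ((c ^^ a) d)"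
      "\<And>u. u \<notin> {(c ^^ a) d, (c ^^ b) d, (c ^^ e) d} \<Longrightarrow> f u = c u" for a b e
  proof (rule single_cycle_three_arcs[OF fin f inD[of a] c, of "b - a" "e - a"])
    have s: "(c ^^ (b - a)) ((c ^^ a) d) = (c ^^ b) d" "(c ^^ (e - a)) ((c ^^ a) d) = (c ^^ e) d"
      using shift h by auto
    show "0 < b - a" "b - a < e - a" "e - a < card D" using h by auto
    show "f ((c ^^ a) d) = c ((c ^^ (b - a)) ((c ^^ a) d))"
      "f ((c ^^ (b - a)) ((c ^^ a) d)) = c ((c ^^ (e - a)) ((c ^^ a) d))"
      "f ((c ^^ (e - a)) ((c ^^ a) d)) = c ((c ^^ a) d)"
      unfolding s by (fact h)+
    show "f u = c u" if "u \<notin> {(c ^^ a) d, (c ^^ (b - a)) ((c ^^ a) d), (c ^^ (e - a)) ((c ^^ a) d)}" for u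
      using that unfolding s by (rule h)
  qed
  have neg: "\<not> single_cycle f D" if h: "a < e" "e < b" "a < card D" "b < card D" "e < card D"
      "f ((c ^^ a) d) = c ((c ^^ b) d)"
      "\<And>u. u \<notin> {(c ^^ a) d, (c ^^ b) d, (c ^^ e) d} \<Longrightarrow> f u = c u" for a b e
  proof (rule not_single_cycle_three_arcs[OF fin inD[of a] c, of "e - a" "b - a"])
    have s: "(c ^^ (b - a)) ((c ^^ a) d) = (c ^^ b) d" "(c ^^ (e - a)) ((c ^^ a) d) = (c ^^ e) d"
      using shift h by auto
    show "0 < e - a" "e - a < b - a" "b - a < card D" using h by auto
    show "f ((c ^^ a) d) = c ((c ^^ (b - a)) ((c ^^ a) d))" unfolding s by (fact h)
    show "f u = c u" if "u \<notin> {(c ^^ a) d, (c ^^ (b - a)) ((c ^^ a) d), (c ^^ (e - a)) ((c ^^ a) d)}" for u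
      using that unfolding s by (rule h)
  qed
  \<comment> \<open>Three of the six orders are rotations of \<open>a < b < e\<close>, the other
    three of \<open>a < e < b\<close>; the hypotheses are invariant under rotation.\<close>
  consider "a < b" "b < e" | "b < e" "e < a" | "e < a" "a < b"
    | "a < e" "e < b" | "e < b" "b < a" | "b < a" "a < e" using ne by linarith
  then show ?thesis
  proof cases
    case 1
    have "single_cycle f D" by (rule pos[OF 1 lt fx other])
    then show ?thesis using 1 unfolding cyc_order_def by simp
  next
    case 2
    have "single_cycle f D" by (rule pos[OF 2 lt(2,3,1) fx(2,3,1)]) (rule other, blast)
    then show ?thesis using 2 unfolding cyc_order_def by simp
  next
    case 3
    have "single_cycle f D" by (rule pos[OF 3 lt(3,1,2) fx(3,1,2)]) (rule other, blast)
    then show ?thesis using 3 unfolding cyc_order_def by simp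
  next
    case 4
    have "\<not> single_cycle f D" by (rule neg[OF 4 lt fx(1) other])
    then show ?thesis using 4 unfolding cyc_order_def by simp
  next
    case 5
    have "\<not> single_cycle f D" by (rule neg[OF 5 lt(3,1,2) fx(3)]) (rule other, blast)
    then show ?thesis using 5 unfolding cyc_order_def by simp
  next
    case 6
    have "\<not> single_cycle f D" by (rule neg[OF 6 lt(2,3,1) fx(2)]) (rule other, blast)
    then show ?thesis using 6 unfolding cyc_order_def by simp
  qed
qed

text \<open>Positions along the face, counted from \<open>d\<close>. The successor rule fails only
  where the face closes up at \<open>d\<close>; this case is recorded separately because the count
  of ascents depends on it.\<close>

lemma exists_positions:
  assumes sc: "single_cycle c D" and fin: "finite D" and d: "d \<in> D"
  shows "\<exists>pos. (\<forall>u\<in>D. pos u < card D \<and> (c ^^ pos u) d = u \<and> (c u \<noteq> d \<longrightarrow> pos (c u) = Suc (pos u)) \<and>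
    (c u = d \<longrightarrow> Suc (pos u) = card D)) \<and> pos d = 0"
proof -
  let ?L = "card D"
  define p where "p = (\<lambda>i. (c ^^ i) d)"
  have bij: "bij_betw p {..<?L} D" and pL: "p ?L = d"
    using single_cycle_positions[OF sc fin d] unfolding p_def by auto
  have L: "?L > 0" using fin d by (auto simp: card_gt_0_iff)
  define pos where "pos = the_inv_into {..<?L} p"
  have inj: "inj_on p {..<?L}" using bij unfolding bij_betw_def by blast
  have im: "p ` {..<?L} = D" using bij unfolding bij_betw_def by blast
  have 1: "pos u < ?L" if "u \<in> D" for u
    using the_inv_into_into[OF inj, of u "{..<?L}"] that im unfolding pos_def by simp
  have 2: "p (pos u) = u" if "u \<in> D" for u
    using f_the_inv_into_f[OF inj, of u] that im unfolding pos_def by simp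
  have 3: "pos (p i) = i" if "i < ?L" for i
    using the_inv_into_f_f[OF inj] that unfolding pos_def by simp
  have p0: "p 0 = d" unfolding p_def by simp
  have cp: "c (p i) = p (Suc i)" for i unfolding p_def by simp
  have 4: "pos (c u) = Suc (pos u)" if "u \<in> D" "c u \<noteq> d" for u
  proof -
    have cu: "c u = p (Suc (pos u))" using cp[of "pos u"] 2[OF that(1)] by simp
    then have "Suc (pos u) \<noteq> ?L" using pL that by metis
    then have "Suc (pos u) < ?L" using 1[OF that(1)] by linarith
    then show ?thesis using cu 3 by simp
  qed
  have 5: "Suc (pos u) = ?L" if "u \<in> D" "c u = d" for u
  proof (rule ccontr)
    assume "Suc (pos u) \<noteq> ?L"
    then have *: "Suc (pos u) < ?L" using 1[OF that(1)] by linarith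
    have "p (Suc (pos u)) = p 0" using cp[of "pos u"] 2[OF that(1)] that p0 by simp
    then show False using inj_onD[OF inj, of "Suc (pos u)" 0] * L by simp
  qed
  have 6: "(c ^^ pos u) d = u" if "u \<in> D" for u using 2[OF that] unfolding p_def .
  have "pos d = 0" using 3[OF L] p0 by simp
  then show ?thesis by (intro exI[of _ pos] conjI ballI impI) (rule 1 4 5 6 | assumption)+
qed

section \<open>Vertices that can be cut and triples of leaves that can be glued\<close>

definition closings :: "('a \<Rightarrow> 'a) \<Rightarrow> 'a set \<Rightarrow> nat \<Rightarrow> ('a \<Rightarrow> 'a) set" where
  "closings \<beta> D k = {\<theta> \<in> cube_roots D k. single_cycle (\<beta> \<circ> \<theta>) D}"

lemma finite_closings: "finite D \<Longrightarrow> finite (closings \<beta> D k)"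
  unfolding closings_def using finite_cube_roots[of D k] by simp

lemma cyc_order_swap:
  assumes "a \<noteq> b" "b \<noteq> e" "e \<noteq> a"
  shows "cyc_order a b e \<longleftrightarrow> \<not> cyc_order a e b"
  using assms unfolding cyc_order_def by linarith

text \<open>A cyclic triple has two ascents in the positive cyclic order and one in the negative
  order; the last summand makes up the difference.\<close>

lemma ascents_cyc_order:
  assumes "a \<noteq> e" "e \<noteq> b" "b \<noteq> a"
  shows "(if a < b then 1 else 0) + (if b < e then 1 else 0) + (if e < a then 1 else 0)
    + (if cyc_order a e b then 1 else 0) = (2 :: nat)"
  using assms unfolding cyc_order_def by (cases "a < b"; cases "b < e"; cases "e < a") auto

text \<open>Interchanging two entries of a triple reverses its cyclic order along the face, so
  exactly half of the ordered triples of leaves glue to a single face.\<close>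

lemma card_glue_triples:
  assumes fin: "finite D" and d: "d \<in> D" and b: "\<beta> permutes D"
    and th: "\<theta> \<in> closings \<beta> D (k + 3)"
  shows "2 * card {p \<in> triples {u \<in> D. \<theta> u = u}. glue \<theta> p \<in> closings \<beta> D k}
     = (k + 3) * (k + 2) * (k + 1)"
proof -
  have t: "\<theta> \<in> cube_roots D (k + 3)" and sc: "single_cycle (\<beta> \<circ> \<theta>) D"
    using th unfolding closings_def by auto
  obtain pos where P: "\<forall>u\<in>D. pos u < card D \<and> ((\<beta> \<circ> \<theta>) ^^ pos u) d = u \<and>
      ((\<beta> \<circ> \<theta>) u \<noteq> d \<longrightarrow> pos ((\<beta> \<circ> \<theta>) u) = Suc (pos u)) \<and>
      ((\<beta> \<circ> \<theta>) u = d \<longrightarrow> Suc (pos u) = card D)" and P0: "pos d = 0"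
    using exists_positions[OF sc fin d] by blast
  have pos: "u \<in> D \<Longrightarrow> pos u < card D" "u \<in> D \<Longrightarrow> ((\<beta> \<circ> \<theta>) ^^ pos u) d = u"
    "u \<in> D \<Longrightarrow> v \<in> D \<Longrightarrow> pos u = pos v \<Longrightarrow> u = v" "pos d = 0"
    "u \<in> D \<Longrightarrow> (\<beta> \<circ> \<theta>) u \<noteq> d \<Longrightarrow> pos ((\<beta> \<circ> \<theta>) u) = Suc (pos u)"
    "u \<in> D \<Longrightarrow> (\<beta> \<circ> \<theta>) u = d \<Longrightarrow> Suc (pos u) = card D" for u v
  proof -
    show "u \<in> D \<Longrightarrow> v \<in> D \<Longrightarrow> pos u = pos v \<Longrightarrow> u = v" using bspec[OF P, of u] bspec[OF P, of v] by metis
  qed (use P P0 in \<open>blast+\<close>)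
  let ?T = "triples {u \<in> D. \<theta> u = u}"
  let ?G = "{p \<in> ?T. glue \<theta> p \<in> closings \<beta> D k}"
  have iff: "glue \<theta> (x, y, z) \<in> closings \<beta> D k \<longleftrightarrow> cyc_order (pos x) (pos y) (pos z)"
    if xyz: "(x, y, z) \<in> ?T" for x y z
  proof -
    have m: "x \<in> D" "y \<in> D" "z \<in> D" "\<theta> x = x" "\<theta> y = y" "\<theta> z = z" "x \<noteq> y" "y \<noteq> z" "z \<noteq> x"
      using xyz unfolding triples_def by auto
    note g = glue_in_cube_roots[OF fin t xyz]
    have gp: "glue \<theta> (x, y, z) permutes D" using g(1) unfolding cube_roots_def by blast
    have "single_cycle (\<beta> \<circ> glue \<theta> (x, y, z)) D \<longleftrightarrow> cyc_order (pos x) (pos y) (pos z)"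
    proof (rule single_cycle_three_iff[OF fin permutes_compose[OF gp b] d sc])
      show "pos x < card D" "pos y < card D" "pos z < card D" using pos(1) m by auto
      show "pos x \<noteq> pos y" "pos y \<noteq> pos z" "pos z \<noteq> pos x"
        using pos(3)[of x y] pos(3)[of y z] pos(3)[of z x] m by auto
      show "(\<beta> \<circ> glue \<theta> (x, y, z)) (((\<beta> \<circ> \<theta>) ^^ pos x) d) = (\<beta> \<circ> \<theta>) (((\<beta> \<circ> \<theta>) ^^ pos y) d)"
        "(\<beta> \<circ> glue \<theta> (x, y, z)) (((\<beta> \<circ> \<theta>) ^^ pos y) d) = (\<beta> \<circ> \<theta>) (((\<beta> \<circ> \<theta>) ^^ pos z) d)"
        "(\<beta> \<circ> glue \<theta> (x, y, z)) (((\<beta> \<circ> \<theta>) ^^ pos z) d) = (\<beta> \<circ> \<theta>) (((\<beta> \<circ> \<theta>) ^^ pos x) d)"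
        unfolding pos(2)[OF m(1)] pos(2)[OF m(2)] pos(2)[OF m(3)] by (simp_all only: comp_apply g(2-4) m(4-6))
      show "(\<beta> \<circ> glue \<theta> (x, y, z)) u = (\<beta> \<circ> \<theta>) u"
        if "u \<notin> {((\<beta> \<circ> \<theta>) ^^ pos x) d, ((\<beta> \<circ> \<theta>) ^^ pos y) d, ((\<beta> \<circ> \<theta>) ^^ pos z) d}" for u
        using that unfolding pos(2)[OF m(1)] pos(2)[OF m(2)] pos(2)[OF m(3)] glue_def by simp
    qed
    then show ?thesis using g(1) unfolding closings_def by simp
  qed
  have swapT: "(x, z, y) \<in> ?T" if "(x, y, z) \<in> ?T" for x y z
    using that unfolding triples_def by auto
  have swap: "glue \<theta> (x, y, z) \<in> closings \<beta> D k \<longleftrightarrow> glue \<theta> (x, z, y) \<notin> closings \<beta> D k"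
    if "(x, y, z) \<in> ?T" for x y z
  proof -
    have "x \<in> D" "y \<in> D" "z \<in> D" "x \<noteq> y" "y \<noteq> z" "z \<noteq> x" using that unfolding triples_def by auto
    then have "pos x \<noteq> pos y" "pos y \<noteq> pos z" "pos z \<noteq> pos x"
      using pos(3)[of x y] pos(3)[of y z] pos(3)[of z x] by auto
    then have "cyc_order (pos x) (pos y) (pos z) \<longleftrightarrow> \<not> cyc_order (pos x) (pos z) (pos y)"
      by (rule cyc_order_swap)
    then show ?thesis using iff[OF that] iff[OF swapT[OF that]] by simp
  qed
  have "bij_betw (\<lambda>(x, y, z). (x, z, y)) ?G (?T - ?G)"
  proof (rule bij_betw_byWitness[where f' = "\<lambda>(x, y, z). (x, z, y)"])
    show "(\<lambda>(x, y, z). (x, z, y)) ` ?G \<subseteq> ?T - ?G"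
    proof
      fix q assume "q \<in> (\<lambda>(x, y, z). (x, z, y)) ` ?G"
      then obtain x y z where h: "(x, y, z) \<in> ?T" "glue \<theta> (x, y, z) \<in> closings \<beta> D k" "q = (x, z, y)"
        by auto
      then show "q \<in> ?T - ?G" using iffD1[OF swap[OF h(1)] h(2)] swapT[OF h(1)] by blast
    qed
    show "(\<lambda>(x, y, z). (x, z, y)) ` (?T - ?G) \<subseteq> ?G"
    proof
      fix q assume "q \<in> (\<lambda>(x, y, z). (x, z, y)) ` (?T - ?G)"
      then obtain x y z where h: "(x, y, z) \<in> ?T" "glue \<theta> (x, y, z) \<notin> closings \<beta> D k" "q = (x, z, y)"
        by auto
      then show "q \<in> ?G" using iffD2[OF swap[OF swapT[OF h(1)]] h(2)] swapT[OF h(1)] by blast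
    qed
  qed auto
  then have "card ?G = card (?T - ?G)" by (rule bij_betw_same_card)
  moreover have "finite ?T" using fin by (intro finite_triples) simp
  then have "card (?T - ?G) = card ?T - card ?G" "card ?G \<le> card ?T"
    by (auto intro!: card_Diff_subset card_mono)
  moreover have "card {u \<in> D. \<theta> u = u} = k + 3" using t unfolding cube_roots_def by auto
  then have "card ?T = (k + 3) * (k + 2) * (k + 1)"
    using card_triples[of "{u \<in> D. \<theta> u = u}"] fin by simp
  ultimately show ?thesis by linarith
qed

text \<open>The involution exchanges weak excedances with weak deficiencies. Together these cover
  \<open>D\<close>, and they overlap in the \<open>r\<close> fixed points because positions are
  distinct.\<close>

lemma card_weak_excedances:
  assumes fin: "finite D" and b: "\<beta> \<in> involutions D r"
    and pos: "\<And>u v. u \<in> D \<Longrightarrow> v \<in> D \<Longrightarrow> pos u = pos v \<Longrightarrow> u = v"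
  shows "2 * card {u \<in> D. (pos u :: nat) \<le> pos (\<beta> u)} = card D + r"
proof -
  have b': "\<beta> permutes D" "\<And>u. \<beta> (\<beta> u) = u" "card {u \<in> D. \<beta> u = u} = r"
    using b unfolding involutions_def by auto
  let ?A = "{u \<in> D. pos u \<le> pos (\<beta> u)}" and ?B = "{u \<in> D. pos (\<beta> u) \<le> pos u}"
  have bD: "\<beta> u \<in> D \<longleftrightarrow> u \<in> D" for u using b'(1) by (simp add: permutes_in_image)
  have "bij_betw \<beta> ?A ?B"
    by (rule bij_betw_byWitness[where f' = \<beta>]) (use b'(2) bD in auto)
  then have "card ?A = card ?B" by (rule bij_betw_same_card)
  moreover have "?A \<union> ?B = D" by auto
  moreover have "?A \<inter> ?B = {u \<in> D. \<beta> u = u}" using pos bD by (auto simp: order_antisym)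
  moreover have "card ?A + card ?B = card (?A \<union> ?B) + card (?A \<inter> ?B)"
    using fin by (intro card_Un_Int) auto
  ultimately show ?thesis using b'(3) by simp
qed

text \<open>Chapuy's trisection lemma for vertices of degree 3. Along the face, a 3-cycle of
  \<open>\<theta>\<close> has one or two ascents; the number of ascents of \<open>\<theta>\<close> is determined by \<open>\<beta>\<close>, and
  the 3-cycles with one ascent are those that can be cut open without destroying the face.\<close>

lemma card_sliceable:
  assumes fin: "finite D" and d: "d \<in> D" and b: "\<beta> \<in> involutions D r"
    and th: "\<theta> \<in> closings \<beta> D k"
  shows "2 * card {x \<in> D. \<theta> x \<noteq> x \<and> slice \<theta> x \<in> closings \<beta> D (k + 3)} + 3 * (card D + r)
     = 4 * (card D - k) + 6"
proof -
  let ?c = "\<beta> \<circ> \<theta>"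
  have t: "\<theta> \<in> cube_roots D k" and sc: "single_cycle ?c D"
    using th unfolding closings_def by auto
  have t': "\<theta> permutes D" "\<And>u. \<theta> (\<theta> (\<theta> u)) = u" "card {u \<in> D. \<theta> u = u} = k"
    using t unfolding cube_roots_def by auto
  have b': "\<beta> permutes D" "\<And>u. \<beta> (\<beta> u) = u" using b unfolding involutions_def by auto
  have tD: "\<theta> u \<in> D \<longleftrightarrow> u \<in> D" for u using t'(1) by (simp add: permutes_in_image)
  have cp: "?c permutes D" using permutes_compose[OF t'(1) b'(1)] .
  obtain pos where P: "\<forall>u\<in>D. pos u < card D \<and> ((\<beta> \<circ> \<theta>) ^^ pos u) d = u \<and>
      ((\<beta> \<circ> \<theta>) u \<noteq> d \<longrightarrow> pos ((\<beta> \<circ> \<theta>) u) = Suc (pos u)) \<and>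
      ((\<beta> \<circ> \<theta>) u = d \<longrightarrow> Suc (pos u) = card D)" and P0: "pos d = 0"
    using exists_positions[OF sc fin d] by blast
  have pos: "u \<in> D \<Longrightarrow> pos u < card D" "u \<in> D \<Longrightarrow> ((\<beta> \<circ> \<theta>) ^^ pos u) d = u"
    "u \<in> D \<Longrightarrow> v \<in> D \<Longrightarrow> pos u = pos v \<Longrightarrow> u = v" "pos d = 0"
    "u \<in> D \<Longrightarrow> (\<beta> \<circ> \<theta>) u \<noteq> d \<Longrightarrow> pos ((\<beta> \<circ> \<theta>) u) = Suc (pos u)"
    "u \<in> D \<Longrightarrow> (\<beta> \<circ> \<theta>) u = d \<Longrightarrow> Suc (pos u) = card D" for u v
  proof -
    show "u \<in> D \<Longrightarrow> v \<in> D \<Longrightarrow> pos u = pos v \<Longrightarrow> u = v" using bspec[OF P, of u] bspec[OF P, of v] by metis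
  qed (use P P0 in \<open>blast+\<close>)
  define N where "N = {x \<in> D. \<theta> x \<noteq> x}"
  define P where "P = {x \<in> D. \<theta> x \<noteq> x \<and> slice \<theta> x \<in> closings \<beta> D (k + 3)}"
  define asc where "asc x = (if pos x < pos (\<theta> x) then 1 else 0 :: nat)" for x
  have finN: "finite N" unfolding N_def using fin by simp
  have iff: "slice \<theta> x \<in> closings \<beta> D (k + 3) \<longleftrightarrow> cyc_order (pos x) (pos (\<theta> (\<theta> x))) (pos (\<theta> x))"
    if x: "x \<in> D" "\<theta> x \<noteq> x" for x
  proof -
    note s = slice_in_cube_roots[OF fin t x]
    note dist = cube_root_orbit_distinct[of \<theta>, OF t'(2) x(2)]
    have sp: "slice \<theta> x permutes D" using s(1) unfolding cube_roots_def by blast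
    have m: "\<theta> x \<in> D" "\<theta> (\<theta> x) \<in> D" using x tD by auto
    have "single_cycle (\<beta> \<circ> slice \<theta> x) D \<longleftrightarrow> cyc_order (pos x) (pos (\<theta> (\<theta> x))) (pos (\<theta> x))"
    proof (rule single_cycle_three_iff[OF fin permutes_compose[OF sp b'(1)] d sc])
      show "pos x < card D" "pos (\<theta> (\<theta> x)) < card D" "pos (\<theta> x) < card D" using pos(1) m x by auto
      show "pos x \<noteq> pos (\<theta> (\<theta> x))" "pos (\<theta> (\<theta> x)) \<noteq> pos (\<theta> x)" "pos (\<theta> x) \<noteq> pos x"
        using pos(3)[OF x(1) m(2)] pos(3)[OF m(2) m(1)] pos(3)[OF m(1) x(1)] x dist by auto
      show "(\<beta> \<circ> slice \<theta> x) u = ?c u"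
        if "u \<notin> {(?c ^^ pos x) d, (?c ^^ pos (\<theta> (\<theta> x))) d, (?c ^^ pos (\<theta> x)) d}" for u
        using that unfolding pos(2)[OF x(1)] pos(2)[OF m(1)] pos(2)[OF m(2)] slice_def by auto
      have "slice \<theta> x x = \<theta> (\<theta> (\<theta> x))" "slice \<theta> x (\<theta> (\<theta> x)) = \<theta> (\<theta> x)" "slice \<theta> x (\<theta> x) = \<theta> x"
        unfolding slice_def t'(2) by simp_all
      then show "(\<beta> \<circ> slice \<theta> x) ((?c ^^ pos x) d) = ?c ((?c ^^ pos (\<theta> (\<theta> x))) d)"
        "(\<beta> \<circ> slice \<theta> x) ((?c ^^ pos (\<theta> (\<theta> x))) d) = ?c ((?c ^^ pos (\<theta> x)) d)"
        "(\<beta> \<circ> slice \<theta> x) ((?c ^^ pos (\<theta> x)) d) = ?c ((?c ^^ pos x) d)"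
        unfolding pos(2)[OF x(1)] pos(2)[OF m(1)] pos(2)[OF m(2)] by (simp_all only: comp_apply)
    qed
    then show ?thesis using s(1) unfolding closings_def by simp
  qed
  have three: "asc x + asc (\<theta> x) + asc (\<theta> (\<theta> x)) + (if x \<in> P then 1 else 0) = 2" if "x \<in> N" for x
  proof -
    have x: "x \<in> D" "\<theta> x \<noteq> x" using that unfolding N_def by auto
    note dist = cube_root_orbit_distinct[of \<theta>, OF t'(2) x(2)]
    have "pos x \<noteq> pos (\<theta> (\<theta> x))" "pos (\<theta> (\<theta> x)) \<noteq> pos (\<theta> x)" "pos (\<theta> x) \<noteq> pos x"
      using pos(3)[of x "\<theta> (\<theta> x)"] pos(3)[of "\<theta> (\<theta> x)" "\<theta> x"] pos(3)[of "\<theta> x" x] tD x dist by auto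
    then have "(if pos x < pos (\<theta> x) then 1 else 0) + (if pos (\<theta> x) < pos (\<theta> (\<theta> x)) then 1 else 0)
        + (if pos (\<theta> (\<theta> x)) < pos x then 1 else 0)
        + (if cyc_order (pos x) (pos (\<theta> (\<theta> x))) (pos (\<theta> x)) then 1 else 0) = (2 :: nat)"
      by (rule ascents_cyc_order)
    moreover have "x \<in> P \<longleftrightarrow> cyc_order (pos x) (pos (\<theta> (\<theta> x))) (pos (\<theta> x))"
      using iff[OF x] x unfolding P_def by blast
    ultimately show ?thesis unfolding asc_def t'(2) by (simp only:)
  qed
  have bijN: "bij_betw \<theta> N N"
  proof (rule bij_betw_byWitness[where f' = "\<theta> \<circ> \<theta>"])
    show "\<theta> ` N \<subseteq> N" using tD cube_root_orbit_distinct[of \<theta>, OF t'(2)] unfolding N_def by auto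
    then show "(\<theta> \<circ> \<theta>) ` N \<subseteq> N" by auto
  qed (use t'(2) in auto)
  have e1: "(\<Sum>x\<in>N. asc (\<theta> x)) = (\<Sum>x\<in>N. asc x)" by (rule sum.reindex_bij_betw[OF bijN])
  have e2: "(\<Sum>x\<in>N. asc (\<theta> (\<theta> x))) = (\<Sum>x\<in>N. asc (\<theta> x))"
    using sum.reindex_bij_betw[OF bijN, of "\<lambda>x. asc (\<theta> x)"] by simp
  have PN: "P \<subseteq> N" unfolding P_def N_def by auto
  have "(\<Sum>x\<in>N. asc x + asc (\<theta> x) + asc (\<theta> (\<theta> x)) + (if x \<in> P then 1 else 0)) = 2 * card N"
    using three by simp
  moreover have "(\<Sum>x\<in>N. if x \<in> P then 1 else 0 :: nat) = card P"
    using finN PN by (simp add: sum.If_cases Int_absorb1)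
  ultimately have main: "3 * (\<Sum>x\<in>N. asc x) + card P = 2 * card N"
    using e1 e2 by (simp add: sum.distrib)
  have "(\<Sum>x\<in>N. asc x) = card {x \<in> N. pos x < pos (\<theta> x)}"
    unfolding asc_def using finN by (simp add: sum.If_cases Int_def)
  also have "{x \<in> N. pos x < pos (\<theta> x)} = {x \<in> D. pos x < pos (\<theta> x)}" unfolding N_def by auto
  \<comment> \<open>The face permutation moves \<open>x\<close> one position on, to a half-edge
    whose partner is \<open>\<theta> x\<close>, so the strict inequality at \<open>x\<close> becomes
    a weak one at \<open>?c x\<close>. The exception is \<open>d\<close>: at position 0 it is a weak
    excedance, while its predecessor, being last, is no ascent.\<close>
  also have "card \<dots> = card ({u \<in> D. pos u \<le> pos (\<beta> u)} - {d})"
  proof (rule bij_betw_same_card[of ?c])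
    have cD: "?c u \<in> D \<longleftrightarrow> u \<in> D" for u using cp by (simp only: permutes_in_image)
    have bc: "\<beta> (?c u) = \<theta> u" for u using b'(2) by simp
    show "bij_betw ?c {x \<in> D. pos x < pos (\<theta> x)} ({u \<in> D. pos u \<le> pos (\<beta> u)} - {d})"
      unfolding bij_betw_def
    proof (intro conjI equalityI subsetI)
      show "inj_on ?c {x \<in> D. pos x < pos (\<theta> x)}"
        using permutes_inj[OF cp] by (rule inj_on_subset) simp
    next
      fix u assume "u \<in> ?c ` {x \<in> D. pos x < pos (\<theta> x)}"
      then obtain x where x: "x \<in> D" "pos x < pos (\<theta> x)" "u = ?c x" by blast
      have "u \<noteq> d"
      proof
        assume "u = d"
        then have "Suc (pos x) = card D" using pos(6)[OF x(1)] x(3) by simp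
        moreover have "pos (\<theta> x) < card D" using pos(1) tD x(1) by simp
        ultimately show False using x(2) by simp
      qed
      moreover have "pos u \<le> pos (\<beta> u)" using pos(5)[OF x(1)] calculation x bc[of x] by simp
      ultimately show "u \<in> {u \<in> D. pos u \<le> pos (\<beta> u)} - {d}" using x cD by simp
    next
      fix u assume u: "u \<in> {u \<in> D. pos u \<le> pos (\<beta> u)} - {d}"
      then obtain x where x: "x \<in> D" "u = ?c x" using permutes_image[OF cp] by blast
      have "pos u = Suc (pos x)" using pos(5)[OF x(1)] u x(2) by simp
      then have "pos x < pos (\<theta> x)" using u x(2) bc[of x] by simp
      then show "u \<in> ?c ` {x \<in> D. pos x < pos (\<theta> x)}" using x by blast
    qed
  qed
  also have "\<dots> = card {u \<in> D. pos u \<le> pos (\<beta> u)} - 1"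
    using d pos(4) fin by (subst card_Diff_singleton) auto
  finally have a: "(\<Sum>x\<in>N. asc x) = card {u \<in> D. pos u \<le> pos (\<beta> u)} - 1" .
  have "{u \<in> D. pos u \<le> pos (\<beta> u)} \<noteq> {}" using d pos(4) by auto
  then have "card {u \<in> D. pos u \<le> pos (\<beta> u)} \<ge> 1"
    using fin by (simp add: Suc_le_eq card_gt_0_iff)
  moreover have "2 * card {u \<in> D. pos u \<le> pos (\<beta> u)} = card D + r"
    by (rule card_weak_excedances[OF fin b]) (rule pos(3))
  moreover have "card N = card D - k"
  proof -
    have "N = D - {u \<in> D. \<theta> u = u}" unfolding N_def by auto
    then show ?thesis using t'(3) fin by (simp add: card_Diff_subset)
  qed
  ultimately have "2 * (sum asc N + 1) = card D + r" "card N = card D - k" using a by auto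
  moreover define S where "S = sum asc N"
  moreover define M where "M = card D - k"
  ultimately have "2 * (S + 1) = card D + r" "3 * S + card P = 2 * M" using main by simp_all
  then have "2 * card P + 3 * (card D + r) = 4 * M + 6" by presburger
  then show ?thesis unfolding P_def M_def .
qed

text \<open>The hypothesis on \<open>f\<close> is Euler's formula, with \<open>f\<close> the genus.
  The half-edges that can be cut at number \<open>6 * f\<close>, three for each of
  \<open>2 * f\<close> vertices; doubling gives \<open>12 * f\<close> and clears the factor one half
  on the side of the triples.\<close>

lemma closings_rec:
  assumes fin: "finite D" and ne: "D \<noteq> {}" and b: "\<beta> \<in> involutions D r"
    and f: "4 * (card D - k) + 6 = 3 * (card D + r) + 12 * f"
  shows "12 * f * card (closings \<beta> D k) = (k + 3) * (k + 2) * (k + 1) * card (closings \<beta> D (k + 3))"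
proof -
  obtain d where d: "d \<in> D" using ne by blast
  have bp: "\<beta> permutes D" using b unfolding involutions_def by blast
  have "12 * f * card (closings \<beta> D k)
      = (\<Sum>\<theta>\<in>closings \<beta> D k. 2 * card {x \<in> D. \<theta> x \<noteq> x \<and> slice \<theta> x \<in> closings \<beta> D (k + 3)})"
  proof -
    have "2 * card {x \<in> D. \<theta> x \<noteq> x \<and> slice \<theta> x \<in> closings \<beta> D (k + 3)} = 12 * f"
      if "\<theta> \<in> closings \<beta> D k" for \<theta>
      using card_sliceable[OF fin d b that] f by linarith
    then show ?thesis by simp
  qed
  also have "\<dots> = 2 * (\<Sum>\<theta>\<in>closings \<beta> D k. card {x \<in> D. \<theta> x \<noteq> x \<and> slice \<theta> x \<in> closings \<beta> D (k + 3)})"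
    by (simp add: sum_distrib_left)
  also have "\<dots> = 2 * (\<Sum>\<theta>\<in>closings \<beta> D (k + 3). card {p \<in> triples {u \<in> D. \<theta> u = u}. glue \<theta> p \<in> closings \<beta> D k})"
    by (subst slice_glue_double_count[OF fin, of _ k]) (auto simp: closings_def)
  also have "\<dots> = (\<Sum>\<theta>\<in>closings \<beta> D (k + 3). 2 * card {p \<in> triples {u \<in> D. \<theta> u = u}. glue \<theta> p \<in> closings \<beta> D k})"
    by (simp add: sum_distrib_left)
  also have "\<dots> = (k + 3) * (k + 2) * (k + 1) * card (closings \<beta> D (k + 3))"
    by (simp only: card_glue_triples[OF fin d bp] sum_constant cong: sum.cong) simp
  finally show ?thesis .
qed

lemma cube_roots_fixed_le: "finite D \<Longrightarrow> \<theta> \<in> cube_roots D k \<Longrightarrow> k \<le> card D"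
  unfolding cube_roots_def by (auto intro!: card_mono)

text \<open>Vertices are cut as long as possible. If none can be cut, \<open>card_sliceable\<close>
  reads as genus 0, and each cut made before has lowered the genus by one; so the genus of a
  one-face map is a natural number.\<close>

lemma closings_nonempty_genus:
  assumes fin: "finite D" and ne: "D \<noteq> {}" and b: "\<beta> \<in> involutions D r"
  shows "\<theta> \<in> closings \<beta> D k \<Longrightarrow> \<exists>f. 4 * (card D - k) + 6 = 3 * (card D + r) + 12 * f"
proof (induction "card D - k" arbitrary: k \<theta> rule: less_induct)
  case less
  obtain d where d: "d \<in> D" using ne by blast
  define P where "P = {x \<in> D. \<theta> x \<noteq> x \<and> slice \<theta> x \<in> closings \<beta> D (k + 3)}"
  have eq: "2 * card P + 3 * (card D + r) = 4 * (card D - k) + 6"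
    unfolding P_def by (rule card_sliceable[OF fin d b less.prems])
  show ?case
  proof (cases "P = {}")
    case True
    then show ?thesis using eq by (intro exI[of _ 0]) simp
  next
    case False
    then obtain x where x: "slice \<theta> x \<in> closings \<beta> D (k + 3)" unfolding P_def by blast
    then have k3: "k + 3 \<le> card D" using cube_roots_fixed_le[OF fin] unfolding closings_def by blast
    then have "card D - (k + 3) < card D - k" by simp
    then obtain f where "4 * (card D - (k + 3)) + 6 = 3 * (card D + r) + 12 * f"
      using less.hyps[OF _ x] by blast
    then have "4 * (card D - k) + 6 = 3 * (card D + r) + 12 * (f + 1)" using k3 by simp
    then show ?thesis by blast
  qed
qed

text \<open>The recursion unrolled down to genus 0, where there are \<open>k + 3 * f\<close> leaves.
  Genus \<open>j\<close> contributes the factor \<open>12 * j\<close>, whence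
  \<open>12 ^ f * fact f\<close>.\<close>

lemma card_closings_shift:
  assumes fin: "finite D" and ne: "D \<noteq> {}" and b: "\<beta> \<in> involutions D r"
  shows "4 * (card D - k) + 6 = 3 * (card D + r) + 12 * f \<Longrightarrow>
    card (closings \<beta> D k) * (fact k * 12 ^ f * fact f) = card (closings \<beta> D (k + 3 * f)) * fact (k + 3 * f)"
proof (induction f arbitrary: k)
  case 0 then show ?case by simp
next
  case (Suc f)
  have L: "card D > 0" using fin ne by (simp add: card_gt_0_iff)
  have rec: "12 * Suc f * card (closings \<beta> D k) = (k + 3) * (k + 2) * (k + 1) * card (closings \<beta> D (k + 3))"
    by (rule closings_rec[OF fin ne b Suc.prems])
  have "4 * (card D - (k + 3)) + 6 = 3 * (card D + r) + 12 * f" using Suc.prems L by simp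
  from Suc.IH[OF this]
  have IH: "card (closings \<beta> D (k + 3)) * (fact (k + 3) * 12 ^ f * fact f)
      = card (closings \<beta> D (k + 3 * Suc f)) * fact (k + 3 * Suc f)" by (simp add: algebra_simps)
  have fk: "fact (k + 3) = (k + 3) * (k + 2) * (k + 1) * (fact k :: nat)"
    by (simp add: numeral_3_eq_3 algebra_simps)
  have "card (closings \<beta> D k) * (fact k * 12 ^ Suc f * fact (Suc f))
      = 12 * Suc f * card (closings \<beta> D k) * (fact k * 12 ^ f * fact f)"
    by (simp add: algebra_simps)
  also have "\<dots> = card (closings \<beta> D (k + 3)) * (fact (k + 3) * 12 ^ f * fact f)"
    unfolding rec fk by (simp only: ac_simps)
  finally show ?case using IH by simp
qed

section \<open>The number of labelled one-face maps\<close>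

definition unicellular :: "'a set \<Rightarrow> nat \<Rightarrow> nat \<Rightarrow> (('a \<Rightarrow> 'a) \<times> ('a \<Rightarrow> 'a)) set" where
  "unicellular D r k = {(\<beta>, \<theta>). \<beta> \<in> involutions D r \<and> \<theta> \<in> cube_roots D k \<and> single_cycle (\<beta> \<circ> \<theta>) D}"

lemma card_unicellular_closings:
  assumes "finite D"
  shows "card (unicellular D r k) = (\<Sum>\<beta>\<in>involutions D r. card (closings \<beta> D k))"
proof -
  have "unicellular D r k = (SIGMA \<beta>:involutions D r. closings \<beta> D k)"
    unfolding unicellular_def closings_def by auto
  then show ?thesis using assms by (simp add: card_SigmaI finite_involutions finite_closings)
qed

lemma card_unicellular_trees:
  assumes "finite D"
  shows "card (unicellular D r k) = (\<Sum>\<theta>\<in>cube_roots D k. card (trees D \<theta> r))"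
proof -
  have "bij_betw prod.swap (unicellular D r k) (SIGMA \<theta>:cube_roots D k. trees D \<theta> r)"
    by (rule bij_betw_byWitness[where f' = prod.swap]) (auto simp: unicellular_def trees_def)
  then have "card (unicellular D r k) = card (SIGMA \<theta>:cube_roots D k. trees D \<theta> r)"
    by (rule bij_betw_same_card)
  then show ?thesis using assms by (simp add: card_SigmaI finite_cube_roots finite_trees)
qed

text \<open>The recursion in the genus keeps \<open>\<beta>\<close> and varies
  \<open>\<theta>\<close>, the tree count keeps \<open>\<theta>\<close> and varies
  \<open>\<beta>\<close>; summation over pairs lets the two be combined. \<open>V\<close> counts the
  degree-3 vertices of the trees reached after \<open>f\<close> cuts, so the map itself has
  \<open>V + f\<close> of them.\<close>

theorem card_unicellular:
  assumes fin: "finite D" and ne: "D \<noteq> {}" and L: "card D + 6 = 4 * k + 3 * r + 12 * f"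
    and V: "V + 2 = k + r + 3 * f"
  shows "card (unicellular D r k) * (fact k * fact r * 12 ^ f * fact f * fact V) = fact (card D) * fact (2 * V)"
proof -
  define K where "K = k + 3 * f"
  have LV: "card D = K + 3 * V" and rK: "r + K = V + 2" using L V unfolding K_def by linarith+
  have f: "4 * (card D - k) + 6 = 3 * (card D + r) + 12 * f"
    using L LV unfolding K_def by (simp add: algebra_simps)
  have "card (unicellular D r k) * (fact k * 12 ^ f * fact f) = card (unicellular D r K) * fact K"
    unfolding card_unicellular_closings[OF fin] sum_distrib_right K_def
    by (intro sum.cong refl card_closings_shift[OF fin ne _ f])
  moreover have "card (unicellular D r K) * fact r = card (cube_roots D K) * (3 ^ V * fact (2 * V))"
    unfolding card_unicellular_trees[OF fin] sum_distrib_right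
    using card_trees[OF fin ne _ LV rK] by simp
  moreover have "card (cube_roots D K) * (fact K * 3 ^ V * fact V) = fact (card D)"
    by (rule card_cube_roots[OF fin LV])
  moreover have "u * (a * r * p * q * v) = L * w"
    if "u * (a * p * q) = U * K" "U * r = t * (x * w)" "t * (K * x * v) = L"
    for u a r p q v L w U K t x :: nat
  proof -
    have "u * (a * r * p * q * v) = (u * (a * p * q)) * (r * v)" by (simp only: ac_simps)
    also have "\<dots> = (U * r) * (K * v)" unfolding that(1) by (simp only: ac_simps)
    also have "\<dots> = t * (K * x * v) * w" unfolding that(2) by (simp only: ac_simps)
    finally show ?thesis unfolding that(3) .
  qed
  ultimately show ?thesis by blast
qed

lemma unicellular_nonempty_genus:
  assumes fin: "finite D" and ne: "D \<noteq> {}" and p: "p \<in> unicellular D r k"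
  shows "\<exists>f. card D + 6 = 4 * k + 3 * r + 12 * f"
proof -
  obtain \<beta> \<theta> where h: "\<beta> \<in> involutions D r" "\<theta> \<in> closings \<beta> D k"
    using p unfolding unicellular_def closings_def by blast
  obtain f where f: "4 * (card D - k) + 6 = 3 * (card D + r) + 12 * f"
    using closings_nonempty_genus[OF fin ne h] by blast
  have "k \<le> card D" using h(2) cube_roots_fixed_le[OF fin] unfolding closings_def by blast
  then have "card D + 6 = 4 * k + 3 * r + 12 * f" using f by (auto simp: diff_mult_distrib2)
  then show ?thesis ..
qed

section \<open>Invariance under relabelling\<close>

lemma conj_fixed_points:
  assumes "\<pi> permutes D"
  shows "{x \<in> D. (\<pi> \<circ> f \<circ> inv_into UNIV \<pi>) x = x} = \<pi> ` {x \<in> D. f x = x}"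
proof (intro equalityI subsetI)
  fix x assume "x \<in> {x \<in> D. (\<pi> \<circ> f \<circ> inv_into UNIV \<pi>) x = x}"
  then have x: "x \<in> D" "\<pi> (f (inv_into UNIV \<pi> x)) = x" by auto
  have "inv_into UNIV \<pi> x \<in> D" using x(1) permutes_in_image[OF permutes_inv[OF assms]] by blast
  moreover have "f (inv_into UNIV \<pi> x) = inv_into UNIV \<pi> x" using x(2) permutes_inverses(2)[OF assms] by metis
  ultimately show "x \<in> \<pi> ` {x \<in> D. f x = x}" using permutes_inverses(1)[OF assms, of x]
    by (intro image_eqI[of _ _ "inv_into UNIV \<pi> x"]) auto
next
  fix x assume "x \<in> \<pi> ` {x \<in> D. f x = x}"
  then obtain y where "y \<in> D" "f y = y" "x = \<pi> y" by blast
  then show "x \<in> {x \<in> D. (\<pi> \<circ> f \<circ> inv_into UNIV \<pi>) x = x}"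
    using permutes_inverses(2)[OF assms] permutes_in_image[OF assms] by simp
qed

lemma card_conj_fixed_points:
  assumes "\<pi> permutes D"
  shows "card {x \<in> D. (\<pi> \<circ> f \<circ> inv_into UNIV \<pi>) x = x} = card {x \<in> D. f x = x}"
  unfolding conj_fixed_points[OF assms]
  by (rule card_image) (rule inj_on_subset[OF permutes_inj[OF assms]], simp)

lemma conj_involutions:
  assumes "\<pi> permutes D" "\<beta> \<in> involutions D r"
  shows "\<pi> \<circ> \<beta> \<circ> inv_into UNIV \<pi> \<in> involutions D r"
  using assms card_conj_fixed_points[OF assms(1), of \<beta>] permutes_inverses[OF assms(1)]
  unfolding involutions_def by (auto intro!: permutes_compose permutes_inv)

lemma conj_cube_roots:
  assumes "\<pi> permutes D" "\<theta> \<in> cube_roots D k"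
  shows "\<pi> \<circ> \<theta> \<circ> inv_into UNIV \<pi> \<in> cube_roots D k"
  using assms card_conj_fixed_points[OF assms(1), of \<theta>] permutes_inverses[OF assms(1)]
  unfolding cube_roots_def by (auto intro!: permutes_compose permutes_inv)

lemma conj_single_cycle:
  assumes p: "\<pi> permutes D" and c: "single_cycle c D"
  shows "single_cycle (\<pi> \<circ> c \<circ> inv_into UNIV \<pi>) D"
  unfolding single_cycle_def
proof (intro conjI allI impI)
  show "\<pi> \<circ> c \<circ> inv_into UNIV \<pi> permutes D"
    using p c unfolding single_cycle_def by (auto intro!: permutes_compose permutes_inv)
  fix S assume S: "S \<subseteq> D" "S \<noteq> {}" "(\<pi> \<circ> c \<circ> inv_into UNIV \<pi>) ` S \<subseteq> S"
  let ?S = "inv_into UNIV \<pi> ` S"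
  have "c ` ?S \<subseteq> ?S"
  proof
    fix v assume "v \<in> c ` ?S"
    then obtain s where s: "s \<in> S" "v = c (inv_into UNIV \<pi> s)" by blast
    then have "\<pi> v \<in> S" using S(3) by auto
    then have "inv_into UNIV \<pi> (\<pi> v) \<in> ?S" by blast
    then show "v \<in> ?S" using permutes_inverses(2)[OF p] by simp
  qed
  moreover have "?S \<subseteq> D" using S(1) permutes_in_image[OF permutes_inv[OF p]] by blast
  ultimately have "?S = D" using single_cycleD[OF c] S(2) by blast
  then have "\<pi> ` ?S = D" using permutes_image[OF p] by simp
  moreover have "\<pi> ` ?S = S" using permutes_inverses(1)[OF p] by (simp add: image_image)
  ultimately show "S = D" by simp
qed

section \<open>Rooted one-face maps\<close>

text \<open>Rotation by one position, extended by the identity so that it is a permutation in the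
  sense of \<open>permutes\<close>.\<close>

definition next_pos :: "nat \<Rightarrow> nat \<Rightarrow> nat" where
  "next_pos L i = (if i < L then Suc i mod L else i)"

lemma next_pos_permutes: "next_pos L permutes {..<L}"
proof (rule bij_imp_permutes)
  have "next_pos L ` {..<L} = {..<L}"
  proof (intro equalityI subsetI)
    fix j assume "j \<in> {..<L}"
    then show "j \<in> next_pos L ` {..<L}"
      by (intro image_eqI[of _ _ "if j = 0 then L - 1 else j - 1"]) (auto simp: next_pos_def)
  qed (auto simp: next_pos_def)
  then show "bij_betw (next_pos L) {..<L} {..<L}"
    by (simp add: bij_betw_def eq_card_imp_inj_on)
qed (simp add: next_pos_def)

lemma next_pos_funpow: "i < L \<Longrightarrow> (next_pos L ^^ i) 0 = i"
  by (induction i) (auto simp: next_pos_def)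

lemma next_pos_single_cycle: "single_cycle (next_pos L) {..<L}"
  unfolding single_cycle_def
proof (intro conjI allI impI next_pos_permutes)
  fix S assume S: "S \<subseteq> {..<L}" "S \<noteq> {}" "next_pos L ` S \<subseteq> S"
  have st: "Suc i mod L \<in> S" if "i \<in> S" for i
    using that S by (force simp: next_pos_def)
  obtain s where s: "s \<in> S" using S(2) by blast
  have up: "(s + i) mod L \<in> S" for i
  proof (induction i)
    case 0 then show ?case using s S(1) by auto
  next
    case (Suc i) then show ?case using st[of "(s + i) mod L"] by (simp add: mod_Suc_eq)
  qed
  have sL: "s < L" using s S(1) by auto
  have "j \<in> S" if "j < L" for j
    using up[of "L - s + j"] that sL by simp
  then show "S = {..<L}" using S(1) by blast
qed

text \<open>The positions on the boundary of the face, counted from the root, serve as half-edges; the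
  face permutation is then \<open>next_pos L\<close>, and the map is determined by \<open>\<beta>\<close> alone.\<close>

definition rooted :: "nat \<Rightarrow> nat \<Rightarrow> nat \<Rightarrow> (nat \<Rightarrow> nat) set" where
  "rooted L r k = {\<beta> \<in> involutions {..<L} r. \<beta> \<circ> next_pos L \<in> cube_roots {..<L} k}"

text \<open>A one-face map with a chosen half-edge \<open>d\<close> has exactly one labelling in
  which \<open>d\<close> is \<open>0\<close> and the face permutation is \<open>next_pos L\<close>:
  follow the face from \<open>d\<close>. So pairs of a permutation and a rooted map match pairs of a
  labelled map and a root.\<close>

lemma card_rooted:
  assumes L: "L > 0"
  shows "fact L * card (rooted L r k) = L * card (unicellular {..<L} r k)"
proof -
  let ?D = "{..<L}" and ?c = "next_pos L"
  define F where "F = (\<lambda>(\<pi> :: nat \<Rightarrow> nat, \<beta>). ((\<pi> \<circ> \<beta> \<circ> inv_into UNIV \<pi>, \<pi> \<circ> (\<beta> \<circ> ?c) \<circ> inv_into UNIV \<pi>), \<pi> 0))"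
  let ?X = "{\<pi>. \<pi> permutes ?D} \<times> rooted L r k"
  let ?Y = "unicellular ?D r k \<times> ?D"
  have bb: "\<beta> (\<beta> x) = x" if "\<beta> \<in> involutions ?D r" for \<beta> x using that unfolding involutions_def by blast
  have comp: "(\<pi> \<circ> \<beta> \<circ> inv_into UNIV \<pi>) \<circ> (\<pi> \<circ> (\<beta> \<circ> ?c) \<circ> inv_into UNIV \<pi>) = \<pi> \<circ> ?c \<circ> inv_into UNIV \<pi>"
    if "\<pi> permutes ?D" "\<beta> \<in> involutions ?D r" for \<pi> \<beta>
    using bb[OF that(2)] permutes_inverses(2)[OF that(1)] by (simp add: fun_eq_iff)
  have pow: "\<pi> i = ((\<pi> \<circ> ?c \<circ> inv_into UNIV \<pi>) ^^ i) (\<pi> 0)" if "\<pi> permutes ?D" "i < L" for \<pi> i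
  proof -
    have "((\<pi> \<circ> ?c \<circ> inv_into UNIV \<pi>) ^^ j) (\<pi> 0) = \<pi> ((?c ^^ j) 0)" for j
      by (induction j) (use permutes_inverses(2)[OF that(1)] in auto)
    then show ?thesis using next_pos_funpow[OF that(2)] by simp
  qed
  have "bij_betw F ?X ?Y"
    unfolding bij_betw_def
  proof (intro conjI equalityI subsetI inj_onI)
    fix a b assume a: "a \<in> ?X" and b: "b \<in> ?X" and eq: "F a = F b"
    obtain \<pi> \<beta> where ab: "a = (\<pi>, \<beta>)" by fastforce
    obtain \<pi>' \<beta>' where bb': "b = (\<pi>', \<beta>')" by fastforce
    have p: "\<pi> permutes ?D" "\<pi>' permutes ?D" "\<beta> \<in> involutions ?D r" "\<beta>' \<in> involutions ?D r"
      using a b unfolding ab bb' rooted_def by auto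
    have e: "\<pi> \<circ> \<beta> \<circ> inv_into UNIV \<pi> = \<pi>' \<circ> \<beta>' \<circ> inv_into UNIV \<pi>'" "\<pi> \<circ> (\<beta> \<circ> ?c) \<circ> inv_into UNIV \<pi> = \<pi>' \<circ> (\<beta>' \<circ> ?c) \<circ> inv_into UNIV \<pi>'"
      "\<pi> 0 = \<pi>' 0" using eq unfolding ab bb' F_def by auto
    have "\<pi> \<circ> ?c \<circ> inv_into UNIV \<pi> = \<pi>' \<circ> ?c \<circ> inv_into UNIV \<pi>'"
      unfolding comp[OF p(1,3), symmetric] comp[OF p(2,4), symmetric] e ..
    then have "\<pi> i = \<pi>' i" if "i < L" for i using pow[OF p(1) that] pow[OF p(2) that] e(3) by simp
    moreover have "\<pi> i = \<pi>' i" if "\<not> i < L" for i using p that unfolding permutes_def by simp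
    ultimately have pp: "\<pi> = \<pi>'" by blast
    have "\<beta> x = \<beta>' x" for x
    proof -
      have "(\<pi> \<circ> \<beta> \<circ> inv_into UNIV \<pi>) (\<pi> x) = (\<pi> \<circ> \<beta>' \<circ> inv_into UNIV \<pi>) (\<pi> x)" using e(1) unfolding pp by simp
      then have "\<pi> (\<beta> x) = \<pi> (\<beta>' x)" using permutes_inverses(2)[OF p(1)] by simp
      then show ?thesis using permutes_inj[OF p(1)] by (auto dest: injD)
    qed
    then show "a = b" unfolding ab bb' pp by auto
  next
    fix y assume "y \<in> F ` ?X"
    then obtain \<pi> \<beta> where h: "\<pi> permutes ?D" "\<beta> \<in> involutions ?D r" "\<beta> \<circ> ?c \<in> cube_roots ?D k"
      and y: "y = ((\<pi> \<circ> \<beta> \<circ> inv_into UNIV \<pi>, \<pi> \<circ> (\<beta> \<circ> ?c) \<circ> inv_into UNIV \<pi>), \<pi> 0)"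
      unfolding F_def rooted_def by auto
    have "\<pi> 0 \<in> ?D" using L permutes_in_image[OF h(1), of 0] by simp
    moreover have "single_cycle ((\<pi> \<circ> \<beta> \<circ> inv_into UNIV \<pi>) \<circ> (\<pi> \<circ> (\<beta> \<circ> ?c) \<circ> inv_into UNIV \<pi>)) ?D"
      unfolding comp[OF h(1,2)] by (rule conj_single_cycle[OF h(1) next_pos_single_cycle])
    ultimately show "y \<in> ?Y" unfolding y unicellular_def
      using conj_involutions[OF h(1,2)] conj_cube_roots[OF h(1,3)] by simp
  next
    fix y assume "y \<in> ?Y"
    then obtain \<beta>' \<theta>' d where h: "\<beta>' \<in> involutions ?D r" "\<theta>' \<in> cube_roots ?D k"
      "single_cycle (\<beta>' \<circ> \<theta>') ?D" and d: "d < L" and y: "y = ((\<beta>', \<theta>'), d)"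
      unfolding unicellular_def by auto
    let ?c' = "\<beta>' \<circ> \<theta>'"
    have bij: "bij_betw (\<lambda>i. (?c' ^^ i) d) {..<L} ?D" and per: "(?c' ^^ L) d = d"
      using single_cycle_positions[OF h(3), of d] d by auto
    define \<pi> where "\<pi> i = (if i < L then (?c' ^^ i) d else i)" for i
    have pp: "\<pi> permutes ?D"
    proof (rule bij_imp_permutes)
      show "bij_betw \<pi> ?D ?D"
        using bij by (rule iffD1[OF bij_betw_cong, rotated]) (simp add: \<pi>_def)
    qed (simp add: \<pi>_def)
    have c'out: "?c' i = i" if "\<not> i < L" for i
      using h(3) that unfolding single_cycle_def permutes_def by blast
    have pc: "\<pi> (?c i) = ?c' (\<pi> i)" for i
    proof (cases "Suc i < L")
      case True then show ?thesis by (simp add: \<pi>_def next_pos_def)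
    next
      case False
      show ?thesis
      proof (cases "i < L")
        case True
        then have "L = Suc i" using False by simp
        then show ?thesis using per L by (simp add: \<pi>_def next_pos_def)
      next
        case F: False
        then show ?thesis using c'out[OF F] by (simp add: \<pi>_def next_pos_def)
      qed
    qed
    note pin = permutes_inverses[OF pp]
    define \<beta> where "\<beta> = inv_into UNIV \<pi> \<circ> \<beta>' \<circ> \<pi>"
    have ii: "inv_into UNIV (inv_into UNIV \<pi>) = \<pi>" using permutes_inv_inv[OF pp] .
    have b: "\<beta> \<in> involutions ?D r" using conj_involutions[OF permutes_inv[OF pp] h(1)] unfolding \<beta>_def ii .
    have bc: "\<beta> \<circ> ?c = inv_into UNIV \<pi> \<circ> \<theta>' \<circ> \<pi>"
      unfolding \<beta>_def using pc bb[OF h(1)] by (simp add: fun_eq_iff)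
    have t: "\<beta> \<circ> ?c \<in> cube_roots ?D k"
      using conj_cube_roots[OF permutes_inv[OF pp] h(2)] unfolding bc ii .
    have "F (\<pi>, \<beta>) = y"
      unfolding F_def y using pin bc L by (simp add: \<beta>_def fun_eq_iff \<pi>_def)
    moreover have "(\<pi>, \<beta>) \<in> ?X" using pp b t unfolding rooted_def by simp
    ultimately show "y \<in> F ` ?X" by force
  qed
  then have "card ?X = card ?Y" by (rule bij_betw_same_card)
  then show ?thesis by (simp add: card_cartesian_product card_permutations mult.commute)
qed

section \<open>Voltages\<close>

text \<open>The total over the half-edges at the vertex of \<open>x\<close>; a vertex of degree 1
  must not be counted three times.\<close>

definition vsum :: "(nat \<Rightarrow> nat) \<Rightarrow> (nat \<Rightarrow> int) \<Rightarrow> nat \<Rightarrow> int" where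
  "vsum \<theta> g x = (if \<theta> x = x then g x else g x + g (\<theta> x) + g (\<theta> (\<theta> x)))"

definition rep :: "(nat \<Rightarrow> nat) \<Rightarrow> nat \<Rightarrow> nat" where
  "rep \<theta> x = Min {x, \<theta> x, \<theta> (\<theta> x)}"

text \<open>\<open>h\<close> is the voltage of a half-edge without partner. Such a half-edge is its
  own reverse, so antisymmetry modulo \<open>d\<close> amounts to
  \<open>d dvd 2 * h\<close>.\<close>

locale voltage_graph =
  fixes D :: "nat set" and \<beta> \<theta> :: "nat \<Rightarrow> nat" and r k d h :: nat
  assumes fin: "finite D" and ne: "D \<noteq> {}" and bin: "\<beta> \<in> involutions D r" and tin: "\<theta> \<in> cube_roots D k"
    and sc: "single_cycle (\<beta> \<circ> \<theta>) D" and d: "d > 0" and hd: "h < d" and h2: "d dvd 2 * h"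
begin

lemma b: "\<beta> permutes D" "\<beta> (\<beta> x) = x" "card {x \<in> D. \<beta> x = x} = r"
  using bin unfolding involutions_def by auto

lemma t: "\<theta> permutes D" "\<theta> (\<theta> (\<theta> x)) = x" "card {x \<in> D. \<theta> x = x} = k"
  using tin unfolding cube_roots_def by auto

lemma bD: "\<beta> x \<in> D \<longleftrightarrow> x \<in> D" and tD: "\<theta> x \<in> D \<longleftrightarrow> x \<in> D"
  using b(1) t(1) by (simp_all add: permutes_in_image)

lemma tfix: "\<theta> (\<theta> x) = \<theta> x \<longleftrightarrow> \<theta> x = x"
  using t(2) by metis

lemma rep_theta: "rep \<theta> (\<theta> x) = rep \<theta> x"
proof -
  have "{\<theta> x, \<theta> (\<theta> x), \<theta> (\<theta> (\<theta> x))} = {x, \<theta> x, \<theta> (\<theta> x)}" unfolding t(2) by blast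
  then show ?thesis unfolding rep_def by (simp only:)
qed

lemma rep_cases: "rep \<theta> x = x \<or> rep \<theta> x = \<theta> x \<or> rep \<theta> x = \<theta> (\<theta> x)"
proof -
  have "rep \<theta> x \<in> {x, \<theta> x, \<theta> (\<theta> x)}" unfolding rep_def by (rule Min_in) auto
  then show ?thesis by blast
qed

lemma rep_eq_iff: "rep \<theta> x = rep \<theta> y \<longleftrightarrow> y = x \<or> y = \<theta> x \<or> y = \<theta> (\<theta> x)"
proof
  assume eq: "rep \<theta> x = rep \<theta> y"
  have "y = rep \<theta> y \<or> y = \<theta> (rep \<theta> y) \<or> y = \<theta> (\<theta> (rep \<theta> y))"
    using rep_cases[of y] t(2)[of y] by metis
  moreover have "\<theta> (rep \<theta> x) = x \<or> \<theta> (rep \<theta> x) = \<theta> x \<or> \<theta> (rep \<theta> x) = \<theta> (\<theta> x)"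
    using rep_cases[of x] t(2)[of x] by metis
  moreover have "\<theta> (\<theta> (rep \<theta> x)) = x \<or> \<theta> (\<theta> (rep \<theta> x)) = \<theta> x \<or> \<theta> (\<theta> (rep \<theta> x)) = \<theta> (\<theta> x)"
    using rep_cases[of x] t(2)[of x] by metis
  ultimately show "y = x \<or> y = \<theta> x \<or> y = \<theta> (\<theta> x)" using rep_cases[of x] eq by metis
next
  assume "y = x \<or> y = \<theta> x \<or> y = \<theta> (\<theta> x)"
  then show "rep \<theta> x = rep \<theta> y" using rep_theta by metis
qed

lemma rep_idem: "rep \<theta> (rep \<theta> x) = rep \<theta> x"
  using rep_cases[of x] rep_theta by metis

lemma rep_in: "x \<in> D \<Longrightarrow> rep \<theta> x \<in> D"
  using rep_cases[of x] tD by metis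

lemma vsum_theta: "vsum \<theta> g (\<theta> x) = vsum \<theta> g x"
  unfolding vsum_def tfix t(2) by auto

lemma vsum_rep: "vsum \<theta> g (rep \<theta> x) = vsum \<theta> g x"
  using rep_cases[of x] vsum_theta by metis

lemma vsum_add: "vsum \<theta> (\<lambda>x. f x + g x) x = vsum \<theta> f x + vsum \<theta> g x"
  unfolding vsum_def by auto

lemma vsum_scale: "vsum \<theta> (\<lambda>x. a * f x) x = a * vsum \<theta> f x"
  unfolding vsum_def by (auto simp: algebra_simps)

lemma vsum_sum: "vsum \<theta> (\<lambda>x. \<Sum>i\<in>I. f i x) x = (\<Sum>i\<in>I. vsum \<theta> (f i) x)"
  unfolding vsum_def by (auto simp: sum.distrib)

lemma vsum_cong: "(\<And>x. x \<in> D \<Longrightarrow> f x = g x) \<Longrightarrow> x \<in> D \<Longrightarrow> vsum \<theta> f x = vsum \<theta> g x"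
  unfolding vsum_def using tD by auto

lemma vsum_mod: "vsum \<theta> (\<lambda>x. f x mod m) x mod m = vsum \<theta> f x mod m"
proof -
  have "[f x mod m + f (\<theta> x) mod m + f (\<theta> (\<theta> x)) mod m = f x + f (\<theta> x) + f (\<theta> (\<theta> x))] (mod m)"
    by (intro cong_add cong_mod_left[THEN iffD2] cong_refl)
  then show ?thesis unfolding vsum_def cong_def by simp
qed

lemma orbit_set: "x \<in> D \<Longrightarrow> {y \<in> D. rep \<theta> y = rep \<theta> x} = {x, \<theta> x, \<theta> (\<theta> x)}"
  using rep_eq_iff[of x] tD by (auto simp: eq_commute)

lemma sum_orbit: "x \<in> D \<Longrightarrow> (\<Sum>y\<in>{y \<in> D. rep \<theta> y = rep \<theta> x}. g y) = vsum \<theta> g x"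
proof -
  assume "x \<in> D"
  note o = orbit_set[OF this]
  show ?thesis
  proof (cases "\<theta> x = x")
    case True then show ?thesis unfolding o vsum_def by simp
  next
    case False
    then have "\<theta> (\<theta> x) \<noteq> \<theta> x" "\<theta> (\<theta> x) \<noteq> x" using cube_root_orbit_distinct[of \<theta>, OF t(2)] by auto
    then show ?thesis using False unfolding o vsum_def by (simp add: eq_commute)
  qed
qed

lemma vsum_indicator:
  assumes "w \<in> D" "y \<in> D"
  shows "vsum \<theta> (\<lambda>u. if u = w then 1 else 0) y = (if rep \<theta> y = rep \<theta> w then 1 else 0)"
proof -
  have "vsum \<theta> (\<lambda>u. if u = w then 1 else 0) y = (\<Sum>u\<in>{u \<in> D. rep \<theta> u = rep \<theta> y}. if u = w then 1 else 0)"
    by (rule sum_orbit[symmetric, OF assms(2)])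
  also have "\<dots> = (if w \<in> {u \<in> D. rep \<theta> u = rep \<theta> y} then 1 else 0)"
    using fin by (subst sum.delta) auto
  finally show ?thesis using assms by auto
qed

lemma sum_vsum: "(\<Sum>x\<in>rep \<theta> ` D. vsum \<theta> g x) = (\<Sum>y\<in>D. g y)"
proof -
  have "(\<Sum>y\<in>D. g y) = (\<Sum>x\<in>rep \<theta> ` D. \<Sum>y\<in>{y \<in> D. rep \<theta> y = x}. g y)"
    by (rule sum.image_gen[OF fin])
  also have "\<dots> = (\<Sum>x\<in>rep \<theta> ` D. vsum \<theta> g x)"
  proof (rule sum.cong[OF refl])
    fix x assume "x \<in> rep \<theta> ` D"
    then obtain z where z: "z \<in> D" "x = rep \<theta> z" by blast
    then show "(\<Sum>y\<in>{y \<in> D. rep \<theta> y = x}. g y) = vsum \<theta> g x"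
      using sum_orbit[OF z(1), of g] vsum_rep[of g z] by simp
  qed
  finally show ?thesis ..
qed

text \<open>Half-edges counted by vertices: three at each, except for the \<open>k\<close> vertices
  with only one.\<close>

lemma card_vertices: "3 * card (rep \<theta> ` D) = card D + 2 * k"
proof -
  let ?Q = "rep \<theta> ` D"
  have finQ: "finite ?Q" using fin by simp
  have sub: "{x \<in> D. \<theta> x = x} \<subseteq> ?Q"
  proof
    fix x assume "x \<in> {x \<in> D. \<theta> x = x}"
    then have "x \<in> D" "rep \<theta> x = x" using rep_cases[of x] by auto
    then show "x \<in> ?Q" by force
  qed
  have QD: "?Q \<subseteq> D" using rep_in by blast
  have "int (card D) = (\<Sum>x\<in>?Q. vsum \<theta> (\<lambda>_. 1) x)" unfolding sum_vsum by simp
  also have "\<dots> = (\<Sum>x\<in>?Q. 3 - (if \<theta> x = x then 2 else 0))"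
    unfolding vsum_def by (intro sum.cong) auto
  also have "\<dots> = 3 * int (card ?Q) - 2 * int (card {x \<in> ?Q. \<theta> x = x})"
    using finQ by (simp add: sum_subtractf sum.If_cases Int_def)
  also have "{x \<in> ?Q. \<theta> x = x} = {x \<in> D. \<theta> x = x}" using sub QD by blast
  finally show ?thesis using t(3) by simp
qed

text \<open>The set of half-edges that such a flow can reach is closed under the face permutation, which has a
  single orbit.\<close>

lemma flow_exists:
  assumes x0: "x0 \<in> D" and x: "x \<in> D"
  shows "\<exists>g. (\<forall>y. g (\<beta> y) = - g y) \<and>
    (\<forall>y\<in>D. vsum \<theta> g y = (if rep \<theta> y = rep \<theta> x then 1 else 0) - (if rep \<theta> y = rep \<theta> x0 then 1 else 0))"
proof -
  define S where "S = {x \<in> D. \<exists>g. (\<forall>y. g (\<beta> y) = - g y) \<and>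
    (\<forall>y\<in>D. vsum \<theta> g y = (if rep \<theta> y = rep \<theta> x then 1 else 0) - (if rep \<theta> y = rep \<theta> x0 then 1 else 0))}"
  have "x0 \<in> S" unfolding S_def using x0 by (auto intro!: exI[of _ "\<lambda>_. 0"] simp: vsum_def)
  moreover have "(\<beta> \<circ> \<theta>) ` S \<subseteq> S"
  proof
    fix v assume "v \<in> (\<beta> \<circ> \<theta>) ` S"
    then obtain x where x: "x \<in> S" "v = \<beta> (\<theta> x)" by auto
    then obtain g where xD: "x \<in> D" and g: "\<And>y. g (\<beta> y) = - g y"
      "\<And>y. y \<in> D \<Longrightarrow> vsum \<theta> g y = (if rep \<theta> y = rep \<theta> x then 1 else 0) - (if rep \<theta> y = rep \<theta> x0 then 1 else 0)"
      unfolding S_def by blast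
    define z where "z = \<theta> x"
    have zD: "z \<in> D" "\<beta> z \<in> D" using xD tD bD z_def by auto
    have rz: "rep \<theta> z = rep \<theta> x" unfolding z_def by (rule rep_theta)
    show "v \<in> S"
    \<comment> \<open>At a half-edge without partner the face turns back to the same vertex and the
      flow can stay as it is; otherwise one more unit is sent along the edge of
      \<open>z\<close>.\<close>
    proof (cases "\<beta> z = z")
      case True
      then have "v = z" using x z_def by simp
      moreover have "\<forall>y\<in>D. vsum \<theta> g y = (if rep \<theta> y = rep \<theta> z then 1 else 0) - (if rep \<theta> y = rep \<theta> x0 then 1 else 0)"
        unfolding rz by (intro ballI) (rule g(2))
      ultimately show ?thesis unfolding S_def using zD(1) g(1) by blast
    next
      case False
      define g' where "g' y = g y + ((if y = \<beta> z then 1 else 0) + (- 1) * (if y = z then 1 else 0))" for y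
      have "g' (\<beta> y) = - g' y" for y
      proof -
        have e: "\<beta> y = \<beta> z \<longleftrightarrow> y = z" "\<beta> y = z \<longleftrightarrow> y = \<beta> z" by (metis b(2))+
        show ?thesis unfolding g'_def g(1) e by simp
      qed
      moreover have "vsum \<theta> g' y = (if rep \<theta> y = rep \<theta> (\<beta> z) then 1 else 0) - (if rep \<theta> y = rep \<theta> x0 then 1 else 0)"
        if "y \<in> D" for y
        unfolding g'_def vsum_add vsum_scale vsum_indicator[OF zD(1) that] vsum_indicator[OF zD(2) that]
          g(2)[OF that] rz by auto
      ultimately show ?thesis unfolding S_def using zD x(2) z_def by blast
    qed
  qed
  ultimately have "S = D" using single_cycleD[OF sc, of S] unfolding S_def by blast
  then show ?thesis using x unfolding S_def by blast
qed

definition antisym_voltages :: "(nat \<Rightarrow> nat) set" where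
  "antisym_voltages = {v \<in> D \<rightarrow>\<^sub>E {..<d}. (\<forall>x\<in>D. d dvd v x + v (\<beta> x)) \<and> (\<forall>x\<in>D. \<beta> x = x \<longrightarrow> v x = h)}"

lemma card_half: "2 * card {x \<in> D. x < \<beta> x} + r = card D"
proof -
  let ?A = "{x \<in> D. x < \<beta> x}" and ?B = "{x \<in> D. \<beta> x < x}" and ?C = "{x \<in> D. \<beta> x = x}"
  have "bij_betw \<beta> ?A ?B"
    by (rule bij_betw_byWitness[where f' = \<beta>]) (use b(2) bD in auto)
  then have "card ?A = card ?B" by (rule bij_betw_same_card)
  moreover have "card D = card (?A \<union> (?B \<union> ?C))" by (rule arg_cong[where f = card]) auto
  moreover have "card (?A \<union> (?B \<union> ?C)) = card ?A + card (?B \<union> ?C)"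
    using fin by (intro card_Un_disjoint) auto
  moreover have "card (?B \<union> ?C) = card ?B + card ?C"
    using fin by (intro card_Un_disjoint) auto
  ultimately show ?thesis using b(3) by linarith
qed

text \<open>Each edge carries one free value, stored at its smaller half-edge. The larger one holds
  the negative modulo \<open>d\<close>, and half-edges without partner hold
  \<open>h\<close>.\<close>

lemma card_antisym_voltages: "card antisym_voltages = d ^ card {x \<in> D. x < \<beta> x}"
proof -
  let ?A = "{x \<in> D. x < \<beta> x}"
  define ext where "ext J x = (if x \<in> D then if x < \<beta> x then J x else if \<beta> x = x then h
      else (d - J (\<beta> x)) mod d else undefined)" for J :: "nat \<Rightarrow> nat" and x
  have "bij_betw (\<lambda>v. restrict v ?A) antisym_voltages (?A \<rightarrow>\<^sub>E {..<d})"
  proof (rule bij_betw_byWitness[where f' = ext])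
    show "\<forall>v\<in>antisym_voltages. ext (restrict v ?A) = v"
    proof
      fix v assume v: "v \<in> antisym_voltages"
      have vd: "v x < d" if "x \<in> D" for x using v that unfolding antisym_voltages_def by auto
      have va: "d dvd v x + v (\<beta> x)" if "x \<in> D" for x using v that unfolding antisym_voltages_def by auto
      have vh: "v x = h" if "x \<in> D" "\<beta> x = x" for x using v that unfolding antisym_voltages_def by auto
      have vu: "v x = undefined" if "x \<notin> D" for x using v that unfolding antisym_voltages_def by auto
      show "ext (restrict v ?A) = v"
      proof
        fix x
        show "ext (restrict v ?A) x = v x"
        proof (cases "x \<in> D \<and> \<beta> x < x")
          case True
          then have m: "\<beta> x \<in> ?A" using bD b(2) by simp
          have "(d - v (\<beta> x)) mod d = v x"
          proof -
            obtain q where q: "v x + v (\<beta> x) = d * q" using va True by (auto elim: dvdE)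
            have "v x < d" "v (\<beta> x) < d" using vd True bD by auto
            then have "d * q < d * 2" using q by linarith
            then have "q < 2" by simp
            then have "q = 0 \<or> q = 1" by linarith
            then show ?thesis
            proof
              assume "q = 0" then show ?thesis using q by simp
            next
              assume "q = 1"
              then have "d - v (\<beta> x) = v x" using q \<open>v (\<beta> x) < d\<close> by simp
              then show ?thesis using \<open>v x < d\<close> by simp
            qed
          qed
          then show ?thesis using True m unfolding ext_def by simp
        next
          case False
          then show ?thesis unfolding ext_def using vh vu by auto
        qed
      qed
    qed
    show "\<forall>J\<in>?A \<rightarrow>\<^sub>E {..<d}. restrict (ext J) ?A = J"
    proof
      fix J :: "nat \<Rightarrow> nat" assume J: "J \<in> ?A \<rightarrow>\<^sub>E {..<d}"
      show "restrict (ext J) ?A = J"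
      proof
        fix x show "restrict (ext J) ?A x = J x"
          using J PiE_arb[OF J, of x] unfolding ext_def by auto
      qed
    qed
    show "(\<lambda>v. restrict v ?A) ` antisym_voltages \<subseteq> ?A \<rightarrow>\<^sub>E {..<d}"
    proof
      fix J assume "J \<in> (\<lambda>v. restrict v ?A) ` antisym_voltages"
      then obtain v where v: "v \<in> D \<rightarrow>\<^sub>E {..<d}" and J: "J = restrict v ?A" unfolding antisym_voltages_def by blast
      have "v x \<in> {..<d}" if "x \<in> ?A" for x using v that by blast
      then show "J \<in> ?A \<rightarrow>\<^sub>E {..<d}" unfolding J by (rule restrict_PiE_iff[THEN iffD2, OF ballI])
    qed
    show "ext ` (?A \<rightarrow>\<^sub>E {..<d}) \<subseteq> antisym_voltages"
    proof
      fix v assume "v \<in> ext ` (?A \<rightarrow>\<^sub>E {..<d})"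
      then obtain J where J: "J \<in> ?A \<rightarrow>\<^sub>E {..<d}" and v: "v = ext J" by blast
      have Jd: "J x < d" if "x \<in> D" "x < \<beta> x" for x using J that by auto
      have key: "d dvd J x + (d - J x) mod d" if "x \<in> D" "x < \<beta> x" for x
      proof -
        have "(J x + (d - J x) mod d) mod d = (J x + (d - J x)) mod d" by (simp add: mod_add_right_eq)
        then show ?thesis using Jd[OF that] by (simp add: dvd_eq_mod_eq_0)
      qed
      have "v \<in> D \<rightarrow>\<^sub>E {..<d}"
        unfolding v ext_def using Jd d hd by (auto simp: PiE_iff extensional_def)
      moreover have "d dvd v x + v (\<beta> x)" if x: "x \<in> D" for x
      proof -
        consider "x < \<beta> x" | "\<beta> x = x" | "\<beta> x < x" by linarith
        then show ?thesis
        proof cases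
          case 1
          then have "v x = J x" "v (\<beta> x) = (d - J x) mod d" using x bD b(2) unfolding v ext_def by auto
          then show ?thesis using key[OF x 1] by simp
        next
          case 2
          then have "v x = h" using x unfolding v ext_def by simp
          then show ?thesis using 2 h2 by (simp add: mult_2)
        next
          case 3
          then have bx: "\<beta> x \<in> D" "\<beta> x < \<beta> (\<beta> x)" using x bD b(2) by auto
          have "v (\<beta> x) = J (\<beta> x)" "v x = (d - J (\<beta> x)) mod d" using 3 x bD b(2) unfolding v ext_def by auto
          then show ?thesis using key[OF bx] by (simp add: add.commute)
        qed
      qed
      moreover have "v x = h" if "x \<in> D" "\<beta> x = x" for x using that unfolding v ext_def by simp
      ultimately show "v \<in> antisym_voltages" unfolding antisym_voltages_def by blast
    qed
  qed
  then have "card antisym_voltages = card (?A \<rightarrow>\<^sub>E {..<d})" by (rule bij_betw_same_card)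
  then show ?thesis using fin by (simp add: card_PiE)
qed

text \<open>The two halves of an edge cancel modulo \<open>d\<close>; what remains is
  \<open>h\<close> for each half-edge without partner.\<close>

lemma sum_antisym: 
  assumes "v \<in> antisym_voltages"
  shows "[(\<Sum>x\<in>D. int (v x)) = int (r * h)] (mod int d)"
proof -
  let ?A = "{x \<in> D. x < \<beta> x}" and ?B = "{x \<in> D. \<beta> x < x}" and ?C = "{x \<in> D. \<beta> x = x}"
  have va: "d dvd v x + v (\<beta> x)" if "x \<in> D" for x using assms that unfolding antisym_voltages_def by auto
  have vh: "v x = h" if "x \<in> D" "\<beta> x = x" for x using assms that unfolding antisym_voltages_def by auto
  have D: "D = ?A \<union> (?B \<union> ?C)" by auto
  have bij: "bij_betw \<beta> ?A ?B"
    by (rule bij_betw_byWitness[where f' = \<beta>]) (use b(2) bD in auto)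
  have "(\<Sum>x\<in>?A \<union> (?B \<union> ?C). int (v x)) = (\<Sum>x\<in>?A. int (v x)) + ((\<Sum>x\<in>?B. int (v x)) + (\<Sum>x\<in>?C. int (v x)))"
    using fin by (subst sum.union_disjoint; (subst sum.union_disjoint)?) auto
  also have "(\<Sum>x\<in>?B. int (v x)) = (\<Sum>x\<in>?A. int (v (\<beta> x)))"
    by (rule sum.reindex_bij_betw[OF bij, symmetric])
  also have "(\<Sum>x\<in>?C. int (v x)) = int (r * h)" using vh b(3) by simp
  finally have "(\<Sum>x\<in>D. int (v x)) = (\<Sum>x\<in>?A. int (v x + v (\<beta> x))) + int (r * h)"
    unfolding D[symmetric] by (simp add: sum.distrib)
  moreover have "int d dvd (\<Sum>x\<in>?A. int (v x + v (\<beta> x)))"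
    by (rule dvd_sum) (use va in \<open>auto simp del: of_nat_add\<close>)
  ultimately show ?thesis by (simp add: cong_iff_dvd_diff)
qed

definition solutions :: "(nat \<Rightarrow> int) \<Rightarrow> (nat \<Rightarrow> nat) set" where
  "solutions g = {v \<in> antisym_voltages. \<forall>x\<in>D. [vsum \<theta> (\<lambda>y. int (v y)) x = vsum \<theta> g x] (mod int d)}"

text \<open>Adding up all vertex equations yields the total voltage, whose residue
  \<open>sum_antisym\<close> determines.\<close>

lemma solutions_empty:
  assumes "\<not> [(\<Sum>x\<in>D. g x) = int (r * h)] (mod int d)"
  shows "solutions g = {}"
proof (rule ccontr)
  assume "solutions g \<noteq> {}"
  then obtain v where v: "v \<in> antisym_voltages" "\<And>x. x \<in> D \<Longrightarrow> [vsum \<theta> (\<lambda>y. int (v y)) x = vsum \<theta> g x] (mod int d)"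
    unfolding solutions_def by blast
  have "[(\<Sum>x\<in>rep \<theta> ` D. vsum \<theta> (\<lambda>y. int (v y)) x) = (\<Sum>x\<in>rep \<theta> ` D. vsum \<theta> g x)] (mod int d)"
    by (rule cong_sum) (use v(2) rep_in in auto)
  then have "[(\<Sum>x\<in>D. int (v x)) = (\<Sum>x\<in>D. g x)] (mod int d)" unfolding sum_vsum .
  then show False using assms sum_antisym[OF v(1)] by (meson cong_sym cong_trans)
qed

text \<open>The vertex sums are prescribed everywhere except at the vertex of \<open>x0\<close>.
  Unit flows from \<open>x0\<close> change any one of them at will, so all prescriptions are met by
  equally many voltages: \<open>d\<close> to the number of edges minus the number of vertices plus
  1. Euler's formula makes this exponent \<open>2 * f\<close>, and the equation at \<open>x0\<close>
  follows from the total.\<close>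

lemma card_solutions:
  assumes g: "[(\<Sum>x\<in>D. g x) = int (r * h)] (mod int d)" and f: "card D + 6 = 4 * k + 3 * r + 12 * f"
  shows "card (solutions g) = d ^ (2 * f)"
proof -
  let ?Q = "rep \<theta> ` D"
  obtain x0 where x0: "x0 \<in> D" using ne by blast
  define R where "R = ?Q - {rep \<theta> x0}"
  have finR: "finite R" unfolding R_def using fin by simp
  have QD: "x \<in> ?Q \<Longrightarrow> x \<in> D" "x \<in> ?Q \<Longrightarrow> rep \<theta> x = x" for x using rep_in rep_idem by auto
  have RD: "x \<in> D" "rep \<theta> x = x" "x \<noteq> rep \<theta> x0" if "x \<in> R" for x
  proof -
    have "x \<in> ?Q" "x \<noteq> rep \<theta> x0" using that unfolding R_def by blast+
    then show "x \<in> D" "rep \<theta> x = x" "x \<noteq> rep \<theta> x0" using QD by blast+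
  qed
  have cR: "card R + 1 = card ?Q"
  proof -
    have "rep \<theta> x0 \<in> ?Q" using x0 by blast
    then show ?thesis unfolding R_def using card_Suc_Diff1[of ?Q "rep \<theta> x0"] fin by simp
  qed
  define W where "W v x = nat (vsum \<theta> (\<lambda>y. int (v y)) x mod int d)" for v x
  define Fib where "Fib J = {v \<in> antisym_voltages. restrict (W v) R = J}" for J
  have finU: "finite antisym_voltages"
    by (rule finite_subset[OF _ finite_PiE[OF fin, of "\<lambda>_. {..<d}"]]) (auto simp: antisym_voltages_def)
  \<comment> \<open>Translation by the flow \<open>G\<close> shifts the vertex sums from
    \<open>J\<close> to \<open>J'\<close>. Being antisymmetric, \<open>G\<close> vanishes on
    half-edges without partner, so the value \<open>h\<close> there survives.\<close>
  have le: "card (Fib J) \<le> card (Fib J')" if J: "J \<in> R \<rightarrow>\<^sub>E {..<d}" and J': "J' \<in> R \<rightarrow>\<^sub>E {..<d}" for J J'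
  proof -
    have "\<forall>x\<in>R. \<exists>g. (\<forall>y. g (\<beta> y) = - g y) \<and>
      (\<forall>y\<in>D. vsum \<theta> g y = (if rep \<theta> y = rep \<theta> x then 1 else 0) - (if rep \<theta> y = rep \<theta> x0 then 1 else 0))"
      using flow_exists[OF x0 RD(1)] by blast
    then obtain fl where fl: "\<And>x y. x \<in> R \<Longrightarrow> fl x (\<beta> y) = - fl x y"
      "\<And>x y. x \<in> R \<Longrightarrow> y \<in> D \<Longrightarrow> vsum \<theta> (fl x) y = (if rep \<theta> y = rep \<theta> x then 1 else 0) - (if rep \<theta> y = rep \<theta> x0 then 1 else 0)"
      by metis
    define G where "G = (\<lambda>y. \<Sum>x\<in>R. (int (J' x) - int (J x)) * fl x y)"
    have Gb: "G (\<beta> y) = - G y" for y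
      unfolding G_def sum_negf[symmetric] by (rule sum.cong) (simp_all add: fl(1))
    have GR: "vsum \<theta> G z = int (J' z) - int (J z)" if z: "z \<in> R" for z
    proof -
      have zD: "z \<in> D" "rep \<theta> z = z" "z \<noteq> rep \<theta> x0" using RD[OF z] by blast+
      have "vsum \<theta> G z = (\<Sum>x\<in>R. (int (J' x) - int (J x)) * vsum \<theta> (fl x) z)"
        unfolding G_def by (simp only: vsum_sum vsum_scale)
      also have "\<dots> = (\<Sum>x\<in>R. if x = z then int (J' x) - int (J x) else 0)"
      proof (rule sum.cong[OF refl])
        fix x assume x: "x \<in> R"
        show "(int (J' x) - int (J x)) * vsum \<theta> (fl x) z = (if x = z then int (J' x) - int (J x) else 0)"
          unfolding fl(2)[OF x zD(1)] RD(2)[OF x] zD(2) using zD(3) by simp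
      qed
      also have "\<dots> = int (J' z) - int (J z)" using finR z by simp
      finally show ?thesis .
    qed
    define T where "T v = (\<lambda>x\<in>D. nat ((int (v x) + G x) mod int d))" for v :: "nat \<Rightarrow> nat"
    have Ti: "int (T v x) = (int (v x) + G x) mod int d" if "x \<in> D" for v x
      unfolding T_def using that d by simp
    have "inj_on T (Fib J)"
    proof (rule inj_onI)
      fix v v' assume v: "v \<in> Fib J" "v' \<in> Fib J" and eq: "T v = T v'"
      have P: "v \<in> D \<rightarrow>\<^sub>E {..<d}" "v' \<in> D \<rightarrow>\<^sub>E {..<d}" using v unfolding Fib_def antisym_voltages_def by auto
      show "v = v'"
      proof (rule PiE_ext[OF P])
        fix x assume x: "x \<in> D"
        have "(int (v x) + G x) mod int d = (int (v' x) + G x) mod int d" using eq Ti[OF x, of v] Ti[OF x, of v'] by simp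
        then have "[int (v x) = int (v' x)] (mod int d)" unfolding cong_def[symmetric] by (simp only: cong_add_rcancel)
        moreover have "v x < d" "v' x < d" using P x by auto
        ultimately show "v x = v' x" by (simp add: cong_def)
      qed
    qed
    moreover have "T ` Fib J \<subseteq> Fib J'"
    proof
      fix v' assume "v' \<in> T ` Fib J"
      then obtain v where v: "v \<in> antisym_voltages" "restrict (W v) R = J" and v': "v' = T v" unfolding Fib_def by blast
      have va: "int d dvd int (v x) + int (v (\<beta> x))" if "x \<in> D" for x
      proof -
        have "d dvd v x + v (\<beta> x)" using v(1) that unfolding antisym_voltages_def by blast
        then have "int d dvd int (v x + v (\<beta> x))" by (simp only: int_dvd_int_iff)
        then show ?thesis by simp
      qed
      have vh: "v x = h" if "x \<in> D" "\<beta> x = x" for x using v(1) that unfolding antisym_voltages_def by auto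
      have "v' \<in> D \<rightarrow>\<^sub>E {..<d}" unfolding v' T_def using d by (auto simp: nat_less_iff)
      moreover have "d dvd v' x + v' (\<beta> x)" if x: "x \<in> D" for x
      proof -
        have "int (v' x + v' (\<beta> x)) = (int (v x) + G x) mod int d + (int (v (\<beta> x)) - G x) mod int d"
          unfolding v' using Ti[OF x] Ti[of "\<beta> x"] bD x Gb[of x] by simp
        then have "int (v' x + v' (\<beta> x)) mod int d = ((int (v x) + G x) + (int (v (\<beta> x)) - G x)) mod int d"
          by (simp only: mod_add_eq)
        also have "\<dots> = (int (v x) + int (v (\<beta> x))) mod int d" by simp
        also have "\<dots> = 0" using va[OF x] by simp
        finally have "int d dvd int (v' x + v' (\<beta> x))" by presburger
        then show ?thesis by (simp only: int_dvd_int_iff)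
      qed
      moreover have "v' x = h" if x: "x \<in> D" "\<beta> x = x" for x
      proof -
        have "G x = 0" using Gb[of x] x(2) by simp
        then have "int (v' x) = int h" unfolding v' using Ti[OF x(1), of v] vh[OF x] hd by simp
        then show ?thesis by simp
      qed
      ultimately have "v' \<in> antisym_voltages" unfolding antisym_voltages_def by blast
      moreover have "restrict (W v') R = J'"
      proof (rule PiE_ext[of _ R "\<lambda>_. {..<d}"])
        show "J' \<in> R \<rightarrow>\<^sub>E {..<d}" by (rule J')
        show "restrict (W v') R \<in> R \<rightarrow>\<^sub>E {..<d}" unfolding W_def using d by (auto simp: nat_less_iff)
        fix z assume z: "z \<in> R"
        have zD: "z \<in> D" using RD[OF z] by blast
        have "vsum \<theta> (\<lambda>y. int (v' y)) z = vsum \<theta> (\<lambda>y. (int (v y) + G y) mod int d) z"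
          by (rule vsum_cong[OF _ zD]) (simp add: v' Ti)
        then have "vsum \<theta> (\<lambda>y. int (v' y)) z mod int d = (vsum \<theta> (\<lambda>y. int (v y)) z + vsum \<theta> G z) mod int d"
          by (simp add: vsum_mod vsum_add)
        also have "\<dots> = (vsum \<theta> (\<lambda>y. int (v y)) z mod int d + (int (J' z) - int (J z))) mod int d"
          unfolding GR[OF z] by (simp add: mod_simps)
        also have "vsum \<theta> (\<lambda>y. int (v y)) z mod int d = int (J z)"
        proof -
          have "W v z = J z" using z unfolding v(2)[symmetric] by simp
          then have "int (W v z) = int (J z)" by simp
          then show ?thesis unfolding W_def using d by simp
        qed
        also have "(int (J z) + (int (J' z) - int (J z))) mod int d = int (J' z)"
        proof -
          have "J' z < d" using PiE_mem[OF J' z] by simp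
          then show ?thesis by simp
        qed
        finally show "restrict (W v') R z = J' z" using z unfolding W_def by simp
      qed
      ultimately show "v' \<in> Fib J'" unfolding Fib_def by blast
    qed
    ultimately show ?thesis
      by (rule card_inj_on_le) (use finU in \<open>auto simp: Fib_def\<close>)
  qed
  define J0 where "J0 = (\<lambda>x\<in>R. nat (vsum \<theta> g x mod int d))"
  have J0: "J0 \<in> R \<rightarrow>\<^sub>E {..<d}" unfolding J0_def using d by (auto simp: nat_less_iff)
  have eq: "card (Fib J) = card (Fib J0)" if "J \<in> R \<rightarrow>\<^sub>E {..<d}" for J
    using le[OF that J0] le[OF J0 that] by simp
  have "card antisym_voltages = (\<Sum>J\<in>R \<rightarrow>\<^sub>E {..<d}. card (Fib J))"
  proof -
    have "antisym_voltages = (\<Union>J\<in>R \<rightarrow>\<^sub>E {..<d}. Fib J)"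
      unfolding Fib_def W_def using d by (auto simp: nat_less_iff)
    then show ?thesis
      using finU finR by (simp only:) (subst card_UN_disjoint, auto simp: Fib_def finite_PiE)
  qed
  also have "\<dots> = d ^ card R * card (Fib J0)"
    using eq finR by (simp add: card_PiE)
  finally have "d ^ card {x \<in> D. x < \<beta> x} = d ^ card R * card (Fib J0)"
    unfolding card_antisym_voltages .
  \<comment> \<open>The graph of a one-face map of genus \<open>f\<close> has \<open>2 * f\<close>
    independent cycles.\<close>
  moreover have "card {x \<in> D. x < \<beta> x} = card R + 2 * f"
  proof -
    have "2 * e + r = n \<Longrightarrow> 3 * q = n + 2 * k \<Longrightarrow> m + 1 = q \<Longrightarrow> n + 6 = 4 * k + 3 * r + 12 * f \<Longrightarrow> e = m + 2 * f"
      for e n q m :: nat by simp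
    from this[OF card_half card_vertices cR f] show ?thesis .
  qed
  ultimately have "card (Fib J0) = d ^ (2 * f)" using d by (simp add: power_add)
  moreover have "solutions g = Fib J0"
  proof (intro equalityI subsetI)
    fix v assume v: "v \<in> solutions g"
    have "restrict (W v) R = J0"
    proof
      fix x
      have "W v x = nat (vsum \<theta> g x mod int d)" if "x \<in> R"
      proof -
        have "x \<in> D" using RD[OF that] by blast
        then show ?thesis using v unfolding solutions_def W_def cong_def by simp
      qed
      then show "restrict (W v) R x = J0 x" unfolding J0_def by simp
    qed
    then show "v \<in> Fib J0" using v unfolding Fib_def solutions_def by simp
  next
    fix v assume v: "v \<in> Fib J0"
    have vU: "v \<in> antisym_voltages" using v unfolding Fib_def by blast
    have onR: "[vsum \<theta> (\<lambda>y. int (v y)) x = vsum \<theta> g x] (mod int d)" if "x \<in> R" for x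
    proof -
      have "restrict (W v) R = J0" using v unfolding Fib_def by blast
      then have "W v x = J0 x" using that by (auto dest!: fun_cong[of _ _ x])
      then have "nat (vsum \<theta> (\<lambda>y. int (v y)) x mod int d) = nat (vsum \<theta> g x mod int d)"
        using that unfolding W_def J0_def by simp
      then show ?thesis using d unfolding cong_def by (simp add: eq_nat_nat_iff)
    qed
    have Q: "?Q = insert (rep \<theta> x0) R" "rep \<theta> x0 \<notin> R" unfolding R_def using x0 by auto
    have "[(\<Sum>x\<in>?Q. vsum \<theta> (\<lambda>y. int (v y)) x) = (\<Sum>x\<in>?Q. vsum \<theta> g x)] (mod int d)"
      unfolding sum_vsum using sum_antisym[OF vU] g by (meson cong_sym cong_trans)
    moreover have "[(\<Sum>x\<in>R. vsum \<theta> (\<lambda>y. int (v y)) x) = (\<Sum>x\<in>R. vsum \<theta> g x)] (mod int d)"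
      by (rule cong_sum) (rule onR)
    \<comment> \<open>The totals agree, and so do the sums over all other vertices; the difference
      is the equation at \<open>x0\<close>.\<close>
    ultimately have at0: "[vsum \<theta> (\<lambda>y. int (v y)) (rep \<theta> x0) = vsum \<theta> g (rep \<theta> x0)] (mod int d)"
      unfolding Q(1) sum.insert[OF finR Q(2)] by (drule_tac cong_diff) auto
    have "[vsum \<theta> (\<lambda>y. int (v y)) x = vsum \<theta> g x] (mod int d)" if "x \<in> D" for x
    proof -
      have "rep \<theta> x \<in> ?Q" using that by blast
      then have "[vsum \<theta> (\<lambda>y. int (v y)) (rep \<theta> x) = vsum \<theta> g (rep \<theta> x)] (mod int d)"
        using at0 onR Q(1) by auto
      then show ?thesis unfolding vsum_rep .
    qed
    then show "v \<in> solutions g" unfolding solutions_def using vU by blast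
  qed
  ultimately show ?thesis by simp
qed

end

section \<open>Cyclic coverings\<close>

text \<open>Position \<open>a + L * b\<close> of the covering lies over \<open>a\<close> in sheet \<open>b\<close>.\<close>

definition tw :: "nat \<Rightarrow> nat \<Rightarrow> (nat \<Rightarrow> nat) \<Rightarrow> (nat \<Rightarrow> nat) \<Rightarrow> nat \<Rightarrow> nat" where
  "tw d L f w = (\<lambda>i. if i < d * L then f (i mod L) + L * ((w (i mod L) + i div L) mod d) else i)"

lemma enc_less: "a < L \<Longrightarrow> b < d \<Longrightarrow> a + L * b < d * (L :: nat)"
proof -
  assume ab: "a < L" "b < d"
  have "a + L * b < L + L * b" using ab by simp
  also have "\<dots> = L * Suc b" by simp
  also have "\<dots> \<le> L * d" using ab by (intro mult_le_mono2) simp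
  finally show ?thesis by (simp add: mult.commute)
qed

lemma enc_cases:
  assumes "i < d * (L :: nat)"
  obtains a b where "a < L" "b < d" "i = a + L * b"
proof
  have "L > 0" using assms by (cases L) auto
  then show "i mod L < L" by simp
  show "i div L < d" using assms by (simp add: less_mult_imp_div_less)
  show "i = i mod L + L * (i div L)" by simp
qed

lemma enc_eq_iff: "a < L \<Longrightarrow> a' < L \<Longrightarrow> a + L * b = a' + L * b' \<longleftrightarrow> a = a' \<and> b = (b' :: nat)"
proof
  assume h: "a < L" "a' < L" "a + L * b = a' + L * b'"
  have "(a + L * b) mod L = a" using h(1) by simp
  moreover have "(a' + L * b') mod L = a'" using h(2) by simp
  ultimately have a: "a = a'" using h(3) by metis
  have "L * b = L * b'" using h(3) unfolding a by simp
  then show "a = a' \<and> b = b'" using a h(1) by simp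
qed simp

lemma tw_enc: "a < L \<Longrightarrow> b < d \<Longrightarrow> tw d L f w (a + L * b) = f a + L * ((w a + b) mod d)"
  unfolding tw_def using enc_less[of a L b d] by simp

lemma tw_out: "\<not> i < d * L \<Longrightarrow> tw d L f w i = i"
  unfolding tw_def by simp

lemma tw_comp:
  assumes "d > 0" "\<And>a. a < L \<Longrightarrow> g a < L"
  shows "tw d L f w (tw d L g z i) = tw d L (f \<circ> g) (\<lambda>a. z a + w (g a)) i"
proof (cases "i < d * L")
  case True
  then obtain a b where i: "a < L" "b < d" "i = a + L * b" by (rule enc_cases)
  have "tw d L f w (g a + L * ((z a + b) mod d)) = f (g a) + L * ((w (g a) + (z a + b) mod d) mod d)"
    by (rule tw_enc) (use assms i in auto)
  also have "(w (g a) + (z a + b) mod d) mod d = (z a + w (g a) + b) mod d"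
    by (simp add: mod_add_right_eq ac_simps)
  finally show ?thesis unfolding i(3) tw_enc[OF i(1,2)] by simp
qed (simp add: tw_out)

lemma enc_shift:
  fixes a L d b m :: nat
  assumes "a < L" "d > 0"
  shows "(a + L * b + L * m) mod (d * L) = a + L * ((b + m) mod d)"
proof -
  define q where "q = b + m"
  have "(a + L * q) mod (L * d) = L * ((a + L * q) div L mod d) + (a + L * q) mod L"
    by (rule mod_mult2_eq)
  moreover have "(a + L * q) div L = q" "(a + L * q) mod L = a" using assms(1) by simp_all
  ultimately have "(a + L * q) mod (d * L) = a + L * (q mod d)" by (simp add: mult.commute)
  then show ?thesis unfolding q_def by (simp add: algebra_simps)
qed

text \<open>The rotation by \<open>L * m\<close> is the deck transformation that raises the sheet by
  \<open>m\<close>. This criterion makes symmetric edges and vertices of the covering visible as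
  fixed points in the quotient.\<close>

lemma tw_shift_iff:
  assumes "a < L" "b < d" "f a < L"
  shows "tw d L f w (a + L * b) = (a + L * b + L * m) mod (d * L) \<longleftrightarrow> f a = a \<and> w a mod d = m mod d"
proof -
  have "d > 0" using assms by simp
  have "(w a + b) mod d = (b + m) mod d \<longleftrightarrow> w a mod d = m mod d"
  proof -
    have "[w a + b = m + b] (mod d) \<longleftrightarrow> [w a = m] (mod d)" by (simp only: cong_add_rcancel_nat)
    then show ?thesis unfolding cong_def by (simp add: add.commute)
  qed
  then show ?thesis
    unfolding tw_enc[OF assms(1,2)] enc_shift[OF assms(1) \<open>d > 0\<close>] enc_eq_iff[OF assms(3,1)] by simp
qed

lemma tw_fix_iff:
  assumes "a < L" "b < d" "f a < L"
  shows "tw d L f w (a + L * b) = a + L * b \<longleftrightarrow> f a = a \<and> d dvd w a"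
  using tw_shift_iff[of a L b d f w 0, OF assms] enc_less[OF assms(1,2)] by (simp add: dvd_eq_mod_eq_0)

lemma tw_id_iff:
  assumes "d > 0" "\<And>a. a < L \<Longrightarrow> f a < L"
  shows "(\<forall>i. tw d L f w i = i) \<longleftrightarrow> (\<forall>a<L. f a = a \<and> d dvd w a)"
proof
  assume h: "\<forall>i. tw d L f w i = i"
  show "\<forall>a<L. f a = a \<and> d dvd w a"
  proof (intro allI impI)
    fix a assume a: "a < L"
    have "tw d L f w (a + L * 0) = a + L * 0" using h by blast
    then show "f a = a \<and> d dvd w a" unfolding tw_fix_iff[of a L 0 d f w, OF a assms(1) assms(2)[OF a]] .
  qed
next
  assume h: "\<forall>a<L. f a = a \<and> d dvd w a"
  show "\<forall>i. tw d L f w i = i"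
  proof
    fix i show "tw d L f w i = i"
    proof (cases "i < d * L")
      case True
      then obtain a b where i: "a < L" "b < d" "i = a + L * b" by (rule enc_cases)
      show ?thesis unfolding i(3) tw_fix_iff[of _ _ _ _ f, OF i(1,2) assms(2)[OF i(1)]] using h i(1) by blast
    qed (simp add: tw_out)
  qed
qed

lemma tw_nofix_iff:
  assumes "d > 0" "\<And>a. a < L \<Longrightarrow> f a < L"
  shows "(\<forall>i<d * L. tw d L f w i \<noteq> i) \<longleftrightarrow> (\<forall>a<L. f a = a \<longrightarrow> \<not> d dvd w a)"
proof
  assume h: "\<forall>i<d * L. tw d L f w i \<noteq> i"
  show "\<forall>a<L. f a = a \<longrightarrow> \<not> d dvd w a"
  proof (intro allI impI notI)
    fix a assume a: "a < L" "f a = a" "d dvd w a"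
    have "tw d L f w (a + L * 0) = a + L * 0"
      unfolding tw_fix_iff[of a L 0 d f w, OF a(1) assms(1) assms(2)[OF a(1)]] using a by blast
    moreover have "a + L * 0 < d * L" by (rule enc_less[OF a(1) assms(1)])
    ultimately show False using h by blast
  qed
next
  assume h: "\<forall>a<L. f a = a \<longrightarrow> \<not> d dvd w a"
  show "\<forall>i<d * L. tw d L f w i \<noteq> i"
  proof (intro allI impI)
    fix i assume "i < d * L"
    then obtain a b where i: "a < L" "b < d" "i = a + L * b" by (rule enc_cases)
    show "tw d L f w i \<noteq> i"
      unfolding i(3) tw_fix_iff[of _ _ _ _ f, OF i(1,2) assms(2)[OF i(1)]] using h i(1) by blast
  qed
qed

text \<open>The criterion does not involve the sheet, so all \<open>d\<close> points over a suitable
  \<open>a\<close> qualify.\<close>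

lemma card_tw_shift:
  assumes "d > 0" "\<And>a. a < L \<Longrightarrow> f a < L"
  shows "card {i. i < d * L \<and> tw d L f w i = (i + L * m) mod (d * L)}
    = d * card {a. a < L \<and> f a = a \<and> w a mod d = m mod d}"
proof -
  let ?A = "{a. a < L \<and> f a = a \<and> w a mod d = m mod d}"
  have "bij_betw (\<lambda>(a, b). a + L * b) (?A \<times> {..<d}) {i. i < d * L \<and> tw d L f w i = (i + L * m) mod (d * L)}"
    unfolding bij_betw_def
  proof (intro conjI equalityI subsetI)
    show "inj_on (\<lambda>(a, b). a + L * b) (?A \<times> {..<d})"
      by (rule inj_onI) (auto simp: enc_eq_iff)
  next
    fix i assume "i \<in> (\<lambda>(a, b). a + L * b) ` (?A \<times> {..<d})"
    then obtain a b where i: "a \<in> ?A" "b < d" "i = a + L * b" by auto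
    then have a: "a < L" by simp
    have "tw d L f w (a + L * b) = (a + L * b + L * m) mod (d * L)"
      unfolding tw_shift_iff[of _ _ _ _ f, OF a i(2) assms(2)[OF a]] using i(1) by simp
    then show "i \<in> {i. i < d * L \<and> tw d L f w i = (i + L * m) mod (d * L)}"
      unfolding i(3) using enc_less[OF a i(2)] by blast
  next
    fix i assume "i \<in> {i. i < d * L \<and> tw d L f w i = (i + L * m) mod (d * L)}"
    then have h: "i < d * L" "tw d L f w i = (i + L * m) mod (d * L)" by auto
    obtain a b where i: "a < L" "b < d" "i = a + L * b" using enc_cases[OF h(1)] .
    have "a \<in> ?A" using h(2) unfolding i(3) tw_shift_iff[of _ _ _ _ f, OF i(1,2) assms(2)[OF i(1)]] using i(1) by blast
    then show "i \<in> (\<lambda>(a, b). a + L * b) ` (?A \<times> {..<d})" using i by force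
  qed
  then have "card {i. i < d * L \<and> tw d L f w i = (i + L * m) mod (d * L)} = card (?A \<times> {..<d})"
    by (rule bij_betw_same_card[symmetric])
  then show ?thesis by (simp add: card_cartesian_product)
qed

lemma next_pos_less: "i < L \<Longrightarrow> next_pos L i < L"
  unfolding next_pos_def by auto

text \<open>The long face winds \<open>d\<close> times around the short one and changes the sheet
  only after the last position; this is the monodromy 1.\<close>

lemma next_pos_tw:
  assumes "d > 0" "L > 0"
  shows "next_pos (d * L) = tw d L (next_pos L) (\<lambda>a. if Suc a = L then 1 else 0)"
proof
  fix i
  show "next_pos (d * L) i = tw d L (next_pos L) (\<lambda>a. if Suc a = L then 1 else 0) i"
  proof (cases "i < d * L")
    case True
    then obtain a b where i: "a < L" "b < d" "i = a + L * b" by (rule enc_cases)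
    have n: "next_pos (d * L) i = Suc (a + L * b) mod (d * L)" using True i unfolding next_pos_def by simp
    show ?thesis
    proof (cases "Suc a = L")
      case True
      then have "Suc (a + L * b) = 0 + L * b + L * 1" by simp
      then have "Suc (a + L * b) mod (d * L) = 0 + L * ((b + 1) mod d)"
        using enc_shift[OF assms(2,1), of b 1] by metis
      then show ?thesis unfolding n unfolding i(3) tw_enc[OF i(1,2)] using True by (simp add: next_pos_def)
    next
      case False
      then have "Suc a < L" using i by simp
      then have "Suc a + L * b < d * L" using enc_less i by blast
      then show ?thesis unfolding n unfolding i(3) tw_enc[OF i(1,2)] using False i by (simp add: next_pos_def)
    qed
  qed (simp add: tw_out next_pos_def)
qed

section \<open>Symmetric maps as liftings of their quotients\<close>

lemma rooted00_iff:
  "\<alpha> \<in> rooted n 0 0 \<longleftrightarrow> (\<forall>i. \<not> i < n \<longrightarrow> \<alpha> i = i) \<and> (\<forall>i. \<alpha> (\<alpha> i) = i) \<and> (\<forall>i<n. \<alpha> i \<noteq> i) \<and>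
    (\<forall>i. (\<alpha> \<circ> next_pos n) ((\<alpha> \<circ> next_pos n) ((\<alpha> \<circ> next_pos n) i)) = i) \<and>
    (\<forall>i<n. (\<alpha> \<circ> next_pos n) i \<noteq> i)"
  (is "?l \<longleftrightarrow> ?r")
proof
  assume ?l
  then have h: "\<alpha> permutes {..<n}" "\<forall>x. \<alpha> (\<alpha> x) = x" "card {x \<in> {..<n}. \<alpha> x = x} = 0"
    "\<forall>i. (\<alpha> \<circ> next_pos n) ((\<alpha> \<circ> next_pos n) ((\<alpha> \<circ> next_pos n) i)) = i"
    "card {x \<in> {..<n}. (\<alpha> \<circ> next_pos n) x = x} = 0"
    unfolding rooted_def involutions_def cube_roots_def by auto
  have "{x \<in> {..<n}. \<alpha> x = x} = {}" "{x \<in> {..<n}. (\<alpha> \<circ> next_pos n) x = x} = {}" using h(3,5) by (simp_all only: card_eq_0_iff) auto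
  then have "\<forall>i<n. \<alpha> i \<noteq> i" "\<forall>i<n. (\<alpha> \<circ> next_pos n) i \<noteq> i" by blast+
  moreover have "\<forall>i. \<not> i < n \<longrightarrow> \<alpha> i = i" using h(1) unfolding permutes_def by simp
  ultimately show ?r using h(2,4) by blast
next
  assume r: ?r
  have p: "\<alpha> permutes {..<n}" by (rule permutes_of_involution) (use r in auto)
  have "{x \<in> {..<n}. \<alpha> x = x} = {}" "{x \<in> {..<n}. (\<alpha> \<circ> next_pos n) x = x} = {}" using r by blast+
  then have "card {x \<in> {..<n}. \<alpha> x = x} = 0" "card {x \<in> {..<n}. (\<alpha> \<circ> next_pos n) x = x} = 0" by (simp_all only: card.empty)
  then show ?l unfolding rooted_def involutions_def cube_roots_def
    using p permutes_compose[OF next_pos_permutes p] r by blast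
qed

text \<open>The summand 1 appears because going once around the boundary of the quotient face leads to the
  next sheet.\<close>

definition ucorner :: "nat \<Rightarrow> (nat \<Rightarrow> nat) \<Rightarrow> nat \<Rightarrow> nat" where
  "ucorner L v a = (if Suc a = L then 1 else 0) + v (next_pos L a)"

lemma tw_theta:
  assumes "d > 0" "L > 0" "\<And>a. a < L \<Longrightarrow> \<beta> a < L"
  shows "tw d L \<beta> v \<circ> next_pos (d * L) = tw d L (\<beta> \<circ> next_pos L) (ucorner L v)"
proof
  fix i
  show "(tw d L \<beta> v \<circ> next_pos (d * L)) i = tw d L (\<beta> \<circ> next_pos L) (ucorner L v) i"
  proof -
    have "tw d L \<beta> v (tw d L (next_pos L) (\<lambda>a. if Suc a = L then 1 else 0) i)
      = tw d L (\<beta> \<circ> next_pos L) (\<lambda>a. (if Suc a = L then 1 else 0) + v (next_pos L a)) i"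
      by (rule tw_comp[OF assms(1) next_pos_less])
    then show ?thesis unfolding next_pos_tw[OF assms(1,2)] comp_apply ucorner_def .
  qed
qed

text \<open>The voltages for which the lifted \<open>\<beta>\<close> is a fixed-point-free
  involution and every vertex upstairs has degree 3. Nothing may be fixed upstairs, so half-edges
  without partner and leaves need nonzero voltages.\<close>

definition volt :: "nat \<Rightarrow> nat \<Rightarrow> (nat \<Rightarrow> nat) \<Rightarrow> (nat \<Rightarrow> nat) set" where
  "volt d L \<beta> = {v \<in> {..<L} \<rightarrow>\<^sub>E {..<d}.
     (\<forall>a<L. d dvd v a + v (\<beta> a)) \<and> (\<forall>a<L. \<beta> a = a \<longrightarrow> \<not> d dvd v a) \<and>
     (\<forall>a<L. d dvd ucorner L v a + ucorner L v (\<beta> (next_pos L a))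
        + ucorner L v (\<beta> (next_pos L (\<beta> (next_pos L a))))) \<and>
     (\<forall>a<L. \<beta> (next_pos L a) = a \<longrightarrow> \<not> d dvd ucorner L v a)}"

lemma rooted_any_iff:
  "(\<exists>r k. \<beta> \<in> rooted L r k) \<longleftrightarrow> (\<forall>i. \<not> i < L \<longrightarrow> \<beta> i = i) \<and> (\<forall>i<L. \<beta> i < L \<and> \<beta> (\<beta> i) = i) \<and>
    (\<forall>i<L. (\<beta> \<circ> next_pos L) ((\<beta> \<circ> next_pos L) ((\<beta> \<circ> next_pos L) i)) = i)"
  (is "?l \<longleftrightarrow> ?r")
proof
  assume ?l
  then have h: "\<beta> permutes {..<L}" "\<forall>x. \<beta> (\<beta> x) = x"
    "\<forall>i. (\<beta> \<circ> next_pos L) ((\<beta> \<circ> next_pos L) ((\<beta> \<circ> next_pos L) i)) = i"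
    unfolding rooted_def involutions_def cube_roots_def by auto
  then show ?r using permutes_in_image[OF h(1)] unfolding permutes_def by auto
next
  assume r: ?r
  have inv: "\<beta> (\<beta> x) = x" for x using r by (cases "x < L") auto
  have p: "\<beta> permutes {..<L}" by (rule permutes_of_involution) (use r inv in auto)
  have out: "(\<beta> \<circ> next_pos L) i = i" if "\<not> i < L" for i using that r by (simp add: next_pos_def)
  have "(\<beta> \<circ> next_pos L) ((\<beta> \<circ> next_pos L) ((\<beta> \<circ> next_pos L) i)) = i" for i
    using r out[of i] by (cases "i < L") auto
  then show ?l unfolding rooted_def involutions_def cube_roots_def
    using p permutes_compose[OF next_pos_permutes p] inv by blast
qed

text \<open>Each requirement on the covering says that a lifted map is the identity or has no fixed
  point. By \<open>tw_id_iff\<close> and \<open>tw_nofix_iff\<close> it splits into a condition on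
  the quotient and one on the voltages.\<close>

lemma tw_rooted_iff:
  assumes d: "d > 0" and L: "L > 0" and bl: "\<And>a. a < L \<Longrightarrow> \<beta> a < L" and bo: "\<And>a. \<not> a < L \<Longrightarrow> \<beta> a = a"
    and v: "v \<in> {..<L} \<rightarrow>\<^sub>E {..<d}"
  shows "tw d L \<beta> v \<in> rooted (d * L) 0 0 \<longleftrightarrow> (\<exists>r k. \<beta> \<in> rooted L r k) \<and> v \<in> volt d L \<beta>"
proof -
  let ?th = "\<beta> \<circ> next_pos L" and ?u = "ucorner L v"
  have tl: "?th a < L" if "a < L" for a using bl next_pos_less that by simp
  have ttl: "(?th \<circ> ?th) a < L" if "a < L" for a using tl that by simp
  have bbl: "(\<beta> \<circ> \<beta>) a < L" if "a < L" for a using bl that by simp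
  have t3l: "(?th \<circ> (?th \<circ> ?th)) a < L" if "a < L" for a using tl that by simp
  have c1: "(\<forall>i. tw d L \<beta> v (tw d L \<beta> v i) = i) \<longleftrightarrow> (\<forall>a<L. \<beta> (\<beta> a) = a \<and> d dvd v a + v (\<beta> a))"
  proof -
    have e: "tw d L \<beta> v (tw d L \<beta> v i) = tw d L (\<beta> \<circ> \<beta>) (\<lambda>a. v a + v (\<beta> a)) i" for i
      by (rule tw_comp[OF d bl])
    have "(\<forall>i. tw d L (\<beta> \<circ> \<beta>) (\<lambda>a. v a + v (\<beta> a)) i = i) \<longleftrightarrow> (\<forall>a<L. (\<beta> \<circ> \<beta>) a = a \<and> d dvd v a + v (\<beta> a))"
      by (rule tw_id_iff[OF d bbl])
    then show ?thesis unfolding e comp_apply .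
  qed
  have c2: "(\<forall>i. tw d L ?th ?u (tw d L ?th ?u (tw d L ?th ?u i)) = i) \<longleftrightarrow>
      (\<forall>a<L. ?th (?th (?th a)) = a \<and> d dvd ?u a + ?u (?th a) + ?u (?th (?th a)))"
  proof -
    have e1: "tw d L ?th ?u (tw d L ?th ?u i) = tw d L (?th \<circ> ?th) (\<lambda>a. ?u a + ?u (?th a)) i" for i
      by (rule tw_comp[OF d tl])
    have e2: "tw d L ?th ?u (tw d L (?th \<circ> ?th) (\<lambda>a. ?u a + ?u (?th a)) i)
        = tw d L (?th \<circ> (?th \<circ> ?th)) (\<lambda>a. ?u a + ?u (?th a) + ?u ((?th \<circ> ?th) a)) i" for i
      by (rule tw_comp[OF d ttl])
    have "(\<forall>i. tw d L (?th \<circ> (?th \<circ> ?th)) (\<lambda>a. ?u a + ?u (?th a) + ?u ((?th \<circ> ?th) a)) i = i)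
        \<longleftrightarrow> (\<forall>a<L. (?th \<circ> (?th \<circ> ?th)) a = a \<and> d dvd ?u a + ?u (?th a) + ?u ((?th \<circ> ?th) a))"
      by (rule tw_id_iff[OF d t3l])
    then show ?thesis unfolding e1 e2 by (simp only: comp_apply)
  qed
  have c3: "(\<forall>i<d * L. tw d L \<beta> v i \<noteq> i) \<longleftrightarrow> (\<forall>a<L. \<beta> a = a \<longrightarrow> \<not> d dvd v a)"
    by (rule tw_nofix_iff[of d L \<beta>, OF d bl])
  have c4: "(\<forall>i<d * L. tw d L ?th ?u i \<noteq> i) \<longleftrightarrow> (\<forall>a<L. ?th a = a \<longrightarrow> \<not> d dvd ?u a)"
    by (rule tw_nofix_iff[of d L ?th, OF d tl])
  have "tw d L \<beta> v \<in> rooted (d * L) 0 0 \<longleftrightarrow>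
    (\<forall>a<L. \<beta> (\<beta> a) = a \<and> d dvd v a + v (\<beta> a)) \<and> (\<forall>a<L. \<beta> a = a \<longrightarrow> \<not> d dvd v a) \<and>
    (\<forall>a<L. ?th (?th (?th a)) = a \<and> d dvd ?u a + ?u (?th a) + ?u (?th (?th a))) \<and>
    (\<forall>a<L. ?th a = a \<longrightarrow> \<not> d dvd ?u a)"
  proof -
    have tt: "tw d L \<beta> v \<circ> next_pos (d * L) = tw d L ?th ?u" by (rule tw_theta[OF d L bl])
    have o: "\<forall>i. \<not> i < d * L \<longrightarrow> tw d L \<beta> v i = i" by (intro allI impI) (rule tw_out)
    have absorb: "P \<Longrightarrow> (P \<and> Q) = Q" for P Q by blast
    show ?thesis unfolding rooted00_iff tt c1 c2 c3 c4 by (rule absorb, rule o)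
  qed
  also have "\<dots> \<longleftrightarrow> (\<exists>r k. \<beta> \<in> rooted L r k) \<and> v \<in> volt d L \<beta>"
  proof -
    have gen: "((\<forall>a<L. P1 a \<and> Q1 a) \<and> V2 \<and> (\<forall>a<L. P3 a \<and> Q3 a) \<and> V4) =
      ((O1 \<and> (\<forall>i<L. B i \<and> P1 i) \<and> (\<forall>i<L. P3 i)) \<and> (Vm \<and> (\<forall>a<L. Q1 a) \<and> V2 \<and> (\<forall>a<L. Q3 a) \<and> V4))"
      if "O1" "\<forall>i<L. B i" "Vm" for O1 B Vm P1 Q1 V2 P3 Q3 V4 using that by blast
    have o1: "\<forall>i. \<not> i < L \<longrightarrow> \<beta> i = i" using bo by simp
    have o2: "\<forall>i<L. \<beta> i < L" using bl by simp
    show ?thesis unfolding rooted_any_iff volt_def comp_apply mem_Collect_eq by (rule gen[OF o1 o2 v])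
  qed
  finally show ?thesis .
qed

definition sym_rooted :: "nat \<Rightarrow> nat \<Rightarrow> (nat \<Rightarrow> nat) set" where
  "sym_rooted d L = {\<alpha> \<in> rooted (d * L) 0 0. \<forall>i<d * L. \<alpha> ((i + L) mod (d * L)) = (\<alpha> i + L) mod (d * L)}"

lemma tw_commutes:
  assumes "d > 0" "i < d * L" "\<And>a. a < L \<Longrightarrow> \<beta> a < L"
  shows "tw d L \<beta> v ((i + L) mod (d * L)) = (tw d L \<beta> v i + L) mod (d * L)"
proof -
  obtain a b where i: "a < L" "b < d" "i = a + L * b" using enc_cases[OF assms(2)] .
  have "(a + L * b + L) mod (d * L) = a + L * ((b + 1) mod d)"
    using enc_shift[OF i(1) assms(1), of b 1] by simp
  moreover have "tw d L \<beta> v (a + L * ((b + 1) mod d)) = \<beta> a + L * ((v a + (b + 1) mod d) mod d)"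
    by (rule tw_enc) (use i assms in auto)
  moreover have "(\<beta> a + L * ((v a + b) mod d) + L) mod (d * L) = \<beta> a + L * (((v a + b) mod d + 1) mod d)"
    using enc_shift[OF assms(3)[OF i(1)] assms(1), of "(v a + b) mod d" 1] by simp
  moreover have "(v a + (b + 1) mod d) mod d = ((v a + b) mod d + 1) mod d"
  proof -
    have "(v a + (b + 1) mod d) mod d = (v a + (b + 1)) mod d" by (rule mod_add_right_eq)
    moreover have "((v a + b) mod d + 1) mod d = (v a + b + 1) mod d" by (rule mod_add_left_eq)
    ultimately show ?thesis by (simp add: add.assoc)
  qed
  ultimately show ?thesis unfolding i(3) tw_enc[OF i(1,2)] by simp
qed

text \<open>The values on the first sheet determine an involution that commutes with the rotation by
  \<open>L\<close>: their remainders modulo \<open>L\<close> are the quotient, the sheets they reach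
  are the voltages.\<close>

lemma sym_rooted_is_tw:
  assumes d: "d > 0" and L: "L > 0" and al: "\<alpha> \<in> sym_rooted d L"
  obtains \<beta> v where "\<And>a. a < L \<Longrightarrow> \<beta> a < L" "\<And>a. \<not> a < L \<Longrightarrow> \<beta> a = a" "v \<in> {..<L} \<rightarrow>\<^sub>E {..<d}" "\<alpha> = tw d L \<beta> v"
proof
  define \<beta> where "\<beta> a = (if a < L then \<alpha> a mod L else a)" for a
  define v where "v = (\<lambda>a\<in>{..<L}. \<alpha> a div L)"
  have perm: "\<alpha> permutes {..<d * L}" and com: "\<And>i. i < d * L \<Longrightarrow> \<alpha> ((i + L) mod (d * L)) = (\<alpha> i + L) mod (d * L)"
    using al unfolding sym_rooted_def rooted_def involutions_def by auto
  have lt: "\<alpha> i < d * L" if "i < d * L" for i using permutes_in_image[OF perm, of i] that by simp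
  have LdL: "L \<le> d * L" using d by (cases d) auto
  show "\<And>a. a < L \<Longrightarrow> \<beta> a < L" unfolding \<beta>_def using L by simp
  show "\<And>a. \<not> a < L \<Longrightarrow> \<beta> a = a" unfolding \<beta>_def by simp
  have "\<alpha> a div L < d" if "a < L" for a
    using lt[of a] that LdL by (intro less_mult_imp_div_less) simp
  then show "v \<in> {..<L} \<rightarrow>\<^sub>E {..<d}" unfolding v_def by auto
  have e: "\<alpha> (a + L * b) = \<beta> a + L * ((v a + b) mod d)" if "a < L" "b < d" for a b
    using that(2)
  proof (induction b)
    case 0
    have "\<alpha> a div L < d" using lt[of a] that LdL by (intro less_mult_imp_div_less) simp
    then show ?case using that(1) unfolding \<beta>_def v_def by simp
  next
    case (Suc b)
    have "a + L * Suc b = (a + L * b + L) mod (d * L)" using enc_less[OF that(1) Suc.prems] by simp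
    then have "\<alpha> (a + L * Suc b) = (\<alpha> (a + L * b) + L) mod (d * L)"
      using com[of "a + L * b"] enc_less[OF that(1), of b d] Suc.prems by simp
    also have "\<dots> = (\<beta> a + L * ((v a + b) mod d) + L * 1) mod (d * L)" using Suc by simp
    also have "\<dots> = \<beta> a + L * (((v a + b) mod d + 1) mod d)"
      by (rule enc_shift) (use L d in \<open>auto simp: \<beta>_def that\<close>)
    also have "((v a + b) mod d + 1) mod d = (v a + Suc b) mod d" by (simp add: mod_Suc_eq)
    finally show ?case .
  qed
  show "\<alpha> = tw d L \<beta> v"
  proof
    fix i show "\<alpha> i = tw d L \<beta> v i"
    proof (cases "i < d * L")
      case True
      then obtain a b where i: "a < L" "b < d" "i = a + L * b" by (rule enc_cases)
      then show ?thesis using e tw_enc by simp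
    next
      case False
      then show ?thesis using perm unfolding permutes_def by (simp add: tw_out)
    qed
  qed
qed

lemma tw_inj:
  assumes d: "d > 0"
    and 1: "\<And>a. a < L \<Longrightarrow> \<beta> a < L" "\<And>a. \<not> a < L \<Longrightarrow> \<beta> a = a" "v \<in> {..<L} \<rightarrow>\<^sub>E {..<d}"
    and 2: "\<And>a. a < L \<Longrightarrow> \<beta>' a < L" "\<And>a. \<not> a < L \<Longrightarrow> \<beta>' a = a" "v' \<in> {..<L} \<rightarrow>\<^sub>E {..<d}"
    and eq: "tw d L \<beta> v = tw d L \<beta>' v'"
  shows "\<beta> = \<beta>'" "v = v'"
proof -
  have "\<beta> a = \<beta>' a \<and> v a = v' a" if a: "a < L" for a
  proof -
    have "\<beta> a + L * ((v a + 0) mod d) = \<beta>' a + L * ((v' a + 0) mod d)"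
      using fun_cong[OF eq, of "a + L * 0"] unfolding tw_enc[OF a d] .
    then have "\<beta> a = \<beta>' a \<and> v a mod d = v' a mod d" using enc_eq_iff[OF 1(1)[OF a] 2(1)[OF a]] by simp
    moreover have "v a < d" "v' a < d" using 1(3) 2(3) a by auto
    ultimately show ?thesis by simp
  qed
  then show "v = v'" using 1(3) 2(3) by (intro PiE_ext[of v "{..<L}" "\<lambda>_. {..<d}"]) auto
  show "\<beta> = \<beta>'"
  proof
    fix a show "\<beta> a = \<beta>' a" using \<open>\<And>a. a < L \<Longrightarrow> \<beta> a = \<beta>' a \<and> v a = v' a\<close> 1(2) 2(2) by (cases "a < L") auto
  qed
qed

lemma rooted_bounds:
  assumes "\<beta> \<in> rooted L r k"
  shows "a < L \<Longrightarrow> \<beta> a < L" "\<not> a < L \<Longrightarrow> \<beta> a = a"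
proof -
  have p: "\<beta> permutes {..<L}" using assms unfolding rooted_def involutions_def by blast
  show "a < L \<Longrightarrow> \<beta> a < L" using permutes_in_image[OF p, of a] by simp
  show "\<not> a < L \<Longrightarrow> \<beta> a = a" using p unfolding permutes_def by simp
qed

text \<open>The numbers of free half-edges and leaves of the quotient stay open here;
  \<open>data_counts\<close> recovers them from the covering.\<close>

lemma sym_rooted_bij:
  assumes d: "d > 0" and L: "L > 0"
  shows "bij_betw (\<lambda>(\<beta>, v). tw d L \<beta> v) {(\<beta>, v). (\<exists>r k. \<beta> \<in> rooted L r k) \<and> v \<in> volt d L \<beta>} (sym_rooted d L)"
  unfolding bij_betw_def
proof (intro conjI equalityI subsetI)
  show "inj_on (\<lambda>(\<beta>, v). tw d L \<beta> v) {(\<beta>, v). (\<exists>r k. \<beta> \<in> rooted L r k) \<and> v \<in> volt d L \<beta>}"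
  proof (rule inj_onI)
    fix p q assume p: "p \<in> {(\<beta>, v). (\<exists>r k. \<beta> \<in> rooted L r k) \<and> v \<in> volt d L \<beta>}"
      and q: "q \<in> {(\<beta>, v). (\<exists>r k. \<beta> \<in> rooted L r k) \<and> v \<in> volt d L \<beta>}"
      and eq: "(\<lambda>(\<beta>, v). tw d L \<beta> v) p = (\<lambda>(\<beta>, v). tw d L \<beta> v) q"
    obtain \<beta> v r k where p': "p = (\<beta>, v)" "\<beta> \<in> rooted L r k" "v \<in> {..<L} \<rightarrow>\<^sub>E {..<d}" using p unfolding volt_def by blast
    obtain \<beta>' v' r' k' where q': "q = (\<beta>', v')" "\<beta>' \<in> rooted L r' k'" "v' \<in> {..<L} \<rightarrow>\<^sub>E {..<d}" using q unfolding volt_def by blast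
    have "tw d L \<beta> v = tw d L \<beta>' v'" using eq p'(1) q'(1) by simp
    from tw_inj[OF d rooted_bounds[OF p'(2)] p'(3) rooted_bounds[OF q'(2)] q'(3) this]
    show "p = q" using p'(1) q'(1) by blast
  qed
next
  fix \<alpha> assume "\<alpha> \<in> (\<lambda>(\<beta>, v). tw d L \<beta> v) ` {(\<beta>, v). (\<exists>r k. \<beta> \<in> rooted L r k) \<and> v \<in> volt d L \<beta>}"
  then obtain p where p: "p \<in> {(\<beta>, v). (\<exists>r k. \<beta> \<in> rooted L r k) \<and> v \<in> volt d L \<beta>}"
    "\<alpha> = (\<lambda>(\<beta>, v). tw d L \<beta> v) p" by blast
  obtain \<beta> v where bv: "p = (\<beta>, v)" by (rule prod.exhaust)
  obtain r k where h: "\<alpha> = tw d L \<beta> v" "\<beta> \<in> rooted L r k" "v \<in> volt d L \<beta>"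
    using p unfolding bv by (simp only: mem_Collect_eq prod.case) blast
  note rb = rooted_bounds[OF h(2)]
  have "v \<in> {..<L} \<rightarrow>\<^sub>E {..<d}" using h(3) unfolding volt_def by blast
  then have "\<alpha> \<in> rooted (d * L) 0 0" unfolding h(1) using tw_rooted_iff[OF d L rb] h(2,3) by blast
  moreover have "\<alpha> ((i + L) mod (d * L)) = (\<alpha> i + L) mod (d * L)" if "i < d * L" for i
    unfolding h(1) by (rule tw_commutes[OF d that rb(1)])
  ultimately show "\<alpha> \<in> sym_rooted d L" unfolding sym_rooted_def by blast
next
  fix \<alpha> assume a: "\<alpha> \<in> sym_rooted d L"
  obtain \<beta> v where h: "\<And>a. a < L \<Longrightarrow> \<beta> a < L" "\<And>a. \<not> a < L \<Longrightarrow> \<beta> a = a" "v \<in> {..<L} \<rightarrow>\<^sub>E {..<d}" "\<alpha> = tw d L \<beta> v"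
    using sym_rooted_is_tw[OF d L a] by blast
  have "tw d L \<beta> v \<in> rooted (d * L) 0 0" using a unfolding sym_rooted_def h(4) by blast
  then have "(\<exists>r k. \<beta> \<in> rooted L r k) \<and> v \<in> volt d L \<beta>" using tw_rooted_iff[OF d L h(1,2,3)] by blast
  then show "\<alpha> \<in> (\<lambda>(\<beta>, v). tw d L \<beta> v) ` {(\<beta>, v). (\<exists>r k. \<beta> \<in> rooted L r k) \<and> v \<in> volt d L \<beta>}"
    unfolding h(4) by blast
qed

lemma rooted_props:
  assumes "\<beta> \<in> rooted L r k"
  shows "\<beta> \<in> involutions {..<L} r" "\<beta> \<circ> next_pos L \<in> cube_roots {..<L} k" "\<beta> (\<beta> x) = x"
    "\<beta> permutes {..<L}" "\<beta> \<circ> (\<beta> \<circ> next_pos L) = next_pos L"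
proof -
  show a: "\<beta> \<in> involutions {..<L} r" "\<beta> \<circ> next_pos L \<in> cube_roots {..<L} k" using assms unfolding rooted_def by auto
  show b: "\<beta> (\<beta> x) = x" for x using a unfolding involutions_def by blast
  show "\<beta> permutes {..<L}" using a unfolding involutions_def by blast
  show "\<beta> \<circ> (\<beta> \<circ> next_pos L) = next_pos L" by (rule ext) (simp add: b)
qed

lemma sum_last: "L > 0 \<Longrightarrow> (\<Sum>a<L. if Suc a = L then 1 else 0) = (1 :: 'a :: comm_semiring_1)"
proof -
  assume "L > 0"
  have "(\<Sum>a<L. if Suc a = L then 1 else 0) = (\<Sum>a<L. if a = L - 1 then 1 else (0 :: 'a))"
    by (rule sum.cong) auto
  then show ?thesis using \<open>L > 0\<close> by simp
qed

text \<open>Twice the total voltage and three times the total corner voltage vanish, but the two totals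
  differ by the monodromy 1 around the face.\<close>

lemma volt_dvd_6:
  assumes L: "L > 0" and b: "\<beta> \<in> rooted L r k" and v: "v \<in> volt d L \<beta>"
  shows "d dvd 6"
proof -
  note p = rooted_props[OF b]
  let ?th = "\<beta> \<circ> next_pos L" and ?u = "ucorner L v"
  have tp: "?th permutes {..<L}" using p(2) unfolding cube_roots_def by blast
  have v': "\<And>a. a < L \<Longrightarrow> d dvd v a + v (\<beta> a)"
    "\<And>a. a < L \<Longrightarrow> d dvd ?u a + ?u (?th a) + ?u (?th (?th a))" using v unfolding volt_def by auto
  define S where "S = (\<Sum>a<L. v a)"
  define U where "U = (\<Sum>a<L. ?u a)"
  have re: "(\<Sum>a<L. f (\<pi> a)) = (\<Sum>a<L. f a)" if "\<pi> permutes {..<L}" for \<pi> and f :: "nat \<Rightarrow> nat"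
    using sum.permute[OF that, of f] by (simp add: comp_def)
  have "d dvd (\<Sum>a<L. v a + v (\<beta> a))" by (rule dvd_sum) (use v'(1) in auto)
  then have dS: "d dvd 2 * S" unfolding sum.distrib re[OF p(4)] S_def by (simp add: mult_2)
  have "d dvd (\<Sum>a<L. ?u a + ?u (?th a) + ?u (?th (?th a)))" by (rule dvd_sum) (use v'(2) in auto)
  moreover have e1: "(\<Sum>a<L. ?u (?th a)) = U" unfolding U_def by (rule re[OF tp])
  moreover have "(\<Sum>a<L. ?u (?th (?th a))) = U" using re[OF tp, of "\<lambda>a. ?u (?th a)"] e1 by (rule trans)
  ultimately have "d dvd U + U + U" by (simp only: sum.distrib U_def[symmetric])
  moreover have "U + U + U = 3 * U" by simp
  ultimately have dU: "d dvd 3 * U" by (simp only:)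
  have US: "U = 1 + S"
    unfolding U_def S_def ucorner_def sum.distrib re[OF next_pos_permutes] by (simp add: sum_last[OF L])
  have "d dvd 2 * (3 * U)" using dU by (rule dvd_mult)
  moreover have "2 * (3 * U) = 6 + 3 * (2 * S)" unfolding US by simp
  ultimately have 1: "d dvd 6 + 3 * (2 * S)" by (simp only:)
  have 2: "d dvd 3 * (2 * S)" using dS by (rule dvd_mult)
  show ?thesis using dvd_add_left_iff[OF 2, of 6] 1 by blast
qed

section \<open>Voltages of order 2 and 3 and the linear system they lead to\<close>

lemma half_iff:
  assumes "(v :: nat) < d" "d dvd 2 * v"
  shows "\<not> d dvd v \<longleftrightarrow> even d \<and> v = d div 2"
proof
  assume n: "\<not> d dvd v"
  obtain q where q: "2 * v = d * q" using assms(2) by (auto elim: dvdE)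
  have "v > 0" using n by (cases v) auto
  then have "q > 0" using q by (cases q) auto
  moreover have "q < 2" 
  proof (rule ccontr)
    assume "\<not> q < 2"
    then have "d * 2 \<le> d * q" by simp
    then show False using q assms(1) by linarith
  qed
  ultimately have "q = 1" by linarith
  then have "d = 2 * v" using q by simp
  then show "even d \<and> v = d div 2" by simp
next
  assume e: "even d \<and> v = d div 2"
  then have "2 * v = d" by simp
  then have "0 < v" "v < d" using assms(1) by auto
  then show "\<not> d dvd v" using nat_dvd_not_less by blast
qed

text \<open>The residues of order 3 modulo \<open>3 * m\<close> are \<open>m\<close> and
  \<open>2 * m\<close>; the distinction between them later becomes the sign of a fixed
  vertex.\<close>

lemma third_iff:
  fixes d m u :: nat
  assumes "d = 3 * m" "m > 0"
  shows "d dvd 3 * u \<and> \<not> d dvd u \<longleftrightarrow> u mod d = m \<or> u mod d = 2 * m"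
proof -
  have "d dvd 3 * u \<longleftrightarrow> m dvd u" using assms by simp
  also have "\<dots> \<longleftrightarrow> m dvd u mod d"
  proof -
    have "m dvd d" using assms(1) by simp
    then show ?thesis by (rule dvd_mod_iff[symmetric])
  qed
  also have "\<dots> \<longleftrightarrow> u mod d = 0 \<or> u mod d = m \<or> u mod d = 2 * m"
  proof
    assume "m dvd u mod d"
    then obtain q where q: "u mod d = m * q" by (elim dvdE)
    have "u mod d < d" using assms by simp
    then have "m * q < d" using q by metis
    then have "m * q < m * 3" unfolding assms(1) by (simp only: mult.commute)
    then have "q < 3" using assms(2) by (simp only: mult_less_cancel1 simp_thms)
    then have "q = 0 \<or> q = 1 \<or> q = 2" by linarith
    then show "u mod d = 0 \<or> u mod d = m \<or> u mod d = 2 * m" using q by auto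
  qed auto
  finally have X: "d dvd 3 * u \<longleftrightarrow> u mod d = 0 \<or> u mod d = m \<or> u mod d = 2 * m" .
  have "d dvd u \<longleftrightarrow> u mod d = 0" by (rule dvd_eq_mod_eq_0)
  then show ?thesis using X assms(2) by linarith
qed

lemma odd_no_half: "odd (d :: nat) \<Longrightarrow> d dvd 2 * v \<Longrightarrow> d dvd v"
proof -
  assume "odd d" "d dvd 2 * v"
  have "coprime d 2" using \<open>odd d\<close> by simp
  then show "d dvd v" using \<open>d dvd 2 * v\<close> by (simp only: coprime_dvd_mult_right_iff)
qed

lemma no_third: "\<not> 3 dvd (d :: nat) \<Longrightarrow> d dvd 3 * v \<Longrightarrow> d dvd v"
proof -
  assume "\<not> 3 dvd d" "d dvd 3 * v"
  have "prime (3 :: nat)" by simp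
  then have "coprime 3 d" using \<open>\<not> 3 dvd d\<close> by (rule prime_imp_coprime)
  then show "d dvd v" using \<open>d dvd 3 * v\<close> by (simp add: coprime_commute coprime_dvd_mult_right_iff)
qed

text \<open>The residue of order 2. For odd \<open>d\<close> there is none and no half-edge can be
  without partner; the default \<open>0\<close> satisfies the assumptions of
  \<open>voltage_graph\<close>.\<close>

definition half_volt :: "nat \<Rightarrow> nat" where
  "half_volt d = (if even d then d div 2 else 0)"

definition low_thirds :: "nat \<Rightarrow> nat \<Rightarrow> (nat \<Rightarrow> nat) \<Rightarrow> (nat \<Rightarrow> nat) \<Rightarrow> nat set" where
  "low_thirds d L \<beta> v = {a. a < L \<and> \<beta> (next_pos L a) = a \<and> ucorner L v a mod d = d div 3}"

text \<open>The right-hand side of the vertex equations. Modulo \<open>d\<close>, the corner voltage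
  at \<open>a\<close> is the monodromy term minus the voltage of
  \<open>\<beta> (next_pos L a)\<close>, so a prescribed corner voltage becomes a prescribed voltage
  sum. At a leaf the prescribed value is one or two thirds of \<open>d\<close>, according to
  \<open>S\<close>.\<close>

definition target :: "nat \<Rightarrow> nat \<Rightarrow> (nat \<Rightarrow> nat) \<Rightarrow> nat set \<Rightarrow> nat \<Rightarrow> int" where
  "target d L \<beta> S a = (if Suc a = L then 1 else 0)
     - (if \<beta> (next_pos L a) = a then if a \<in> S then int (d div 3) else int (2 * (d div 3)) else 0)"

lemma volt_dvd3:
  assumes "v \<in> volt d L \<beta>" "a < L" "\<beta> (next_pos L a) = a"
  shows "d dvd 3 * ucorner L v a" "\<not> d dvd ucorner L v a"
proof -
  have "d dvd ucorner L v a + ucorner L v (\<beta> (next_pos L a)) + ucorner L v (\<beta> (next_pos L (\<beta> (next_pos L a))))"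
    using assms(1,2) unfolding volt_def by blast
  then show "d dvd 3 * ucorner L v a" unfolding assms(3) by (simp add: numeral_3_eq_3 add.assoc)
  show "\<not> d dvd ucorner L v a" using assms unfolding volt_def by blast
qed

lemma volt_dvd2:
  assumes "v \<in> volt d L \<beta>" "a < L" "\<beta> a = a"
  shows "d dvd 2 * v a" "\<not> d dvd v a" "v a < d"
proof -
  have "d dvd v a + v (\<beta> a)" using assms(1,2) unfolding volt_def by blast
  then show "d dvd 2 * v a" unfolding assms(3) by (simp add: mult_2)
  show "\<not> d dvd v a" using assms unfolding volt_def by blast
  show "v a < d" using assms(1,2) unfolding volt_def by auto
qed

lemma volt_graph:
  assumes L: "L > 0" and d: "d > 0" and b: "\<beta> \<in> rooted L r k"
  shows "voltage_graph {..<L} \<beta> (\<beta> \<circ> next_pos L) r k d (half_volt d)"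
proof
  note p = rooted_props[OF b]
  show "single_cycle (\<beta> \<circ> (\<beta> \<circ> next_pos L)) {..<L}" unfolding p(5) by (rule next_pos_single_cycle)
  show "half_volt d < d" unfolding half_volt_def using d by auto
  show "d dvd 2 * half_volt d" unfolding half_volt_def by auto
qed (use L d rooted_props[OF b] in auto)

text \<open>Fixing the set \<open>S\<close> of leaves with corner voltage \<open>d div 3\<close>
  turns the inequations at the leaves into equations, so \<open>volt\<close> splits into solution
  sets of linear systems. Likewise a nonzero voltage at a half-edge without partner can only be
  \<open>half_volt d\<close>.\<close>

lemma volt_solutions:
  assumes L: "L > 0" and d: "d > 0" and br: "\<beta> \<in> rooted L r k"
    and r: "r > 0 \<Longrightarrow> even d" and k: "k > 0 \<Longrightarrow> 3 dvd d"
    and S: "S \<subseteq> {a. a < L \<and> \<beta> (next_pos L a) = a}"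
  shows "{v \<in> volt d L \<beta>. low_thirds d L \<beta> v = S}
    = voltage_graph.solutions {..<L} \<beta> (\<beta> \<circ> next_pos L) d (half_volt d) (target d L \<beta> S)"
proof -
  interpret voltage_graph "{..<L}" \<beta> "\<beta> \<circ> next_pos L" r k d "half_volt d" by (rule volt_graph[OF L d br])
  note p = rooted_props[OF br]
  define th where "th = \<beta> \<circ> next_pos L"
  have thb: "\<beta> (th a) = next_pos L a" for a unfolding th_def using p(3) by simp
  have th_eq: "\<beta> (next_pos L a) = th a" for a unfolding th_def by simp
  have th3: "th (th (th a)) = a" for a unfolding th_def by (rule t(2))
  have thL: "th a < L" if "a < L" for a using tD[of a] that unfolding th_def by simp
  have thfix: "th (th a) = th a \<longleftrightarrow> th a = a" for a unfolding th_def by (rule tfix)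
  have evr: "even d" if "a < L" "\<beta> a = a" for a
  proof -
    have "a \<in> {x \<in> {..<L}. \<beta> x = x}" using that by simp
    then have "card {x \<in> {..<L}. \<beta> x = x} \<noteq> 0" by (subst card_eq_0_iff) auto
    then have "r > 0" unfolding b(3) by simp
    then show ?thesis by (rule r)
  qed
  have d3: "3 dvd d" if "a < L" "th a = a" for a
  proof -
    have "a \<in> {x \<in> {..<L}. (\<beta> \<circ> next_pos L) x = x}" using that unfolding th_def by simp
    then have "card {x \<in> {..<L}. (\<beta> \<circ> next_pos L) x = x} \<noteq> 0" by (subst card_eq_0_iff) auto
    then have "k > 0" unfolding t(3) by simp
    then show ?thesis by (rule k)
  qed
  \<comment> \<open>\<open>next_pos L a\<close> and \<open>th a\<close> are partners, so their
    voltages cancel.\<close>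
  have u: "[int (ucorner L v a) = (if Suc a = L then 1 else 0) - int (v (th a))] (mod int d)"
    if v: "\<And>a. a < L \<Longrightarrow> d dvd v a + v (\<beta> a)" and a: "a < L" for v a
  proof -
    have "d dvd v (th a) + v (next_pos L a)" using v[OF thL[OF a]] unfolding thb .
    then have "int d dvd int (v (th a) + v (next_pos L a))" by (simp only: int_dvd_int_iff)
    then show ?thesis unfolding cong_iff_dvd_diff ucorner_def by (simp add: algebra_simps)
  qed
  have main: "(\<forall>a<L. \<beta> a = a \<longrightarrow> \<not> d dvd v a) \<and>
      (\<forall>a<L. d dvd ucorner L v a + ucorner L v (th a) + ucorner L v (th (th a))) \<and>
      (\<forall>a<L. th a = a \<longrightarrow> \<not> d dvd ucorner L v a) \<and> low_thirds d L \<beta> v = S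
    \<longleftrightarrow> (\<forall>x\<in>{..<L}. \<beta> x = x \<longrightarrow> v x = half_volt d) \<and>
      (\<forall>x\<in>{..<L}. [vsum th (\<lambda>y. int (v y)) x = vsum th (target d L \<beta> S) x] (mod int d))"
    if v0: "\<forall>a<L. d dvd v a + v (\<beta> a)" and vd0: "\<forall>a<L. v a < d" for v
  proof -
    have v: "d dvd v a + v (\<beta> a)" if "a < L" for a using v0 that by blast
    have vd: "v a < d" if "a < L" for a using vd0 that by blast
    have u': "[int (ucorner L v a) = (if Suc a = L then 1 else 0) - int (v (th a))] (mod int d)" if "a < L" for a
    proof (rule u)
      show "d dvd v b + v (\<beta> b)" if "b < L" for b by (rule v[OF that])
    qed (rule that)
    have A: "\<not> d dvd v a \<longleftrightarrow> v a = half_volt d" if "a < L" "\<beta> a = a" for a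
    proof -
      have "d dvd 2 * v a" using v[OF that(1)] unfolding that(2) by (simp add: mult_2)
      then show ?thesis using half_iff[OF vd[OF that(1)]] evr[OF that] unfolding half_volt_def by simp
    qed
    have B: "d dvd ucorner L v a + ucorner L v (th a) + ucorner L v (th (th a)) \<longleftrightarrow>
        [vsum th (\<lambda>y. int (v y)) a = vsum th (target d L \<beta> S) a] (mod int d)"
      if a: "a < L" "th a \<noteq> a" for a
    proof -
      define e where "e a = (if Suc a = L then 1 else 0 :: int)" for a
      have nf: "th (th a) \<noteq> th a" "th (th a) \<noteq> a" using cube_root_orbit_distinct[of th, OF th3 a(2)] by blast+
      have nf2: "th (th (th a)) \<noteq> th (th a)" using nf(2) unfolding th3 by simp
      have tg: "target d L \<beta> S a = e a" "target d L \<beta> S (th a) = e (th a)" "target d L \<beta> S (th (th a)) = e (th (th a))"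
        unfolding target_def th_eq e_def using a(2) nf nf2 by simp_all
      let ?U = "int (ucorner L v a) + int (ucorner L v (th a)) + int (ucorner L v (th (th a)))"
      let ?E = "e a + e (th a) + e (th (th a))"
      let ?V = "int (v a) + int (v (th a)) + int (v (th (th a)))"
      have "[?U = (e a - int (v (th a))) + (e (th a) - int (v (th (th a)))) + (e (th (th a)) - int (v (th (th (th a)))))] (mod int d)"
        unfolding e_def by (intro cong_add u'[OF a(1)] u'[OF thL[OF a(1)]] u'[OF thL[OF thL[OF a(1)]]])
      then have c: "[?U = ?E - ?V] (mod int d)" unfolding th3 by (simp add: algebra_simps)
      have "d dvd ucorner L v a + ucorner L v (th a) + ucorner L v (th (th a)) \<longleftrightarrow> [?U = 0] (mod int d)"
        unfolding cong_0_iff by (simp flip: of_nat_add add: int_dvd_int_iff)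
      also have "\<dots> \<longleftrightarrow> [?E - ?V = 0] (mod int d)" using c by (meson cong_sym cong_trans)
      also have "\<dots> \<longleftrightarrow> [?V = ?E] (mod int d)"
        unfolding cong_iff_dvd_diff by (simp only: diff_zero dvd_diff_commute[of "int d" ?E ?V])
      finally show ?thesis unfolding vsum_def tg using a(2) by simp
    qed
    \<comment> \<open>At a leaf, order exactly 3 together with membership in \<open>S\<close> is one
      congruence, with the value \<open>g\<close> defined below.\<close>
    have C: "d dvd 3 * ucorner L v a \<and> \<not> d dvd ucorner L v a \<and> (a \<in> S \<longleftrightarrow> ucorner L v a mod d = d div 3)
        \<longleftrightarrow> [vsum th (\<lambda>y. int (v y)) a = vsum th (target d L \<beta> S) a] (mod int d)"
      if a: "a < L" "th a = a" for a
    proof -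
      define m where "m = d div 3"
      have dm: "d = 3 * m" "m > 0" using d3[OF a] d unfolding m_def by auto
      define e where "e = (if Suc a = L then 1 else 0 :: int)"
      define g where "g = (if a \<in> S then m else 2 * m)"
      have tg: "target d L \<beta> S a = e - int g" unfolding target_def th_eq e_def g_def m_def using a(2) by simp
      have uu: "[int (ucorner L v a) = e - int (v a)] (mod int d)" using u'[OF a(1)] unfolding a(2) e_def .
      have "[int (v a) = e - int g] (mod int d) \<longleftrightarrow> [e - int (v a) = int g] (mod int d)"
      proof -
        have "e - int (v a) - int g = - (int (v a) - (e - int g))" by simp
        then show ?thesis unfolding cong_iff_dvd_diff by (simp only: dvd_minus_iff)
      qed
      also have "\<dots> \<longleftrightarrow> [int (ucorner L v a) = int g] (mod int d)" using uu by (meson cong_sym cong_trans)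
      also have "\<dots> \<longleftrightarrow> ucorner L v a mod d = g"
      proof -
        have "g < d" unfolding g_def using dm by simp
        moreover have "[int (ucorner L v a) = int g] (mod int d) \<longleftrightarrow> [ucorner L v a = g] (mod d)"
          by (rule cong_int_iff)
        ultimately show ?thesis unfolding cong_def[of "ucorner L v a"] by simp
      qed
      also have "\<dots> \<longleftrightarrow> (ucorner L v a mod d = m \<or> ucorner L v a mod d = 2 * m) \<and> (a \<in> S \<longleftrightarrow> ucorner L v a mod d = m)"
        unfolding g_def using dm(2) by auto
      also have "\<dots> \<longleftrightarrow> (d dvd 3 * ucorner L v a \<and> \<not> d dvd ucorner L v a) \<and> (a \<in> S \<longleftrightarrow> ucorner L v a mod d = m)"
        unfolding third_iff[OF dm] ..
      finally show ?thesis unfolding vsum_def tg m_def using a(2) by simp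
    qed
    have Seq: "low_thirds d L \<beta> v = S \<longleftrightarrow> (\<forall>a<L. th a = a \<longrightarrow> (a \<in> S \<longleftrightarrow> ucorner L v a mod d = d div 3))"
      using S unfolding low_thirds_def th_eq by blast
    have three: "ucorner L v a + ucorner L v (th a) + ucorner L v (th (th a)) = 3 * ucorner L v a" if "th a = a" for a
      using that by simp
    show ?thesis
    proof
      assume H: "(\<forall>a<L. \<beta> a = a \<longrightarrow> \<not> d dvd v a) \<and>
        (\<forall>a<L. d dvd ucorner L v a + ucorner L v (th a) + ucorner L v (th (th a))) \<and>
        (\<forall>a<L. th a = a \<longrightarrow> \<not> d dvd ucorner L v a) \<and> low_thirds d L \<beta> v = S"
      then have h0: "\<forall>a<L. \<beta> a = a \<longrightarrow> \<not> d dvd v a"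
        and h: "\<forall>a<L. d dvd ucorner L v a + ucorner L v (th a) + ucorner L v (th (th a))"
        "\<forall>a<L. th a = a \<longrightarrow> \<not> d dvd ucorner L v a"
        "\<forall>a<L. th a = a \<longrightarrow> (a \<in> S \<longleftrightarrow> ucorner L v a mod d = d div 3)"
        unfolding Seq by blast+
      have "v x = half_volt d" if "x < L" "\<beta> x = x" for x using iffD1[OF A[OF that]] h0 that by blast
      moreover have "[vsum th (\<lambda>y. int (v y)) x = vsum th (target d L \<beta> S) x] (mod int d)" if xL: "x < L" for x
      proof (cases "th x = x")
        case True
        have "d dvd 3 * ucorner L v x" using h(1) xL unfolding three[OF True, symmetric] by blast
        then show ?thesis using iffD1[OF C[OF xL True]] h(2,3) xL True by blast
      next
        case False
        then show ?thesis using iffD1[OF B[OF xL False]] h(1) xL by blast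
      qed
      ultimately show "(\<forall>x\<in>{..<L}. \<beta> x = x \<longrightarrow> v x = half_volt d) \<and>
        (\<forall>x\<in>{..<L}. [vsum th (\<lambda>y. int (v y)) x = vsum th (target d L \<beta> S) x] (mod int d))"
        by simp
    next
      assume H: "(\<forall>x\<in>{..<L}. \<beta> x = x \<longrightarrow> v x = half_volt d) \<and>
        (\<forall>x\<in>{..<L}. [vsum th (\<lambda>y. int (v y)) x = vsum th (target d L \<beta> S) x] (mod int d))"
      then have h0: "v x = half_volt d" if "x < L" "\<beta> x = x" for x using that by simp
      have h: "[vsum th (\<lambda>y. int (v y)) x = vsum th (target d L \<beta> S) x] (mod int d)" if "x < L" for x
        using H that by simp
      have C': "d dvd 3 * ucorner L v a \<and> \<not> d dvd ucorner L v a \<and> (a \<in> S \<longleftrightarrow> ucorner L v a mod d = d div 3)"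
        if "a < L" "th a = a" for a by (rule iffD2[OF C[OF that] h[OF that(1)]])
      have "d dvd ucorner L v a + ucorner L v (th a) + ucorner L v (th (th a))" if a: "a < L" for a
      proof (cases "th a = a")
        case True then show ?thesis using C'[OF a True] unfolding three[OF True] by blast
      next
        case False show ?thesis by (rule iffD2[OF B[OF a False] h[OF a]])
      qed
      moreover have "\<not> d dvd v a" if "a < L" "\<beta> a = a" for a by (rule iffD2[OF A[OF that] h0[OF that]])
      ultimately show "(\<forall>a<L. \<beta> a = a \<longrightarrow> \<not> d dvd v a) \<and>
        (\<forall>a<L. d dvd ucorner L v a + ucorner L v (th a) + ucorner L v (th (th a))) \<and>
        (\<forall>a<L. th a = a \<longrightarrow> \<not> d dvd ucorner L v a) \<and> low_thirds d L \<beta> v = S"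
        unfolding Seq using C' by blast
    qed
  qed
  show ?thesis
  proof (rule Set.set_eqI)
    fix v
    have l: "v \<in> {v \<in> volt d L \<beta>. low_thirds d L \<beta> v = S} \<longleftrightarrow>
      (v \<in> {..<L} \<rightarrow>\<^sub>E {..<d} \<and> (\<forall>a<L. d dvd v a + v (\<beta> a))) \<and> ((\<forall>a<L. \<beta> a = a \<longrightarrow> \<not> d dvd v a) \<and>
      (\<forall>a<L. d dvd ucorner L v a + ucorner L v (th a) + ucorner L v (th (th a))) \<and>
      (\<forall>a<L. th a = a \<longrightarrow> \<not> d dvd ucorner L v a) \<and> low_thirds d L \<beta> v = S)"
      unfolding volt_def th_eq by blast
    have r: "v \<in> solutions (target d L \<beta> S) \<longleftrightarrow>
      (v \<in> {..<L} \<rightarrow>\<^sub>E {..<d} \<and> (\<forall>a<L. d dvd v a + v (\<beta> a))) \<and> ((\<forall>x\<in>{..<L}. \<beta> x = x \<longrightarrow> v x = half_volt d) \<and>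
      (\<forall>x\<in>{..<L}. [vsum th (\<lambda>y. int (v y)) x = vsum th (target d L \<beta> S) x] (mod int d)))"
      unfolding solutions_def antisym_voltages_def
      unfolding th_def[symmetric] by (simp only: mem_Collect_eq conj_assoc lessThan_iff Ball_def)
    show "v \<in> {v \<in> volt d L \<beta>. low_thirds d L \<beta> v = S} \<longleftrightarrow> v \<in> solutions (target d L \<beta> S)"
    proof (cases "v \<in> {..<L} \<rightarrow>\<^sub>E {..<d} \<and> (\<forall>a<L. d dvd v a + v (\<beta> a))")
      case True
      then have 1: "\<forall>a<L. d dvd v a + v (\<beta> a)" by blast
      have 2: "\<forall>a<L. v a < d" using True by auto
      show ?thesis unfolding l r main[OF 1 2] ..
    next
      case False
      then show ?thesis unfolding l r by blast
    qed
  qed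
qed

text \<open>The leading 1 is the monodromy term of the last position. Compared with
  \<open>r * half_volt d\<close>, this total gives the solvability condition from which all
  congruences of the theorem are derived.\<close>

lemma sum_target:
  assumes L: "L > 0" and br: "\<beta> \<in> rooted L r (s + t)" and S: "S \<subseteq> {a. a < L \<and> \<beta> (next_pos L a) = a}" "card S = s"
  shows "(\<Sum>a<L. target d L \<beta> S a) = 1 - int (s * (d div 3) + t * (2 * (d div 3)))"
proof -
  let ?F = "{a. a < L \<and> \<beta> (next_pos L a) = a}"
  have cF: "card ?F = s + t" using rooted_props(2)[OF br] unfolding cube_roots_def by simp
  have finF: "finite ?F" by simp
  have "(\<Sum>a<L. if \<beta> (next_pos L a) = a then if a \<in> S then int (d div 3) else int (2 * (d div 3)) else 0)
      = (\<Sum>a\<in>?F. if a \<in> S then int (d div 3) else int (2 * (d div 3)))"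
    by (subst sum.inter_filter[symmetric]) (auto intro: sum.cong)
  also have "\<dots> = int s * int (d div 3) + int t * int (2 * (d div 3))"
  proof -
    have "?F \<inter> S = S" "card (?F \<inter> - S) = t"
      using S cF finF by (auto simp: card_Diff_subset finite_subset Diff_eq[symmetric])
    then show ?thesis using finF S(2) by (simp add: sum.If_cases)
  qed
  finally show ?thesis
    unfolding target_def sum_subtractf sum_last[OF L] by simp
qed

section \<open>Quotients of a given type and the symmetric maps above them\<close>

definition quotient_data :: "nat \<Rightarrow> nat \<Rightarrow> nat \<Rightarrow> nat \<Rightarrow> nat \<Rightarrow> ((nat \<Rightarrow> nat) \<times> (nat \<Rightarrow> nat)) set" where
  "quotient_data d L r s t = {(\<beta>, v). \<beta> \<in> rooted L r (s + t) \<and> v \<in> volt d L \<beta> \<and> card (low_thirds d L \<beta> v) = s}"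

lemma finite_rooted: "finite (rooted L r k)"
  unfolding rooted_def using finite_involutions[of "{..<L}" r] by simp

lemma finite_volt: "finite (volt d L \<beta>)"
  by (rule finite_subset[OF _ finite_PiE[of "{..<L}" "\<lambda>_. {..<d}"]]) (auto simp: volt_def)

text \<open>Any \<open>s\<close> of the \<open>s + t\<close> leaves may receive the corner voltage
  \<open>d div 3\<close>, and each choice leaves \<open>d ^ (2 * f)\<close> voltages.\<close>

lemma card_quotient_data:
  assumes L: "L > 0" and d: "d > 0"
    and r: "r > 0 \<Longrightarrow> even d" and k: "s + t > 0 \<Longrightarrow> 3 dvd d"
    and c: "[1 - int (s * (d div 3) + t * (2 * (d div 3))) = int (r * half_volt d)] (mod int d)"
    and f: "L + 6 = 4 * (s + t) + 3 * r + 12 * f"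
  shows "card (quotient_data d L r s t) = card (rooted L r (s + t)) * ((s + t choose s) * d ^ (2 * f))"
proof -
  let ?V = "\<lambda>\<beta>. {v \<in> volt d L \<beta>. card (low_thirds d L \<beta> v) = s}"
  have "quotient_data d L r s t = (SIGMA \<beta>:rooted L r (s + t). ?V \<beta>)"
    unfolding quotient_data_def by auto
  then have "card (quotient_data d L r s t) = (\<Sum>\<beta>\<in>rooted L r (s + t). card (?V \<beta>))"
    by (simp add: card_SigmaI finite_rooted finite_volt)
  also have "\<dots> = (\<Sum>\<beta>\<in>rooted L r (s + t). (s + t choose s) * d ^ (2 * f))"
  proof (rule sum.cong[OF refl])
    fix \<beta> assume br: "\<beta> \<in> rooted L r (s + t)"
    let ?F = "{a. a < L \<and> \<beta> (next_pos L a) = a}"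
    let ?P = "{S. S \<subseteq> ?F \<and> card S = s}"
    have cF: "card ?F = s + t" using rooted_props(2)[OF br] unfolding cube_roots_def by simp
    have finP: "finite ?P" by (rule finite_subset[of _ "Pow ?F"]) auto
    have lt: "low_thirds d L \<beta> v \<subseteq> ?F" for v unfolding low_thirds_def by blast
    have "?V \<beta> = (\<Union>S\<in>?P. {v \<in> volt d L \<beta>. low_thirds d L \<beta> v = S})" using lt by blast
    then have "card (?V \<beta>) = (\<Sum>S\<in>?P. card {v \<in> volt d L \<beta>. low_thirds d L \<beta> v = S})"
      using finP by (simp only:) (subst card_UN_disjoint, auto simp: finite_volt)
    also have "\<dots> = (\<Sum>S\<in>?P. d ^ (2 * f))"
    proof (rule sum.cong[OF refl])
      fix S assume S: "S \<in> ?P"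
      interpret voltage_graph "{..<L}" \<beta> "\<beta> \<circ> next_pos L" r "s + t" d "half_volt d" by (rule volt_graph[OF L d br])
      have "{v \<in> volt d L \<beta>. low_thirds d L \<beta> v = S} = solutions (target d L \<beta> S)"
        by (rule volt_solutions[OF L d br r k]) (use S in auto)
      moreover have "card (solutions (target d L \<beta> S)) = d ^ (2 * f)"
      proof (rule card_solutions)
        show "[(\<Sum>x<L. target d L \<beta> S x) = int (r * half_volt d)] (mod int d)"
          using c S by (subst sum_target[OF L br]) auto
        show "card {..<L} + 6 = 4 * (s + t) + 3 * r + 12 * f" using f by simp
      qed
      ultimately show "card {v \<in> volt d L \<beta>. low_thirds d L \<beta> v = S} = d ^ (2 * f)" by simp
    qed
    also have "\<dots> = (s + t choose s) * d ^ (2 * f)"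
      using n_subsets[of ?F s] cF by simp
    finally show "card (?V \<beta>) = (s + t choose s) * d ^ (2 * f)" .
  qed
  finally show ?thesis by simp
qed

text \<open>Residues of order 2 or 3 must exist where they are used, the linear system must be
  solvable, and the genus of the quotient must be a natural number. These are exactly the
  assumptions of \<open>card_quotient_data\<close> beyond positivity of \<open>L\<close> and
  \<open>d\<close>.\<close>

lemma quotient_data_nonempty:
  assumes L: "L > 0" and d: "d > 0" and q: "q \<in> quotient_data d L r s t"
  shows "r > 0 \<Longrightarrow> even d" "s + t > 0 \<Longrightarrow> 3 dvd d"
    "[1 - int (s * (d div 3) + t * (2 * (d div 3))) = int (r * half_volt d)] (mod int d)"
    "\<exists>f. L + 6 = 4 * (s + t) + 3 * r + 12 * f"
proof -
  obtain \<beta> v where br: "\<beta> \<in> rooted L r (s + t)" and v: "v \<in> volt d L \<beta>" and s: "card (low_thirds d L \<beta> v) = s"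
    using q unfolding quotient_data_def by blast
  note p = rooted_props[OF br]
  let ?F = "{a. a < L \<and> \<beta> (next_pos L a) = a}"
  have cF: "card ?F = s + t" using p(2) unfolding cube_roots_def by simp
  have cr: "card {a. a < L \<and> \<beta> a = a} = r" using p(1) unfolding involutions_def by simp
  show e: "even d" if "r > 0"
  proof -
    have "{a. a < L \<and> \<beta> a = a} \<noteq> {}" using that cr by (metis card.empty less_irrefl)
    then obtain a where "a < L" "\<beta> a = a" by blast
    from volt_dvd2[OF v this] show ?thesis using odd_no_half by blast
  qed
  show k: "3 dvd d" if "s + t > 0"
  proof -
    have "?F \<noteq> {}" using that cF by (metis card.empty less_irrefl)
    then obtain a where "a < L" "\<beta> (next_pos L a) = a" by blast
    from volt_dvd3[OF v this] show ?thesis using no_third by blast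
  qed
  interpret voltage_graph "{..<L}" \<beta> "\<beta> \<circ> next_pos L" r "s + t" d "half_volt d" by (rule volt_graph[OF L d br])
  let ?S = "low_thirds d L \<beta> v"
  have S: "?S \<subseteq> ?F" unfolding low_thirds_def by blast
  have "{w \<in> volt d L \<beta>. low_thirds d L \<beta> w = ?S} = solutions (target d L \<beta> ?S)"
    by (rule volt_solutions[OF L d br e k S])
  then have "solutions (target d L \<beta> ?S) \<noteq> {}" using v by blast
  then have "[(\<Sum>x<L. target d L \<beta> ?S x) = int (r * half_volt d)] (mod int d)"
    using solutions_empty by blast
  then show "[1 - int (s * (d div 3) + t * (2 * (d div 3))) = int (r * half_volt d)] (mod int d)"
    unfolding sum_target[OF L br S s] .
  have uni: "(\<beta>, \<beta> \<circ> next_pos L) \<in> unicellular {..<L} r (s + t)"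
    unfolding unicellular_def using p next_pos_single_cycle[of L] by simp
  show "\<exists>f. L + 6 = 4 * (s + t) + 3 * r + 12 * f"
    using unicellular_nonempty_genus[OF finite_lessThan _ uni] L by (simp add: lessThan_empty_iff)
qed

text \<open>The number of sides glued to their own image under the rotation by \<open>m\<close>.
  Together with \<open>vert_shift\<close> it expresses the type of a symmetric map without mention
  of the quotient.\<close>

definition edge_shift :: "nat \<Rightarrow> (nat \<Rightarrow> nat) \<Rightarrow> nat \<Rightarrow> nat" where
  "edge_shift n \<alpha> m = card {i. i < n \<and> \<alpha> i = (i + m) mod n}"

definition vert_shift :: "nat \<Rightarrow> (nat \<Rightarrow> nat) \<Rightarrow> nat \<Rightarrow> nat" where
  "vert_shift n \<alpha> m = card {i. i < n \<and> \<alpha> (next_pos n i) = (i + m) mod n}"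

text \<open>A half-edge without partner has \<open>d\<close> preimages, where the lifted involution
  is the half turn. A leaf has \<open>d\<close> preimages, where the vertex permutation is a turn by
  one or two thirds. The type of the quotient can thus be read off upstairs.\<close>

lemma data_counts:
  assumes L: "L > 0" and d: "d > 0" and b: "\<beta> \<in> rooted L r k" and v: "v \<in> volt d L \<beta>"
  shows "even d \<Longrightarrow> edge_shift (d * L) (tw d L \<beta> v) (L * (d div 2)) = d * r"
    and "odd d \<Longrightarrow> r = 0"
    and "3 dvd d \<Longrightarrow> vert_shift (d * L) (tw d L \<beta> v) (L * (d div 3)) = d * card (low_thirds d L \<beta> v)"
    and "3 dvd d \<Longrightarrow> vert_shift (d * L) (tw d L \<beta> v) (L * (2 * (d div 3))) = d * (k - card (low_thirds d L \<beta> v))"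
    and "\<not> 3 dvd d \<Longrightarrow> k = 0"
    and "card (low_thirds d L \<beta> v) \<le> k"
proof -
  note p = rooted_props[OF b] and bl = rooted_bounds(1)[OF b]
  have cr: "card {a. a < L \<and> \<beta> a = a} = r" using p(1) unfolding involutions_def by simp
  let ?th = "\<beta> \<circ> next_pos L" and ?u = "ucorner L v"
  let ?F = "{a. a < L \<and> \<beta> (next_pos L a) = a}"
  have cF: "card ?F = k" using p(2) unfolding cube_roots_def by simp
  have tl: "?th a < L" if "a < L" for a using bl[OF next_pos_less[OF that]] by simp
  have lt: "low_thirds d L \<beta> v \<subseteq> ?F" unfolding low_thirds_def by blast
  show cl: "card (low_thirds d L \<beta> v) \<le> k" using card_mono[OF _ lt] cF by simp
  show "edge_shift (d * L) (tw d L \<beta> v) (L * (d div 2)) = d * r" if "even d"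
  proof -
    have "{a. a < L \<and> \<beta> a = a \<and> v a mod d = d div 2 mod d} = {a. a < L \<and> \<beta> a = a}"
    proof (intro equalityI subsetI)
      fix a assume "a \<in> {a. a < L \<and> \<beta> a = a}"
      then have a: "a < L" "\<beta> a = a" by auto
      have "v a = d div 2" using half_iff[OF volt_dvd2(3)[OF v a] volt_dvd2(1)[OF v a]] volt_dvd2(2)[OF v a] by blast
      then show "a \<in> {a. a < L \<and> \<beta> a = a \<and> v a mod d = d div 2 mod d}" using a by simp
    qed auto
    moreover have "card {i. i < d * L \<and> tw d L \<beta> v i = (i + L * (d div 2)) mod (d * L)}
      = d * card {a. a < L \<and> \<beta> a = a \<and> v a mod d = d div 2 mod d}"
      by (rule card_tw_shift[OF d bl])
    ultimately show ?thesis unfolding edge_shift_def using cr by simp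
  qed
  show "r = 0" if "odd d"
  proof (rule ccontr)
    assume "r \<noteq> 0"
    then have "{a. a < L \<and> \<beta> a = a} \<noteq> {}" using cr by (metis card.empty)
    then obtain a where "a < L" "\<beta> a = a" by blast
    from volt_dvd2[OF v this] show False using odd_no_half that by blast
  qed
  show "k = 0" if "\<not> 3 dvd d"
  proof (rule ccontr)
    assume "k \<noteq> 0"
    then have "?F \<noteq> {}" using cF by (metis card.empty)
    then obtain a where "a < L" "\<beta> (next_pos L a) = a" by blast
    from volt_dvd3[OF v this] show False using no_third that by blast
  qed
  have tt: "tw d L \<beta> v (next_pos (d * L) i) = tw d L ?th ?u i" for i
  proof -
    have "tw d L \<beta> v \<circ> next_pos (d * L) = tw d L ?th ?u" by (rule tw_theta[OF d L bl])
    from fun_cong[OF this, of i] show ?thesis by simp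
  qed
  have vs: "vert_shift (d * L) (tw d L \<beta> v) (L * m) = d * card {a. a < L \<and> ?th a = a \<and> ?u a mod d = m mod d}" for m
    unfolding vert_shift_def tt by (rule card_tw_shift[OF d tl])
  show "vert_shift (d * L) (tw d L \<beta> v) (L * (d div 3)) = d * card (low_thirds d L \<beta> v)"
  proof -
    have "d div 3 mod d = d div 3" using d by simp
    then show ?thesis unfolding vs low_thirds_def by simp
  qed
  show "vert_shift (d * L) (tw d L \<beta> v) (L * (2 * (d div 3))) = d * (k - card (low_thirds d L \<beta> v))" if "3 dvd d"
  proof -
    define m where "m = d div 3"
    have dm: "d = 3 * m" "m > 0" using that d unfolding m_def by auto
    have "{a. a < L \<and> ?th a = a \<and> ?u a mod d = 2 * m mod d} = ?F - low_thirds d L \<beta> v"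
    proof (intro equalityI subsetI)
      fix a assume "a \<in> {a. a < L \<and> ?th a = a \<and> ?u a mod d = 2 * m mod d}"
      then show "a \<in> ?F - low_thirds d L \<beta> v" unfolding low_thirds_def m_def[symmetric] using dm by simp
    next
      fix a assume "a \<in> ?F - low_thirds d L \<beta> v"
      then have a: "a < L" "\<beta> (next_pos L a) = a" and n: "?u a mod d \<noteq> m" unfolding low_thirds_def m_def by auto
      have "?u a mod d = m \<or> ?u a mod d = 2 * m" using iffD1[OF third_iff[OF dm]] volt_dvd3[OF v a] by blast
      then show "a \<in> {a. a < L \<and> ?th a = a \<and> ?u a mod d = 2 * m mod d}" using a n dm by simp
    qed
    moreover have "card (?F - low_thirds d L \<beta> v) = k - card (low_thirds d L \<beta> v)"
      using card_Diff_subset[OF finite_subset[OF lt] lt] cF by simp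
    ultimately show ?thesis unfolding vs m_def[symmetric] by simp
  qed
qed

definition sym_typed :: "nat \<Rightarrow> nat \<Rightarrow> nat \<Rightarrow> nat \<Rightarrow> nat \<Rightarrow> (nat \<Rightarrow> nat) set" where
  "sym_typed d L r s t = {\<alpha> \<in> sym_rooted d L. (even d \<longrightarrow> edge_shift (d * L) \<alpha> (L * (d div 2)) = d * r) \<and>
     (3 dvd d \<longrightarrow> vert_shift (d * L) \<alpha> (L * (d div 3)) = d * s \<and> vert_shift (d * L) \<alpha> (L * (2 * (d div 3))) = d * t)}"

text \<open>For odd \<open>d\<close> the edge condition in \<open>sym_typed\<close> is vacuous and
  the quotient has no free half-edges; likewise for leaves when 3 does not divide \<open>d\<close>.
  This is why \<open>r\<close>, or \<open>s\<close> and \<open>t\<close>, must be 0 in these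
  cases.\<close>

lemma card_sym_typed:
  assumes L: "L > 0" and d: "d > 0" and r: "odd d \<Longrightarrow> r = 0" and st: "\<not> 3 dvd d \<Longrightarrow> s = 0 \<and> t = 0"
  shows "card (sym_typed d L r s t) = card (quotient_data d L r s t)"
proof -
  let ?X = "{(\<beta>, v). (\<exists>r k. \<beta> \<in> rooted L r k) \<and> v \<in> volt d L \<beta>}"
  let ?T = "\<lambda>(\<beta>, v). tw d L \<beta> v"
  have bij: "bij_betw ?T ?X (sym_rooted d L)" by (rule sym_rooted_bij[OF d L])
  have iff: "tw d L \<beta> v \<in> sym_typed d L r s t \<longleftrightarrow> (\<beta>, v) \<in> quotient_data d L r s t"
    if b: "\<beta> \<in> rooted L r' k'" and v: "v \<in> volt d L \<beta>" for \<beta> v r' k'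
  proof -
    note c = data_counts[OF L d b v]
    have "(\<beta>, v) \<in> ?X" using b v by blast
    then have s0: "tw d L \<beta> v \<in> sym_rooted d L" using bij unfolding bij_betw_def by blast
    have rr: "\<beta> \<in> rooted L r (s + t) \<longleftrightarrow> r' = r \<and> k' = s + t"
      using b unfolding rooted_def involutions_def cube_roots_def by auto
    have 1: "(even d \<longrightarrow> edge_shift (d * L) (tw d L \<beta> v) (L * (d div 2)) = d * r) \<longleftrightarrow> r' = r"
      using c(1,2) r d by (cases "even d") auto
    have 2: "(3 dvd d \<longrightarrow> vert_shift (d * L) (tw d L \<beta> v) (L * (d div 3)) = d * s \<and>
        vert_shift (d * L) (tw d L \<beta> v) (L * (2 * (d div 3))) = d * t)
      \<longleftrightarrow> k' = s + t \<and> card (low_thirds d L \<beta> v) = s"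
    proof (cases "3 dvd d")
      case True
      then show ?thesis using c(3,4,6) d by auto
    next
      case False
      then show ?thesis using c(5,6) st by simp
    qed
    show ?thesis unfolding sym_typed_def quotient_data_def mem_Collect_eq prod.case 1 2 rr using s0 v by blast
  qed
  have "bij_betw ?T (quotient_data d L r s t) (sym_typed d L r s t)"
  proof (rule bij_betw_subset[OF bij])
    show "quotient_data d L r s t \<subseteq> ?X" unfolding quotient_data_def by blast
    show "?T ` quotient_data d L r s t = sym_typed d L r s t"
    proof (intro equalityI subsetI)
      fix \<alpha> assume "\<alpha> \<in> ?T ` quotient_data d L r s t"
      then obtain \<beta> v where q: "(\<beta>, v) \<in> quotient_data d L r s t" and a: "\<alpha> = tw d L \<beta> v" by auto
      then have "\<beta> \<in> rooted L r (s + t)" "v \<in> volt d L \<beta>" unfolding quotient_data_def by auto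
      then show "\<alpha> \<in> sym_typed d L r s t" unfolding a using iff q by blast
    next
      fix \<alpha> assume al: "\<alpha> \<in> sym_typed d L r s t"
      then have "\<alpha> \<in> sym_rooted d L" unfolding sym_typed_def by blast
      then have "\<alpha> \<in> ?T ` ?X" using bij unfolding bij_betw_def by blast
      then obtain \<beta> v r' k' where a: "\<alpha> = tw d L \<beta> v" and h: "\<beta> \<in> rooted L r' k'" "v \<in> volt d L \<beta>" by auto
      then have "(\<beta>, v) \<in> quotient_data d L r s t" using iff[OF h] al by blast
      then show "\<alpha> \<in> ?T ` quotient_data d L r s t" unfolding a by force
    qed
  qed
  then show ?thesis by (rule bij_betw_same_card[symmetric])
qed

lemma sym_rooted_dvd_6:
  assumes "L > 0" "d > 0" "\<alpha> \<in> sym_rooted d L"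
  shows "d dvd 6"
proof -
  have "\<alpha> \<in> (\<lambda>(\<beta>, v). tw d L \<beta> v) ` {(\<beta>, v). (\<exists>r k. \<beta> \<in> rooted L r k) \<and> v \<in> volt d L \<beta>}"
    using sym_rooted_bij[OF assms(2,1)] assms(3) unfolding bij_betw_def by blast
  then show ?thesis using volt_dvd_6[OF assms(1)] by auto
qed

text \<open>The factors are collected here. \<open>fact L\<close> cancels against the labellings and
  \<open>L\<close> against the choice of the root, so division by \<open>d * L\<close> leaves
  \<open>1 / d\<close>; the binomial coefficient splits \<open>fact (s + t)\<close> into
  \<open>fact s * fact t\<close>.\<close>

lemma sym_typed_count:
  assumes L: "L > 0" and d: "d > 0" and r: "odd d \<Longrightarrow> r = 0" and st: "\<not> 3 dvd d \<Longrightarrow> s = 0 \<and> t = 0"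
    and c: "[1 - int (s * (d div 3) + t * (2 * (d div 3))) = int (r * half_volt d)] (mod int d)"
    and f: "L + 6 = 4 * (s + t) + 3 * r + 12 * f" and V: "V + 2 = s + t + r + 3 * f"
  shows "real (card (sym_typed d L r s t)) / real (d * L)
    = (real d ^ 2) ^ f / real d * fact (2 * V) / (12 ^ f * fact f * fact r * fact s * fact t * fact V)"
proof -
  let ?k = "s + t"
  have "card (sym_typed d L r s t) = card (rooted L r ?k) * ((?k choose s) * d ^ (2 * f))"
  proof -
    have "card (sym_typed d L r s t) = card (quotient_data d L r s t)"
      by (rule card_sym_typed[OF L d r st])
    also have "\<dots> = card (rooted L r ?k) * ((?k choose s) * d ^ (2 * f))"
    proof (rule card_quotient_data[OF L d _ _ c f])
      show "even d" if "r > 0" using that r by (cases "even d") auto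
      show "3 dvd d" if "?k > 0" using that st by (cases "3 dvd d") auto
    qed
    finally show ?thesis .
  qed
  then have N: "real (card (sym_typed d L r s t)) = real (card (rooted L r ?k)) * (real (?k choose s) * (real d ^ 2) ^ f)"
    by (simp add: power_mult)
  have "fact L * card (rooted L r ?k) = L * card (unicellular {..<L} r ?k)" by (rule card_rooted[OF L])
  then have 1: "fact L * real (card (rooted L r ?k)) = real L * real (card (unicellular {..<L} r ?k))"
    by (metis of_nat_fact of_nat_mult)
  have "card (unicellular {..<L} r ?k) * (fact ?k * fact r * 12 ^ f * fact f * fact V) = fact (card {..<L}) * fact (2 * V)"
    by (rule card_unicellular) (use L f V in auto)
  then have "real (card (unicellular {..<L} r ?k) * (fact ?k * fact r * 12 ^ f * fact f * fact V)) = real (fact L * fact (2 * V))"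
    by simp
  then have 2: "real (card (unicellular {..<L} r ?k)) * (fact ?k * fact r * 12 ^ f * fact f * fact V) = fact L * fact (2 * V)"
    by (simp only: of_nat_mult of_nat_fact of_nat_power of_nat_numeral)
  have "fact s * fact (?k - s) * (?k choose s) = fact ?k" by (rule binomial_fact_lemma) simp
  then have "real (fact s * fact t * (?k choose s)) = real (fact ?k)" by simp
  then have 3: "fact s * fact t * real (?k choose s) = fact ?k" by (simp only: of_nat_mult of_nat_fact)
  define R where "R = real (card (rooted L r ?k))"
  define U where "U = real (card (unicellular {..<L} r ?k))"
  have R: "R = real L * U / fact L" using 1 unfolding R_def U_def by (simp add: field_simps)
  have U: "U = fact L * fact (2 * V) / (fact ?k * fact r * 12 ^ f * fact f * fact V)"
    using 2 unfolding U_def by (simp add: field_simps)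
  have "R = real L * fact (2 * V) / (fact ?k * fact r * 12 ^ f * fact f * fact V)"
    unfolding R U by simp
  then show ?thesis unfolding N R_def[symmetric] using L d unfolding 3[symmetric] by (simp add: field_simps)
qed

section \<open>Words and involutions of positions\<close>

lemma letter_inv_inv [simp]: "letter_inv (letter_inv a) = a"
  unfolding letter_inv_def by simp

lemma letter_inv_neq [simp]: "letter_inv a \<noteq> a" "a \<noteq> letter_inv a"
  unfolding letter_inv_def by (metis snd_conv)+

definition paired :: "letter list \<Rightarrow> bool" where
  "paired w \<longleftrightarrow> distinct w \<and> (\<forall>a\<in>set w. letter_inv a \<in> set w)"

lemma count_list_card: "count_list w a = card {i. i < length w \<and> w ! i = a}"
  unfolding count_list_eq_length_filter length_filter_conv_card by (simp add: eq_commute)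

text \<open>The condition for the inverse letter gives the multiplicity of the letter itself, so
  every letter that occurs does so exactly once.\<close>

lemma paired_iff: "paired w \<longleftrightarrow> (\<forall>a\<in>set w. count_list w (letter_inv a) = 1)"
proof
  assume p: "paired w"
  show "\<forall>a\<in>set w. count_list w (letter_inv a) = 1"
  proof
    fix a assume "a \<in> set w"
    then have "letter_inv a \<in> set w" using p unfolding paired_def by blast
    then obtain k where k: "k < length w" "w ! k = letter_inv a" by (auto simp: in_set_conv_nth)
    have "x = k" if "x < length w" "w ! x = letter_inv a" for x
      using p that k nth_eq_iff_index_eq[of w x k] unfolding paired_def by simp
    then have "{i. i < length w \<and> w ! i = letter_inv a} = {k}" using k by blast
    then show "count_list w (letter_inv a) = 1" unfolding count_list_card by simp
  qed
next
  assume h: "\<forall>a\<in>set w. count_list w (letter_inv a) = 1"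
  have mem: "letter_inv a \<in> set w" if "a \<in> set w" for a
  proof (rule ccontr)
    assume "letter_inv a \<notin> set w"
    then have "count_list w (letter_inv a) = 0" by (simp add: count_list_0_iff)
    then show False using h that by auto
  qed
  have one: "card {i. i < length w \<and> w ! i = a} = 1" if "a \<in> set w" for a
    using h mem[OF that] unfolding count_list_card[symmetric] by (metis letter_inv_inv)
  have "distinct w" unfolding distinct_conv_nth
  proof (intro allI impI notI)
    fix i j assume ij: "i < length w" "j < length w" "i \<noteq> j" "w ! i = w ! j"
    have "card {x. x < length w \<and> w ! x = w ! i} = 1" by (rule one) (use ij in simp)
    then obtain x where x: "{x. x < length w \<and> w ! x = w ! i} = {x}" by (rule card_1_singletonE)
    have "i \<in> {x}" "j \<in> {x}" unfolding x[symmetric] using ij by auto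
    then show False using ij(3) by simp
  qed
  then show "paired w" unfolding paired_def using mem by blast
qed

definition pairing :: "letter list \<Rightarrow> nat \<Rightarrow> nat" where
  "pairing w i = (if i < length w then (THE j. j < length w \<and> w ! j = letter_inv (w ! i)) else i)"

lemma paired_nth_eq: "paired w \<Longrightarrow> i < length w \<Longrightarrow> j < length w \<Longrightarrow> w ! i = w ! j \<longleftrightarrow> i = j"
  unfolding paired_def by (simp add: nth_eq_iff_index_eq)

lemma pairing_props:
  assumes p: "paired w" and i: "i < length w"
  shows "pairing w i < length w" "w ! pairing w i = letter_inv (w ! i)"
proof -
  have "letter_inv (w ! i) \<in> set w" using p i unfolding paired_def by simp
  then obtain j where j: "j < length w" "w ! j = letter_inv (w ! i)" by (auto simp: in_set_conv_nth)
  have "\<exists>!j. j < length w \<and> w ! j = letter_inv (w ! i)"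
  proof (rule ex1I[of _ j])
    fix x assume x: "x < length w \<and> w ! x = letter_inv (w ! i)"
    then have "w ! x = w ! j" using j by simp
    then show "x = j" using paired_nth_eq[OF p] x j by blast
  qed (use j in simp)
  from theI'[OF this] show "pairing w i < length w" "w ! pairing w i = letter_inv (w ! i)"
    unfolding pairing_def using i by auto
qed

lemma pairing_eq_iff:
  assumes p: "paired w" and i: "i < length w" and j: "j < length w"
  shows "pairing w i = j \<longleftrightarrow> w ! j = letter_inv (w ! i)"
  using pairing_props[OF p i] paired_nth_eq[OF p _ j, of "pairing w i"] by auto

lemma pairing_out: "\<not> i < length w \<Longrightarrow> pairing w i = i"
  unfolding pairing_def by simp

lemma pairing_invol:
  assumes p: "paired w"
  shows "pairing w (pairing w i) = i"
proof (cases "i < length w")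
  case True
  note q = pairing_props[OF p True]
  have "w ! i = letter_inv (w ! pairing w i)" using q(2) by simp
  then show ?thesis using pairing_eq_iff[OF p q(1) True] by blast
qed (simp add: pairing_out)

lemma pairing_neq: "paired w \<Longrightarrow> i < length w \<Longrightarrow> pairing w i \<noteq> i"
  using pairing_props(2)[of w i] by (metis letter_inv_neq(1))

lemma cyclic_factor2_iff:
  "cyclic_factor [a, b] w \<longleftrightarrow> length w \<ge> 2 \<and> (\<exists>i<length w. w ! i = a \<and> w ! (Suc i mod length w) = b)"
proof
  assume "cyclic_factor [a, b] w"
  then obtain v k where r: "rotate k w = [a, b] @ v" unfolding cyclic_factor_def same_cyclic_word_def by blast
  have len: "length w = length v + 2" using arg_cong[OF r, of length] by simp
  have "rotate k w ! 0 = a" "rotate k w ! 1 = b" unfolding r by simp_all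
  then have "w ! (k mod length w) = a" "w ! (Suc k mod length w) = b"
    using nth_rotate[of 0 w k] nth_rotate[of 1 w k] len by simp_all
  moreover have "Suc (k mod length w) mod length w = Suc k mod length w" by (simp add: mod_Suc_eq)
  moreover have "k mod length w < length w" using len by simp
  ultimately show "length w \<ge> 2 \<and> (\<exists>i<length w. w ! i = a \<and> w ! (Suc i mod length w) = b)"
    using len by (metis le_add2)
next
  assume h: "length w \<ge> 2 \<and> (\<exists>i<length w. w ! i = a \<and> w ! (Suc i mod length w) = b)"
  then obtain i where i: "i < length w" "w ! i = a" "w ! (Suc i mod length w) = b" by blast
  have "w \<noteq> []" using i(1) by auto
  then have "rotate i w ! 0 = a" "rotate i w ! 1 = b"
    using nth_rotate[of 0 w i] nth_rotate[of 1 w i] h i by simp_all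
  moreover have "length (rotate i w) \<ge> 2" using h by simp
  ultimately have "rotate i w = [a, b] @ drop 2 (rotate i w)"
  proof (cases "rotate i w")
    case (Cons x xs) note c1 = this
    then show ?thesis using \<open>rotate i w ! 0 = a\<close> \<open>rotate i w ! 1 = b\<close> \<open>length (rotate i w) \<ge> 2\<close>
      by (cases xs) auto
  qed auto
  then show "cyclic_factor [a, b] w" unfolding cyclic_factor_def same_cyclic_word_def by blast
qed

text \<open>The vertex permutation of the gluing: the side after corner \<open>i\<close> is crossed
  to the side glued with it, and the corner at the end of that side is the next one around the same
  vertex.\<close>

definition corner :: "letter list \<Rightarrow> nat \<Rightarrow> nat" where
  "corner w = pairing w \<circ> next_pos (length w)"

lemma corner_props:
  assumes p: "paired w"
  shows "i < length w \<Longrightarrow> corner w i < length w"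
    "i < length w \<Longrightarrow> j < length w \<Longrightarrow> corner w i = j \<longleftrightarrow> w ! (Suc i mod length w) = letter_inv (w ! j)"
    "corner w permutes {..<length w}"
proof -
  have pp: "pairing w permutes {..<length w}"
    by (rule permutes_of_involution) (use pairing_invol[OF p] in \<open>auto simp: pairing_out\<close>)
  show cp: "corner w permutes {..<length w}" unfolding corner_def using permutes_compose[OF next_pos_permutes pp] .
  show "corner w i < length w" if "i < length w" using permutes_in_image[OF cp, of i] that by simp
  show "corner w i = j \<longleftrightarrow> w ! (Suc i mod length w) = letter_inv (w ! j)" if "i < length w" "j < length w"
  proof -
    have "length w > 0" using that by linarith
    then have n: "next_pos (length w) i = Suc i mod length w" "Suc i mod length w < length w" using that by (simp_all add: next_pos_def)
    have "corner w i = j \<longleftrightarrow> w ! j = letter_inv (w ! (Suc i mod length w))"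
      unfolding corner_def comp_apply n(1) by (rule pairing_eq_iff[OF p n(2) that(2)])
    also have "\<dots> \<longleftrightarrow> w ! (Suc i mod length w) = letter_inv (w ! j)" by (metis letter_inv_inv)
    finally show ?thesis .
  qed
qed

lemma paired_length:
  assumes p: "paired w" and ne: "w \<noteq> []"
  shows "length w \<ge> 2"
proof (rule ccontr)
  assume "\<not> length w \<ge> 2"
  moreover have "length w \<noteq> 0" using ne by simp
  ultimately have "length w = 1" by linarith
  then show False using pairing_neq[OF p, of 0] pairing_props(1)[OF p, of 0] by simp
qed

text \<open>A letter followed by its inverse is a vertex of degree 1, and two factors forbidden by
  the third condition form an orbit of \<open>corner w\<close> of length at most 2. The Wicks
  conditions thus say that every vertex has degree at least 3.\<close>

lemma oriented_wicks_iff: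
  assumes ne: "w \<noteq> []"
  shows "oriented_wicks w \<longleftrightarrow> paired w \<and> (\<forall>i<length w. corner w i \<noteq> i \<and> corner w (corner w i) \<noteq> i)"
proof (cases "paired w")
  case p: True
  note len = paired_length[OF p ne] and c = corner_props[OF p]
  let ?n = "length w"
  have A: "(\<forall>a. \<not> cyclic_factor [a, letter_inv a] w) \<longleftrightarrow> (\<forall>i<?n. corner w i \<noteq> i)"
  proof
    assume h: "\<forall>a. \<not> cyclic_factor [a, letter_inv a] w"
    show "\<forall>i<?n. corner w i \<noteq> i"
    proof (intro allI impI notI)
      fix i assume i: "i < ?n" "corner w i = i"
      have "w ! (Suc i mod ?n) = letter_inv (w ! i)" using iffD1[OF c(2)[OF i(1) i(1)] i(2)] .
      then have "cyclic_factor [w ! i, letter_inv (w ! i)] w" unfolding cyclic_factor2_iff using len i(1) by blast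
      then show False using h by blast
    qed
  next
    assume h: "\<forall>i<?n. corner w i \<noteq> i"
    show "\<forall>a. \<not> cyclic_factor [a, letter_inv a] w"
    proof (intro allI notI)
      fix a assume "cyclic_factor [a, letter_inv a] w"
      then obtain i where i: "i < ?n" "w ! i = a" "w ! (Suc i mod ?n) = letter_inv a" unfolding cyclic_factor2_iff by blast
      have "corner w i = i" using iffD2[OF c(2)[OF i(1) i(1)]] i by simp
      then show False using h i(1) by blast
    qed
  qed
  have B: "(\<forall>a b. cyclic_factor [a, b] w \<longrightarrow> \<not> cyclic_factor [letter_inv b, letter_inv a] w)
      \<longleftrightarrow> (\<forall>i<?n. corner w (corner w i) \<noteq> i)"
  proof
    assume h: "\<forall>a b. cyclic_factor [a, b] w \<longrightarrow> \<not> cyclic_factor [letter_inv b, letter_inv a] w"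
    show "\<forall>i<?n. corner w (corner w i) \<noteq> i"
    proof (intro allI impI notI)
      fix i assume i: "i < ?n" "corner w (corner w i) = i"
      define j where "j = corner w i"
      have j: "j < ?n" using c(1)[OF i(1)] j_def by simp
      have e1: "w ! (Suc i mod ?n) = letter_inv (w ! j)" using c(2)[OF i(1) j] j_def by blast
      have e2: "w ! (Suc j mod ?n) = letter_inv (w ! i)" using c(2)[OF j i(1)] i(2) j_def by blast
      have "cyclic_factor [w ! i, w ! (Suc i mod ?n)] w" unfolding cyclic_factor2_iff using len i(1) by blast
      moreover have "cyclic_factor [w ! j, w ! (Suc j mod ?n)] w" unfolding cyclic_factor2_iff using len j by blast
      then have "cyclic_factor [letter_inv (w ! (Suc i mod ?n)), letter_inv (w ! i)] w" unfolding e1 e2 letter_inv_inv .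
      ultimately show False using h by blast
    qed
  next
    assume h: "\<forall>i<?n. corner w (corner w i) \<noteq> i"
    show "\<forall>a b. cyclic_factor [a, b] w \<longrightarrow> \<not> cyclic_factor [letter_inv b, letter_inv a] w"
    proof (intro allI impI notI)
      fix a b assume f: "cyclic_factor [a, b] w" "cyclic_factor [letter_inv b, letter_inv a] w"
      obtain i where i: "i < ?n" "w ! i = a" "w ! (Suc i mod ?n) = b" using f(1) unfolding cyclic_factor2_iff by blast
      obtain j where j: "j < ?n" "w ! j = letter_inv b" "w ! (Suc j mod ?n) = letter_inv a" using f(2) unfolding cyclic_factor2_iff by blast
      have e1: "corner w i = j" using c(2)[OF i(1) j(1)] i(3) j(2) by simp
      have e2: "corner w j = i" using c(2)[OF j(1) i(1)] i(2) j(3) by simp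
      have "corner w (corner w i) = i" unfolding e1 by (rule e2)
      then show False using h i(1) by blast
    qed
  qed
  show ?thesis unfolding oriented_wicks_def A B paired_iff[symmetric] using p by blast
next
  case False
  then show ?thesis unfolding oriented_wicks_def paired_iff[symmetric] by blast
qed

section \<open>Edges, vertices and genus of a word\<close>

lemma card_inverse_pairs:
  assumes fin: "finite B" and inv: "\<And>a. a \<in> B \<Longrightarrow> letter_inv a \<in> B"
  shows "2 * card {{a, letter_inv a} | a. a \<in> B} = card B"
proof -
  let ?T = "{a \<in> B. snd a}" and ?F = "{a \<in> B. \<not> snd a}"
  have sn: "snd (letter_inv a) \<longleftrightarrow> \<not> snd a" for a unfolding letter_inv_def by simp
  have "bij_betw letter_inv ?T ?F"
    by (rule bij_betw_byWitness[where f' = letter_inv]) (use inv sn in auto)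
  then have "card ?T = card ?F" by (rule bij_betw_same_card)
  moreover have "card B = card (?T \<union> ?F)" by (rule arg_cong[where f = card]) auto
  moreover have "card (?T \<union> ?F) = card ?T + card ?F" using fin by (intro card_Un_disjoint) auto
  moreover have "{{a, letter_inv a} | a. a \<in> B} = (\<lambda>a. {a, letter_inv a}) ` ?T"
  proof (intro equalityI subsetI)
    fix e assume "e \<in> {{a, letter_inv a} | a. a \<in> B}"
    then obtain a where a: "e = {a, letter_inv a}" "a \<in> B" by blast
    show "e \<in> (\<lambda>a. {a, letter_inv a}) ` ?T"
    proof (cases "snd a")
      case True then show ?thesis using a by blast
    next
      case False
      then have "letter_inv a \<in> ?T" using sn inv a by simp
      moreover have "e = {letter_inv a, letter_inv (letter_inv a)}" using a by auto
      ultimately show ?thesis by blast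
    qed
  qed auto
  moreover have "inj_on (\<lambda>a. {a, letter_inv a}) ?T"
  proof (rule inj_onI)
    fix a b assume h: "a \<in> ?T" "b \<in> ?T" "{a, letter_inv a} = {b, letter_inv b}"
    then have "a = b \<or> a = letter_inv b" by blast
    then show "a = b" using h sn[of b] by auto
  qed
  ultimately show ?thesis by (simp add: card_image)
qed

lemma card_edges: "paired w \<Longrightarrow> 2 * card (edges w) = length w"
proof -
  assume p: "paired w"
  have "2 * card {{a, letter_inv a} | a. a \<in> set w} = card (set w)"
    by (rule card_inverse_pairs) (use p in \<open>auto simp: paired_def\<close>)
  then show ?thesis using p unfolding edges_def paired_def by (simp add: distinct_card)
qed

definition glue_rel :: "letter list \<Rightarrow> (nat \<times> nat) set" where
  "glue_rel w = (corner_gluing w \<union> (corner_gluing w)\<inverse>)\<^sup>*"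

lemma glue_equiv: "equiv UNIV (glue_rel w)"
proof (rule equivI)
  show "refl (glue_rel w)" unfolding glue_rel_def by (rule refl_rtrancl)
  show "sym (glue_rel w)" unfolding glue_rel_def by (intro sym_rtrancl sym_Un_converse)
  show "trans (glue_rel w)" unfolding glue_rel_def by (rule trans_rtrancl)
qed auto

lemma glue_trans: "(x, y) \<in> glue_rel w \<Longrightarrow> (y, z) \<in> glue_rel w \<Longrightarrow> (x, z) \<in> glue_rel w"
  unfolding glue_rel_def by (rule rtrancl_trans)

lemma glue_refl: "(x, x) \<in> glue_rel w"
  unfolding glue_rel_def by (rule rtrancl_refl)

lemma vertices_eq: "vertices w = {glue_rel w `` {i} | i. i < length w}"
  unfolding vertices_def glue_rel_def[symmetric] quotient_def by auto

lemma vertices_elim: "V \<in> vertices w \<Longrightarrow> \<exists>i. V = glue_rel w `` {i} \<and> i < length w"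
  unfolding vertices_eq mem_Collect_eq .

lemma corner_gluing_eq:
  assumes p: "paired w"
  shows "corner_gluing w = {(corner w j, j) | j. j < length w}"
  unfolding corner_gluing_def using corner_props(1,2)[OF p] by auto

text \<open>The classes are defined through a symmetric reflexive-transitive closure; sets closed in
  both directions under \<open>corner w\<close> bound them from above.\<close>

lemma glue_closed:
  assumes p: "paired w" and T: "\<And>x. x \<in> T \<Longrightarrow> x < length w" "\<And>x. x < length w \<Longrightarrow> x \<in> T \<longleftrightarrow> corner w x \<in> T"
    and xy: "(x, y) \<in> glue_rel w" and x: "x \<in> T"
  shows "y \<in> T"
  using xy unfolding glue_rel_def
proof (induction rule: rtrancl_induct)
  case base then show ?case by (rule x)
next
  case (step y z)
  then have "(\<exists>j<length w. y = corner w j \<and> z = j) \<or> (\<exists>j<length w. z = corner w j \<and> y = j)"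
    unfolding corner_gluing_eq[OF p] by auto
  then show ?case using step.IH T(2) by auto
qed

lemma glue_step: "paired w \<Longrightarrow> i < length w \<Longrightarrow> (i, corner w i) \<in> glue_rel w"
  unfolding glue_rel_def by (rule r_into_rtrancl) (auto simp: corner_gluing_eq)

lemma glue_bound:
  assumes "paired w" "(x, y) \<in> glue_rel w" "x < length w"
  shows "y < length w"
proof -
  have "y \<in> {..<length w}"
    by (rule glue_closed[OF assms(1) _ _ assms(2)]) (use assms(3) corner_props(1)[OF assms(1)] in auto)
  then show ?thesis by simp
qed

lemma glue_class_cubic:
  assumes p: "paired w" and t3: "\<And>i. corner w (corner w (corner w i)) = i" and i: "i < length w"
  shows "glue_rel w `` {i} = {i, corner w i, corner w (corner w i)}"
proof (intro equalityI subsetI)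
  let ?T = "{i, corner w i, corner w (corner w i)}"
  have iff: "corner w x \<in> ?T \<longleftrightarrow> x \<in> ?T" for x by (rule cube_root_orbit_closed[OF t3 refl])
  fix y assume "y \<in> glue_rel w `` {i}"
  then have y: "(i, y) \<in> glue_rel w" by simp
  show "y \<in> ?T"
  proof (rule glue_closed[OF p _ _ y])
    show "x < length w" if "x \<in> ?T" for x using that i corner_props(1)[OF p] by auto
    show "x \<in> ?T \<longleftrightarrow> corner w x \<in> ?T" for x using iff[of x] by (rule sym)
  qed simp
next
  fix y assume "y \<in> {i, corner w i, corner w (corner w i)}"
  moreover have "(i, corner w i) \<in> glue_rel w" by (rule glue_step[OF p i])
  moreover have "(corner w i, corner w (corner w i)) \<in> glue_rel w" by (rule glue_step[OF p corner_props(1)[OF p i]])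
  ultimately show "y \<in> glue_rel w `` {i}" using glue_trans glue_refl by blast
qed

lemma vertices_card_sum:
  assumes p: "paired w"
  shows "(\<Sum>V\<in>vertices w. card V) = length w" "finite (vertices w)" "\<And>V. V \<in> vertices w \<Longrightarrow> finite V"
proof -
  have sub: "V \<subseteq> {..<length w}" if "V \<in> vertices w" for V
    using that glue_bound[OF p] unfolding vertices_eq by auto
  show fv: "finite V" if "V \<in> vertices w" for V using sub[OF that] finite_subset by blast
  have "vertices w \<subseteq> Pow {..<length w}" using sub by blast
  then show fin: "finite (vertices w)" by (rule finite_subset) simp
  have "vertices w \<subseteq> UNIV // glue_rel w" unfolding vertices_eq quotient_def by auto
  then have disj: "V \<inter> V' = {}" if "V \<in> vertices w" "V' \<in> vertices w" "V \<noteq> V'" for V V'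
    using quotient_disj[OF glue_equiv, of V w V'] that by blast
  have "\<Union> (vertices w) = {..<length w}"
  proof (intro equalityI subsetI)
    fix i assume "i \<in> {..<length w}"
    then have "glue_rel w `` {i} \<in> vertices w" "i \<in> glue_rel w `` {i}"
      unfolding vertices_eq by (auto simp: glue_rel_def)
    then show "i \<in> \<Union> (vertices w)" by blast
  qed (use sub in blast)
  moreover have "card (\<Union> (vertices w)) = (\<Sum>V\<in>vertices w. card V)"
    by (rule card_Union_disjoint) (use disj fv in \<open>auto simp: pairwise_def disjnt_def\<close>)
  ultimately show "(\<Sum>V\<in>vertices w. card V) = length w" by simp
qed

lemma cubic_iff:
  assumes p: "paired w"
  shows "pairing w \<in> rooted (length w) 0 0 \<longleftrightarrow> (\<forall>i. corner w (corner w (corner w i)) = i) \<and> (\<forall>i<length w. corner w i \<noteq> i)"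
  unfolding rooted00_iff corner_def[symmetric]
proof -
  have absorb: "P \<Longrightarrow> Q \<Longrightarrow> R \<Longrightarrow> (P \<and> Q \<and> R \<and> S) = S" for P Q R S by blast
  show "((\<forall>i. \<not> i < length w \<longrightarrow> pairing w i = i) \<and> (\<forall>i. pairing w (pairing w i) = i) \<and>
    (\<forall>i<length w. pairing w i \<noteq> i) \<and> (\<forall>i. corner w (corner w (corner w i)) = i) \<and> (\<forall>i<length w. corner w i \<noteq> i)) =
    ((\<forall>i. corner w (corner w (corner w i)) = i) \<and> (\<forall>i<length w. corner w i \<noteq> i))"
    by (rule absorb) (intro allI impI; rule pairing_out pairing_invol[OF p] pairing_neq[OF p]; assumption)+
qed

text \<open>A paired word of this length has \<open>6 * g - 3\<close> edges, so genus
  \<open>g\<close> means \<open>3 * card (vertices w) = length w\<close>, an average degree of 3.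
  The Wicks conditions bound every degree below by 3, which forces equality everywhere; conversely,
  degree 3 throughout gives both the conditions and the genus.\<close>

lemma maximal_wicks_iff:
  assumes g: "g \<ge> 1"
  shows "maximal_wicks g w \<longleftrightarrow> length w = 12 * g - 6 \<and> paired w \<and> pairing w \<in> rooted (12 * g - 6) 0 0"
proof -
  have lenq: "int (length w) = 6 * (2 * int g - 1) \<longleftrightarrow> length w = 12 * g - 6" 
  proof -
    have "int (12 * g - 6) = 6 * (2 * int g - 1)" using g by simp
    then show ?thesis by (simp only: of_nat_eq_iff flip: \<open>int (12 * g - 6) = 6 * (2 * int g - 1)\<close>)
  qed
  show ?thesis
  proof (cases "length w = 12 * g - 6 \<and> paired w")
    case True
    then have len: "length w = 12 * g - 6" and p: "paired w" by auto
    have ne: "w \<noteq> []" using len g by auto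
    have ed: "card (edges w) = 6 * g - 3" using card_edges[OF p] len g by linarith
    have genus: "has_genus w g \<longleftrightarrow> 3 * card (vertices w) = length w"
    proof -
      have "int (card (edges w)) = 6 * int g - 3" using ed g by simp
      moreover have "int (length w) = 12 * int g - 6" using len g by simp
      moreover have "3 * card (vertices w) = length w \<longleftrightarrow> 3 * int (card (vertices w)) = int (length w)" by linarith
      moreover have "(v - e + 1 = 2 - 2 * a) = (3 * v = l)" if "e = 6 * a - 3" "l = 12 * a - 6" for v e a l :: int
        using that by linarith
      ultimately show ?thesis unfolding has_genus_def using ne by simp
    qed
    have "oriented_wicks w \<and> 3 * card (vertices w) = length w \<longleftrightarrow> pairing w \<in> rooted (length w) 0 0"
    proof
      assume h: "oriented_wicks w \<and> 3 * card (vertices w) = length w"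
      then have nf: "corner w i \<noteq> i" "corner w (corner w i) \<noteq> i" if "i < length w" for i
        using that oriented_wicks_iff[OF ne] by blast+
      have cl: "{i, corner w i, corner w (corner w i)} \<subseteq> glue_rel w `` {i}" if i: "i < length w" for i
      proof -
        have 1: "(i, corner w i) \<in> glue_rel w" by (rule glue_step[OF p i])
        have "(corner w i, corner w (corner w i)) \<in> glue_rel w" by (rule glue_step[OF p corner_props(1)[OF p i]])
        then have "(i, corner w (corner w i)) \<in> glue_rel w" by (rule glue_trans[OF 1])
        then show ?thesis using 1 glue_refl by blast
      qed
      have c3: "card {i, corner w i, corner w (corner w i)} = 3" if i: "i < length w" for i
      proof -
        have "corner w i \<noteq> i" "corner w (corner w i) \<noteq> corner w i" "corner w (corner w i) \<noteq> i"
          using nf[OF i] nf(1)[OF corner_props(1)[OF p i]] by auto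
        then show ?thesis by auto
      qed
      note vs = vertices_card_sum[OF p]
      have ge: "card V \<ge> 3" if Vin: "V \<in> vertices w" for V
      proof -
        obtain i where i: "i < length w" "V = glue_rel w `` {i}" using vertices_elim[OF Vin] by blast
        have "card {i, corner w i, corner w (corner w i)} \<le> card V"
          by (rule card_mono[OF vs(3)[OF Vin]]) (use cl[OF i(1)] i(2) in simp)
        then show ?thesis using c3[OF i(1)] by simp
      qed
      have eq3: "card V = 3" if V: "V \<in> vertices w" for V
      proof (rule ccontr)
        assume "card V \<noteq> 3"
        then have "card V > 3" using ge[OF V] by simp
        then have "(\<Sum>V\<in>vertices w. 3) < (\<Sum>V\<in>vertices w. card V)"
          by (intro sum_strict_mono_ex1[OF vs(2)]) (use ge V in auto)
        then show False using vs(1) h by simp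
      qed
      have cls: "glue_rel w `` {i} = {i, corner w i, corner w (corner w i)}" if i: "i < length w" for i
      proof -
        have V: "glue_rel w `` {i} \<in> vertices w" unfolding vertices_eq using i by blast
        show ?thesis by (rule card_subset_eq[OF vs(3)[OF V] cl[OF i], symmetric]) (simp only: eq3[OF V] c3[OF i])
      qed
      \<comment> \<open>The image of the third corner lies in the same class of three corners and is
        neither the second nor the third of them, so the orbit closes.\<close>
      have t3: "corner w (corner w (corner w i)) = i" for i
      proof (cases "i < length w")
        case True
        define j k where "j = corner w i" and "k = corner w j"
        have jL: "j < length w" "k < length w" using corner_props(1)[OF p] True unfolding j_def k_def by auto
        have "(i, corner w k) \<in> glue_rel w"
        proof (rule glue_trans)
          show "(i, k) \<in> glue_rel w" using cl[OF True] unfolding j_def k_def by blast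
          show "(k, corner w k) \<in> glue_rel w" by (rule glue_step[OF p jL(2)])
        qed
        then have "corner w k \<in> {i, j, k}" using cls[OF True] unfolding j_def k_def by auto
        moreover have "corner w k \<noteq> j" using nf(2)[OF jL(1)] unfolding k_def .
        moreover have "corner w k \<noteq> k" using nf(1)[OF jL(2)] .
        ultimately show ?thesis unfolding j_def k_def by simp
      next
        case False
        then have "corner w i = i" using corner_props(3)[OF p] unfolding permutes_def by simp
        then show ?thesis by simp
      qed
      show "pairing w \<in> rooted (length w) 0 0" unfolding cubic_iff[OF p] using t3 nf(1) by blast
    next
      assume "pairing w \<in> rooted (length w) 0 0"
      then have t3: "\<And>i. corner w (corner w (corner w i)) = i" and nf: "\<And>i. i < length w \<Longrightarrow> corner w i \<noteq> i"
        unfolding cubic_iff[OF p] by blast+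
      have dist: "corner w (corner w i) \<noteq> corner w i" "corner w (corner w i) \<noteq> i" if "i < length w" for i
        using cube_root_orbit_distinct[of "corner w", OF t3 nf[OF that]] by blast+
      have "oriented_wicks w" unfolding oriented_wicks_iff[OF ne] using p nf dist by blast
      moreover have "card V = 3" if V: "V \<in> vertices w" for V
      proof -
        obtain i where i: "i < length w" "V = glue_rel w `` {i}" using vertices_elim[OF V] by blast
        have "V = {i, corner w i, corner w (corner w i)}" unfolding i(2) by (rule glue_class_cubic[OF p t3 i(1)])
        then show ?thesis using nf[OF i(1)] dist[OF i(1)] by auto
      qed
      then have "3 * card (vertices w) = length w" using vertices_card_sum(1)[OF p] by simp
      ultimately show "oriented_wicks w \<and> 3 * card (vertices w) = length w" by blast
    qed
    moreover have "maximal_wicks g w \<longleftrightarrow> oriented_wicks w \<and> 3 * card (vertices w) = length w"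
      unfolding maximal_wicks_def lenq genus using len by blast
    ultimately show ?thesis using p len by (simp only: simp_thms)
  next
    case False
    then show ?thesis unfolding maximal_wicks_def lenq oriented_wicks_def paired_iff[symmetric] by blast
  qed
qed

text \<open>Both sides of a glued pair are named after the smaller position, which carries the
  positive letter; every abstract gluing is thereby realised by a word.\<close>

definition word_of :: "nat \<Rightarrow> (nat \<Rightarrow> nat) \<Rightarrow> letter list" where
  "word_of n \<alpha> = map (\<lambda>i. (min i (\<alpha> i), i < \<alpha> i)) [0..<n]"

lemma word_of_props:
  assumes a: "\<alpha> \<in> rooted n 0 0"
  shows "length (word_of n \<alpha>) = n" "paired (word_of n \<alpha>)" "pairing (word_of n \<alpha>) = \<alpha>"
proof -
  have out: "\<And>i. \<not> i < n \<Longrightarrow> \<alpha> i = i" and inv: "\<And>i. \<alpha> (\<alpha> i) = i" and nf: "\<And>i. i < n \<Longrightarrow> \<alpha> i \<noteq> i"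
    using a unfolding rooted00_iff by blast+
  have lt: "\<alpha> i < n" if "i < n" for i
  proof (rule ccontr)
    assume h: "\<not> \<alpha> i < n"
    then have "\<alpha> (\<alpha> i) = \<alpha> i" by (rule out)
    then show False using inv[of i] nf[OF that] by simp
  qed
  let ?w = "word_of n \<alpha>"
  show len: "length ?w = n" unfolding word_of_def by simp
  have nth: "?w ! i = (min i (\<alpha> i), i < \<alpha> i)" if "i < n" for i using that unfolding word_of_def by simp
  have inv_nth: "?w ! \<alpha> i = letter_inv (?w ! i)" if i: "i < n" for i
    unfolding nth[OF i] nth[OF lt[OF i]] letter_inv_def inv using nf[OF i] by (auto simp: min.commute)
  have inj: "i = j" if ij: "i < n" "j < n" "?w ! i = ?w ! j" for i j
  proof -
    have e: "min i (\<alpha> i) = min j (\<alpha> j)" "i < \<alpha> i \<longleftrightarrow> j < \<alpha> j" using ij(3) unfolding nth[OF ij(1)] nth[OF ij(2)] by auto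
    show ?thesis
    proof (cases "i < \<alpha> i")
      case True then show ?thesis using e by simp
    next
      case False
      then have "\<alpha> i = \<alpha> j" using e by simp
      then have "\<alpha> (\<alpha> i) = \<alpha> (\<alpha> j)" by simp
      then show ?thesis unfolding inv .
    qed
  qed
  have "distinct ?w" unfolding distinct_conv_nth len using inj by blast
  moreover have "letter_inv a \<in> set ?w" if "a \<in> set ?w" for a
  proof -
    obtain i where "i < n" "a = ?w ! i" using \<open>a \<in> set ?w\<close> len by (auto simp: in_set_conv_nth)
    then show ?thesis using inv_nth[of i] lt[of i] len nth_mem[of "\<alpha> i" ?w] by simp
  qed
  ultimately show p: "paired ?w" unfolding paired_def by blast
  show "pairing ?w = \<alpha>"
  proof
    fix i show "pairing ?w i = \<alpha> i"
    proof (cases "i < n")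
      case True
      then show ?thesis using pairing_eq_iff[OF p, of i "\<alpha> i"] inv_nth[OF True] lt[OF True] len by simp
    next
      case False then show ?thesis using out len pairing_out[of i ?w] by simp
    qed
  qed
qed

section \<open>Automorphisms and masses\<close>

definition shifts :: "nat \<Rightarrow> nat \<Rightarrow> nat \<Rightarrow> nat" where
  "shifts n k = next_pos n ^^ k"

lemma shifts_apply: "i < n \<Longrightarrow> shifts n k i = (i + k) mod n"
  unfolding shifts_def by (induction k) (auto simp: next_pos_def mod_Suc_eq)

lemma shifts_out: "\<not> i < n \<Longrightarrow> shifts n k i = i"
  unfolding shifts_def by (induction k) (auto simp: next_pos_def)

lemma shifts_add: "shifts n (j + k) = shifts n j \<circ> shifts n k"
  unfolding shifts_def by (rule funpow_add)

lemma shifts_mod: "shifts n (k mod n) = shifts n k"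
proof
  fix i show "shifts n (k mod n) i = shifts n k i"
    by (cases "i < n") (simp_all add: shifts_apply shifts_out mod_add_right_eq)
qed

lemma shifts_permutes: "shifts n k permutes {..<n}"
proof -
  have "next_pos n ^^ k permutes {..<n}"
  proof (induction k)
    case 0 then show ?case by (simp add: permutes_id id_def[symmetric])
  next
    case (Suc k) then show ?case using permutes_compose[OF Suc next_pos_permutes] by (simp only: funpow.simps)
  qed
  then show ?thesis unfolding shifts_def .
qed

lemma shifts_0: "shifts n 0 = id" unfolding shifts_def by simp

lemma shifts_n: "shifts n n = id"
  using shifts_mod[of n n] shifts_0[of n] by simp

lemma shifts_next: "shifts n k \<circ> next_pos n = next_pos n \<circ> shifts n k"
  unfolding shifts_def by (simp add: funpow_swap1 fun_eq_iff)

text \<open>Conjugation by a rotation, written without an inverse: \<open>\<alpha>'\<close> is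
  \<open>\<alpha>\<close> up to a shift of the starting point of the cyclic word.\<close>

definition rot_eq :: "nat \<Rightarrow> nat \<Rightarrow> (nat \<Rightarrow> nat) \<Rightarrow> (nat \<Rightarrow> nat) \<Rightarrow> bool" where
  "rot_eq n k \<alpha> \<alpha>' \<longleftrightarrow> \<alpha>' \<circ> shifts n k = shifts n k \<circ> \<alpha>"

lemma rot_eq_iff:
  assumes "\<And>i. \<not> i < n \<Longrightarrow> \<alpha> i = i" "\<And>i. \<not> i < n \<Longrightarrow> \<alpha>' i = i" "\<And>i. i < n \<Longrightarrow> \<alpha> i < n"
  shows "rot_eq n k \<alpha> \<alpha>' \<longleftrightarrow> (\<forall>i<n. \<alpha>' ((i + k) mod n) = (\<alpha> i + k) mod n)"
proof
  assume h: "rot_eq n k \<alpha> \<alpha>'"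
  show "\<forall>i<n. \<alpha>' ((i + k) mod n) = (\<alpha> i + k) mod n"
  proof (intro allI impI)
    fix i assume i: "i < n"
    have "\<alpha>' (shifts n k i) = shifts n k (\<alpha> i)" using h unfolding rot_eq_def by (metis comp_apply)
    then show "\<alpha>' ((i + k) mod n) = (\<alpha> i + k) mod n" unfolding shifts_apply[OF i] shifts_apply[OF assms(3)[OF i]] .
  qed
next
  assume h: "\<forall>i<n. \<alpha>' ((i + k) mod n) = (\<alpha> i + k) mod n"
  show "rot_eq n k \<alpha> \<alpha>'" unfolding rot_eq_def
  proof
    fix i show "(\<alpha>' \<circ> shifts n k) i = (shifts n k \<circ> \<alpha>) i"
    proof (cases "i < n")
      case True then show ?thesis using h assms(3)[OF True] by (simp add: shifts_apply)
    next
      case False then show ?thesis using assms(1,2)[OF False] by (simp add: shifts_out)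
    qed
  qed
qed

lemma rot_eq_trans: "rot_eq n j \<alpha> \<alpha>' \<Longrightarrow> rot_eq n k \<alpha>' \<alpha>'' \<Longrightarrow> rot_eq n (k + j) \<alpha> \<alpha>''"
  unfolding rot_eq_def shifts_add by (metis comp_assoc)

lemma rot_eq_mod: "rot_eq n (k mod n) \<alpha> \<alpha>' \<longleftrightarrow> rot_eq n k \<alpha> \<alpha>'"
  unfolding rot_eq_def shifts_mod ..

lemma rot_eq_0: "rot_eq n 0 \<alpha> \<alpha>' \<longleftrightarrow> \<alpha>' = \<alpha>"
  unfolding rot_eq_def shifts_0 by simp

lemma rot_eq_n: "rot_eq n n \<alpha> \<alpha>' \<longleftrightarrow> \<alpha>' = \<alpha>"
  unfolding rot_eq_def shifts_n by simp

lemma rot_eq_unique: "rot_eq n k \<alpha> \<alpha>' \<Longrightarrow> rot_eq n k \<alpha> \<alpha>'' \<Longrightarrow> \<alpha>' = \<alpha>''"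
proof
  fix i assume h: "rot_eq n k \<alpha> \<alpha>'" "rot_eq n k \<alpha> \<alpha>''"
  obtain j where j: "i = shifts n k j" using permutes_surj[OF shifts_permutes[of n k]] by (metis surjD)
  have "(\<alpha>' \<circ> shifts n k) j = (\<alpha>'' \<circ> shifts n k) j" using h unfolding rot_eq_def by simp
  then show "\<alpha>' i = \<alpha>'' i" unfolding j by simp
qed

lemma rot_eq_cancel:
  assumes "rot_eq n j \<alpha> \<alpha>'" "rot_eq n (j + s) \<alpha> \<alpha>'"
  shows "rot_eq n s \<alpha> \<alpha>"
proof -
  have "shifts n j \<circ> (\<alpha> \<circ> shifts n s) = \<alpha>' \<circ> shifts n j \<circ> shifts n s"
    using assms(1) unfolding rot_eq_def by (simp add: comp_assoc[symmetric])
  also have "\<dots> = shifts n j \<circ> (shifts n s \<circ> \<alpha>)"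
    using assms(2) unfolding rot_eq_def shifts_add by (simp add: comp_assoc)
  finally have e: "shifts n j \<circ> (\<alpha> \<circ> shifts n s) = shifts n j \<circ> (shifts n s \<circ> \<alpha>)" .
  show ?thesis unfolding rot_eq_def
  proof
    fix i
    have "shifts n j ((\<alpha> \<circ> shifts n s) i) = shifts n j ((shifts n s \<circ> \<alpha>) i)" using fun_cong[OF e, of i] by simp
    then show "(\<alpha> \<circ> shifts n s) i = (shifts n s \<circ> \<alpha>) i"
      using permutes_inj[OF shifts_permutes[of n j]] by (auto dest: injD)
  qed
qed

lemma rot_eq_sym: "k \<le> n \<Longrightarrow> rot_eq n k \<alpha> \<alpha>' \<Longrightarrow> rot_eq n (n - k) \<alpha>' \<alpha>"
proof -
  assume k: "k \<le> n" and h: "rot_eq n k \<alpha> \<alpha>'"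
  have "shifts n (n - k) \<circ> shifts n k = id" "shifts n k \<circ> shifts n (n - k) = id"
    unfolding shifts_add[symmetric] using k shifts_n by simp_all
  then have c: "shifts n (n - k) (shifts n k i) = i" "shifts n k (shifts n (n - k) i) = i" for i
    by (metis comp_apply id_apply)+
  show ?thesis unfolding rot_eq_def
  proof
    fix i
    have "(\<alpha>' \<circ> shifts n k) (shifts n (n - k) i) = (shifts n k \<circ> \<alpha>) (shifts n (n - k) i)"
      using h unfolding rot_eq_def by simp
    then have "\<alpha>' i = shifts n k (\<alpha> (shifts n (n - k) i))" using c by simp
    then show "(\<alpha> \<circ> shifts n (n - k)) i = (shifts n (n - k) \<circ> \<alpha>') i" using c by simp
  qed
qed

lemma rot_eq_rooted:
  assumes a: "\<alpha> \<in> rooted n 0 0" and e: "rot_eq n k \<alpha> \<alpha>'"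
  shows "\<alpha>' \<in> rooted n 0 0"
proof -
  let ?s = "shifts n k"
  have p: "?s permutes {..<n}" by (rule shifts_permutes)
  note q = permutes_inverses[OF p]
  have al: "\<alpha>' = ?s \<circ> \<alpha> \<circ> inv_into UNIV ?s"
  proof
    fix i
    have "(\<alpha>' \<circ> ?s) (inv_into UNIV ?s i) = (?s \<circ> \<alpha>) (inv_into UNIV ?s i)" using e unfolding rot_eq_def by simp
    then show "\<alpha>' i = (?s \<circ> \<alpha> \<circ> inv_into UNIV ?s) i" using q by simp
  qed
  have "\<alpha>' \<circ> next_pos n = ?s \<circ> (\<alpha> \<circ> next_pos n) \<circ> inv_into UNIV ?s"
  proof
    fix i
    obtain j where j: "i = ?s j" using q(1)[of i] by metis
    have "next_pos n (?s j) = ?s (next_pos n j)" using fun_cong[OF shifts_next[of n k], of j] by simp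
    then show "(\<alpha>' \<circ> next_pos n) i = (?s \<circ> (\<alpha> \<circ> next_pos n) \<circ> inv_into UNIV ?s) i" unfolding al j using q by simp
  qed
  moreover have "\<alpha> \<in> involutions {..<n} 0" "\<alpha> \<circ> next_pos n \<in> cube_roots {..<n} 0" using a unfolding rooted_def by auto
  ultimately show ?thesis unfolding rooted_def
    using conj_involutions[OF p] conj_cube_roots[OF p] al by simp
qed

section \<open>Orbits and stabilisers under rotation\<close>

definition stab :: "nat \<Rightarrow> (nat \<Rightarrow> nat) \<Rightarrow> nat set" where
  "stab n \<alpha> = {k. k < n \<and> rot_eq n k \<alpha> \<alpha>}"

definition rot_orbit :: "nat \<Rightarrow> (nat \<Rightarrow> nat) \<Rightarrow> (nat \<Rightarrow> nat) set" where
  "rot_orbit n \<alpha> = {\<alpha>'. \<exists>k<n. rot_eq n k \<alpha> \<alpha>'}"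

text \<open>The shifts that carry \<open>\<alpha>\<close> to a given member of its orbit form a
  coset of the stabiliser, so all fibres have the same size.\<close>

lemma orbit_stabilizer:
  assumes n: "n > 0"
  shows "card (rot_orbit n \<alpha>) * card (stab n \<alpha>) = n" "finite (rot_orbit n \<alpha>)"
proof -
  define R where "R k = (\<lambda>i. shifts n k (\<alpha> (inv_into UNIV (shifts n k) i)))" for k
  have R: "rot_eq n k \<alpha> (R k)" for k
    unfolding rot_eq_def R_def using permutes_inverses(2)[OF shifts_permutes[of n k]] by (simp add: fun_eq_iff)
  have RU: "rot_eq n k \<alpha> \<alpha>' \<longleftrightarrow> \<alpha>' = R k" for k \<alpha>' using R[of k] rot_eq_unique by blast
  have orb: "rot_orbit n \<alpha> = R ` {..<n}" unfolding rot_orbit_def RU by auto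
  show fin: "finite (rot_orbit n \<alpha>)" unfolding orb by simp
  have fibre: "card {k \<in> {..<n}. R k = \<alpha>'} = card (stab n \<alpha>)" if a': "\<alpha>' \<in> rot_orbit n \<alpha>" for \<alpha>'
  proof -
    obtain j where j: "j < n" "rot_eq n j \<alpha> \<alpha>'" using a' unfolding rot_orbit_def by blast
    have "bij_betw (\<lambda>s. (s + j) mod n) (stab n \<alpha>) {k \<in> {..<n}. R k = \<alpha>'}"
    proof (rule bij_betw_byWitness[where f' = "\<lambda>k. (k + (n - j)) mod n"])
      show "\<forall>s\<in>stab n \<alpha>. ((s + j) mod n + (n - j)) mod n = s"
      proof
        fix s assume "s \<in> stab n \<alpha>"
        then have "s < n" unfolding stab_def by simp
        have "((s + j) mod n + (n - j)) mod n = (s + j + (n - j)) mod n" by (rule mod_add_left_eq)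
        also have "s + j + (n - j) = s + n" using j(1) by simp
        finally show "((s + j) mod n + (n - j)) mod n = s" using \<open>s < n\<close> by simp
      qed
      show "\<forall>k\<in>{k \<in> {..<n}. R k = \<alpha>'}. ((k + (n - j)) mod n + j) mod n = k"
      proof
        fix k assume "k \<in> {k \<in> {..<n}. R k = \<alpha>'}"
        then have "k < n" by simp
        have "((k + (n - j)) mod n + j) mod n = (k + (n - j) + j) mod n" by (rule mod_add_left_eq)
        also have "k + (n - j) + j = k + n" using j(1) by simp
        finally show "((k + (n - j)) mod n + j) mod n = k" using \<open>k < n\<close> by simp
      qed
      show "(\<lambda>s. (s + j) mod n) ` stab n \<alpha> \<subseteq> {k \<in> {..<n}. R k = \<alpha>'}"
      proof
        fix k assume "k \<in> (\<lambda>s. (s + j) mod n) ` stab n \<alpha>"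
        then obtain s where s: "rot_eq n s \<alpha> \<alpha>" "k = (s + j) mod n" unfolding stab_def by blast
        have "rot_eq n (j + s) \<alpha> \<alpha>'" by (rule rot_eq_trans[OF s(1) j(2)])
        then have "rot_eq n k \<alpha> \<alpha>'" unfolding s(2) rot_eq_mod by (simp only: add.commute)
        then show "k \<in> {k \<in> {..<n}. R k = \<alpha>'}" unfolding RU using s(2) n by simp
      qed
      show "(\<lambda>k. (k + (n - j)) mod n) ` {k \<in> {..<n}. R k = \<alpha>'} \<subseteq> stab n \<alpha>"
      proof
        fix s assume "s \<in> (\<lambda>k. (k + (n - j)) mod n) ` {k \<in> {..<n}. R k = \<alpha>'}"
        then obtain k where k: "k < n" "R k = \<alpha>'" "s = (k + (n - j)) mod n" by blast
        have "(j + s) mod n = (j + (k + (n - j))) mod n" unfolding k(3) by (rule mod_add_right_eq)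
        also have "j + (k + (n - j)) = k + n" using j(1) by simp
        finally have "(j + s) mod n = k" using k(1) by simp
        then have "rot_eq n ((j + s) mod n) \<alpha> \<alpha>'" using k(2) R[of k] by simp
        then have "rot_eq n (j + s) \<alpha> \<alpha>'" unfolding rot_eq_mod .
        then have "rot_eq n s \<alpha> \<alpha>" by (rule rot_eq_cancel[OF j(2)])
        then show "s \<in> stab n \<alpha>" unfolding stab_def using k(3) n by simp
      qed
    qed
    then show ?thesis by (rule bij_betw_same_card[symmetric])
  qed
  have "n = (\<Sum>k\<in>{..<n}. 1)" by simp
  also have "\<dots> = (\<Sum>\<alpha>'\<in>R ` {..<n}. \<Sum>k\<in>{k \<in> {..<n}. R k = \<alpha>'}. 1)" by (rule sum.image_gen) simp
  also have "\<dots> = (\<Sum>\<alpha>'\<in>rot_orbit n \<alpha>. card (stab n \<alpha>))"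
    unfolding orb[symmetric] by (rule sum.cong[OF refl]) (simp only: fibre flip: card_eq_sum)
  finally show "card (rot_orbit n \<alpha>) * card (stab n \<alpha>) = n" by simp
qed

text \<open>Division with remainder shows that the least positive period \<open>L\<close> divides
  every period. The full turn \<open>n\<close> is a period, hence \<open>n = d * L\<close>, and the
  stabiliser consists of the \<open>d\<close> multiples of \<open>L\<close> below
  \<open>n\<close>.\<close>

lemma stab_structure:
  assumes n: "n > 0"
  obtains d L where "d > 0" "L > 0" "n = d * L" "\<And>k. rot_eq n k \<alpha> \<alpha> \<longleftrightarrow> L dvd k" "card (stab n \<alpha>) = d"
proof -
  define L where "L = (LEAST k. k > 0 \<and> rot_eq n k \<alpha> \<alpha>)"
  have "n > 0 \<and> rot_eq n n \<alpha> \<alpha>" using n rot_eq_n by blast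
  then have L: "L > 0" "rot_eq n L \<alpha> \<alpha>" using LeastI[of "\<lambda>k. k > 0 \<and> rot_eq n k \<alpha> \<alpha>"] unfolding L_def by blast+
  have min: "L \<le> k" if "k > 0" "rot_eq n k \<alpha> \<alpha>" for k unfolding L_def by (rule Least_le) (use that in blast)
  have mult: "rot_eq n (L * q) \<alpha> \<alpha>" for q
  proof (induction q)
    case 0 then show ?case using rot_eq_0 by simp
  next
    case (Suc q) then show ?case using rot_eq_trans[OF Suc L(2)] by simp
  qed
  have iff: "rot_eq n k \<alpha> \<alpha> \<longleftrightarrow> L dvd k" for k
  proof
    assume h: "rot_eq n k \<alpha> \<alpha>"
    have "rot_eq n (L * (k div L) + k mod L) \<alpha> \<alpha>" using h by simp
    then have "rot_eq n (k mod L) \<alpha> \<alpha>" by (rule rot_eq_cancel[OF mult])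
    moreover have "k mod L < L" using L(1) by simp
    ultimately have "k mod L = 0" using min[of "k mod L"] by linarith
    then show "L dvd k" by (simp add: dvd_eq_mod_eq_0)
  next
    assume "L dvd k"
    then show "rot_eq n k \<alpha> \<alpha>" using mult by (auto elim: dvdE)
  qed
  have "L dvd n" using iff[of n] rot_eq_n by blast
  then obtain d where "n = L * d" by (elim dvdE)
  then have d: "n = d * L" by (simp only: mult.commute)
  have d0: "d > 0" using d n by (cases d) auto
  have "stab n \<alpha> = (\<lambda>q. L * q) ` {..<d}"
  proof (intro equalityI subsetI)
    fix k assume "k \<in> stab n \<alpha>"
    then have k: "k < n" "L dvd k" unfolding stab_def iff by auto
    obtain q where q: "k = L * q" using k(2) by (elim dvdE)
    have "L * q < L * d" using k(1) q d by (simp add: mult.commute)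
    then have "q < d" by simp
    then show "k \<in> (\<lambda>q. L * q) ` {..<d}" using q by blast
  next
    fix k assume "k \<in> (\<lambda>q. L * q) ` {..<d}"
    then obtain q where q: "q < d" "k = L * q" by blast
    have "L * q < L * d" using q(1) L(1) by simp
    then show "k \<in> stab n \<alpha>" unfolding stab_def iff using q d by (simp add: mult.commute)
  qed
  moreover have "inj_on (\<lambda>q. L * q) {..<d}" using L(1) by (simp add: inj_on_def)
  ultimately have "card (stab n \<alpha>) = d" by (simp add: card_image)
  then show ?thesis using that[OF d0 L(1) d iff] by blast
qed

text \<open>Rotations commute, so a rotation carries one solution set onto the other; both counts
  are invariants of the cyclic word.\<close>

lemma edge_shift_rot:
  assumes n: "\<And>i. i < n \<Longrightarrow> \<alpha> i < n" and e: "rot_eq n k \<alpha> \<alpha>'"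
  shows "edge_shift n \<alpha>' m = edge_shift n \<alpha> m" "vert_shift n \<alpha>' m = vert_shift n \<alpha> m"
proof -
  let ?s = "shifts n k"
  have p: "?s permutes {..<n}" by (rule shifts_permutes)
  have gen: "card {i. i < n \<and> f' i = (i + m) mod n} = card {i. i < n \<and> f i = (i + m) mod n}"
    if f: "\<And>i. f' (?s i) = ?s (f i)" for f f'
  proof -
    have "{i. i < n \<and> f' i = (i + m) mod n} = ?s ` {i. i < n \<and> f i = (i + m) mod n}"
    proof (intro equalityI subsetI)
      fix i assume "i \<in> {i. i < n \<and> f' i = (i + m) mod n}"
      then have i: "i < n" "f' i = (i + m) mod n" by auto
      have "i \<in> ?s ` {..<n}" using permutes_image[OF p] i(1) by simp
      then obtain j where j: "j < n" "i = ?s j" by blast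
      have "?s (f j) = ?s (shifts n m j)"
        using i(2) f[of j] fun_cong[OF shifts_add[of n m k], of j] fun_cong[OF shifts_add[of n k m], of j]
        unfolding j(2) using shifts_apply[of "?s j" n m] i(1) j(2) by (simp add: add.commute)
      then have "f j = shifts n m j" using permutes_inj[OF p] by (auto dest: injD)
      then have "j \<in> {i. i < n \<and> f i = (i + m) mod n}" using j(1) shifts_apply[OF j(1), of m] by simp
      then show "i \<in> ?s ` {i. i < n \<and> f i = (i + m) mod n}" unfolding j(2) by (rule imageI)
    next
      fix i assume "i \<in> ?s ` {i. i < n \<and> f i = (i + m) mod n}"
      then obtain j where j: "j < n" "f j = (j + m) mod n" "i = ?s j" by blast
      have iL: "i < n" using permutes_in_image[OF p, of j] j by simp
      have "f' i = ?s (shifts n m j)" unfolding j(3) f j(2) shifts_apply[OF j(1), of m] ..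
      also have "\<dots> = shifts n m (?s j)"
        using fun_cong[OF shifts_add[of n m k], of j] fun_cong[OF shifts_add[of n k m], of j] by (simp add: add.commute)
      also have "\<dots> = (i + m) mod n" using shifts_apply[OF iL, of m] unfolding j(3) .
      finally show "i \<in> {i. i < n \<and> f' i = (i + m) mod n}" using iL by simp
    qed
    moreover have "inj_on ?s {i. i < n \<and> f i = (i + m) mod n}" using permutes_inj[OF p] by (rule inj_on_subset) simp
    ultimately show ?thesis by (simp add: card_image)
  qed
  have c: "\<alpha>' (?s i) = ?s (\<alpha> i)" for i using fun_cong[OF e[unfolded rot_eq_def], of i] by simp
  show "edge_shift n \<alpha>' m = edge_shift n \<alpha> m" unfolding edge_shift_def by (rule gen) (rule c)
  have nx: "next_pos n (?s i) = ?s (next_pos n i)" for i using fun_cong[OF shifts_next[of n k], of i] by simp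
  show "vert_shift n \<alpha>' m = vert_shift n \<alpha> m" unfolding vert_shift_def
    by (rule gen) (simp only: nx c)
qed

section \<open>Isomorphisms and automorphisms as rotations of positions\<close>

lemma relabel_commute:
  assumes p: "paired w" "paired w'" and len: "length w = n" "length w' = n"
    and r: "relabelling \<phi> w w'" "rotate k w' = map \<phi> w"
  shows "i < n \<Longrightarrow> \<phi> (w ! i) = w' ! ((i + k) mod n)" "rot_eq n k (pairing w) (pairing w')"
proof -
  have nth: "\<phi> (w ! i) = w' ! ((i + k) mod n)" if "i < n" for i
  proof -
    have "map \<phi> w ! i = rotate k w' ! i" using r(2) by simp
    then show ?thesis using nth_rotate[of i w' k] that len by (simp add: add.commute)
  qed
  then show "i < n \<Longrightarrow> \<phi> (w ! i) = w' ! ((i + k) mod n)" for i .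
  have lt: "pairing w i < n" if "i < n" for i using pairing_props(1)[OF p(1)] that len by simp
  have "pairing w' ((i + k) mod n) = (pairing w i + k) mod n" if i: "i < n" for i
  proof -
    have m: "(i + k) mod n < n" "(pairing w i + k) mod n < n" using i by simp_all
    have "w' ! ((pairing w i + k) mod n) = \<phi> (w ! pairing w i)" using nth[OF lt[OF i]] by simp
    also have "\<dots> = \<phi> (letter_inv (w ! i))" using pairing_props(2)[OF p(1)] i len by simp
    also have "\<dots> = letter_inv (\<phi> (w ! i))" using r(1) i len unfolding relabelling_def by simp
    also have "\<dots> = letter_inv (w' ! ((i + k) mod n))" using nth[OF i] by simp
    finally show ?thesis using pairing_eq_iff[OF p(2)] m len by simp
  qed
  then show "rot_eq n k (pairing w) (pairing w')"
    by (subst rot_eq_iff) (use lt pairing_out[of _ w] pairing_out[of _ w'] len in auto)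
qed

text \<open>In a paired word a letter stands at one position only, so a rotation of positions
  defines a map of letters. It respects inverses because the rotation intertwines the two
  pairings.\<close>

lemma relabel_exists:
  assumes p: "paired w" "paired w'" and len: "length w = n" "length w' = n"
    and e: "rot_eq n k (pairing w) (pairing w')"
  shows "\<exists>\<phi>. relabelling \<phi> w w' \<and> rotate k w' = map \<phi> w"
proof -
  have inj: "inj_on ((!) w) {..<n}" using p(1) len unfolding paired_def by (simp add: inj_on_nth)
  define \<phi> where "\<phi> a = w' ! ((the_inv_into {..<n} ((!) w) a + k) mod n)" for a
  have nth: "\<phi> (w ! i) = w' ! ((i + k) mod n)" if "i < n" for i
    unfolding \<phi>_def using the_inv_into_f_f[OF inj, of i] that by simp
  have m: "rotate k w' = map \<phi> w"
  proof (rule nth_equalityI)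
    show "length (rotate k w') = length (map \<phi> w)" using len by simp
    fix i assume "i < length (rotate k w')"
    then have i: "i < n" using len by simp
    show "rotate k w' ! i = map \<phi> w ! i" using nth_rotate[of i w' k] nth[OF i] i len by (simp add: add.commute)
  qed
  have lt: "pairing w i < n" if "i < n" for i using pairing_props(1)[OF p(1)] that len by simp
  have com: "pairing w' ((i + k) mod n) = (pairing w i + k) mod n" if "i < n" for i
    using e that by (subst (asm) rot_eq_iff) (use lt pairing_out[of _ w] pairing_out[of _ w'] len in auto)
  have "set w' = \<phi> ` set w" using arg_cong[OF m, of set] by simp
  moreover have "inj_on \<phi> (set w)"
  proof -
    have "distinct (map \<phi> w)" unfolding m[symmetric] using p(2) unfolding paired_def by simp
    then show ?thesis by (simp add: distinct_map)
  qed
  moreover have "\<phi> (letter_inv a) = letter_inv (\<phi> a)" if aw: "a \<in> set w" for a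
  proof -
    obtain i where i: "i < n" "a = w ! i" using aw len by (auto simp: in_set_conv_nth)
    have m: "(i + k) mod n < n" using i by simp
    have "\<phi> (letter_inv a) = \<phi> (w ! pairing w i)" using pairing_props(2)[OF p(1)] i len by simp
    also have "\<dots> = w' ! pairing w' ((i + k) mod n)" using nth[OF lt[OF i(1)]] com[OF i(1)] by simp
    also have "\<dots> = letter_inv (w' ! ((i + k) mod n))" using pairing_props(2)[OF p(2)] m len by simp
    finally show ?thesis using nth[OF i(1)] i(2) by simp
  qed
  ultimately have "relabelling \<phi> w w'" unfolding relabelling_def bij_betw_def by simp
  then show ?thesis using m by blast
qed

lemma isomorphic_iff:
  assumes p: "paired w" "paired w'" and len: "length w = n" "length w' = n"
  shows "wicks_isomorphic w w' \<longleftrightarrow> (\<exists>k. rot_eq n k (pairing w) (pairing w'))"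
proof
  assume "wicks_isomorphic w w'"
  then obtain \<phi> k where "relabelling \<phi> w w'" "rotate k w' = map \<phi> w"
    unfolding wicks_isomorphic_def same_cyclic_word_def by blast
  then show "\<exists>k. rot_eq n k (pairing w) (pairing w')" using relabel_commute(2)[OF p len] by blast
next
  assume "\<exists>k. rot_eq n k (pairing w) (pairing w')"
  then obtain k where "rot_eq n k (pairing w) (pairing w')" by blast
  then obtain \<phi> where "relabelling \<phi> w w'" "rotate k w' = map \<phi> w" using relabel_exists[OF p len] by blast
  then show "wicks_isomorphic w w'" unfolding wicks_isomorphic_def same_cyclic_word_def by blast
qed

lemma carrier_Aut:
  assumes p: "paired w" and n: "length w = n" "n > 0"
  shows "carrier (wicks_Aut w) = int ` stab n (pairing w)"
proof (intro equalityI subsetI)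
  fix \<mu> assume "\<mu> \<in> carrier (wicks_Aut w)"
  then obtain \<phi> where m: "0 \<le> \<mu>" "\<mu> < int n" and s: "shift_relabelling w \<mu> \<phi>"
    unfolding wicks_Aut_def using n by (auto simp: carrier_integer_mod_group)
  have "rot_eq n (nat \<mu>) (pairing w) (pairing w)"
    using s relabel_commute(2)[OF p p n(1) n(1)] unfolding shift_relabelling_def by blast
  then have "nat \<mu> \<in> stab n (pairing w)" unfolding stab_def using m by simp
  moreover have "\<mu> = int (nat \<mu>)" using m by simp
  ultimately show "\<mu> \<in> int ` stab n (pairing w)" by blast
next
  fix \<mu> assume "\<mu> \<in> int ` stab n (pairing w)"
  then obtain k where k: "k < n" "rot_eq n k (pairing w) (pairing w)" "\<mu> = int k" unfolding stab_def by blast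
  obtain \<phi> where "relabelling \<phi> w w" "rotate k w = map \<phi> w" using relabel_exists[OF p p n(1) n(1) k(2)] by blast
  then have "\<exists>\<phi>. shift_relabelling w \<mu> \<phi>" unfolding shift_relabelling_def k(3) by auto
  then show "\<mu> \<in> carrier (wicks_Aut w)" unfolding wicks_Aut_def using n k by (simp add: carrier_integer_mod_group)
qed

lemma Aut_ops:
  assumes "length w = n"
  shows "x \<otimes>\<^bsub>wicks_Aut w\<^esub> y = (x + y) mod int n" "\<one>\<^bsub>wicks_Aut w\<^esub> = 0"
  unfolding wicks_Aut_def using assms by simp_all

lemma order_Aut:
  assumes "paired w" "length w = n" "n > 0"
  shows "order (wicks_Aut w) = card (stab n (pairing w))"
  unfolding order_def carrier_Aut[OF assms] by (simp add: card_image)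

lemma Aut_group:
  assumes p: "paired w" and n: "length w = n" "n > 0"
  shows "group (wicks_Aut w)"
proof -
  let ?S = "stab n (pairing w)"
  have "subgroup (int ` ?S) (integer_mod_group n)"
  proof (rule subgroup.intro)
    show "int ` ?S \<subseteq> carrier (integer_mod_group n)" using n unfolding stab_def by (auto simp: carrier_integer_mod_group)
    show "\<one>\<^bsub>integer_mod_group n\<^esub> \<in> int ` ?S" using n(2) rot_eq_0 unfolding stab_def by auto
  next
    fix x y assume "x \<in> int ` ?S" "y \<in> int ` ?S"
    then obtain j k where jk: "x = int j" "y = int k" "j \<in> ?S" "k \<in> ?S" by blast
    have "rot_eq n ((j + k) mod n) (pairing w) (pairing w)"
      unfolding rot_eq_mod by (rule rot_eq_trans[of n k _ "pairing w" j]) (use jk in \<open>auto simp: stab_def\<close>)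
    then have "(j + k) mod n \<in> ?S" unfolding stab_def using n(2) by simp
    moreover have "(x + y) mod int n = int ((j + k) mod n)" unfolding jk by (simp add: zmod_int)
    ultimately show "x \<otimes>\<^bsub>integer_mod_group n\<^esub> y \<in> int ` ?S" by simp
  next
    fix x assume x: "x \<in> int ` ?S"
    then obtain k where k: "x = int k" "k < n" "rot_eq n k (pairing w) (pairing w)" unfolding stab_def by blast
    have "rot_eq n ((n - k) mod n) (pairing w) (pairing w)" unfolding rot_eq_mod by (rule rot_eq_sym) (use k in auto)
    then have "(n - k) mod n \<in> ?S" unfolding stab_def using n(2) by simp
    moreover have "(- x) mod int n = int ((n - k) mod n)"
    proof -
      have "int ((n - k) mod n) = (int n - int k) mod int n" using k(2) by (simp add: zmod_int of_nat_diff)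
      also have "\<dots> = (- int k) mod int n" by (rule minus_mod_self1)
      finally show ?thesis unfolding k(1) by simp
    qed
    moreover have "x \<in> carrier (integer_mod_group n)" unfolding k(1) using k(2) by (simp add: carrier_integer_mod_group)
    ultimately show "inv\<^bsub>integer_mod_group n\<^esub> x \<in> int ` ?S" by simp
  qed
  then have "group ((integer_mod_group n)\<lparr>carrier := int ` ?S\<rparr>)"
    by (rule subgroup.subgroup_is_group[OF _ group_integer_mod_group])
  moreover have "wicks_Aut w = (integer_mod_group n)\<lparr>carrier := int ` ?S\<rparr>"
    using carrier_Aut[OF p n] unfolding wicks_Aut_def n(1) by simp
  ultimately show ?thesis by simp
qed

lemma stab_sym_rooted:
  assumes a: "\<alpha> \<in> rooted n 0 0" and n: "n = d * L"
  shows "\<alpha> \<in> sym_rooted d L \<longleftrightarrow> rot_eq n L \<alpha> \<alpha>"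
proof -
  have p: "\<alpha> permutes {..<n}" using rooted_props(4)[OF a] .
  have "rot_eq n L \<alpha> \<alpha> \<longleftrightarrow> (\<forall>i<n. \<alpha> ((i + L) mod n) = (\<alpha> i + L) mod n)"
    by (rule rot_eq_iff) (use rooted_bounds[OF a] in auto)
  then show ?thesis unfolding sym_rooted_def n[symmetric] using a by blast
qed

text \<open>The multiples of the least period \<open>L\<close> make the group an epimorphic image of
  the integers. A group of order \<open>d\<close> exhibits the pairing as a \<open>d\<close>-fold
  covering, for which the monodromy argument gives \<open>d dvd 6\<close>.\<close>

lemma Aut_cyclic:
  assumes p: "paired w" and n: "length w = n" "n > 0" and a: "pairing w \<in> rooted n 0 0"
  shows "cyclic_group (wicks_Aut w)" "order (wicks_Aut w) \<in> {1, 2, 3, 6}"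
proof -
  obtain d L where dL: "d > 0" "L > 0" "n = d * L" and iff: "\<And>k. rot_eq n k (pairing w) (pairing w) \<longleftrightarrow> L dvd k"
    and card: "card (stab n (pairing w)) = d"
    by (rule stab_structure[OF n(2), of "pairing w"]) blast
  have car: "carrier (wicks_Aut w) = int ` stab n (pairing w)" by (rule carrier_Aut[OF p n])
  have "(\<lambda>z. (z * int L) mod int n) \<in> epi integer_group (wicks_Aut w)"
    unfolding epi_def
  proof (intro CollectI conjI)
    have mem: "(z * int L) mod int n \<in> carrier (wicks_Aut w)" for z
    proof -
      define k where "k = nat ((z * int L) mod int n)"
      have k: "int k = (z * int L) mod int n" unfolding k_def using n(2) by simp
      have "int L dvd int k" unfolding k dL(3) by (simp add: dvd_mod_iff)
      then have "L dvd k" by (simp only: int_dvd_int_iff)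
      moreover have "k < n"
      proof -
        have "int k < int n" unfolding k using n(2) by simp
        then show ?thesis by simp
      qed
      ultimately have "k \<in> stab n (pairing w)" unfolding stab_def iff by simp
      then show ?thesis unfolding car k[symmetric] by blast
    qed
    show "(\<lambda>z. (z * int L) mod int n) \<in> hom integer_group (wicks_Aut w)"
      unfolding hom_def using mem by (auto simp: Aut_ops[OF n(1)] integer_group_def mod_add_eq distrib_right)
    show "(\<lambda>z. (z * int L) mod int n) ` carrier integer_group = carrier (wicks_Aut w)"
    proof (intro equalityI subsetI)
      fix x assume "x \<in> carrier (wicks_Aut w)"
      then obtain k where k: "x = int k" "k < n" "L dvd k" unfolding car stab_def iff by blast
      obtain q where q: "k = L * q" using k(3) by (elim dvdE)
      have xq: "x = int q * int L" unfolding k(1) q by simp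
      have "x mod int n = x" using k(1,2) by simp
      then have "x = (int q * int L) mod int n" unfolding xq by simp
      then show "x \<in> (\<lambda>z. (z * int L) mod int n) ` carrier integer_group" by (auto simp: integer_group_def)
    qed (use mem in auto)
  qed
  then show "cyclic_group (wicks_Aut w)"
    using group.cyclic_group_epimorphic_image[OF group_integer_group _ cyclic_integer_group Aut_group[OF p n]] by blast
  have "pairing w \<in> sym_rooted d L" unfolding stab_sym_rooted[OF a dL(3)] iff by simp
  then have "d dvd 6" by (rule sym_rooted_dvd_6[OF dL(2,1)])
  then have "d \<le> 6" by (rule dvd_imp_le) simp
  then have "d = 0 \<or> d = 1 \<or> d = 2 \<or> d = 3 \<or> d = 4 \<or> d = 5 \<or> d = 6" by linarith
  then have "d \<in> {1, 2, 3, 6}" using \<open>d dvd 6\<close> dL(1) by auto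
  then show "order (wicks_Aut w) \<in> {1, 2, 3, 6}" unfolding order_Aut[OF p n] card .
qed

text \<open>For a prime it suffices that the element is nontrivial and its \<open>q\<close>-th power
  is trivial, which turns the order into a divisibility between shifts.\<close>

lemma Aut_ord_prime:
  assumes p: "paired w" and n: "length w = n" "n > 0" and m: "\<mu> \<in> carrier (wicks_Aut w)" and q: "prime q"
  shows "group.ord (wicks_Aut w) \<mu> = q \<longleftrightarrow> \<mu> \<noteq> 0 \<and> int n dvd int q * \<mu>"
proof -
  interpret G: group "wicks_Aut w" by (rule Aut_group[OF p n])
  have pow: "\<mu> [^]\<^bsub>wicks_Aut w\<^esub> k = (int k * \<mu>) mod int n" for k :: nat
  proof (induction k)
    case 0 then show ?case by (simp add: Aut_ops[OF n(1)])
  next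
    case (Suc k) then show ?case by (simp add: Aut_ops[OF n(1)] mod_add_left_eq mod_add_right_eq distrib_right add.commute)
  qed
  have 1: "G.ord \<mu> dvd q \<longleftrightarrow> int n dvd int q * \<mu>"
    using G.pow_eq_id[OF m, of q] unfolding pow Aut_ops(2)[OF n(1)] by (auto simp: dvd_eq_mod_eq_0)
  have 2: "G.ord \<mu> = 1 \<longleftrightarrow> \<mu> = 0" using G.ord_eq_1[OF m] unfolding Aut_ops(2)[OF n(1)] .
  have q1: "q \<noteq> 1" and pr: "\<And>m. m dvd q \<Longrightarrow> m = 1 \<or> m = q" using q unfolding prime_nat_iff by auto
  show ?thesis
  proof
    assume o: "G.ord \<mu> = q"
    then show "\<mu> \<noteq> 0 \<and> int n dvd int q * \<mu>" using 1 2 q1 by auto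
  next
    assume "\<mu> \<noteq> 0 \<and> int n dvd int q * \<mu>"
    then show "G.ord \<mu> = q" using 1 2 pr[of "G.ord \<mu>"] by blast
  qed
qed

section \<open>Mass of a set of classes as a number of involutions\<close>

definition cls :: "nat \<Rightarrow> letter list \<Rightarrow> letter list set" where
  "cls g w = {w'. maximal_wicks g w' \<and> wicks_isomorphic w w'}"

lemma W1_eq: "W1 g = {cls g w | w. maximal_wicks g w}"
  unfolding W1_def quotient_def cls_def by blast

context
  fixes g n :: nat
  assumes g: "g \<ge> 1" and n: "n = 12 * g - 6"
begin

lemma n0: "n > 0" using g n by simp

lemma maxD: "maximal_wicks g w \<Longrightarrow> length w = n" "maximal_wicks g w \<Longrightarrow> paired w"
  "maximal_wicks g w \<Longrightarrow> pairing w \<in> rooted n 0 0"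
  unfolding maximal_wicks_iff[OF g] n by blast+

lemma cls_iff:
  assumes "maximal_wicks g w"
  shows "w' \<in> cls g w \<longleftrightarrow> maximal_wicks g w' \<and> pairing w' \<in> rot_orbit n (pairing w)"
proof -
  have "wicks_isomorphic w w' \<longleftrightarrow> pairing w' \<in> rot_orbit n (pairing w)" if "maximal_wicks g w'"
  proof -
    have "wicks_isomorphic w w' \<longleftrightarrow> (\<exists>k. rot_eq n k (pairing w) (pairing w'))"
      by (rule isomorphic_iff) (use maxD assms that in auto)
    also have "\<dots> \<longleftrightarrow> (\<exists>k<n. rot_eq n k (pairing w) (pairing w'))"
    proof
      assume "\<exists>k. rot_eq n k (pairing w) (pairing w')"
      then obtain k where "rot_eq n (k mod n) (pairing w) (pairing w')" unfolding rot_eq_mod by blast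
      moreover have "k mod n < n" using n0 by simp
      ultimately show "\<exists>k<n. rot_eq n k (pairing w) (pairing w')" by blast
    qed blast
    finally show ?thesis unfolding rot_orbit_def by simp
  qed
  then show ?thesis unfolding cls_def by blast
qed

lemma orbit_same:
  assumes "\<alpha>' \<in> rot_orbit n \<alpha>"
  shows "rot_orbit n \<alpha>' = rot_orbit n \<alpha>" "\<alpha> \<in> rot_orbit n \<alpha>'"
proof -
  have tr: "\<gamma> \<in> rot_orbit n \<alpha>" if h: "\<beta> \<in> rot_orbit n \<alpha>" "\<gamma> \<in> rot_orbit n \<beta>" for \<alpha> \<beta> \<gamma>
  proof -
    obtain j k where "rot_eq n j \<alpha> \<beta>" "rot_eq n k \<beta> \<gamma>" using h unfolding rot_orbit_def by blast
    then have "rot_eq n ((k + j) mod n) \<alpha> \<gamma>" unfolding rot_eq_mod by (rule rot_eq_trans)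
    moreover have "(k + j) mod n < n" using n0 by simp
    ultimately show ?thesis unfolding rot_orbit_def by blast
  qed
  have sy: "\<alpha> \<in> rot_orbit n \<beta>" if h: "\<beta> \<in> rot_orbit n \<alpha>" for \<alpha> \<beta>
  proof -
    obtain j where "j < n" "rot_eq n j \<alpha> \<beta>" using h unfolding rot_orbit_def by blast
    then have "rot_eq n ((n - j) mod n) \<beta> \<alpha>" unfolding rot_eq_mod by (intro rot_eq_sym) auto
    moreover have "(n - j) mod n < n" using n0 by simp
    ultimately show ?thesis unfolding rot_orbit_def by blast
  qed
  show "\<alpha> \<in> rot_orbit n \<alpha>'" by (rule sy[OF assms])
  show "rot_orbit n \<alpha>' = rot_orbit n \<alpha>"
  proof (intro equalityI subsetI)
    show "\<gamma> \<in> rot_orbit n \<alpha>" if "\<gamma> \<in> rot_orbit n \<alpha>'" for \<gamma> by (rule tr[OF assms that])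
    show "\<gamma> \<in> rot_orbit n \<alpha>'" if "\<gamma> \<in> rot_orbit n \<alpha>" for \<gamma> by (rule tr[OF sy[OF assms] that])
  qed
qed

lemma word_exists:
  assumes "\<alpha> \<in> rooted n 0 0"
  obtains w where "maximal_wicks g w" "pairing w = \<alpha>"
proof (rule that[of "word_of n \<alpha>"])
  note wp = word_of_props[OF assms]
  show "pairing (word_of n \<alpha>) = \<alpha>" by (rule wp(3))
  show "maximal_wicks g (word_of n \<alpha>)"
    unfolding maximal_wicks_iff[OF g] n[symmetric] wp(3) using wp(1,2) assms by (intro conjI)
qed

lemma self_orbit: "\<alpha> \<in> rot_orbit n \<alpha>"
  unfolding rot_orbit_def using n0 rot_eq_0 by blast

lemma pairing_cls:
  assumes w: "maximal_wicks g w"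
  shows "pairing ` cls g w = rot_orbit n (pairing w)"
proof (intro equalityI subsetI)
  fix \<alpha> assume "\<alpha> \<in> pairing ` cls g w"
  then obtain v where "v \<in> cls g w" "\<alpha> = pairing v" by blast
  then show "\<alpha> \<in> rot_orbit n (pairing w)" unfolding cls_iff[OF w] by simp
next
  fix \<alpha> assume a: "\<alpha> \<in> rot_orbit n (pairing w)"
  then obtain k where "rot_eq n k (pairing w) \<alpha>" unfolding rot_orbit_def by blast
  then have "\<alpha> \<in> rooted n 0 0" by (rule rot_eq_rooted[OF maxD(3)[OF w]])
  then obtain w' where "maximal_wicks g w'" "pairing w' = \<alpha>" by (rule word_exists)
  then show "\<alpha> \<in> pairing ` cls g w" using cls_iff[OF w, of w'] a by blast
qed

text \<open>A class contains infinitely many words, but \<open>pairing\<close> maps it onto a single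
  rotation orbit. By orbit counting its weight is the size of that orbit over \<open>n\<close>,
  whichever representative is selected, and the orbits of the classes in \<open>W\<close> partition
  the involutions satisfying \<open>Q\<close>.\<close>

lemma mass_eq:
  assumes W: "W \<subseteq> W1 g" and Q: "\<And>w. maximal_wicks g w \<Longrightarrow> cls g w \<in> W \<longleftrightarrow> Q (pairing w)"
  shows "mass W = real (card {\<alpha> \<in> rooted n 0 0. Q \<alpha>}) / real n"
proof -
  have C: "\<exists>w. maximal_wicks g w \<and> C = cls g w" if "C \<in> W" for C using W that unfolding W1_eq by blast
  have summand: "1 / real (order (wicks_Aut (SOME w. w \<in> C))) = real (card (pairing ` C)) / real n" if C': "C \<in> W" for C
  proof -
    obtain w where w: "maximal_wicks g w" "C = cls g w" using C[OF C'] by blast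
    have "w \<in> C" unfolding w(2) cls_iff[OF w(1)] using w(1) self_orbit by blast
    then have "(SOME w. w \<in> C) \<in> C" by (rule someI)
    then obtain v where v: "v = (SOME w. w \<in> C)" "maximal_wicks g v" "pairing v \<in> rot_orbit n (pairing w)"
      unfolding w(2) cls_iff[OF w(1)] by blast
    have "card (rot_orbit n (pairing v)) * card (stab n (pairing v)) = n" by (rule orbit_stabilizer(1)[OF n0])
    moreover have "rot_orbit n (pairing v) = pairing ` C" unfolding w(2) pairing_cls[OF w(1)] by (rule orbit_same(1)[OF v(3)])
    moreover have "order (wicks_Aut v) = card (stab n (pairing v))" by (rule order_Aut[OF maxD(2)[OF v(2)] maxD(1)[OF v(2)] n0])
    ultimately have e: "real (card (pairing ` C)) * real (order (wicks_Aut v)) = real n" by (metis of_nat_mult)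
    have "real n \<noteq> 0" using n0 by simp
    then have nz: "real (card (pairing ` C)) \<noteq> 0" unfolding e[symmetric] by simp
    have "1 / y = x / n'" if "x * y = n'" "x \<noteq> 0" for x y n' :: real
      unfolding that(1)[symmetric] using that(2) by simp
    from this[OF e nz] show ?thesis unfolding v(1) .
  qed
  have disj: "pairing ` C \<inter> pairing ` C' = {}" if h: "C \<in> W" "C' \<in> W" "C \<noteq> C'" for C C'
  proof (rule ccontr)
    assume "pairing ` C \<inter> pairing ` C' \<noteq> {}"
    obtain w where w1: "maximal_wicks g w" "C = cls g w" using C[OF h(1)] by blast
    obtain w' where w2: "maximal_wicks g w'" "C' = cls g w'" using C[OF h(2)] by blast
    note w = w1 w2
    obtain \<alpha> where a: "\<alpha> \<in> rot_orbit n (pairing w)" "\<alpha> \<in> rot_orbit n (pairing w')"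
      using \<open>pairing ` C \<inter> pairing ` C' \<noteq> {}\<close> unfolding w(2,4) pairing_cls[OF w(1)] pairing_cls[OF w(3)] by blast
    have eq: "rot_orbit n (pairing w) = rot_orbit n (pairing w')" using orbit_same(1)[OF a(1)] orbit_same(1)[OF a(2)] by simp
    have "C = C'" unfolding w(2,4) by (rule Set.set_eqI) (simp only: cls_iff[OF w(1)] cls_iff[OF w(3)] eq)
    then show False using h(3) by blast
  qed
  have un: "(\<Union>C\<in>W. pairing ` C) = {\<alpha> \<in> rooted n 0 0. Q \<alpha>}"
  proof (intro equalityI subsetI)
    fix \<alpha> assume "\<alpha> \<in> (\<Union>C\<in>W. pairing ` C)"
    then obtain C where C1: "C \<in> W" "\<alpha> \<in> pairing ` C" by (elim UN_E)
    obtain v where v: "C \<in> W" "v \<in> C" "\<alpha> = pairing v" using C1 by (elim imageE) simp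
    obtain w where w: "maximal_wicks g w" "C = cls g w" using C[OF v(1)] by blast
    have vm: "maximal_wicks g v" "pairing v \<in> rot_orbit n (pairing w)" using v(2) unfolding w(2) cls_iff[OF w(1)] by blast+
    have "cls g v = cls g w"
      by (rule Set.set_eqI) (simp only: cls_iff[OF vm(1)] cls_iff[OF w(1)] orbit_same(1)[OF vm(2)])
    then have "Q (pairing v)" using Q[OF vm(1)] v(1) w(2) by simp
    then show "\<alpha> \<in> {\<alpha> \<in> rooted n 0 0. Q \<alpha>}" using maxD(3)[OF vm(1)] v(3) by blast
  next
    fix \<alpha> assume "\<alpha> \<in> {\<alpha> \<in> rooted n 0 0. Q \<alpha>}"
    then have a: "\<alpha> \<in> rooted n 0 0" "Q \<alpha>" by auto
    obtain w where w: "maximal_wicks g w" "pairing w = \<alpha>" using word_exists[OF a(1)] .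
    then have "cls g w \<in> W" using Q a(2) by blast
    moreover have "\<alpha> \<in> pairing ` cls g w" unfolding pairing_cls[OF w(1)] w(2) by (rule self_orbit)
    ultimately show "\<alpha> \<in> (\<Union>C\<in>W. pairing ` C)" by blast
  qed
  have finC: "finite (pairing ` C)" if "C \<in> W" for C
  proof -
    obtain w where w: "maximal_wicks g w" "C = cls g w" using C[OF \<open>C \<in> W\<close>] by blast
    show ?thesis unfolding w(2) pairing_cls[OF w(1)] by (rule orbit_stabilizer(2)[OF n0])
  qed
  have finM: "finite {\<alpha> \<in> rooted n 0 0. Q \<alpha>}" using finite_rooted[of n 0 0] by simp
  have neC: "pairing ` C \<noteq> {}" if "C \<in> W" for C 
  proof -
    obtain w where w: "maximal_wicks g w" "C = cls g w" using C[OF \<open>C \<in> W\<close>] by blast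
    show ?thesis unfolding w(2) pairing_cls[OF w(1)] using self_orbit by blast
  qed
  \<comment> \<open>\<open>W\<close> is finite because its members have disjoint nonempty images
    inside a finite set; only then do \<open>mass\<close> and the cardinality of the union
    agree.\<close>
  have "finite ((`) pairing ` W)"
    by (rule finite_subset[of _ "Pow {\<alpha> \<in> rooted n 0 0. Q \<alpha>}"]) (use un finM in auto)
  moreover have "inj_on ((`) pairing) W"
  proof (rule inj_onI)
    fix C C' assume h: "C \<in> W" "C' \<in> W" "pairing ` C = pairing ` C'"
    show "C = C'"
    proof (rule ccontr)
      assume "C \<noteq> C'"
      then have "pairing ` C \<inter> pairing ` C' = {}" by (rule disj[OF h(1,2)])
      then show False using neC[OF h(1)] h(3) by simp
    qed
  qed
  ultimately have finW: "finite W" by (rule finite_imageD)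
  have "mass W = (\<Sum>C\<in>W. real (card (pairing ` C)) / real n)" unfolding mass_def by (rule sum.cong[OF refl]) (rule summand)
  also have "\<dots> = real (\<Sum>C\<in>W. card (pairing ` C)) / real n" by (simp add: sum_divide_distrib)
  also have "(\<Sum>C\<in>W. card (pairing ` C)) = card (\<Union>C\<in>W. pairing ` C)"
    by (rule card_UN_disjoint[symmetric]) (use finW finC disj in auto)
  finally show ?thesis unfolding un .
qed

end

text \<open>A letter goes to its inverse exactly when the rotation moves its position to the one
  glued with it; each reversed edge accounts for two positions.\<close>

lemma card_reversed_edges:
  assumes p: "paired w" and len: "length w = n" and s: "shift_relabelling w \<mu> \<phi>"
  shows "2 * card (reversed_edges w \<phi>) = edge_shift n (pairing w) (nat \<mu>)"
proof -
  have r: "relabelling \<phi> w w" "rotate (nat \<mu>) w = map \<phi> w" using s unfolding shift_relabelling_def by blast+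
  note ph = relabel_commute(1)[OF p p len len r]
  let ?B = "{a \<in> set w. \<phi> a = letter_inv a}"
  have rev: "reversed_edges w \<phi> = {{a, letter_inv a} | a. a \<in> ?B}"
    unfolding reversed_edges_def by simp
  have inv: "letter_inv a \<in> ?B" if "a \<in> ?B" for a
  proof -
    have a: "a \<in> set w" "\<phi> a = letter_inv a" using that by auto
    have "letter_inv a \<in> set w" using p a(1) unfolding paired_def by blast
    moreover have "\<phi> (letter_inv a) = letter_inv (\<phi> a)" using r(1) a(1) unfolding relabelling_def by blast
    ultimately show ?thesis using a(2) by simp
  qed
  have "2 * card (reversed_edges w \<phi>) = card ?B"
    unfolding rev by (rule card_inverse_pairs[OF _ inv]) auto
  also have "?B = (!) w ` {i. i < n \<and> pairing w i = (i + nat \<mu>) mod n}"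
  proof (intro equalityI subsetI)
    fix a assume "a \<in> ?B"
    then have a: "a \<in> set w" "\<phi> a = letter_inv a" by auto
    obtain i where i: "i < n" "a = w ! i" using a(1) len by (auto simp: in_set_conv_nth)
    have m: "(i + nat \<mu>) mod n < n" using i(1) by simp
    have "w ! ((i + nat \<mu>) mod n) = letter_inv (w ! i)" using ph[OF i(1)] a(2) i(2) by simp
    then have "pairing w i = (i + nat \<mu>) mod n" using pairing_eq_iff[OF p] i(1) m len by simp
    then show "a \<in> (!) w ` {i. i < n \<and> pairing w i = (i + nat \<mu>) mod n}" using i by blast
  next
    fix a assume "a \<in> (!) w ` {i. i < n \<and> pairing w i = (i + nat \<mu>) mod n}"
    then obtain i where i: "i < n" "pairing w i = (i + nat \<mu>) mod n" "a = w ! i" by blast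
    have "\<phi> a = w ! pairing w i" using ph[OF i(1)] i(2,3) by simp
    also have "\<dots> = letter_inv a" using pairing_props(2)[OF p, of i] i(1,3) len by simp
    finally show "a \<in> ?B" using i len by simp
  qed
  also have "card \<dots> = edge_shift n (pairing w) (nat \<mu>)"
    unfolding edge_shift_def
  proof (rule card_image)
    have "inj_on ((!) w) {..<n}" using p len unfolding paired_def by (simp add: inj_on_nth)
    then show "inj_on ((!) w) {i. i < n \<and> pairing w i = (i + nat \<mu>) mod n}" by (rule inj_on_subset) auto
  qed
  finally show ?thesis .
qed

section \<open>Signs of the vertices fixed by a symmetry of order 3\<close>

lemma three_blocks:
  assumes "length u = 3 * m" "m \<ge> 2"
  shows "\<exists>x y z. u = [u ! 0, u ! 1] @ x @ [u ! m, u ! Suc m] @ y @ [u ! (2 * m), u ! Suc (2 * m)] @ z"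
proof -
  have two: "v = [v ! 0, v ! 1] @ drop 2 v" if "length v \<ge> 2" for v :: "'a list"
  proof -
    obtain a b r where "v = a # b # r" using \<open>length v \<ge> 2\<close> by (cases v; cases "tl v") auto
    then show ?thesis by simp
  qed
  let ?b1 = "take m u" and ?b2 = "take m (drop m u)" and ?b3 = "drop (2 * m) u"
  have u: "u = ?b1 @ ?b2 @ ?b3"
  proof -
    have "?b2 @ drop m (drop m u) = drop m u" by (rule append_take_drop_id)
    then have "?b2 @ ?b3 = drop m u" unfolding drop_drop mult_2 .
    then show ?thesis by (simp only: append_take_drop_id)
  qed
  have b1: "?b1 = [u ! 0, u ! 1] @ drop 2 ?b1" using two[of ?b1] assms by simp
  have b2: "?b2 = [u ! m, u ! Suc m] @ drop 2 ?b2" using two[of ?b2] assms by simp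
  have b3: "?b3 = [u ! (2 * m), u ! Suc (2 * m)] @ drop 2 ?b3" using two[of ?b3] assms by simp
  have "u = ([u ! 0, u ! 1] @ drop 2 ?b1) @ ([u ! m, u ! Suc m] @ drop 2 ?b2) @ ([u ! (2 * m), u ! Suc (2 * m)] @ drop 2 ?b3)"
    using u b1 b2 b3 by (simp only:)
  then have "u = [u ! 0, u ! 1] @ drop 2 ?b1 @ [u ! m, u ! Suc m] @ drop 2 ?b2 @ [u ! (2 * m), u ! Suc (2 * m)] @ drop 2 ?b3"
    by (simp only: append_assoc)
  then show ?thesis by blast
qed

lemma multiples_between:
  assumes "m dvd X" "m dvd Y" "0 < X" "X < Y" "Y < 3 * m"
  shows "X = m" "Y = 2 * (m :: nat)"
proof -
  obtain a where a: "X = m * a" using assms(1) by (elim dvdE)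
  obtain b where b: "Y = m * b" using assms(2) by (elim dvdE)
  have "a > 0" using assms(3) a by (cases a) auto
  moreover have "a < b" using assms(4) unfolding a b by simp
  moreover have "b < 3" using assms(5) unfolding b by (simp add: mult.commute)
  ultimately have "a = 1" "b = 2" by linarith+
  then show "X = m" "Y = 2 * m" using a b by auto
qed

context
  fixes w :: "letter list" and n m :: nat
  assumes p: "paired w" and len: "length w = n" and n: "n = 3 * m" and m2: "m \<ge> 2"
    and t3: "\<And>i. corner w (corner w (corner w i)) = i" and nf: "\<And>i. i < n \<Longrightarrow> corner w i \<noteq> i"
    and com: "rot_eq n m (pairing w) (pairing w)"
begin

definition orb :: "nat \<Rightarrow> nat set" where
  "orb i = {i, corner w i, corner w (corner w i)}"

definition shifted :: "nat \<Rightarrow> nat set" where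
  "shifted e = {i. i < n \<and> corner w i = (i + e) mod n}"

lemma corner_com: "i < n \<Longrightarrow> corner w ((i + m) mod n) = (corner w i + m) mod n"
proof -
  assume i: "i < n"
  have cL: "corner w i < n" using corner_props(1)[OF p] i len by simp
  have e: "pairing w (shifts n m x) = shifts n m (pairing w x)" for x using fun_cong[OF com[unfolded rot_eq_def], of x] by simp
  have nx: "next_pos n (shifts n m x) = shifts n m (next_pos n x)" for x using fun_cong[OF shifts_next[of n m], of x] by simp
  have "corner w (shifts n m i) = shifts n m (corner w i)" unfolding corner_def len comp_apply nx e ..
  then show ?thesis unfolding shifts_apply[OF i] shifts_apply[OF cL] .
qed

lemma mod2: "((i + m) mod n + m) mod n = (i + 2 * m) mod n"
  by (simp add: mod_add_left_eq mult_2 add.assoc)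

lemma mod3: "i < n \<Longrightarrow> ((i + 2 * m) mod n + m) mod n = i" "i < n \<Longrightarrow> ((i + 2 * m) mod n + 2 * m) mod n = (i + m) mod n"
proof -
  show "((i + 2 * m) mod n + m) mod n = i" if "i < n"
  proof -
    have "((i + 2 * m) mod n + m) mod n = (i + 2 * m + m) mod n" by (rule mod_add_left_eq)
    also have "i + 2 * m + m = i + n" using n by simp
    finally show ?thesis using that by simp
  qed
  show "((i + 2 * m) mod n + 2 * m) mod n = (i + m) mod n" if "i < n"
  proof -
    have "((i + 2 * m) mod n + 2 * m) mod n = (i + 2 * m + 2 * m) mod n" by (rule mod_add_left_eq)
    also have "i + 2 * m + 2 * m = i + m + n" using n by simp
    finally show ?thesis by simp
  qed
qed

lemma corner_com2: "i < n \<Longrightarrow> corner w ((i + 2 * m) mod n) = (corner w i + 2 * m) mod n"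
proof -
  assume i: "i < n"
  have n0: "n > 0" using i by simp
  have "corner w (((i + m) mod n + m) mod n) = (corner w ((i + m) mod n) + m) mod n"
    by (rule corner_com) (use n0 in simp)
  also have "\<dots> = ((corner w i + m) mod n + m) mod n" unfolding corner_com[OF i] ..
  finally show ?thesis unfolding mod2 .
qed

lemma shifted_orb:
  assumes i: "i < n" and e: "e = m \<or> e = 2 * m" and s: "i \<in> shifted e"
  shows "orb i = {i, (i + m) mod n, (i + 2 * m) mod n}" "corner w i \<in> shifted e"
proof -
  have ci: "corner w i = (i + e) mod n" using s unfolding shifted_def by blast
  have n0: "n > 0" using i by simp
  have cc: "corner w (corner w i) = (corner w i + e) mod n"
    using e corner_com[OF i] corner_com2[OF i] ci by auto
  then show "corner w i \<in> shifted e" unfolding shifted_def using ci n0 by simp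
  show "orb i = {i, (i + m) mod n, (i + 2 * m) mod n}"
  proof (cases "e = m")
    case True
    have "corner w (corner w i) = (i + 2 * m) mod n" unfolding cc unfolding ci True mod2 ..
    then show ?thesis unfolding orb_def using ci True by simp
  next
    case False
    then have e2: "e = 2 * m" using e by blast
    have X: "corner w (corner w i) = (i + m) mod n" unfolding cc unfolding ci e2 by (rule mod3(2)[OF i])
    show ?thesis unfolding orb_def X unfolding ci e2 by blast
  qed
qed

lemma shift_ne: "i < n \<Longrightarrow> (i + m) mod n \<noteq> i" "i < n \<Longrightarrow> (i + 2 * m) mod n \<noteq> i" "i < n \<Longrightarrow> (i + m) mod n \<noteq> (i + 2 * m) mod n"
proof -
  have gen: "(i + x) mod n \<noteq> i" if "i < n" "0 < x" "x < n" for i x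
  proof (cases "i + x < n")
    case True then show ?thesis using that by simp
  next
    case False
    then have "(i + x) mod n = i + x - n" using that by (simp add: le_mod_geq)
    then show ?thesis using that False by simp
  qed
  show 1: "(i + m) mod n \<noteq> i" if "i < n" for i by (rule gen[OF that]) (use n m2 in auto)
  show "(i + 2 * m) mod n \<noteq> i" if "i < n" by (rule gen[OF that]) (use n m2 in auto)
  show "(i + m) mod n \<noteq> (i + 2 * m) mod n" if "i < n"
    using 1[of "(i + m) mod n"] that unfolding mod2 by (metis mod_less_divisor not_gr_zero not_less_zero)
qed

lemma vertices_orb: "V \<in> vertices w \<longleftrightarrow> (\<exists>i. i < n \<and> V = orb i)"
proof -
  have "glue_rel w `` {i} = orb i" if "i < n" for i
    unfolding orb_def by (rule glue_class_cubic[OF p t3]) (use that len in simp)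
  then show ?thesis unfolding vertices_eq mem_Collect_eq len by metis
qed

text \<open>A turn by one or two thirds fixes no position, so on a fixed vertex it permutes the
  three corners cyclically, as \<open>corner w\<close> or as its inverse. The two nontrivial turns
  fix the same vertices, hence the freedom in \<open>\<mu>\<close>.\<close>

lemma fixed_iff:
  assumes mu: "\<mu> = int m \<or> \<mu> = int (2 * m)" and V: "V = orb i" and i: "i < n"
  shows "V \<in> fixed_vertices w \<mu> \<longleftrightarrow> i \<in> shifted m \<or> i \<in> shifted (2 * m)"
proof -
  have n0: "n > 0" using i by simp
  have Vv: "V \<in> vertices w" unfolding vertices_orb using V i by blast
  define e where "e = nat \<mu>"
  have e: "e = m \<or> e = 2 * m" using mu unfolding e_def by auto
  have fx: "V \<in> fixed_vertices w \<mu> \<longleftrightarrow> (\<lambda>j. (j + e) mod n) ` V = V"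
    unfolding fixed_vertices_def e_def len using Vv by simp
  have ce: "corner w ((j + e) mod n) = (corner w j + e) mod n" if "j < n" for j
    using e corner_com[OF that] corner_com2[OF that] by blast
  have ene: "(i + e) mod n \<noteq> i" using e shift_ne[OF i] by blast
  show ?thesis unfolding fx
  proof
    assume h: "(\<lambda>j. (j + e) mod n) ` V = V"
    have "i \<in> V" unfolding V orb_def by simp
    then have "(i + e) mod n \<in> V" using h by blast
    then have "corner w i = (i + e) mod n \<or> corner w (corner w i) = (i + e) mod n"
      using ene unfolding V orb_def by auto
    then show "i \<in> shifted m \<or> i \<in> shifted (2 * m)"
    proof
      assume "corner w i = (i + e) mod n"
      then show ?thesis unfolding shifted_def using e i by blast
    next
      assume "corner w (corner w i) = (i + e) mod n"
      then have "corner w (corner w (corner w i)) = (corner w i + e) mod n" using ce[OF i] by simp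
      then have ii: "i = (corner w i + e) mod n" unfolding t3 .
      define c where "c = corner w i"
      have cL: "c < n" unfolding c_def using corner_props(1)[OF p] i len by simp
      \<comment> \<open>Inverting the turn by \<open>e\<close> exchanges \<open>m\<close> and
        \<open>2 * m\<close>.\<close>
      have "c = (i + (3 * m - e)) mod n"
      proof -
        have "(i + (3 * m - e)) mod n = ((c + e) mod n + (3 * m - e)) mod n" using ii unfolding c_def by simp
        also have "\<dots> = (c + e + (3 * m - e)) mod n" by (rule mod_add_left_eq)
        also have "c + e + (3 * m - e) = c + n" using e n by auto
        finally show ?thesis using cL by simp
      qed
      moreover have "3 * m - e = m \<or> 3 * m - e = 2 * m" using e by auto
      ultimately show ?thesis unfolding shifted_def c_def using i by auto
    qed
  next
    assume "i \<in> shifted m \<or> i \<in> shifted (2 * m)"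
    then have V3: "V = {i, (i + m) mod n, (i + 2 * m) mod n}" unfolding V using shifted_orb(1)[OF i] by blast
    have three: "(\<lambda>j. (j + m) mod n) ` V = V" unfolding V3 using mod2[of i] mod3(1)[OF i] by auto
    moreover have "(\<lambda>j. (j + 2 * m) mod n) ` V = V"
    proof -
      have "(\<lambda>j. (j + 2 * m) mod n) ` V = (\<lambda>j. (j + m) mod n) ` ((\<lambda>j. (j + m) mod n) ` V)"
        by (simp add: image_image mod2)
      then show ?thesis unfolding three .
    qed
    ultimately show "(\<lambda>j. (j + e) mod n) ` V = V" using e by blast
  qed
qed

text \<open>The three corners of a fixed vertex are spaced by \<open>m\<close>, hence congruent
  modulo \<open>m\<close>. In an occurrence of a pattern the second and third blocks therefore start
  at multiples of \<open>m\<close> from the first, and their order inside the word leaves only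
  \<open>m\<close> and \<open>2 * m\<close>.\<close>

lemma pattern_positions:
  assumes i: "i < n" and V: "incoming w (orb i) = {a, b, c}" "orb i = {i, (i + m) mod n, (i + 2 * m) mod n}"
    and r: "rotate k w = [a, a'] @ x @ [b, b'] @ y @ [c, c'] @ z"
  shows "\<exists>j. j \<in> orb i \<and> j < n \<and> w ! j = a \<and> w ! (Suc j mod n) = a' \<and> w ! ((j + m) mod n) = b \<and> w ! ((j + 2 * m) mod n) = c"
proof -
  have n0: "n > 0" using i by simp
  \<comment> \<open>Offsets of \<open>b\<close> and \<open>c\<close> from \<open>a\<close>; every
    block has two letters.\<close>
  define X Y where "X = 2 + length x" and "Y = 4 + length x + length y"
  have ln: "n = length x + length y + length z + 6" using arg_cong[OF r, of length] len by simp
  have nth: "rotate k w ! t = w ! ((k + t) mod n)" if "t < n" for t using nth_rotate[of t w k] that len by simp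
  have at: "w ! ((k + 0) mod n) = a" "w ! ((k + 1) mod n) = a'" "w ! ((k + X) mod n) = b" "w ! ((k + Y) mod n) = c"
  proof -
    have "0 < n" "1 < n" "X < n" "Y < n" unfolding X_def Y_def using ln by auto
    moreover have "rotate k w ! 0 = a" "rotate k w ! 1 = a'" "rotate k w ! X = b" "rotate k w ! Y = c"
      unfolding r X_def Y_def by (simp_all add: nth_append)
    ultimately show "w ! ((k + 0) mod n) = a" "w ! ((k + 1) mod n) = a'" "w ! ((k + X) mod n) = b" "w ! ((k + Y) mod n) = c"
      using nth by metis+
  qed
  have inV: "t \<in> orb i" if t: "t < n" "w ! t \<in> {a, b, c}" for t
  proof -
    obtain v where v: "v \<in> orb i" "w ! t = w ! v" using t(2) unfolding V(1)[symmetric] incoming_def by blast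
    have "v < n" using v(1) unfolding V(2) using i n0 by auto
    then show ?thesis using paired_nth_eq[OF p, of t v] t(1) v len by simp
  qed
  have modm: "t mod m = i mod m" if "t \<in> orb i" for t
  proof -
    have "m dvd n" using n by simp
    then have *: "(s mod n) mod m = s mod m" for s by (rule mod_mod_cancel)
    show ?thesis using that unfolding V(2) by (auto simp: * mod_add_eq)
  qed
  have "m dvd n" using n by simp
  then have mc: "(s mod n) mod m = s mod m" for s by (rule mod_mod_cancel)
  have kk: "(k + t) mod m = i mod m" if "w ! ((k + t) mod n) \<in> {a, b, c}" for t
    using modm[OF inV[OF _ that]] n0 unfolding mc by simp
  have k0: "k mod m = i mod m" using kk[of 0] at by simp
  have dv: "m dvd t" if "w ! ((k + t) mod n) \<in> {a, b, c}" for t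
  proof -
    have "(k + t) mod m = (k + 0) mod m" using kk[OF that] k0 by simp
    then have "[k + t = k + 0] (mod m)" unfolding cong_def .
    then have "[t = 0] (mod m)" by (simp only: cong_add_lcancel_nat)
    then show ?thesis by (simp only: cong_0_iff)
  qed
  have "m dvd X" "m dvd Y" using dv[of X] dv[of Y] at by auto
  moreover have "0 < X" "X < Y" "Y < 3 * m" unfolding X_def Y_def using ln n by auto
  ultimately have XY: "X = m" "Y = 2 * m" using multiples_between[of m X Y] by auto
  define j where "j = k mod n"
  have jn: "j < n" unfolding j_def using n0 by simp
  have e: "(j + t) mod n = (k + t) mod n" for t unfolding j_def by (rule mod_add_left_eq)
  have ja: "w ! j = a" using at(1) jn e[of 0] by simp
  have "j \<in> orb i" by (rule inV[OF jn]) (simp add: ja)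
  moreover have "w ! (Suc j mod n) = a'" using at(2) e[of 1] by simp
  moreover have "w ! ((j + m) mod n) = b" "w ! ((j + 2 * m) mod n) = c" unfolding e using at(3,4) XY by auto
  ultimately show ?thesis using jn ja by blast
qed

lemma shifted_mem_orb:
  assumes i: "i < n" "i \<in> shifted e" "e = m \<or> e = 2 * m" and j: "j \<in> orb i"
  shows "j \<in> shifted e"
proof -
  have c: "corner w i \<in> shifted e" by (rule shifted_orb(2)[OF i(1,3,2)])
  have cn: "corner w i < n" using c unfolding shifted_def by blast
  have "corner w (corner w i) \<in> shifted e" by (rule shifted_orb(2)[OF cn i(3) c])
  then show ?thesis using j c i(2) unfolding orb_def by auto
qed

lemma shifted_disj: "i \<in> shifted m \<Longrightarrow> i \<notin> shifted (2 * m)"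
  unfolding shifted_def using shift_ne(3) by auto

lemma rot_nth: "i < n \<Longrightarrow> t < n \<Longrightarrow> rotate i w ! t = w ! ((i + t) mod n)"
  using nth_rotate[of t w i] len by simp

lemma corner_letter: "j < n \<Longrightarrow> w ! (Suc j mod n) = letter_inv (w ! corner w j)"
  using iffD1[OF corner_props(2)[OF p, of j "corner w j"]] corner_props(1)[OF p, of j] len by simp

text \<open>In a positive pattern the corner at \<open>a\<close> is followed around the vertex by
  the corner at \<open>b\<close>, which is the next block, at distance \<open>m\<close>. In a
  negative pattern \<open>b\<close> begins the third block, at distance \<open>2 * m\<close>. The
  sign is thus the turn by which \<open>corner w\<close> acts.\<close>

lemma sign_iff:
  assumes i: "i < n" and s: "i \<in> shifted m \<or> i \<in> shifted (2 * m)"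
  shows "positive_vertex w (orb i) \<longleftrightarrow> i \<in> shifted m" "negative_vertex w (orb i) \<longleftrightarrow> i \<in> shifted (2 * m)"
proof -
  have n0: "n > 0" using i by simp
  have V: "orb i = {i, (i + m) mod n, (i + 2 * m) mod n}" using s shifted_orb(1)[OF i] by blast
  have posD: "i \<in> shifted m" if pt: "positive_pattern w a b c" and inc: "incoming w (orb i) = {a, b, c}" for a b c
  proof -
    obtain x y z k where "rotate k w = [a, letter_inv b] @ x @ [b, letter_inv c] @ y @ [c, letter_inv a] @ z"
      using pt unfolding positive_pattern_def same_cyclic_word_def by blast
    from pattern_positions[OF i inc V this]
    obtain j where j: "j \<in> orb i" "j < n" "w ! (Suc j mod n) = letter_inv b" "w ! ((j + m) mod n) = b" by blast
    have "corner w j = (j + m) mod n" using corner_props(2)[OF p, of j "(j + m) mod n"] j len n0 by simp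
    then have "j \<in> shifted m" unfolding shifted_def using j(2) by blast
    then show ?thesis using s shifted_mem_orb[OF i _ _ j(1), of "2 * m"] shifted_disj by blast
  qed
  have negD: "i \<in> shifted (2 * m)" if pt: "negative_pattern w a b c" and inc: "incoming w (orb i) = {a, b, c}" for a b c
  proof -
    obtain x y z k where r: "rotate k w = [a, letter_inv b] @ x @ [c, letter_inv a] @ y @ [b, letter_inv c] @ z"
      using pt unfolding negative_pattern_def same_cyclic_word_def by blast
    have inc': "incoming w (orb i) = {a, c, b}" using inc by blast
    from pattern_positions[OF i inc' V r]
    obtain j where j: "j \<in> orb i" "j < n" "w ! (Suc j mod n) = letter_inv b" "w ! ((j + 2 * m) mod n) = b" by blast
    have "corner w j = (j + 2 * m) mod n" using corner_props(2)[OF p, of j "(j + 2 * m) mod n"] j len n0 by simp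
    then have "j \<in> shifted (2 * m)" unfolding shifted_def using j(2) by blast
    then show ?thesis using s shifted_mem_orb[OF i _ _ j(1), of m] shifted_disj by blast
  qed
  let ?a = "w ! i" and ?b = "w ! ((i + m) mod n)" and ?c = "w ! ((i + 2 * m) mod n)"
  have dist: "distinct [?a, ?b, ?c]"
    using shift_ne[OF i] paired_nth_eq[OF p, of i "(i + m) mod n"] paired_nth_eq[OF p, of i "(i + 2 * m) mod n"]
      paired_nth_eq[OF p, of "(i + m) mod n" "(i + 2 * m) mod n"] i n0 len by auto
  have inc: "incoming w (orb i) = {?a, ?b, ?c}" unfolding incoming_def V by simp
  \<comment> \<open>Read from corner \<open>i\<close>, the word falls into three blocks of length
    \<open>m\<close>, each beginning at a corner of the vertex; what follows each corner then
    decides the pattern.\<close>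
  obtain x y z where blk: "rotate i w = [rotate i w ! 0, rotate i w ! 1] @ x @ [rotate i w ! m, rotate i w ! Suc m] @ y
      @ [rotate i w ! (2 * m), rotate i w ! Suc (2 * m)] @ z"
    using three_blocks[of "rotate i w" m] len n m2 by auto
  have sm: "m < n" "Suc m < n" "2 * m < n" "Suc (2 * m) < n" "1 < n" using n m2 by auto
  have S: "(i + Suc t) mod n = Suc ((i + t) mod n) mod n" for t by (simp add: mod_Suc_eq)
  have i1: "(i + m) mod n < n" "(i + 2 * m) mod n < n" using n0 by simp_all
  have r: "rotate i w ! 0 = ?a" "rotate i w ! m = ?b" "rotate i w ! (2 * m) = ?c"
    "rotate i w ! 1 = letter_inv (w ! corner w i)" "rotate i w ! Suc m = letter_inv (w ! corner w ((i + m) mod n))"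
    "rotate i w ! Suc (2 * m) = letter_inv (w ! corner w ((i + 2 * m) mod n))"
    using rot_nth[OF i n0] rot_nth[OF i sm(1)] rot_nth[OF i sm(3)] rot_nth[OF i sm(5)] rot_nth[OF i sm(2)] rot_nth[OF i sm(4)]
      corner_letter[OF i] corner_letter[OF i1(1)] corner_letter[OF i1(2)] i S[of m] S[of "2 * m"] by simp_all
  have blk': "rotate i w = [?a, letter_inv (w ! corner w i)] @ x @ [?b, letter_inv (w ! corner w ((i + m) mod n))] @ y
      @ [?c, letter_inv (w ! corner w ((i + 2 * m) mod n))] @ z"
    using blk unfolding r .
  have posI: "positive_vertex w (orb i)" if h: "i \<in> shifted m"
  proof -
    have c0: "corner w i = (i + m) mod n" using h unfolding shifted_def by blast
    have c1: "corner w ((i + m) mod n) = (i + 2 * m) mod n" unfolding corner_com[OF i] c0 mod2 ..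
    have c2: "corner w ((i + 2 * m) mod n) = i"
    proof -
      have "((i + m) mod n + 2 * m) mod n = (i + m + 2 * m) mod n" by (rule mod_add_left_eq)
      also have "i + m + 2 * m = i + n" using n by simp
      finally show ?thesis unfolding corner_com2[OF i] c0 using i by simp
    qed
    have "positive_pattern w ?a ?b ?c" unfolding positive_pattern_def same_cyclic_word_def
      using blk' unfolding c0 c1 c2 by blast
    then show ?thesis unfolding positive_vertex_def using dist inc by blast
  qed
  have negI: "negative_vertex w (orb i)" if h: "i \<in> shifted (2 * m)"
  proof -
    have c0: "corner w i = (i + 2 * m) mod n" using h unfolding shifted_def by blast
    have c1: "corner w ((i + m) mod n) = i" unfolding corner_com[OF i] c0 by (rule mod3(1)[OF i])
    have c2: "corner w ((i + 2 * m) mod n) = (i + m) mod n" unfolding corner_com2[OF i] c0 by (rule mod3(2)[OF i])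
    have "negative_pattern w ?a ?c ?b" unfolding negative_pattern_def same_cyclic_word_def
      using blk' unfolding c0 c1 c2 by blast
    moreover have "distinct [?a, ?c, ?b]" "incoming w (orb i) = {?a, ?c, ?b}" using dist inc by auto
    ultimately show ?thesis unfolding negative_vertex_def by blast
  qed
  show "positive_vertex w (orb i) \<longleftrightarrow> i \<in> shifted m"
  proof
    assume "positive_vertex w (orb i)"
    then obtain a b c where h: "incoming w (orb i) = {a, b, c}" "positive_pattern w a b c \<or> positive_pattern w a c b"
      unfolding positive_vertex_def by blast
    have "incoming w (orb i) = {a, c, b}" using h(1) by blast
    then show "i \<in> shifted m" using h posD by blast
  qed (rule posI)
  show "negative_vertex w (orb i) \<longleftrightarrow> i \<in> shifted (2 * m)"
  proof
    assume "negative_vertex w (orb i)"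
    then obtain a b c where h: "incoming w (orb i) = {a, b, c}" "negative_pattern w a b c \<or> negative_pattern w a c b"
      unfolding negative_vertex_def by blast
    have "incoming w (orb i) = {a, c, b}" using h(1) by blast
    then show "i \<in> shifted (2 * m)" using h negD by blast
  qed (rule negI)
qed

lemma card_orbs:
  assumes e: "e = m \<or> e = 2 * m"
  shows "3 * card (orb ` shifted e) = vert_shift n (pairing w) e"
proof -
  have vs: "vert_shift n (pairing w) e = card (shifted e)"
    unfolding vert_shift_def shifted_def corner_def len by simp
  have un: "\<Union> (orb ` shifted e) = shifted e"
  proof (intro equalityI subsetI)
    fix j assume "j \<in> \<Union> (orb ` shifted e)"
    then obtain i where i: "i \<in> shifted e" "j \<in> orb i" by blast
    then have "i < n" unfolding shifted_def by blast
    then show "j \<in> shifted e" using shifted_mem_orb[OF _ i(1) e i(2)] by blast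
  next
    fix j assume "j \<in> shifted e"
    moreover have "j \<in> orb j" unfolding orb_def by simp
    ultimately show "j \<in> \<Union> (orb ` shifted e)" by blast
  qed
  have iff: "corner w x \<in> orb i \<longleftrightarrow> x \<in> orb i" for x i unfolding orb_def by (rule cube_root_orbit_closed[OF t3 refl])
  have eq: "orb x = orb i" if x: "x \<in> orb i" for x i
  proof -
    have "x = i \<or> x = corner w i \<or> x = corner w (corner w i)" using x unfolding orb_def by blast
    then show ?thesis unfolding orb_def using t3 by auto
  qed
  have c3: "card (orb i) = 3" if "i \<in> shifted e" for i
  proof -
    have "corner w i \<noteq> i" using that nf unfolding shifted_def by blast
    then show ?thesis using cube_root_orbit_distinct[of "corner w" i, OF t3] unfolding orb_def by auto
  qed
  have "card (\<Union> (orb ` shifted e)) = (\<Sum>V\<in>orb ` shifted e. card V)"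
  proof (rule card_Union_disjoint)
    show "pairwise disjnt (orb ` shifted e)"
    proof (rule pairwiseI)
      fix A B assume h: "A \<in> orb ` shifted e" "B \<in> orb ` shifted e" "A \<noteq> B"
      obtain i j where ij: "A = orb i" "B = orb j" using h by blast
      have "A \<inter> B = {}"
      proof (rule ccontr)
        assume "A \<inter> B \<noteq> {}"
        then obtain x where "x \<in> orb i" "x \<in> orb j" using ij by blast
        then have "orb i = orb j" using eq by metis
        then show False using h(3) ij by simp
      qed
      then show "disjnt A B" unfolding disjnt_def .
    qed
    show "finite A" if "A \<in> orb ` shifted e" for A using that unfolding orb_def by auto
  qed
  also have "\<dots> = (\<Sum>V\<in>orb ` shifted e. 3)" by (rule sum.cong) (use c3 in auto)
  finally show ?thesis unfolding un vs by simp
qed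

text \<open>The counts do not depend on \<open>\<mu>\<close>: passing to the inverse symmetry keeps
  the fixed vertices, and the signs depend on the word alone.\<close>

lemma card_signed_fixed:
  assumes mu: "\<mu> = int m \<or> \<mu> = int (2 * m)"
  shows "3 * card {V \<in> fixed_vertices w \<mu>. positive_vertex w V} = vert_shift n (pairing w) m"
    "3 * card {V \<in> fixed_vertices w \<mu>. negative_vertex w V} = vert_shift n (pairing w) (2 * m)"
proof -
  have fv: "\<exists>i. i < n \<and> V = orb i" if "V \<in> fixed_vertices w \<mu>" for V
    using that unfolding fixed_vertices_def vertices_orb by blast
  have 1: "{V \<in> fixed_vertices w \<mu>. positive_vertex w V} = orb ` shifted m"
  proof (intro equalityI subsetI)
    fix V assume "V \<in> {V \<in> fixed_vertices w \<mu>. positive_vertex w V}"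
    then have V: "V \<in> fixed_vertices w \<mu>" "positive_vertex w V" by auto
    obtain i where i: "i < n" "V = orb i" using fv[OF V(1)] by blast
    have s: "i \<in> shifted m \<or> i \<in> shifted (2 * m)" using V(1) unfolding fixed_iff[OF mu i(2,1)] .
    then show "V \<in> orb ` shifted m" using sign_iff(1)[OF i(1) s] V(2) i(2) by blast
  next
    fix V assume "V \<in> orb ` shifted m"
    then obtain i where i: "i \<in> shifted m" "V = orb i" by blast
    then have iL: "i < n" unfolding shifted_def by blast
    have "V \<in> fixed_vertices w \<mu>" unfolding fixed_iff[OF mu i(2) iL] using i by blast
    then show "V \<in> {V \<in> fixed_vertices w \<mu>. positive_vertex w V}" using sign_iff(1)[OF iL] i by blast
  qed
  have 2: "{V \<in> fixed_vertices w \<mu>. negative_vertex w V} = orb ` shifted (2 * m)"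
  proof (intro equalityI subsetI)
    fix V assume "V \<in> {V \<in> fixed_vertices w \<mu>. negative_vertex w V}"
    then have V: "V \<in> fixed_vertices w \<mu>" "negative_vertex w V" by auto
    obtain i where i: "i < n" "V = orb i" using fv[OF V(1)] by blast
    have s: "i \<in> shifted m \<or> i \<in> shifted (2 * m)" using V(1) unfolding fixed_iff[OF mu i(2,1)] .
    then show "V \<in> orb ` shifted (2 * m)" using sign_iff(2)[OF i(1) s] V(2) i(2) by blast
  next
    fix V assume "V \<in> orb ` shifted (2 * m)"
    then obtain i where i: "i \<in> shifted (2 * m)" "V = orb i" by blast
    then have iL: "i < n" unfolding shifted_def by blast
    have "V \<in> fixed_vertices w \<mu>" unfolding fixed_iff[OF mu i(2) iL] using i by blast
    then show "V \<in> {V \<in> fixed_vertices w \<mu>. negative_vertex w V}" using sign_iff(2)[OF iL] i by blast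
  qed
  show "3 * card {V \<in> fixed_vertices w \<mu>. positive_vertex w V} = vert_shift n (pairing w) m"
    unfolding 1 by (rule card_orbs) simp
  show "3 * card {V \<in> fixed_vertices w \<mu>. negative_vertex w V} = vert_shift n (pairing w) (2 * m)"
    unfolding 2 by (rule card_orbs) simp
qed

end

text \<open>\<open>U\<close> is one less than the number of degree-3 vertices of the tree. Splitting
  factors off the factorials gives \<open>fact (2 * Suc U) / fact (Suc U) = 2 * fact (2 * U + 1) /
  fact U\<close>. This requires at least one such vertex; for the words at hand only genus 1 admits
  a quotient without one.\<close>

lemma typed_mass:
  assumes L: "L > 0" and d: "d > 0" and r: "odd d \<Longrightarrow> r = 0" and st: "\<not> 3 dvd d \<Longrightarrow> s = 0 \<and> t = 0"
    and c: "[1 - int (s * (d div 3) + t * (2 * (d div 3))) = int (r * half_volt d)] (mod int d)"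
    and f: "L + 6 = 4 * (s + t) + 3 * r + 12 * f" and V: "r + s + t + 3 * f \<ge> 3"
  shows "real (card (sym_typed d L r s t)) / real (d * L)
    = 2 / real d * ((real d)\<^sup>2 / 12) ^ f * (1 / (fact r * fact s * fact t))
      * (fact (6 * f + 2 * r + 2 * s + 2 * t - 5) / (fact f * fact (3 * f + r + s + t - 3)))"
proof -
  define U where "U = 3 * f + r + s + t - 3"
  have U: "Suc U + 2 = s + t + r + 3 * f" "6 * f + 2 * r + 2 * s + 2 * t - 5 = Suc (2 * U)"
    unfolding U_def using V by linarith+
  have "real (card (sym_typed d L r s t)) / real (d * L)
    = (real d ^ 2) ^ f / real d * fact (2 * Suc U) / (12 ^ f * fact f * fact r * fact s * fact t * fact (Suc U))"
    by (rule sym_typed_count[OF L d r st c f U(1)])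
  also have "(fact (2 * Suc U) :: real) = (2 * real U + 2) * fact (Suc (2 * U))"
    by (simp add: algebra_simps)
  also have "(fact (Suc U) :: real) = (real U + 1) * fact U" by (simp add: algebra_simps)
  also have "(real d ^ 2) ^ f / real d * ((2 * real U + 2) * fact (Suc (2 * U))) /
      (12 ^ f * fact f * fact r * fact s * fact t * ((real U + 1) * fact U))
    = 2 / real d * ((real d)\<^sup>2 / 12) ^ f * (1 / (fact r * fact s * fact t)) * (fact (Suc (2 * U)) / (fact f * fact U))"
  proof -
    have "(2 * real U + 2) = 2 * (real U + 1)" by simp
    moreover have "real U + 1 \<noteq> 0" by linarith
    moreover have "a / b * (2 * x * p) / (q * f' * r' * s' * t' * (x * u)) = 2 / b * (a / q) * (1 / (r' * s' * t')) * (p / (f' * u))"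
      if "x \<noteq> 0" for a b x p q f' r' s' t' u :: real using that by (simp add: field_simps)
    ultimately show ?thesis by (simp only: power_divide)
  qed
  finally show ?thesis unfolding U(2) U_def .
qed

lemma typed_nonempty:
  assumes L: "L > 0" and d: "d > 0" and r: "odd d \<Longrightarrow> r = 0" and st: "\<not> 3 dvd d \<Longrightarrow> s = 0 \<and> t = 0"
    and ne: "card (sym_typed d L r s t) > 0"
  shows "[1 - int (s * (d div 3) + t * (2 * (d div 3))) = int (r * half_volt d)] (mod int d)"
    "\<exists>f. L + 6 = 4 * (s + t) + 3 * r + 12 * f"
proof -
  have "card (sym_typed d L r s t) = card (quotient_data d L r s t)" by (rule card_sym_typed[OF L d r st])
  then have "quotient_data d L r s t \<noteq> {}" using ne by auto
  then obtain q where "q \<in> quotient_data d L r s t" by blast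
  from quotient_data_nonempty[OF L d this]
  show "[1 - int (s * (d div 3) + t * (2 * (d div 3))) = int (r * half_volt d)] (mod int d)"
    "\<exists>f. L + 6 = 4 * (s + t) + 3 * r + 12 * f" by blast+
qed

text \<open>Rotations commute, so conjugate involutions have the same periods.\<close>

lemma rot_eq_conj: "rot_eq n k \<alpha> \<alpha>' \<Longrightarrow> rot_eq n m \<alpha>' \<alpha>' \<Longrightarrow> rot_eq n m \<alpha> \<alpha>"
  by (rule rot_eq_cancel[of n k \<alpha> \<alpha>' m]) (use rot_eq_trans[of n k \<alpha> \<alpha>' m \<alpha>'] in \<open>simp_all add: add.commute\<close>)

context
  fixes g n :: nat
  assumes g: "g \<ge> 1" and n: "n = 12 * g - 6"
begin

text \<open>\<open>W2\<close> and \<open>W3\<close> ask for a suitable word somewhere in the class;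
  these invariances move the condition to a given representative.\<close>

lemma orbit_invariant:
  assumes w: "maximal_wicks g w" and w': "w' \<in> cls g w"
  shows "rot_eq n m (pairing w') (pairing w') \<Longrightarrow> rot_eq n m (pairing w) (pairing w)"
    "edge_shift n (pairing w') m = edge_shift n (pairing w) m"
    "vert_shift n (pairing w') m = vert_shift n (pairing w) m" "maximal_wicks g w'"
proof -
  have h: "maximal_wicks g w'" "pairing w' \<in> rot_orbit n (pairing w)" using w' unfolding cls_iff[OF g n w] by blast+
  then show "maximal_wicks g w'" by blast
  obtain k where k: "rot_eq n k (pairing w) (pairing w')" using h(2) unfolding rot_orbit_def by blast
  have lt: "pairing w i < n" if "i < n" for i by (rule rooted_bounds(1)[OF maxD(3)[OF g n w] that])
  show "rot_eq n m (pairing w) (pairing w)" if "rot_eq n m (pairing w') (pairing w')" by (rule rot_eq_conj[OF k that])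
  show "edge_shift n (pairing w') m = edge_shift n (pairing w) m"
    "vert_shift n (pairing w') m = vert_shift n (pairing w) m" using edge_shift_rot[OF lt k] by blast+
qed

lemma self_cls: "maximal_wicks g w \<Longrightarrow> w \<in> cls g w"
  using cls_iff[OF g n, of w w] self_orbit[OF g n] by blast

text \<open>The shift \<open>6 * g - 3\<close> is half the length, the only one of order 2. A
  reversed edge has two sides, hence the factor in \<open>2 * r\<close>.\<close>

lemma W2_iff:
  assumes w: "maximal_wicks g w"
  shows "cls g w \<in> W2 g r \<longleftrightarrow> rot_eq n (6 * g - 3) (pairing w) (pairing w) \<and> edge_shift n (pairing w) (6 * g - 3) = 2 * r"
proof
  assume "cls g w \<in> W2 g r"
  then obtain w' \<mu> \<phi> where h: "w' \<in> cls g w" "\<mu> \<in> carrier (wicks_Aut w')" "group.ord (wicks_Aut w') \<mu> = 2"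
    "shift_relabelling w' \<mu> \<phi>" "card (reversed_edges w' \<phi>) = r" unfolding W2_def by blast
  note inv = orbit_invariant[OF w h(1)]
  note mx = maxD[OF g n inv(4)] and n0 = n0[OF g n]
  obtain k where k: "k < n" "rot_eq n k (pairing w') (pairing w')" "\<mu> = int k"
    using h(2) unfolding carrier_Aut[OF mx(2,1) n0] stab_def by blast
  have "\<mu> \<noteq> 0 \<and> int n dvd int 2 * \<mu>" using Aut_ord_prime[OF mx(2,1) n0 h(2) two_is_prime_nat] h(3) by blast
  then have k2: "k \<noteq> 0" "int n dvd int (2 * k)" unfolding k(3) by simp_all
  have "n dvd 2 * k" using k2(2) by (simp only: int_dvd_int_iff)
  then obtain q where q: "2 * k = n * q" by (elim dvdE)
  have "q > 0" using k2(1) q by (cases q) auto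
  moreover have "q < 2"
  proof (rule ccontr)
    assume "\<not> q < 2"
    then have "n * 2 \<le> n * q" by simp
    then show False using q k(1) by linarith
  qed
  ultimately have "q = 1" by linarith
  then have kk: "k = 6 * g - 3" using q n g by simp
  have "2 * r = edge_shift n (pairing w') (nat \<mu>)" using card_reversed_edges[OF mx(2,1) h(4)] h(5) by simp
  then show "rot_eq n (6 * g - 3) (pairing w) (pairing w) \<and> edge_shift n (pairing w) (6 * g - 3) = 2 * r"
    using inv(1)[of k] inv(2)[of k] k(2,3) kk by simp
next
  assume h: "rot_eq n (6 * g - 3) (pairing w) (pairing w) \<and> edge_shift n (pairing w) (6 * g - 3) = 2 * r"
  note mx = maxD[OF g n w] and n0 = n0[OF g n]
  let ?k = "6 * g - 3"
  have kn: "?k < n" "0 < ?k" "2 * ?k = n" using n g by auto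
  have c: "int ?k \<in> carrier (wicks_Aut w)" unfolding carrier_Aut[OF mx(2,1) n0] stab_def using h kn by blast
  obtain \<phi> where "relabelling \<phi> w w" "rotate ?k w = map \<phi> w" using relabel_exists[OF mx(2) mx(2) mx(1) mx(1)] h by blast
  then have s: "shift_relabelling w (int ?k) \<phi>" unfolding shift_relabelling_def by simp
  have "int n dvd int 2 * int ?k" unfolding of_nat_mult[symmetric] kn(3) by simp
  then have o: "group.ord (wicks_Aut w) (int ?k) = 2"
    using Aut_ord_prime[OF mx(2,1) n0 c two_is_prime_nat] kn(2) by simp
  have "2 * card (reversed_edges w \<phi>) = edge_shift n (pairing w) (nat (int ?k))" by (rule card_reversed_edges[OF mx(2,1) s])
  then have "card (reversed_edges w \<phi>) = r" using h by simp
  moreover have "cls g w \<in> W1 g" unfolding W1_eq using w by blast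
  ultimately show "cls g w \<in> W2 g r" unfolding W2_def using self_cls[OF w] c o s by blast
qed

text \<open>The shift \<open>4 * g - 2\<close> is a third of the length. An automorphism of order 3
  may also be the turn by two thirds, but it generates the same group and the signed counts are
  equal. A vertex has three corners, hence \<open>3 * s\<close> and \<open>3 * t\<close>.\<close>

lemma W3_iff:
  assumes w: "maximal_wicks g w"
  shows "cls g w \<in> W3 g s t \<longleftrightarrow> rot_eq n (4 * g - 2) (pairing w) (pairing w) \<and>
    vert_shift n (pairing w) (4 * g - 2) = 3 * s \<and> vert_shift n (pairing w) (2 * (4 * g - 2)) = 3 * t"
proof -
  define m where "m = 4 * g - 2"
  have nm: "n = 3 * m" "m \<ge> 2" "m > 0" unfolding m_def using n g by auto
  note n0 = n0[OF g n]
  have three: "prime (3 :: nat)" by simp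
  have signed: "3 * card {V \<in> fixed_vertices v \<mu>. positive_vertex v V} = vert_shift n (pairing v) m"
    "3 * card {V \<in> fixed_vertices v \<mu>. negative_vertex v V} = vert_shift n (pairing v) (2 * m)"
    if v: "maximal_wicks g v" and mu: "\<mu> = int m \<or> \<mu> = int (2 * m)" and c: "rot_eq n m (pairing v) (pairing v)" for v \<mu>
  proof -
    note mx = maxD[OF g n v]
    have "pairing v \<in> rooted (length v) 0 0" unfolding mx(1) by (rule mx(3))
    from iffD1[OF cubic_iff[OF mx(2)] this]
    have cub: "\<And>i. corner v (corner v (corner v i)) = i" "\<And>i. i < n \<Longrightarrow> corner v i \<noteq> i"
      unfolding mx(1) by blast+
    show "3 * card {V \<in> fixed_vertices v \<mu>. positive_vertex v V} = vert_shift n (pairing v) m"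
      by (rule card_signed_fixed(1)[OF mx(2,1) nm(1,2) cub c mu])
    show "3 * card {V \<in> fixed_vertices v \<mu>. negative_vertex v V} = vert_shift n (pairing v) (2 * m)"
      by (rule card_signed_fixed(2)[OF mx(2,1) nm(1,2) cub c mu])
  qed
  show ?thesis unfolding m_def[symmetric]
  proof
    assume "cls g w \<in> W3 g s t"
    then obtain w' \<mu> where h: "w' \<in> cls g w" "\<mu> \<in> carrier (wicks_Aut w')" "group.ord (wicks_Aut w') \<mu> = 3"
      "card {V \<in> fixed_vertices w' \<mu>. positive_vertex w' V} = s" "card {V \<in> fixed_vertices w' \<mu>. negative_vertex w' V} = t"
      unfolding W3_def by blast
    note inv = orbit_invariant[OF w h(1)]
    note mx = maxD[OF g n inv(4)]
    obtain k where k: "k < n" "rot_eq n k (pairing w') (pairing w')" "\<mu> = int k"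
      using h(2) unfolding carrier_Aut[OF mx(2,1) n0] stab_def by blast
    have "\<mu> \<noteq> 0 \<and> int n dvd int 3 * \<mu>" using Aut_ord_prime[OF mx(2,1) n0 h(2) three] h(3) by blast
    then have k2: "k \<noteq> 0" "int n dvd int (3 * k)" unfolding k(3) by simp_all
    have "n dvd 3 * k" using k2(2) by (simp only: int_dvd_int_iff)
    then have "m dvd k" unfolding nm(1) by simp
    then obtain q where q: "k = m * q" by (elim dvdE)
    have "q > 0" using k2(1) q by (cases q) auto
    moreover have "q < 3"
    proof -
      have "m * q < m * 3" using k(1) unfolding q nm(1) by (simp only: mult.commute)
      then show ?thesis by (simp only: mult_less_cancel1)
    qed
    ultimately have "q = 1 \<or> q = 2" by linarith
    then have km: "k = m \<or> k = 2 * m" using q by auto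
    have rm: "rot_eq n m (pairing w') (pairing w')"
    proof -
      have "rot_eq n m (pairing w') (pairing w')" if "k = 2 * m"
      proof -
        \<comment> \<open>Twice two thirds of a turn is one third, modulo a full turn.\<close>
        have "rot_eq n ((2 * m + 2 * m) mod n) (pairing w') (pairing w')"
          unfolding rot_eq_mod using rot_eq_trans[OF k(2) k(2)] that by simp
        moreover have "(2 * m + 2 * m) mod n = m"
        proof -
          have "2 * m + 2 * m = m + n" using nm(1) by simp
          then show ?thesis using nm by simp
        qed
        ultimately show ?thesis by simp
      qed
      then show ?thesis using km k(2) by blast
    qed
    have mu: "\<mu> = int m \<or> \<mu> = int (2 * m)" using km k(3) by auto
    show "rot_eq n m (pairing w) (pairing w) \<and> vert_shift n (pairing w) m = 3 * s \<and> vert_shift n (pairing w) (2 * m) = 3 * t"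
      using inv(1)[OF rm] inv(3)[of m] inv(3)[of "2 * m"] signed[OF inv(4) mu rm] h(4,5) by simp
  next
    assume h: "rot_eq n m (pairing w) (pairing w) \<and> vert_shift n (pairing w) m = 3 * s \<and> vert_shift n (pairing w) (2 * m) = 3 * t"
    note mx = maxD[OF g n w]
    have c: "int m \<in> carrier (wicks_Aut w)" unfolding carrier_Aut[OF mx(2,1) n0] stab_def using h nm by auto
    have "int n dvd int 3 * int m" unfolding of_nat_mult[symmetric] nm(1) by simp
    then have o: "group.ord (wicks_Aut w) (int m) = 3"
      using Aut_ord_prime[OF mx(2,1) n0 c three] nm(3) by simp
    have sg: "card {V \<in> fixed_vertices w (int m). positive_vertex w V} = s" "card {V \<in> fixed_vertices w (int m). negative_vertex w V} = t"
      using signed[OF w _ conjunct1[OF h], of "int m"] h by auto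
    have "cls g w \<in> W1 g" unfolding W1_eq using w by blast
    then show "cls g w \<in> W3 g s t" unfolding W3_def using self_cls[OF w] c o sg by blast
  qed
qed

text \<open>For \<open>d = 1\<close> the required symmetry is the full turn, which every involution
  has.\<close>

lemma mass_W1: "mass (W1 g) = real (card (sym_typed 1 n 0 0 0)) / real (1 * n)"
proof -
  have "mass (W1 g) = real (card {\<alpha> \<in> rooted n 0 0. True}) / real n"
    by (rule mass_eq[OF g n]) (auto simp: W1_eq)
  moreover have "{\<alpha> \<in> rooted n 0 0. True} = sym_typed 1 n 0 0 0"
  proof -
    have "\<alpha> \<in> sym_rooted 1 n \<longleftrightarrow> True" if "\<alpha> \<in> rooted n 0 0" for \<alpha>
      using stab_sym_rooted[OF that, of 1 n] rot_eq_n[of n \<alpha> \<alpha>] by simp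
    then show ?thesis unfolding sym_typed_def by (auto simp: sym_rooted_def)
  qed
  ultimately show ?thesis by simp
qed

lemma mass_W2: "mass (W2 g r) = real (card (sym_typed 2 (6 * g - 3) r 0 0)) / real (2 * (6 * g - 3))"
proof -
  let ?L = "6 * g - 3"
  have nL: "n = 2 * ?L" using n g by simp
  have "mass (W2 g r) = real (card {\<alpha> \<in> rooted n 0 0. rot_eq n ?L \<alpha> \<alpha> \<and> edge_shift n \<alpha> ?L = 2 * r}) / real n"
  proof (rule mass_eq[OF g n])
    show "W2 g r \<subseteq> W1 g" unfolding W2_def by blast
  qed (rule W2_iff)
  moreover have "{\<alpha> \<in> rooted n 0 0. rot_eq n ?L \<alpha> \<alpha> \<and> edge_shift n \<alpha> ?L = 2 * r} = sym_typed 2 ?L r 0 0"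
  proof -
    have "\<alpha> \<in> sym_typed 2 ?L r 0 0 \<longleftrightarrow> \<alpha> \<in> rooted n 0 0 \<and> rot_eq n ?L \<alpha> \<alpha> \<and> edge_shift n \<alpha> ?L = 2 * r" for \<alpha>
    proof -
      have "\<alpha> \<in> sym_rooted 2 ?L \<longleftrightarrow> \<alpha> \<in> rooted n 0 0 \<and> rot_eq n ?L \<alpha> \<alpha>"
        using stab_sym_rooted[OF _ nL, of \<alpha>] unfolding sym_rooted_def nL[symmetric] by blast
      then show ?thesis unfolding sym_typed_def nL[symmetric] by simp
    qed
    then show ?thesis by blast
  qed
  ultimately show ?thesis using nL by simp
qed

lemma mass_W3: "mass (W3 g s t) = real (card (sym_typed 3 (4 * g - 2) 0 s t)) / real (3 * (4 * g - 2))"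
proof -
  let ?L = "4 * g - 2"
  have nL: "n = 3 * ?L" using n g by simp
  have "mass (W3 g s t) = real (card {\<alpha> \<in> rooted n 0 0. rot_eq n ?L \<alpha> \<alpha> \<and>
      vert_shift n \<alpha> ?L = 3 * s \<and> vert_shift n \<alpha> (2 * ?L) = 3 * t}) / real n"
  proof (rule mass_eq[OF g n])
    show "W3 g s t \<subseteq> W1 g" unfolding W3_def by blast
  qed (rule W3_iff)
  moreover have "{\<alpha> \<in> rooted n 0 0. rot_eq n ?L \<alpha> \<alpha> \<and> vert_shift n \<alpha> ?L = 3 * s \<and> vert_shift n \<alpha> (2 * ?L) = 3 * t}
      = sym_typed 3 ?L 0 s t"
  proof -
    have "\<alpha> \<in> sym_typed 3 ?L 0 s t \<longleftrightarrow> \<alpha> \<in> rooted n 0 0 \<and> rot_eq n ?L \<alpha> \<alpha> \<and> vert_shift n \<alpha> ?L = 3 * s \<and> vert_shift n \<alpha> (2 * ?L) = 3 * t" for \<alpha>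
    proof -
      have "\<alpha> \<in> sym_rooted 3 ?L \<longleftrightarrow> \<alpha> \<in> rooted n 0 0 \<and> rot_eq n ?L \<alpha> \<alpha>"
        using stab_sym_rooted[OF _ nL, of \<alpha>] unfolding sym_rooted_def nL[symmetric] by blast
      then show ?thesis unfolding sym_typed_def nL[symmetric] by (simp add: mult.commute)
    qed
    then show ?thesis by blast
  qed
  ultimately show ?thesis using nL by simp
qed

text \<open>The quotient by a sixth of a turn has \<open>r\<close> free half-edges and
  \<open>s + t\<close> leaves. Above them lie \<open>6 * r\<close> sides, which make
  \<open>3 * r\<close> edges, and \<open>6 * s\<close> and \<open>6 * t\<close> corners, which make
  \<open>2 * s\<close> and \<open>2 * t\<close> vertices; hence the factors in the definition of
  \<open>W6\<close>.\<close>

lemma mass_W6: "mass (W6 g r s t) = real (card (sym_typed 6 (2 * g - 1) r s t)) / real (6 * (2 * g - 1))"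
proof -
  let ?L = "2 * g - 1"
  have nL: "n = 6 * ?L" and L3: "6 * g - 3 = ?L * 3" and L2: "4 * g - 2 = ?L * 2" "2 * (?L * 2) = ?L * 4" using n g by auto
  define Q where "Q \<alpha> \<longleftrightarrow> (rot_eq n (6 * g - 3) \<alpha> \<alpha> \<and> edge_shift n \<alpha> (6 * g - 3) = 2 * (3 * r)) \<and>
    (rot_eq n (4 * g - 2) \<alpha> \<alpha> \<and> vert_shift n \<alpha> (4 * g - 2) = 3 * (2 * s) \<and> vert_shift n \<alpha> (2 * (4 * g - 2)) = 3 * (2 * t))" for \<alpha>
  have "mass (W6 g r s t) = real (card {\<alpha> \<in> rooted n 0 0. Q \<alpha>}) / real n"
  proof (rule mass_eq[OF g n])
    show "W6 g r s t \<subseteq> W1 g" unfolding W6_def W2_def by blast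
    show "cls g w \<in> W6 g r s t \<longleftrightarrow> Q (pairing w)" if "maximal_wicks g w" for w
      unfolding W6_def Int_iff W2_iff[OF that] W3_iff[OF that] Q_def ..
  qed
  moreover have "{\<alpha> \<in> rooted n 0 0. Q \<alpha>} = sym_typed 6 ?L r s t"
  proof -
    \<comment> \<open>A sixth of a turn is the difference of one half and one third.\<close>
    have rr: "rot_eq n ?L \<alpha> \<alpha> \<longleftrightarrow> rot_eq n (?L * 3) \<alpha> \<alpha> \<and> rot_eq n (?L * 2) \<alpha> \<alpha>" for \<alpha>
    proof
      assume h: "rot_eq n ?L \<alpha> \<alpha>"
      have "rot_eq n (?L + ?L) \<alpha> \<alpha>" by (rule rot_eq_trans[OF h h])
      moreover from rot_eq_trans[OF this h] have "rot_eq n (?L + (?L + ?L)) \<alpha> \<alpha>" .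
      ultimately show "rot_eq n (?L * 3) \<alpha> \<alpha> \<and> rot_eq n (?L * 2) \<alpha> \<alpha>" by (simp add: mult_2_right numeral_3_eq_3)
    next
      assume h: "rot_eq n (?L * 3) \<alpha> \<alpha> \<and> rot_eq n (?L * 2) \<alpha> \<alpha>"
      have eq: "?L * 2 + ?L = ?L * 3" by simp
      show "rot_eq n ?L \<alpha> \<alpha>" using rot_eq_cancel[of n "?L * 2" \<alpha> \<alpha> ?L, unfolded eq] h by blast
    qed
    have "\<alpha> \<in> sym_typed 6 ?L r s t \<longleftrightarrow> \<alpha> \<in> rooted n 0 0 \<and> Q \<alpha>" for \<alpha>
    proof -
      have "\<alpha> \<in> sym_rooted 6 ?L \<longleftrightarrow> \<alpha> \<in> rooted n 0 0 \<and> rot_eq n ?L \<alpha> \<alpha>"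
        using stab_sym_rooted[OF _ nL, of \<alpha>] unfolding sym_rooted_def nL[symmetric] by blast
      moreover have "(6 :: nat) div 2 = 3" "(6 :: nat) div 3 = 2" "2 * ((6 :: nat) div 3) = 4" "even (6 :: nat)" "(3 :: nat) dvd 6"
        "2 * (3 * r) = 6 * r" "3 * (2 * s) = 6 * s" "3 * (2 * t) = 6 * t" by simp_all
      ultimately show ?thesis unfolding sym_typed_def nL[symmetric] mem_Collect_eq Q_def L3 L2 rr by (simp only: simp_thms) blast
    qed
    then show ?thesis by blast
  qed
  ultimately show ?thesis using nL by simp
qed

end

text \<open>Under both conditions the explicit count is a product of positive factors. Its parameter
  \<open>V\<close> exists because Euler's formula with \<open>L > 0\<close> forces
  \<open>s + t + r + 3 * f\<close> to be at least 2.\<close>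

lemma typed_pos_iff:
  assumes L: "L > 0" and d: "d > 0" and r: "odd d \<Longrightarrow> r = 0" and st: "\<not> 3 dvd d \<Longrightarrow> s = 0 \<and> t = 0"
  shows "real (card (sym_typed d L r s t)) / real (d * L) > 0 \<longleftrightarrow>
    [1 - int (s * (d div 3) + t * (2 * (d div 3))) = int (r * half_volt d)] (mod int d) \<and>
    (\<exists>f. L + 6 = 4 * (s + t) + 3 * r + 12 * f)" (is "?P \<longleftrightarrow> ?C \<and> ?F")
proof
  assume ?P
  then have "card (sym_typed d L r s t) > 0" by (cases "card (sym_typed d L r s t)") auto
  then show "?C \<and> ?F" using typed_nonempty[OF L d r st] by blast
next
  assume h: "?C \<and> ?F"
  then obtain f where f: "L + 6 = 4 * (s + t) + 3 * r + 12 * f" by blast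
  have "L + 6 \<le> 4 * (s + t + r + 3 * f)" unfolding f by simp
  moreover have "X \<ge> 2" if "L + 6 \<le> 4 * X" for X using that L by linarith
  ultimately have "s + t + r + 3 * f \<ge> 2" by blast
  then obtain V where "s + t + r + 3 * f = 2 + V" using le_Suc_ex by blast
  then have V: "V + 2 = s + t + r + 3 * f" by simp
  have "real (card (sym_typed d L r s t)) / real (d * L)
    = (real d ^ 2) ^ f / real d * fact (2 * V) / (12 ^ f * fact f * fact r * fact s * fact t * fact V)"
    by (rule sym_typed_count[OF L d r st conjunct1[OF h] f V])
  also have "\<dots> > 0" using d by simp
  finally show ?P .
qed

lemma cong_two_iff: "[1 - int (0 * (2 div 3) + 0 * (2 * (2 div 3))) = int (r * half_volt 2)] (mod int 2) \<longleftrightarrow> odd r"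
proof -
  have "(1 :: int) mod 2 = int r mod 2 \<longleftrightarrow> odd r" by presburger
  then show ?thesis by (simp add: half_volt_def cong_def)
qed

text \<open>With \<open>g\<close> eliminated by Euler's formula, the two differences become
  \<open>k\<close> and \<open>2 * k\<close> modulo 3, so each congruence of the statement is
  equivalent to solvability.\<close>

lemma cong_three_iff:
  assumes f: "g + 1 = s + t + 3 * f"
  shows "[1 - int (s * (3 div 3) + t * (2 * (3 div 3))) = int (0 * half_volt 3)] (mod int 3) \<longleftrightarrow>
    [s = 2 * g + 1] (mod 3) \<and> [t = 2 * g] (mod 3)"
proof -
  define k where "k = 1 - (int s + 2 * int t)"
  have "int g + 1 = int s + int t + 3 * int f" using arg_cong[OF f, of int] by simp
  then have e: "int s - int (2 * g + 1) = k + (- 2 * int f) * 3" "int t - int (2 * g) = 2 * k + (int t - 2 * int f) * 3"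
    unfolding k_def by (simp_all add: algebra_simps)
  have "[s = 2 * g + 1] (mod 3) \<longleftrightarrow> 3 dvd k" "[t = 2 * g] (mod 3) \<longleftrightarrow> 3 dvd 2 * k"
    unfolding cong_int_iff[symmetric] cong_iff_dvd_diff e by (simp_all only: of_nat_numeral dvd_add_times_triv_right_iff)
  moreover have "[1 - int (s * (3 div 3) + t * (2 * (3 div 3))) = int (0 * half_volt 3)] (mod int 3) \<longleftrightarrow> 3 dvd k"
    unfolding cong_iff_dvd_diff k_def by (simp add: mult.commute)
  ultimately show ?thesis using dvd_mult[of 3 k 2] by blast
qed

text \<open>As for order 3. The part of the condition modulo 2 is automatic: Euler's formula makes
  \<open>r\<close> odd and therefore \<open>k\<close> even.\<close>

lemma cong_six_iff:
  assumes f: "2 * g + 5 = 4 * (s + t) + 3 * r + 12 * f"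
  shows "[1 - int (s * (6 div 3) + t * (2 * (6 div 3))) = int (r * half_volt 6)] (mod int 6) \<longleftrightarrow>
    [2 * s = 2 * g + 1] (mod 3) \<and> [2 * t = 2 * g] (mod 3)"
proof -
  define k where "k = 1 - (2 * int s + 4 * int t) - 3 * int r"
  have g: "2 * int g + 5 = 4 * (int s + int t) + 3 * int r + 12 * int f" using arg_cong[OF f, of int] by simp
  then have e: "int (2 * s) - int (2 * g + 1) = k + (1 - 4 * int f) * 3"
    "int (2 * t) - int (2 * g) = 2 * k + (1 + 2 * int t + int r - 4 * int f) * 3"
    unfolding k_def by (simp_all add: algebra_simps)
  have "k = 2 * (int s - int g - 2 + 6 * int f)" unfolding k_def using g by (simp add: algebra_simps)
  then have "even k" by simp
  then have six: "6 dvd k \<longleftrightarrow> 3 dvd k" by presburger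
  have "[2 * s = 2 * g + 1] (mod 3) \<longleftrightarrow> 3 dvd k" "[2 * t = 2 * g] (mod 3) \<longleftrightarrow> 3 dvd 2 * k"
    unfolding cong_int_iff[symmetric] cong_iff_dvd_diff e by (simp_all only: of_nat_numeral dvd_add_times_triv_right_iff)
  moreover have "[1 - int (s * (6 div 3) + t * (2 * (6 div 3))) = int (r * half_volt 6)] (mod int 6) \<longleftrightarrow> 6 dvd k"
    unfolding cong_iff_dvd_diff k_def half_volt_def by (simp add: mult.commute)
  ultimately show ?thesis using dvd_mult[of 3 k 2] six by blast
qed

theorem theorem1p1:
  fixes g :: nat
  assumes "g \<ge> 1"
  shows "(\<forall>w. maximal_wicks g w \<longrightarrow>
            group (wicks_Aut w) \<and> cyclic_group (wicks_Aut w) \<and>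
            order (wicks_Aut w) \<in> {1, 2, 3, 6})
    \<and> mass (W1 g) = 2 / 1 * (1\<^sup>2 / 12) ^ g * fact (6 * g - 5) / (fact g * fact (3 * g - 3))
    \<and> (\<forall>r::nat.
          (mass (W2 g r) > 0 \<longleftrightarrow> (\<exists>f::nat. real f = (2 * real g + 1 - real r) / 4))
        \<and> (\<forall>f::nat. real f = (2 * real g + 1 - real r) / 4 \<longrightarrow>
             mass (W2 g r) = 2 / 2 * (2\<^sup>2 / 12) ^ f * (1 / fact r)
               * (fact (6 * f + 2 * r - 5) / (fact f * fact (3 * f + r - 3)))))
    \<and> (\<forall>s t::nat.
          (mass (W3 g s t) > 0 \<longleftrightarrow>
             (\<exists>f::nat. real f = (real g + 1 - real s - real t) / 3)
             \<and> [s = 2 * g + 1] (mod 3) \<and> [t = 2 * g] (mod 3))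
        \<and> (\<forall>f::nat. real f = (real g + 1 - real s - real t) / 3
             \<and> [s = 2 * g + 1] (mod 3) \<and> [t = 2 * g] (mod 3) \<and> g > 1 \<longrightarrow>
             mass (W3 g s t) = 2 / 3 * (3\<^sup>2 / 12) ^ f * (1 / (fact s * fact t))
               * (fact (6 * f + 2 * s + 2 * t - 5) / (fact f * fact (3 * f + s + t - 3)))))
    \<and> (g = 1 \<longrightarrow> mass (W3 g 0 2) = 1 / 6)
    \<and> (\<forall>r s t::nat.
          (mass (W6 g r s t) > 0 \<longleftrightarrow>
             (\<exists>f::nat. real f = (2 * real g + 5 - 3 * real r - 4 * real s - 4 * real t) / 12)
             \<and> [2 * s = 2 * g + 1] (mod 3) \<and> [2 * t = 2 * g] (mod 3))
        \<and> (\<forall>f::nat. real f = (2 * real g + 5 - 3 * real r - 4 * real s - 4 * real t) / 12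
             \<and> [2 * s = 2 * g + 1] (mod 3) \<and> [2 * t = 2 * g] (mod 3) \<and> g > 1 \<longrightarrow>
             mass (W6 g r s t) = 2 / 6 * (6\<^sup>2 / 12) ^ f * (1 / (fact r * fact s * fact t))
               * (fact (6 * f + 2 * r + 2 * s + 2 * t - 5)
                  / (fact f * fact (3 * f + r + s + t - 3)))))
    \<and> (g = 1 \<longrightarrow> mass (W6 g 1 0 1) = 1 / 6)"
proof (intro conjI allI impI)
  define n where "n = 12 * g - 6"
  note g = assms and n = n_def
  note mW = mass_W1[OF g n] mass_W2[OF g n] mass_W3[OF g n] mass_W6[OF g n]
  {
    fix w assume "maximal_wicks g w"
    note mx = maxD[OF g n this]
    show "group (wicks_Aut w)" by (rule Aut_group[OF mx(2,1) n0[OF g n]])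
    show "cyclic_group (wicks_Aut w)" by (rule Aut_cyclic(1)[OF mx(2,1) n0[OF g n] mx(3)])
    show "order (wicks_Aut w) \<in> {1, 2, 3, 6}" by (rule Aut_cyclic(2)[OF mx(2,1) n0[OF g n] mx(3)])
  }
  show "mass (W1 g) = 2 / 1 * (1\<^sup>2 / 12) ^ g * fact (6 * g - 5) / (fact g * fact (3 * g - 3))"
  proof -
    have "n + 6 = 4 * (0 + 0) + 3 * 0 + 12 * g" "0 + 0 + 0 + 3 * g \<ge> 3" using n g by simp_all
    then show ?thesis unfolding mW(1) using n0[OF g n] by (subst typed_mass[where f = g]) (simp_all add: cong_def)
  qed
  have L: "6 * g - 3 > 0" "4 * g - 2 > 0" "2 * g - 1 > 0" using g by simp_all
  {
    fix r
    have e2: "6 * g - 3 + 6 = 6 * g + 3" using g by simp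
    \<comment> \<open>Cleared of denominators and multiplied by 3, the definition of
      \<open>f\<close> is Euler's formula for a quotient with face length
      \<open>6 * g - 3\<close>.\<close>
    have f2: "real f = (2 * real g + 1 - real r) / 4 \<longleftrightarrow> 6 * g - 3 + 6 = 4 * (0 + 0) + 3 * r + 12 * f" for f
    proof -
      have "real f = (2 * real g + 1 - real r) / 4 \<longleftrightarrow> real (2 * g + 1) = real (r + 4 * f)"
        by (auto simp: field_simps)
      also have "\<dots> \<longleftrightarrow> 6 * g - 3 + 6 = 4 * (0 + 0) + 3 * r + 12 * f"
        unfolding of_nat_eq_iff e2 by auto
      finally show ?thesis .
    qed
    \<comment> \<open>Solvability modulo 2 follows from \<open>f\<close> being a natural number,
      which is why no congruence is stated for order 2.\<close>
    have odd: "odd r" if "6 * g - 3 + 6 = 4 * (0 + 0) + 3 * r + 12 * f" for f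
    proof -
      have "2 * g + 1 = r + 4 * f" using that unfolding e2 by simp
      then show ?thesis by presburger
    qed
    show "mass (W2 g r) > 0 \<longleftrightarrow> (\<exists>f::nat. real f = (2 * real g + 1 - real r) / 4)"
      unfolding f2 mW(2) using typed_pos_iff[of "6 * g - 3" 2 r 0 0] L(1) odd unfolding cong_two_iff by auto
    fix f assume "real f = (2 * real g + 1 - real r) / 4"
    then have f: "6 * g - 3 + 6 = 4 * (0 + 0) + 3 * r + 12 * f" unfolding f2 .
    have V: "r + 0 + 0 + 3 * f \<ge> 3" using f g unfolding e2 by (cases f) auto
    have "mass (W2 g r) = 2 / real 2 * ((real 2)\<^sup>2 / 12) ^ f * (1 / (fact r * fact 0 * fact 0))
      * (fact (6 * f + 2 * r + 2 * 0 + 2 * 0 - 5) / (fact f * fact (3 * f + r + 0 + 0 - 3)))"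
      unfolding mW(2) by (rule typed_mass[OF L(1) _ _ _ _ f V]) (use odd[OF f] cong_two_iff[of r] in simp_all)
    then show "mass (W2 g r) = 2 / 2 * (2\<^sup>2 / 12) ^ f * (1 / fact r)
               * (fact (6 * f + 2 * r - 5) / (fact f * fact (3 * f + r - 3)))" by simp
  }
  {
    fix s t
    have f3: "real f = (real g + 1 - real s - real t) / 3 \<longleftrightarrow> g + 1 = s + t + 3 * f" for f
    proof -
      have "real f = (real g + 1 - real s - real t) / 3 \<longleftrightarrow> real (g + 1) = real (s + t + 3 * f)"
        by (auto simp: field_simps)
      then show ?thesis unfolding of_nat_eq_iff .
    qed
    have e3: "4 * g - 2 + 6 = 4 * g + 4" using g by simp
    have L3: "4 * g - 2 + 6 = 4 * (s + t) + 3 * 0 + 12 * f \<longleftrightarrow> g + 1 = s + t + 3 * f" for f unfolding e3 by auto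
    show "mass (W3 g s t) > 0 \<longleftrightarrow> (\<exists>f::nat. real f = (real g + 1 - real s - real t) / 3)
             \<and> [s = 2 * g + 1] (mod 3) \<and> [t = 2 * g] (mod 3)"
    proof -
      have "mass (W3 g s t) > 0 \<longleftrightarrow> [1 - int (s * (3 div 3) + t * (2 * (3 div 3))) = int (0 * half_volt 3)] (mod int 3) \<and>
          (\<exists>f. g + 1 = s + t + 3 * f)"
        unfolding mW(3) L3[symmetric] by (rule typed_pos_iff[OF L(2)]) simp_all
      then show ?thesis unfolding f3 using cong_three_iff by blast
    qed
    fix f assume h: "real f = (real g + 1 - real s - real t) / 3 \<and> [s = 2 * g + 1] (mod 3) \<and> [t = 2 * g] (mod 3) \<and> g > 1"
    then have f: "g + 1 = s + t + 3 * f" unfolding f3 by blast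
    have g1: "g > 1" using h by blast
    have V: "0 + s + t + 3 * f \<ge> 3" using f g1 by simp
    have c: "[1 - int (s * (3 div 3) + t * (2 * (3 div 3))) = int (0 * half_volt 3)] (mod int 3)"
      unfolding cong_three_iff[OF f] using h by blast
    have "mass (W3 g s t) = 2 / real 3 * ((real 3)\<^sup>2 / 12) ^ f * (1 / (fact 0 * fact s * fact t))
      * (fact (6 * f + 2 * 0 + 2 * s + 2 * t - 5) / (fact f * fact (3 * f + 0 + s + t - 3)))"
      unfolding mW(3) by (rule typed_mass[OF L(2) _ _ _ c iffD2[OF L3 f] V]) simp_all
    then show "mass (W3 g s t) = 2 / 3 * (3\<^sup>2 / 12) ^ f * (1 / (fact s * fact t))
               * (fact (6 * f + 2 * s + 2 * t - 5) / (fact f * fact (3 * f + s + t - 3)))" by simp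
  }
  \<comment> \<open>The quotient is a single edge between two leaves, so \<open>V = 0\<close> and
    the count is taken before the factorials are rewritten.\<close>
  show "mass (W3 g 0 2) = 1 / 6" if g1: "g = 1"
  proof -
    have f: "g + 1 = 0 + 2 + 3 * 0" "4 * g - 2 + 6 = 4 * (0 + 2) + 3 * 0 + 12 * 0" using g1 by simp_all
    have c: "[1 - int (0 * (3 div 3) + 2 * (2 * (3 div 3))) = int (0 * half_volt 3)] (mod int 3)"
      unfolding cong_three_iff[OF f(1)] g1 by (simp add: cong_def)
    have "mass (W3 g 0 2) = (real 3 ^ 2) ^ 0 / real 3 * fact (2 * 0) / (12 ^ 0 * fact 0 * fact 0 * fact 0 * fact 2 * fact 0)"
      unfolding mW(3) by (rule sym_typed_count[OF L(2) _ _ _ c f(2)]) simp_all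
    then show ?thesis by simp
  qed
  {
    fix r s t
    have f6: "real f = (2 * real g + 5 - 3 * real r - 4 * real s - 4 * real t) / 12 \<longleftrightarrow> 2 * g + 5 = 4 * (s + t) + 3 * r + 12 * f" for f
    proof -
      have "real f = (2 * real g + 5 - 3 * real r - 4 * real s - 4 * real t) / 12 \<longleftrightarrow> real (2 * g + 5) = real (4 * (s + t) + 3 * r + 12 * f)"
        by (auto simp: field_simps)
      then show ?thesis unfolding of_nat_eq_iff .
    qed
    have e6: "2 * g - 1 + 6 = 2 * g + 5" using g by simp
    have L6: "2 * g - 1 + 6 = 4 * (s + t) + 3 * r + 12 * f \<longleftrightarrow> 2 * g + 5 = 4 * (s + t) + 3 * r + 12 * f" for f unfolding e6 ..
    show "mass (W6 g r s t) > 0 \<longleftrightarrow> (\<exists>f::nat. real f = (2 * real g + 5 - 3 * real r - 4 * real s - 4 * real t) / 12)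
             \<and> [2 * s = 2 * g + 1] (mod 3) \<and> [2 * t = 2 * g] (mod 3)"
    proof -
      have "mass (W6 g r s t) > 0 \<longleftrightarrow> [1 - int (s * (6 div 3) + t * (2 * (6 div 3))) = int (r * half_volt 6)] (mod int 6) \<and>
          (\<exists>f. 2 * g + 5 = 4 * (s + t) + 3 * r + 12 * f)"
        unfolding mW(4) L6[symmetric] by (rule typed_pos_iff[OF L(3)]) simp_all
      then show ?thesis unfolding f6 using cong_six_iff by blast
    qed
    fix f assume h: "real f = (2 * real g + 5 - 3 * real r - 4 * real s - 4 * real t) / 12
             \<and> [2 * s = 2 * g + 1] (mod 3) \<and> [2 * t = 2 * g] (mod 3) \<and> g > 1"
    then have f: "2 * g + 5 = 4 * (s + t) + 3 * r + 12 * f" unfolding f6 by blast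
    have g1: "g > 1" using h by blast
    have "2 * g + 5 \<le> 4 * (r + s + t + 3 * f)" unfolding f by simp
    moreover have "X \<ge> 3" if "2 * g + 5 \<le> 4 * X" for X using that g1 by linarith
    ultimately have V: "r + s + t + 3 * f \<ge> 3" by blast
    have c: "[1 - int (s * (6 div 3) + t * (2 * (6 div 3))) = int (r * half_volt 6)] (mod int 6)"
      unfolding cong_six_iff[OF f] using h by blast
    have "mass (W6 g r s t) = 2 / real 6 * ((real 6)\<^sup>2 / 12) ^ f * (1 / (fact r * fact s * fact t))
      * (fact (6 * f + 2 * r + 2 * s + 2 * t - 5) / (fact f * fact (3 * f + r + s + t - 3)))"
      unfolding mW(4) by (rule typed_mass[OF L(3) _ _ _ c iffD2[OF L6 f] V]) simp_all
    then show "mass (W6 g r s t) = 2 / 6 * (6\<^sup>2 / 12) ^ f * (1 / (fact r * fact s * fact t))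
               * (fact (6 * f + 2 * r + 2 * s + 2 * t - 5)
                  / (fact f * fact (3 * f + r + s + t - 3)))" by (simp only: of_nat_numeral)
  }
  \<comment> \<open>The quotient is one leaf with a half-edge that has no partner; again
    \<open>V = 0\<close>.\<close>
  show "mass (W6 g 1 0 1) = 1 / 6" if g1: "g = 1"
  proof -
    have f: "2 * g + 5 = 4 * (0 + 1) + 3 * 1 + 12 * 0" "2 * g - 1 + 6 = 4 * (0 + 1) + 3 * 1 + 12 * 0" using g1 by simp_all
    have c: "[1 - int (0 * (6 div 3) + 1 * (2 * (6 div 3))) = int (1 * half_volt 6)] (mod int 6)"
      unfolding cong_six_iff[OF f(1)] g1 by (simp add: cong_def)
    have "mass (W6 g 1 0 1) = (real 6 ^ 2) ^ 0 / real 6 * fact (2 * 0) / (12 ^ 0 * fact 0 * fact 1 * fact 0 * fact 1 * fact 0)"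
      unfolding mW(4) by (rule sym_typed_count[OF L(3) _ _ _ c f(2)]) simp_all
    then show ?thesis by simp
  qed
qed

end
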